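(* Let $p$ be a prime, $g$ a positive integer, $q=p^{g}$, and $\mathfrak{G}=SL_{2}(\mathbb{F}_{q})$. Let $K_{0}(\mathfrak{G})$ be the Grothendieck ring of finitely generated $\mathbb{F}_{q}[\mathfrak{G}]$-modules, let $\mathfrak{X}$ denote (the class in $K_0(\mathfrak{G})$ of) the standard representation of $\mathfrak{G}$ on $\mathbb{F}_{q}^{2}$, and let $\mathfrak{x}$ be an indeterminate over $\mathbb{Z}$. Then the assignment $\mathfrak{X}\longmapsto \mathfrak{x}$ induces an isomorphism of rings $$K_{0}(\mathfrak{G})\simeq \frac{\mathbb{Z}[\mathfrak{x}]}{\left(\mathfrak{f}^{[g]}(\mathfrak{x})-\mathfrak{x}\right)\mathbb{Z}[\mathfrak{x}]},$$ where $\mathfrak{f}^{[g]}(\mathfrak{x})=(\mathfrak{f}\circ\cdots\circ\mathfrak{f})(\mathfrak{x})$ is the polynomial of $\mathbb{Z}[\mathfrak{x}]$ having degree $p^{g}$ obtained by $g$-fold composition of the monic degree $p$ polynomial $$\mathfrak{f}(\mathfrak{x})=\sum_{j=0}^{\lfloor p/2\rfloor}(-1)^{j}\,\frac{p}{p-j}\binom{p-j}{j}\,\mathfrak{x}^{p-2j}.$$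
   Context: $\mathbb{F}_q$ is a field with $q$ elements. $K_{0}(\mathfrak{G})$ is the Grothendieck group of finitely generated $\mathbb{F}_{q}[\mathfrak{G}]$-modules (with relations coming from short exact sequences), made into a commutative ring with identity by the tensor product over $\mathbb{F}_{q}$; it is the free abelian group on the isomorphism classes of irreducible representations of $\mathfrak{G}$ over $\mathbb{F}_{q}$. A module and its class in $K_0(\mathfrak{G})$ are denoted by the same symbol. *)

theory Defs
  imports
    "HOL-Analysis.Determinants"
    "HOL-Algebra.Module"
    "HOL-Algebra.QuotRing"
    "HOL-Algebra.Generated_Groups"
    "HOL-Algebra.Free_Abelian_Groups"
    "HOL-Algebra.Algebraic_Closure_Type"
    "HOL-Computational_Algebra.Polynomial"
    "HOL-Computational_Algebra.Primes"
begin


section \<open>Modules over a group algebra\<close>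

text \<open>
  A module over \<open>F[G]\<close> is an \<open>F\<close>-module \<open>M\<close> together with an \<open>F\<close>-linear action of the group \<open>G\<close>.
  The scalar field is a type \<open>'a\<close>, seen as an HOL-Algebra ring via \<^const>\<open>ring_of_type_algebra\<close>.
  The fields \<^const>\<open>mult\<close> and \<^const>\<open>one\<close>, which the library record of modules inherits from rings,
  carry no meaning here.
\<close>

record ('a, 'v, 'g) gmodule = "('a, 'v) module" +
  act :: "'g \<Rightarrow> 'v \<Rightarrow> 'v"

abbreviation scalars :: "'a::field ring"
  where "scalars \<equiv> ring_of_type_algebra"

locale group_module =
  group G + module "scalars :: 'a ring" M
  for G :: "'g monoid" and M :: "('a::field, 'v, 'g) gmodule" +
  assumes act_closed: "\<lbrakk>g \<in> carrier G; v \<in> carrier M\<rbrakk> \<Longrightarrow> act M g v \<in> carrier M"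
    and act_add: "\<lbrakk>g \<in> carrier G; v \<in> carrier M; w \<in> carrier M\<rbrakk>
      \<Longrightarrow> act M g (v \<oplus>\<^bsub>M\<^esub> w) = act M g v \<oplus>\<^bsub>M\<^esub> act M g w"
    and act_smult: "\<lbrakk>g \<in> carrier G; v \<in> carrier M\<rbrakk>
      \<Longrightarrow> act M g (c \<odot>\<^bsub>M\<^esub> v) = c \<odot>\<^bsub>M\<^esub> act M g v"
    and act_one: "v \<in> carrier M \<Longrightarrow> act M \<one>\<^bsub>G\<^esub> v = v"
    and act_mult: "\<lbrakk>g \<in> carrier G; h \<in> carrier G; v \<in> carrier M\<rbrakk>
      \<Longrightarrow> act M (g \<otimes>\<^bsub>G\<^esub> h) v = act M g (act M h v)"

definition gsubmodule :: "'g monoid \<Rightarrow> ('a::field, 'v, 'g) gmodule \<Rightarrow> 'v set \<Rightarrow> bool"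
  where "gsubmodule G M N \<longleftrightarrow>
    submodule N (scalars :: 'a ring) M \<and> (\<forall>g\<in>carrier G. \<forall>v\<in>N. act M g v \<in> N)"

definition finitely_generated :: "'g monoid \<Rightarrow> ('a::field, 'v, 'g) gmodule \<Rightarrow> bool"
  where "finitely_generated G M \<longleftrightarrow>
    (\<exists>S\<subseteq>carrier M. finite S \<and> \<Inter>{N. gsubmodule G M N \<and> S \<subseteq> N} = carrier M)"

definition fg_module :: "'g monoid \<Rightarrow> ('a::field, 'v, 'g) gmodule \<Rightarrow> bool"
  where "fg_module G M \<longleftrightarrow> group_module G M \<and> finitely_generated G M"

definition gmodule_hom ::
    "'g monoid \<Rightarrow> ('a::field, 'v, 'g) gmodule \<Rightarrow> ('a, 'w, 'g) gmodule \<Rightarrow> ('v \<Rightarrow> 'w) set"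
  where "gmodule_hom G M N = {h. h \<in> carrier M \<rightarrow> carrier N \<and>
    (\<forall>v\<in>carrier M. \<forall>w\<in>carrier M. h (v \<oplus>\<^bsub>M\<^esub> w) = h v \<oplus>\<^bsub>N\<^esub> h w) \<and>
    (\<forall>c. \<forall>v\<in>carrier M. h (c \<odot>\<^bsub>M\<^esub> v) = c \<odot>\<^bsub>N\<^esub> h v) \<and>
    (\<forall>g\<in>carrier G. \<forall>v\<in>carrier M. h (act M g v) = act N g (h v))}"

definition gmodule_isomorphic ::
    "'g monoid \<Rightarrow> ('a::field, 'v, 'g) gmodule \<Rightarrow> ('a, 'w, 'g) gmodule \<Rightarrow> bool"
  where "gmodule_isomorphic G M N \<longleftrightarrow>
    (\<exists>h\<in>gmodule_hom G M N. bij_betw h (carrier M) (carrier N))"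

text \<open>Exactness of \<open>0 \<longrightarrow> A \<longrightarrow> B \<longrightarrow> C \<longrightarrow> 0\<close>.\<close>

definition short_exact ::
    "'g monoid \<Rightarrow> ('a::field, 'u, 'g) gmodule \<Rightarrow> ('a, 'v, 'g) gmodule \<Rightarrow> ('a, 'w, 'g) gmodule \<Rightarrow>
     ('u \<Rightarrow> 'v) \<Rightarrow> ('v \<Rightarrow> 'w) \<Rightarrow> bool"
  where "short_exact G A B C i p \<longleftrightarrow>
    i \<in> gmodule_hom G A B \<and> p \<in> gmodule_hom G B C \<and>
    inj_on i (carrier A) \<and> p ` carrier B = carrier C \<and>
    i ` carrier A = {v \<in> carrier B. p v = \<zero>\<^bsub>C\<^esub>}"

definition trivial_module :: "('a::field, 'a, 'g) gmodule"
  where "trivial_module = \<lparr>carrier = UNIV, mult = undefined, one = undefined, zero = 0,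
    add = (+), module.smult = (*), act = (\<lambda>g v. v)\<rparr>"


section \<open>Tensor products over the scalar field\<close>

text \<open>
  The tensor product over \<open>F\<close> is the free \<open>F\<close>-module on the set \<open>carrier M \<times> carrier N\<close>
  (finitely supported functions) modulo the submodule generated by the bilinearity relators;
  the group acts diagonally.
\<close>

definition tensor_free ::
    "('a::field, 'v, 'g) gmodule \<Rightarrow> ('a, 'w, 'g) gmodule \<Rightarrow> ('a, ('v \<times> 'w) \<Rightarrow>\<^sub>0 'a, 'g) gmodule"
  where "tensor_free M N =
    \<lparr>carrier = {f. Poly_Mapping.keys f \<subseteq> carrier M \<times> carrier N},
     mult = undefined, one = undefined, zero = 0, add = (+),
     module.smult = (\<lambda>c. Poly_Mapping.map ((*) c)),
     act = (\<lambda>g f. \<Sum>(v, w)\<in>Poly_Mapping.keys f.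
              Poly_Mapping.single (act M g v, act N g w) (Poly_Mapping.lookup f (v, w)))\<rparr>"

definition tensor_relators ::
    "('a::field, 'v, 'g) gmodule \<Rightarrow> ('a, 'w, 'g) gmodule \<Rightarrow> (('v \<times> 'w) \<Rightarrow>\<^sub>0 'a) set"
  where "tensor_relators M N = (let e = (\<lambda>v w. Poly_Mapping.single (v, w) 1) in
      {e (v \<oplus>\<^bsub>M\<^esub> v') w - e v w - e v' w | v v' w.
         v \<in> carrier M \<and> v' \<in> carrier M \<and> w \<in> carrier N} \<union>
      {e v (w \<oplus>\<^bsub>N\<^esub> w') - e v w - e v w' | v w w'.
         v \<in> carrier M \<and> w \<in> carrier N \<and> w' \<in> carrier N} \<union>
      {e (c \<odot>\<^bsub>M\<^esub> v) w - Poly_Mapping.single (v, w) c | c v w. v \<in> carrier M \<and> w \<in> carrier N} \<union>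
      {e v (c \<odot>\<^bsub>N\<^esub> w) - Poly_Mapping.single (v, w) c | c v w. v \<in> carrier M \<and> w \<in> carrier N})"

definition tensor_kernel ::
    "('a::field, 'v, 'g) gmodule \<Rightarrow> ('a, 'w, 'g) gmodule \<Rightarrow> (('v \<times> 'w) \<Rightarrow>\<^sub>0 'a) set"
  where "tensor_kernel M N =
    \<Inter>{U. submodule U (scalars :: 'a ring) (tensor_free M N) \<and> tensor_relators M N \<subseteq> U}"

definition tensor ::
    "('a::field, 'v, 'g) gmodule \<Rightarrow> ('a, 'w, 'g) gmodule \<Rightarrow>
     ('a, (('v \<times> 'w) \<Rightarrow>\<^sub>0 'a) set, 'g) gmodule"
  where "tensor M N = (let F = tensor_free M N; R = tensor_kernel M N in
    \<lparr>carrier = a_rcosets\<^bsub>F\<^esub> R, mult = undefined, one = undefined, zero = R,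
     add = set_add F,
     module.smult = (\<lambda>c Y. \<Union>f\<in>Y. R +>\<^bsub>F\<^esub> (c \<odot>\<^bsub>F\<^esub> f)),
     act = (\<lambda>g Y. \<Union>f\<in>Y. R +>\<^bsub>F\<^esub> (act F g f))\<rparr>)"


section \<open>The Grothendieck ring\<close>

text \<open>
  For a finite field \<open>F\<close> and a finite group \<open>G\<close>, the algebra \<open>F[G]\<close> is finite, hence so is every
  finitely generated \<open>F[G]\<close>-module. Modules whose carrier is a set of natural numbers therefore
  represent all isomorphism classes, and they are used as generators. The function \<open>nat_copy\<close>
  transports a module over any type into this universe. Isomorphic generators are identified by the
  relations, because \<open>0 \<longrightarrow> 0 \<longrightarrow> M \<longrightarrow> M' \<longrightarrow> 0\<close> is exact for isomorphic \<open>M\<close> and \<open>M'\<close>.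
\<close>

definition nat_copy ::
    "'g monoid \<Rightarrow> ('a::{field,finite}, 'v, 'g) gmodule \<Rightarrow> ('a, nat, 'g) gmodule"
  where "nat_copy G M = (SOME N. fg_module G N \<and> gmodule_isomorphic G M N)"

text \<open>
  The free abelian group on the finitely generated modules, with the biadditive product that extends
  the tensor product. This product is commutative, associative and unital only modulo
  isomorphism of modules; \<open>K0\<close> is the quotient by the relations from short exact sequences.
\<close>

definition K0_free ::
    "'a::{field,finite} itself \<Rightarrow> 'g monoid \<Rightarrow> (('a, nat, 'g) gmodule \<Rightarrow>\<^sub>0 int) ring"
  where "K0_free _ G =
    \<lparr>carrier = {c. Poly_Mapping.keys c \<subseteq> {M. fg_module G M}},
     mult = (\<lambda>c d. frag_extend (\<lambda>M. frag_extend (\<lambda>N. frag_of (nat_copy G (tensor M N))) d) c),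
     one = frag_of (nat_copy G trivial_module),
     zero = 0,
     add = (+)\<rparr>"

definition K0_relations ::
    "'a::{field,finite} itself \<Rightarrow> 'g monoid \<Rightarrow> (('a, nat, 'g) gmodule \<Rightarrow>\<^sub>0 int) set"
  where "K0_relations T G = generate (add_monoid (K0_free T G))
    {frag_of B - frag_of A - frag_of C | A B C.
       fg_module G A \<and> fg_module G B \<and> fg_module G C \<and> (\<exists>i p. short_exact G A B C i p)}"

definition K0 ::
    "'a::{field,finite} itself \<Rightarrow> 'g monoid \<Rightarrow> (('a, nat, 'g) gmodule \<Rightarrow>\<^sub>0 int) set ring"
  where "K0 T G = K0_free T G Quot K0_relations T G"

definition K0_class ::
    "'g monoid \<Rightarrow> ('a::{field,finite}, 'v, 'g) gmodule \<Rightarrow> (('a, nat, 'g) gmodule \<Rightarrow>\<^sub>0 int) set"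
  where "K0_class G M =
    K0_relations TYPE('a) G +>\<^bsub>K0_free TYPE('a) G\<^esub> frag_of (nat_copy G M)"


section \<open>The group and its standard representation\<close>

definition SL2 :: "('a::field ^ 2 ^ 2) monoid"
  where "SL2 = \<lparr>carrier = {A. det A = 1}, mult = (**), one = mat 1\<rparr>"

definition standard_module :: "('a::field, 'a ^ 2, 'a ^ 2 ^ 2) gmodule"
  where "standard_module = \<lparr>carrier = UNIV, mult = undefined, one = undefined, zero = 0,
    add = (+), module.smult = (*s), act = (*v)\<rparr>"


section \<open>The polynomials\<close>

definition f_coeff :: "nat \<Rightarrow> nat \<Rightarrow> int"
  where "f_coeff p j = (-1) ^ j * int (p * ((p - j) choose j) div (p - j))"

text \<open>The division in \<^const>\<open>f_coeff\<close> leaves no remainder.\<close>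

lemma f_coeff_exact:
  assumes "p > 0" "j \<le> p div 2"
  shows "real_of_int (f_coeff p j) = (-1) ^ j * (real p / real (p - j)) * real ((p - j) choose j)"
proof -
  have pj: "p - j > 0" using assms by linarith
  have "(p - j) dvd p * ((p - j) choose j)"
  proof (cases "j = 0")
    case False
    have "p * ((p - j) choose j) = (p - j) * ((p - j) choose j) + j * ((p - j) choose j)"
      using assms by (simp flip: distrib_right)
    also have "j * ((p - j) choose j) = (p - j) * ((p - j - 1) choose (j - 1))"
      using False by (simp add: times_binomial_minus1_eq)
    finally show ?thesis by (metis dvd_add dvd_triv_left)
  qed simp
  then have "real (p * ((p - j) choose j) div (p - j)) = real (p * ((p - j) choose j)) / real (p - j)"
    by (rule real_of_nat_div)
  then show ?thesis by (simp add: f_coeff_def)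
qed

definition f_poly :: "nat \<Rightarrow> int poly"
  where "f_poly p = (\<Sum>j = 0..p div 2. monom (f_coeff p j) (p - 2 * j))"

definition f_iter :: "nat \<Rightarrow> nat \<Rightarrow> int poly"
  where "f_iter p g = (pcompose (f_poly p) ^^ g) [:0, 1:]"

abbreviation Zx :: "int poly ring"
  where "Zx \<equiv> ring_of_type_algebra"

definition relation_ideal :: "nat \<Rightarrow> nat \<Rightarrow> int poly set"
  where "relation_ideal p g = PIdl\<^bsub>Zx\<^esub> (f_iter p g - [:0, 1:])"

end

theory Submission
  imports Defs
begin

text \<open>
  Write \<open>Y\<close> for the class of the standard module and \<open>H n\<close> for the binary forms of degree \<open>n\<close>.
  The Clebsch-Gordan sequence \<open>0 \<rightarrow> H n \<rightarrow> H 1 \<otimes> H (n + 1) \<rightarrow> H (n + 2) \<rightarrow> 0\<close> gives \<open>[H n] = S_n(Y)\<close> for the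
  Chebyshev polynomials \<open>S_n\<close>. In characteristic \<open>p\<close>, the derivation of the dehomogenised forms is an
  equivariant map \<open>H p \<rightarrow> H (p - 2)\<close> whose kernel, spanned by \<open>x^p\<close> and \<open>y^p\<close>, is the Frobenius twist of
  the standard module. Since \<open>f = S_p - S_(p-2)\<close>, the twist has class \<open>f(Y)\<close>, and the \<open>g\<close>-fold twist is the
  identity, hence \<open>f^[g](Y) = Y\<close>.

  For \<open>m < q\<close> let \<open>L m\<close> be the span of the powers \<open>(\<alpha>x + \<beta>y)^m\<close>. With \<open>m = r + p m'\<close> it is the tensor
  product of \<open>H r\<close> and the twist of \<open>L m'\<close>, so its class is \<open>e_m(Y)\<close> for a monic polynomial \<open>e_m\<close> of degree
  \<open>m\<close>. Every simple module embeds into the functions on the plane that vanish at the origin, and every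
  nonzero submodule there contains some \<open>x^m\<close> or the indicator function of the punctured plane. Hence
  the \<open>L m\<close> are simple, pairwise non-isomorphic and exhaust the simple modules. Their classes generate
  the ring, and they are independent because composition multiplicities are additive; division by the
  monic polynomial \<open>f^[g] - x\<close> of degree \<open>q\<close> then identifies the kernel of \<open>x \<mapsto> Y\<close>.
\<close>

(* Vectors only: an inherited notation for power series would make every \<open>$\<close> ambiguous. *)
no_notation fps_nth (infixl \<open>$\<close> 75)


section \<open>Modules over a group algebra\<close>

text \<open>Over a finite field the dimension of a module is an exponent of its cardinality.
  Injectivity of maps out of tensor products and equality of images with kernels are therefore
  mostly settled by counting. The modules of forms are spaces of functions, so that substitution is
  the group action and multiplication of functions is a tensor product. The obstacle is that a form
  of degree \<open>n\<close> is determined by its values only over a ring with more than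
  \<open>n\<close> elements; already for q = p the functions x^p and x agree on the field. Hence
  functions take values in a ring \<open>'k\<close> into which the field embeds: a polynomial ring
  for the Frobenius sequence in degree p, and the field itself for the \<open>L m\<close>, whose
  degrees stay below q. The two halves of the final count fit because the exponents m < q number q,
  which is the degree of f^[g] - x. That multiplicities descend to the Grothendieck group rests on
  the Jordan-Hoelder theorem, derived below from the lattice of submodules.\<close>

lemma scalars_simps [simp]:
  "carrier (ring_of_type_algebra :: 'a::comm_ring_1 ring) = UNIV"
  "x \<oplus>\<^bsub>(ring_of_type_algebra :: 'a ring)\<^esub> y = x + y"
  "x \<otimes>\<^bsub>(ring_of_type_algebra :: 'a ring)\<^esub> y = x * y"
  "\<zero>\<^bsub>(ring_of_type_algebra :: 'a ring)\<^esub> = 0"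
  "\<one>\<^bsub>(ring_of_type_algebra :: 'a ring)\<^esub> = 1"
  by (simp_all add: ring_of_type_algebra_def)

text \<open>Negatives need not be supplied: by distributivity and \<open>smult_zero\<close> the
  vector (-1) v is inverse to v. What is left to check is closure, the laws of a commutative monoid
  and the scalars.\<close>

lemma group_moduleI:
  fixes M :: "('a::field, 'v, 'g) gmodule"
  assumes "group G"
    and zero: "\<zero>\<^bsub>M\<^esub> \<in> carrier M"
    and add: "\<And>v w. v \<in> carrier M \<Longrightarrow> w \<in> carrier M \<Longrightarrow> v \<oplus>\<^bsub>M\<^esub> w \<in> carrier M"
    and assoc: "\<And>u v w. u \<in> carrier M \<Longrightarrow> v \<in> carrier M \<Longrightarrow> w \<in> carrier M \<Longrightarrow>
      (u \<oplus>\<^bsub>M\<^esub> v) \<oplus>\<^bsub>M\<^esub> w = u \<oplus>\<^bsub>M\<^esub> (v \<oplus>\<^bsub>M\<^esub> w)"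
    and comm: "\<And>v w. v \<in> carrier M \<Longrightarrow> w \<in> carrier M \<Longrightarrow> v \<oplus>\<^bsub>M\<^esub> w = w \<oplus>\<^bsub>M\<^esub> v"
    and l_zero: "\<And>v. v \<in> carrier M \<Longrightarrow> \<zero>\<^bsub>M\<^esub> \<oplus>\<^bsub>M\<^esub> v = v"
    and smult: "\<And>c v. v \<in> carrier M \<Longrightarrow> c \<odot>\<^bsub>M\<^esub> v \<in> carrier M"
    and l_distr: "\<And>c d v. v \<in> carrier M \<Longrightarrow> (c + d) \<odot>\<^bsub>M\<^esub> v = c \<odot>\<^bsub>M\<^esub> v \<oplus>\<^bsub>M\<^esub> d \<odot>\<^bsub>M\<^esub> v"
    and r_distr: "\<And>c v w. v \<in> carrier M \<Longrightarrow> w \<in> carrier M \<Longrightarrow>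
      c \<odot>\<^bsub>M\<^esub> (v \<oplus>\<^bsub>M\<^esub> w) = c \<odot>\<^bsub>M\<^esub> v \<oplus>\<^bsub>M\<^esub> c \<odot>\<^bsub>M\<^esub> w"
    and smult_smult: "\<And>c d v. v \<in> carrier M \<Longrightarrow> (c * d) \<odot>\<^bsub>M\<^esub> v = c \<odot>\<^bsub>M\<^esub> (d \<odot>\<^bsub>M\<^esub> v)"
    and smult_one: "\<And>v. v \<in> carrier M \<Longrightarrow> 1 \<odot>\<^bsub>M\<^esub> v = v"
    and smult_zero: "\<And>v. v \<in> carrier M \<Longrightarrow> 0 \<odot>\<^bsub>M\<^esub> v = \<zero>\<^bsub>M\<^esub>"
    and act: "\<And>g v. g \<in> carrier G \<Longrightarrow> v \<in> carrier M \<Longrightarrow> act M g v \<in> carrier M"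
      "\<And>g v w. g \<in> carrier G \<Longrightarrow> v \<in> carrier M \<Longrightarrow> w \<in> carrier M \<Longrightarrow>
        act M g (v \<oplus>\<^bsub>M\<^esub> w) = act M g v \<oplus>\<^bsub>M\<^esub> act M g w"
      "\<And>g v c. g \<in> carrier G \<Longrightarrow> v \<in> carrier M \<Longrightarrow> act M g (c \<odot>\<^bsub>M\<^esub> v) = c \<odot>\<^bsub>M\<^esub> act M g v"
      "\<And>v. v \<in> carrier M \<Longrightarrow> act M \<one>\<^bsub>G\<^esub> v = v"
      "\<And>g h v. g \<in> carrier G \<Longrightarrow> h \<in> carrier G \<Longrightarrow> v \<in> carrier M \<Longrightarrow>
        act M (g \<otimes>\<^bsub>G\<^esub> h) v = act M g (act M h v)"
  shows "group_module G M"
proof -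
  have "\<exists>w\<in>carrier M. w \<oplus>\<^bsub>M\<^esub> v = \<zero>\<^bsub>M\<^esub>" if v: "v \<in> carrier M" for v
  proof
    show "(-1) \<odot>\<^bsub>M\<^esub> v \<in> carrier M" using v by (rule smult)
    have "(-1) \<odot>\<^bsub>M\<^esub> v \<oplus>\<^bsub>M\<^esub> 1 \<odot>\<^bsub>M\<^esub> v = \<zero>\<^bsub>M\<^esub>"
      using l_distr[OF v, of "-1" 1] smult_zero[OF v] by simp
    then show "(-1) \<odot>\<^bsub>M\<^esub> v \<oplus>\<^bsub>M\<^esub> v = \<zero>\<^bsub>M\<^esub>" using smult_one[OF v] by simp
  qed
  then have ab: "abelian_group M"
    using zero add assoc comm l_zero by (intro abelian_groupI) auto
  have "module (scalars :: 'a ring) M"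
    using ab smult l_distr r_distr smult_smult smult_one
    by (intro moduleI cring_from_type_algebra) auto
  then show ?thesis
    using assms(1) act by (intro group_module.intro group_module_axioms.intro) auto
qed

lemma group_module_typeI:
  fixes M :: "('a::field, 'v::ab_group_add, 'g) gmodule"
  assumes "group G" and zero: "\<zero>\<^bsub>M\<^esub> = 0" and plus: "add M = (+)"
    and "0 \<in> carrier M"
    and "\<And>v w. v \<in> carrier M \<Longrightarrow> w \<in> carrier M \<Longrightarrow> v + w \<in> carrier M"
    and smult: "\<And>c v. v \<in> carrier M \<Longrightarrow> c \<odot>\<^bsub>M\<^esub> v \<in> carrier M"
    and l_distr: "\<And>c d v. v \<in> carrier M \<Longrightarrow> (c + d) \<odot>\<^bsub>M\<^esub> v = c \<odot>\<^bsub>M\<^esub> v + d \<odot>\<^bsub>M\<^esub> v"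
    and r_distr: "\<And>c v w. v \<in> carrier M \<Longrightarrow> w \<in> carrier M \<Longrightarrow>
      c \<odot>\<^bsub>M\<^esub> (v + w) = c \<odot>\<^bsub>M\<^esub> v + c \<odot>\<^bsub>M\<^esub> w"
    and smult_smult: "\<And>c d v. v \<in> carrier M \<Longrightarrow> (c * d) \<odot>\<^bsub>M\<^esub> v = c \<odot>\<^bsub>M\<^esub> (d \<odot>\<^bsub>M\<^esub> v)"
    and smult_one: "\<And>v. v \<in> carrier M \<Longrightarrow> 1 \<odot>\<^bsub>M\<^esub> v = v"
    and act: "\<And>g v. g \<in> carrier G \<Longrightarrow> v \<in> carrier M \<Longrightarrow> act M g v \<in> carrier M"
      "\<And>g v w. g \<in> carrier G \<Longrightarrow> v \<in> carrier M \<Longrightarrow> w \<in> carrier M \<Longrightarrow>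
        act M g (v + w) = act M g v + act M g w"
      "\<And>g v c. g \<in> carrier G \<Longrightarrow> v \<in> carrier M \<Longrightarrow> act M g (c \<odot>\<^bsub>M\<^esub> v) = c \<odot>\<^bsub>M\<^esub> act M g v"
      "\<And>v. v \<in> carrier M \<Longrightarrow> act M \<one>\<^bsub>G\<^esub> v = v"
      "\<And>g h v. g \<in> carrier G \<Longrightarrow> h \<in> carrier G \<Longrightarrow> v \<in> carrier M \<Longrightarrow>
        act M (g \<otimes>\<^bsub>G\<^esub> h) v = act M g (act M h v)"
  shows "group_module G M"
proof (rule group_moduleI)
  show "0 \<odot>\<^bsub>M\<^esub> v = \<zero>\<^bsub>M\<^esub>" if "v \<in> carrier M" for v
    using l_distr[OF that, of 0 0] by (simp add: zero)
qed (use assms in \<open>auto simp: algebra_simps\<close>)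

context group_module begin

lemma smult_in [simp, intro]: "v \<in> carrier M \<Longrightarrow> c \<odot>\<^bsub>M\<^esub> v \<in> carrier M"
  by (simp add: smult_closed)

lemma smult_add_left: "v \<in> carrier M \<Longrightarrow> (c + d) \<odot>\<^bsub>M\<^esub> v = c \<odot>\<^bsub>M\<^esub> v \<oplus>\<^bsub>M\<^esub> d \<odot>\<^bsub>M\<^esub> v"
  using smult_l_distr[of c d v] by simp

lemma smult_add_right:
  "v \<in> carrier M \<Longrightarrow> w \<in> carrier M \<Longrightarrow> c \<odot>\<^bsub>M\<^esub> (v \<oplus>\<^bsub>M\<^esub> w) = c \<odot>\<^bsub>M\<^esub> v \<oplus>\<^bsub>M\<^esub> c \<odot>\<^bsub>M\<^esub> w"
  using smult_r_distr[of c v w] by simp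

lemma smult_mult: "v \<in> carrier M \<Longrightarrow> (c * d) \<odot>\<^bsub>M\<^esub> v = c \<odot>\<^bsub>M\<^esub> (d \<odot>\<^bsub>M\<^esub> v)"
  using smult_assoc1[of c d v] by simp

lemma one_smult [simp]: "v \<in> carrier M \<Longrightarrow> 1 \<odot>\<^bsub>M\<^esub> v = v"
  using smult_one[of v] by simp

lemma zero_smult [simp]: "v \<in> carrier M \<Longrightarrow> 0 \<odot>\<^bsub>M\<^esub> v = \<zero>\<^bsub>M\<^esub>"
  using smult_l_null[of v] by simp

lemma smult_zero [simp]: "c \<odot>\<^bsub>M\<^esub> \<zero>\<^bsub>M\<^esub> = \<zero>\<^bsub>M\<^esub>"
  using smult_r_null[of c] by simp

lemma minus_one_smult:
  assumes v: "v \<in> carrier M" shows "(-1) \<odot>\<^bsub>M\<^esub> v = \<ominus>\<^bsub>M\<^esub> v"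
proof -
  have "(-1) \<odot>\<^bsub>M\<^esub> v \<oplus>\<^bsub>M\<^esub> v = \<zero>\<^bsub>M\<^esub>" using smult_add_left[OF v, of "-1" 1] v by simp
  then show ?thesis using v by (metis M.minus_equality smult_in)
qed

lemma diff_eq_zero_iff [simp]:
  assumes "v \<in> carrier M" "w \<in> carrier M" shows "v \<ominus>\<^bsub>M\<^esub> w = \<zero>\<^bsub>M\<^esub> \<longleftrightarrow> v = w"
  using assms M.minus_equality[of v "\<ominus>\<^bsub>M\<^esub> w"] M.r_neg by (auto simp: a_minus_def)

lemma diff_zero [simp]: "v \<in> carrier M \<Longrightarrow> v \<ominus>\<^bsub>M\<^esub> \<zero>\<^bsub>M\<^esub> = v"
  using minus_one_smult[of "\<zero>\<^bsub>M\<^esub>"] by (simp add: a_minus_def)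

lemma act_zero [simp]: "g \<in> carrier G \<Longrightarrow> act M g \<zero>\<^bsub>M\<^esub> = \<zero>\<^bsub>M\<^esub>"
  using act_smult[of g "\<zero>\<^bsub>M\<^esub>" 0] by (simp add: act_closed)

lemma submodule_iff:
  "submodule N (scalars :: 'a ring) M \<longleftrightarrow> N \<subseteq> carrier M \<and> \<zero>\<^bsub>M\<^esub> \<in> N \<and>
    (\<forall>v\<in>N. \<forall>w\<in>N. v \<oplus>\<^bsub>M\<^esub> w \<in> N) \<and> (\<forall>c. \<forall>v\<in>N. c \<odot>\<^bsub>M\<^esub> v \<in> N)" (is "_ = ?R")
proof
  assume N: "submodule N (scalars :: 'a ring) M"
  have "\<zero>\<^bsub>M\<^esub> \<in> N" using N by (simp add: submodule_def subgroup_def)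
  with submoduleE[OF N] show ?R by auto
next
  assume R: ?R
  show "submodule N (scalars :: 'a ring) M"
  proof (rule submoduleI)
    show "\<ominus>\<^bsub>M\<^esub> a \<in> N" if "a \<in> N" for a
      using R that minus_one_smult[of a] by (metis subsetD)
  qed (use R in auto)
qed

lemma gsubmodule_iff:
  "gsubmodule G M N \<longleftrightarrow> N \<subseteq> carrier M \<and> \<zero>\<^bsub>M\<^esub> \<in> N \<and>
    (\<forall>v\<in>N. \<forall>w\<in>N. v \<oplus>\<^bsub>M\<^esub> w \<in> N) \<and> (\<forall>c. \<forall>v\<in>N. c \<odot>\<^bsub>M\<^esub> v \<in> N) \<and>
    (\<forall>g\<in>carrier G. \<forall>v\<in>N. act M g v \<in> N)"
  by (auto simp: gsubmodule_def submodule_iff)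

lemma group_module_submodule:
  assumes "gsubmodule G M N" shows "group_module G (M\<lparr>carrier := N\<rparr>)"
proof -
  have N: "N \<subseteq> carrier M" "\<zero>\<^bsub>M\<^esub> \<in> N" "\<And>v w. v \<in> N \<Longrightarrow> w \<in> N \<Longrightarrow> v \<oplus>\<^bsub>M\<^esub> w \<in> N"
    "\<And>c v. v \<in> N \<Longrightarrow> c \<odot>\<^bsub>M\<^esub> v \<in> N" "\<And>g v. g \<in> carrier G \<Longrightarrow> v \<in> N \<Longrightarrow> act M g v \<in> N"
    using assms by (auto simp: gsubmodule_iff)
  note [simp] = subsetD[OF N(1)]
  show ?thesis
    by (rule group_moduleI)
      (auto simp: N is_group M.a_ac smult_add_left smult_add_right smult_mult
        act_add act_smult act_one act_mult)
qed

lemma gsubmodule_carrier: "gsubmodule G M (carrier M)"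
  by (auto simp: gsubmodule_iff act_closed)

lemma gsubmodule_zero: "gsubmodule G M {\<zero>\<^bsub>M\<^esub>}"
  by (auto simp: gsubmodule_iff)

text \<open>Forgetting the action makes every linear map a homomorphism over the one-element group.
  In this way the universal property of the tensor product, which speaks of equivariant maps, also
  yields maps that are merely linear.\<close>

lemma group_module_trivial_group: "group_module (G\<lparr>carrier := {\<one>\<^bsub>G\<^esub>}\<rparr>) M"
proof -
  have "group (G\<lparr>carrier := {\<one>\<^bsub>G\<^esub>}\<rparr>)"
    by (rule subgroup.subgroup_is_group[OF triv_subgroup]) (rule is_group)
  then show ?thesis
    by (rule group_moduleI)
      (auto simp: is_group M.a_ac smult_add_left smult_add_right smult_mult
        act_add act_smult act_one act_mult)
qed

end

section \<open>Linear spans, and finite generation as finiteness of the carrier\<close>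

definition lin_span :: "('a::field, 'v, 'g) gmodule \<Rightarrow> 'v set \<Rightarrow> 'v set"
  where "lin_span M T = \<Inter>{U. submodule U (scalars :: 'a ring) M \<and> T \<subseteq> U}"

lemma lin_span_superset: "T \<subseteq> lin_span M T"
  by (auto simp: lin_span_def)

lemma lin_span_least: "submodule U scalars M \<Longrightarrow> T \<subseteq> U \<Longrightarrow> lin_span M T \<subseteq> U"
  by (auto simp: lin_span_def)

lemma (in group_module) submodule_lin_span:
  assumes "T \<subseteq> carrier M" shows "submodule (lin_span M T) scalars M"
proof -
  have "carrier M \<in> {U. submodule U (scalars :: 'a ring) M \<and> T \<subseteq> U}"
    using assms by (auto simp: submodule_iff)
  then show ?thesis unfolding submodule_iff lin_span_def
    by (intro conjI Inter_lower) (auto simp: submodule_iff)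
qed

lemma (in group_module) gsubmodule_lin_span:
  assumes T: "T \<subseteq> carrier M" and stable: "\<And>g t. g \<in> carrier G \<Longrightarrow> t \<in> T \<Longrightarrow> act M g t \<in> T"
  shows "gsubmodule G M (lin_span M T)"
  unfolding gsubmodule_def
proof (intro conjI ballI)
  show sub: "submodule (lin_span M T) (scalars :: 'a ring) M" by (rule submodule_lin_span[OF T])
  fix g v assume g: "g \<in> carrier G" and v: "v \<in> lin_span M T"
  note S = sub[unfolded submodule_iff]
  \<comment> \<open>The vectors of the span that \<open>g\<close> carries back into the span form a
    subspace containing \<open>T\<close>, hence exhaust the span.\<close>
  have "submodule {v \<in> lin_span M T. act M g v \<in> lin_span M T} (scalars :: 'a ring) M"
    unfolding submodule_iff using S g by (auto simp: act_add act_smult subset_iff)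
  moreover have "T \<subseteq> {v \<in> lin_span M T. act M g v \<in> lin_span M T}"
    using lin_span_superset[of T M] stable[OF g] by blast
  ultimately have "lin_span M T \<subseteq> {v \<in> lin_span M T. act M g v \<in> lin_span M T}"
    by (rule lin_span_least)
  then show "act M g v \<in> lin_span M T" using v by blast
qed

lemma (in group_module) finite_lin_span:
  assumes "finite (UNIV :: 'a set)" "finite T" "T \<subseteq> carrier M"
  shows "finite (lin_span M T)"
  using assms(2,3)
proof (induction T)
  case empty
  have "submodule {\<zero>\<^bsub>M\<^esub>} (scalars :: 'a ring) M" by (auto simp: submodule_iff)
  then have "lin_span M {} \<subseteq> {\<zero>\<^bsub>M\<^esub>}" by (rule lin_span_least) auto
  then show ?case by (rule finite_subset) simp
next
  case (insert t T)
  then have t: "t \<in> carrier M" and T: "T \<subseteq> carrier M" by auto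
  define N where "N = lin_span M T"
  have N: "N \<subseteq> carrier M" "\<zero>\<^bsub>M\<^esub> \<in> N" "\<And>v w. v \<in> N \<Longrightarrow> w \<in> N \<Longrightarrow> v \<oplus>\<^bsub>M\<^esub> w \<in> N"
    "\<And>c v. v \<in> N \<Longrightarrow> c \<odot>\<^bsub>M\<^esub> v \<in> N"
    using submodule_lin_span[OF T] unfolding N_def submodule_iff by auto
  note NM = subsetD[OF N(1)]
  \<comment> \<open>Adjoining one vector t to a subspace N gives N + F t, the image of N x F under
    (v, c) to v + c t, which is finite with N.\<close>
  let ?N' = "(\<lambda>(v, c). v \<oplus>\<^bsub>M\<^esub> c \<odot>\<^bsub>M\<^esub> t) ` (N \<times> UNIV)"
  have "submodule ?N' (scalars :: 'a ring) M"
    unfolding submodule_iff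
  proof (intro conjI allI ballI)
    show "?N' \<subseteq> carrier M" using NM t by auto
    show "\<zero>\<^bsub>M\<^esub> \<in> ?N'" using N(2) t by (intro image_eqI[of _ _ "(\<zero>\<^bsub>M\<^esub>, 0)"]) auto
  next
    fix v w assume "v \<in> ?N'" "w \<in> ?N'"
    then obtain v' c w' d where vw: "v = v' \<oplus>\<^bsub>M\<^esub> c \<odot>\<^bsub>M\<^esub> t" "v' \<in> N" "w = w' \<oplus>\<^bsub>M\<^esub> d \<odot>\<^bsub>M\<^esub> t" "w' \<in> N" by auto
    then have "v \<oplus>\<^bsub>M\<^esub> w = (v' \<oplus>\<^bsub>M\<^esub> w') \<oplus>\<^bsub>M\<^esub> (c + d) \<odot>\<^bsub>M\<^esub> t"
      using t NM by (simp add: smult_add_left M.a_ac)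
    then show "v \<oplus>\<^bsub>M\<^esub> w \<in> ?N'" using N(3)[OF vw(2,4)] by (intro image_eqI[of _ _ "(v' \<oplus>\<^bsub>M\<^esub> w', c + d)"]) auto
  next
    fix c v assume "v \<in> ?N'"
    then obtain v' d where v: "v = v' \<oplus>\<^bsub>M\<^esub> d \<odot>\<^bsub>M\<^esub> t" "v' \<in> N" by auto
    then have "c \<odot>\<^bsub>M\<^esub> v = c \<odot>\<^bsub>M\<^esub> v' \<oplus>\<^bsub>M\<^esub> (c * d) \<odot>\<^bsub>M\<^esub> t"
      using t NM by (simp add: smult_add_right smult_mult)
    then show "c \<odot>\<^bsub>M\<^esub> v \<in> ?N'" using N(4)[OF v(2)] by (intro image_eqI[of _ _ "(c \<odot>\<^bsub>M\<^esub> v', c * d)"]) auto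
  qed
  moreover have "insert t T \<subseteq> ?N'"
  proof -
    have "t \<in> ?N'" using N(2) t by (intro image_eqI[of _ _ "(\<zero>\<^bsub>M\<^esub>, 1)"]) auto
    moreover have "v \<in> ?N'" if "v \<in> T" for v
    proof -
      have v: "v \<in> N" using that lin_span_superset[of T M] by (auto simp: N_def)
      show ?thesis using t NM[OF v] v by (intro image_eqI[of _ _ "(v, 0)"]) auto
    qed
    ultimately show ?thesis by auto
  qed
  ultimately have "lin_span M (insert t T) \<subseteq> ?N'" by (rule lin_span_least)
  moreover have "finite ?N'" using insert.IH T assms(1) by (simp add: N_def)
  ultimately show ?case by (rule finite_subset)
qed

text \<open>The translates of a finite generating set under the finite group are finitely many and
  span the module linearly, and a finite span over a finite field is a finite set. From here on a
  finite carrier stands in for finite generation.\<close>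

lemma fg_module_iff_finite:
  fixes M :: "('a::{field,finite}, 'v, 'g) gmodule"
  assumes fin: "finite (carrier G)"
  shows "fg_module G M \<longleftrightarrow> group_module G M \<and> finite (carrier M)"
proof (intro iffI conjI)
  assume fg: "fg_module G M"
  then show gm: "group_module G M" by (simp add: fg_module_def)
  interpret group_module G M by (rule gm)
  from fg obtain S where S: "S \<subseteq> carrier M" "finite S" "\<Inter>{N. gsubmodule G M N \<and> S \<subseteq> N} = carrier M"
    by (auto simp: fg_module_def finitely_generated_def)
  define T where "T = (\<Union>g\<in>carrier G. act M g ` S)"
  have T: "T \<subseteq> carrier M" using S(1) by (auto simp: T_def act_closed)
  have "gsubmodule G M (lin_span M T)"
  proof (rule gsubmodule_lin_span[OF T])
    fix g t assume g: "g \<in> carrier G" and "t \<in> T"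
    then obtain h s where "h \<in> carrier G" "s \<in> S" "t = act M h s" by (auto simp: T_def)
    then show "act M g t \<in> T" unfolding T_def using g S(1)
      by (intro UN_I[of "g \<otimes>\<^bsub>G\<^esub> h"] image_eqI[of _ _ s]) (auto simp: act_mult)
  qed
  moreover have "S \<subseteq> T"
  proof
    fix s assume "s \<in> S"
    then show "s \<in> T" unfolding T_def using S(1)
      by (intro UN_I[of "\<one>\<^bsub>G\<^esub>"] image_eqI[of _ _ s]) (auto simp: act_one)
  qed
  then have "S \<subseteq> lin_span M T" using lin_span_superset[of T M] by blast
  ultimately have "carrier M \<subseteq> lin_span M T" unfolding S(3)[symmetric] by blast
  moreover have "finite (lin_span M T)" using S(2) fin T by (intro finite_lin_span) (auto simp: T_def)
  ultimately show "finite (carrier M)" by (rule finite_subset)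
next
  assume *: "group_module G M \<and> finite (carrier M)"
  then interpret group_module G M by simp
  have "\<Inter>{N. gsubmodule G M N \<and> carrier M \<subseteq> N} = carrier M"
    using gsubmodule_carrier by (auto simp: gsubmodule_iff)
  then show "fg_module G M" using * unfolding fg_module_def finitely_generated_def by blast
qed

section \<open>Homomorphisms, kernels, images and isomorphisms\<close>

lemma gmodule_homI:
  assumes "\<And>v. v \<in> carrier M \<Longrightarrow> h v \<in> carrier N"
    and "\<And>v w. v \<in> carrier M \<Longrightarrow> w \<in> carrier M \<Longrightarrow> h (v \<oplus>\<^bsub>M\<^esub> w) = h v \<oplus>\<^bsub>N\<^esub> h w"
    and "\<And>c v. v \<in> carrier M \<Longrightarrow> h (c \<odot>\<^bsub>M\<^esub> v) = c \<odot>\<^bsub>N\<^esub> h v"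
    and "\<And>g v. g \<in> carrier G \<Longrightarrow> v \<in> carrier M \<Longrightarrow> h (act M g v) = act N g (h v)"
  shows "h \<in> gmodule_hom G M N"
  using assms by (auto simp: gmodule_hom_def)

lemma gmodule_homD:
  assumes "h \<in> gmodule_hom G M N"
  shows "v \<in> carrier M \<Longrightarrow> h v \<in> carrier N"
    and "v \<in> carrier M \<Longrightarrow> w \<in> carrier M \<Longrightarrow> h (v \<oplus>\<^bsub>M\<^esub> w) = h v \<oplus>\<^bsub>N\<^esub> h w"
    and "v \<in> carrier M \<Longrightarrow> h (c \<odot>\<^bsub>M\<^esub> v) = c \<odot>\<^bsub>N\<^esub> h v"
    and "g \<in> carrier G \<Longrightarrow> v \<in> carrier M \<Longrightarrow> h (act M g v) = act N g (h v)"
  using assms by (auto simp: gmodule_hom_def)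

lemma gmodule_hom_zero:
  assumes "group_module G M" "group_module G' N" "h \<in> gmodule_hom G M N"
  shows "h \<zero>\<^bsub>M\<^esub> = \<zero>\<^bsub>N\<^esub>"
proof -
  interpret M: group_module G M by fact
  interpret N: group_module G' N by fact
  have "h (0 \<odot>\<^bsub>M\<^esub> \<zero>\<^bsub>M\<^esub>) = 0 \<odot>\<^bsub>N\<^esub> h \<zero>\<^bsub>M\<^esub>" by (rule gmodule_homD(3)[OF assms(3)]) simp
  then show ?thesis using gmodule_homD(1)[OF assms(3)] by simp
qed

lemma gmodule_hom_diff:
  assumes "group_module G M" "group_module G' N" "h \<in> gmodule_hom G M N" "v \<in> carrier M" "w \<in> carrier M"
  shows "h (v \<ominus>\<^bsub>M\<^esub> w) = h v \<ominus>\<^bsub>N\<^esub> h w"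
proof -
  interpret M: group_module G M by fact
  interpret N: group_module G' N by fact
  have "h (v \<ominus>\<^bsub>M\<^esub> w) = h (v \<oplus>\<^bsub>M\<^esub> (-1) \<odot>\<^bsub>M\<^esub> w)"
    using assms by (simp add: M.minus_one_smult a_minus_def)
  also have "\<dots> = h v \<ominus>\<^bsub>N\<^esub> h w"
    using assms by (simp add: gmodule_homD[OF assms(3)] N.minus_one_smult a_minus_def)
  finally show ?thesis .
qed

lemma gmodule_hom_comp:
  "h \<in> gmodule_hom G M N \<Longrightarrow> k \<in> gmodule_hom G N L \<Longrightarrow> k \<circ> h \<in> gmodule_hom G M L"
  by (auto simp: gmodule_hom_def Pi_iff)

lemma gmodule_hom_restrict:
  "h \<in> gmodule_hom G M N \<Longrightarrow> U \<subseteq> carrier M \<Longrightarrow> h ` U \<subseteq> V \<Longrightarrow>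
    h \<in> gmodule_hom G (M\<lparr>carrier := U\<rparr>) (N\<lparr>carrier := V\<rparr>)"
  by (auto simp: gmodule_hom_def Pi_iff subset_iff)

lemma gmodule_hom_inj_iff:
  assumes "group_module G M" "group_module G' N" "h \<in> gmodule_hom G M N"
  shows "inj_on h (carrier M) \<longleftrightarrow> (\<forall>v\<in>carrier M. h v = \<zero>\<^bsub>N\<^esub> \<longrightarrow> v = \<zero>\<^bsub>M\<^esub>)"
proof -
  interpret M: group_module G M by fact
  interpret N: group_module G' N by fact
  show ?thesis
  proof (intro iffI ballI impI)
    fix v assume "inj_on h (carrier M)" "v \<in> carrier M" "h v = \<zero>\<^bsub>N\<^esub>"
    then show "v = \<zero>\<^bsub>M\<^esub>" using gmodule_hom_zero[OF assms] by (metis M.zero_closed inj_onD)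
  next
    assume *: "\<forall>v\<in>carrier M. h v = \<zero>\<^bsub>N\<^esub> \<longrightarrow> v = \<zero>\<^bsub>M\<^esub>"
    show "inj_on h (carrier M)"
    proof (rule inj_onI)
      fix v w assume vw: "v \<in> carrier M" "w \<in> carrier M" "h v = h w"
      then have "h (v \<ominus>\<^bsub>M\<^esub> w) = \<zero>\<^bsub>N\<^esub>"
        using gmodule_hom_diff[OF assms vw(1,2)] gmodule_homD(1)[OF assms(3)] by simp
      with * vw have "v \<ominus>\<^bsub>M\<^esub> w = \<zero>\<^bsub>M\<^esub>" by simp
      then show "v = w" using vw by simp
    qed
  qed
qed

lemma gsubmodule_kernel:
  assumes "group_module G M" "group_module G N" "h \<in> gmodule_hom G M N"
  shows "gsubmodule G M {v \<in> carrier M. h v = \<zero>\<^bsub>N\<^esub>}"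
proof -
  interpret M: group_module G M by fact
  interpret N: group_module G N by fact
  show ?thesis
    using gmodule_hom_zero[OF assms]
    by (auto simp: M.gsubmodule_iff gmodule_homD[OF assms(3)] M.act_closed)
qed

lemma gsubmodule_vimage:
  assumes "group_module G M" "group_module G N" "h \<in> gmodule_hom G M N" "gsubmodule G N U"
  shows "gsubmodule G M {v \<in> carrier M. h v \<in> U}"
proof -
  interpret M: group_module G M by fact
  interpret N: group_module G N by fact
  show ?thesis
    using gmodule_hom_zero[OF assms(1-3)] assms(4)
    by (auto simp: M.gsubmodule_iff N.gsubmodule_iff gmodule_homD[OF assms(3)] M.act_closed)
qed

lemma gsubmodule_image:
  assumes "group_module G M" "group_module G N" "h \<in> gmodule_hom G M N" "gsubmodule G M U"
  shows "gsubmodule G N (h ` U)"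
proof -
  interpret M: group_module G M by fact
  interpret N: group_module G N by fact
  have U: "U \<subseteq> carrier M" "\<zero>\<^bsub>M\<^esub> \<in> U" "\<And>v w. v \<in> U \<Longrightarrow> w \<in> U \<Longrightarrow> v \<oplus>\<^bsub>M\<^esub> w \<in> U"
    "\<And>c v. v \<in> U \<Longrightarrow> c \<odot>\<^bsub>M\<^esub> v \<in> U" "\<And>g v. g \<in> carrier G \<Longrightarrow> v \<in> U \<Longrightarrow> act M g v \<in> U"
    using assms(4) by (auto simp: M.gsubmodule_iff)
  note h = gmodule_homD(2-4)[OF assms(3), symmetric]
  show ?thesis unfolding N.gsubmodule_iff
  proof (intro conjI ballI allI)
    show "h ` U \<subseteq> carrier N" using U(1) gmodule_homD(1)[OF assms(3)] by auto
    show "\<zero>\<^bsub>N\<^esub> \<in> h ` U" using gmodule_hom_zero[OF assms(1-3)] U(2) by (metis imageI)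
  next
    fix v w assume "v \<in> h ` U" "w \<in> h ` U"
    then obtain v' w' where "v = h v'" "w = h w'" "v' \<in> U" "w' \<in> U" by auto
    then show "v \<oplus>\<^bsub>N\<^esub> w \<in> h ` U" using U by (auto simp: h subset_iff)
  next
    fix c v assume "v \<in> h ` U"
    then show "c \<odot>\<^bsub>N\<^esub> v \<in> h ` U" using U by (auto simp: h subset_iff)
  next
    fix g v assume "g \<in> carrier G" "v \<in> h ` U"
    then show "act N g v \<in> h ` U" using U by (auto simp: h subset_iff)
  qed
qed

lemma gmodule_isomorphicI:
  "h \<in> gmodule_hom G M N \<Longrightarrow> bij_betw h (carrier M) (carrier N) \<Longrightarrow> gmodule_isomorphic G M N"
  by (auto simp: gmodule_isomorphic_def)

lemma gmodule_isomorphic_refl: "gmodule_isomorphic G M M"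
  by (rule gmodule_isomorphicI[of id]) (auto simp: gmodule_hom_def)

lemma gmodule_isomorphic_trans:
  "gmodule_isomorphic G M N \<Longrightarrow> gmodule_isomorphic G N L \<Longrightarrow> gmodule_isomorphic G M L"
  unfolding gmodule_isomorphic_def by (meson bij_betw_trans gmodule_hom_comp)

lemma gmodule_hom_inverse:
  assumes "group_module G M" "h \<in> gmodule_hom G M N" "bij_betw h (carrier M) (carrier N)"
  shows "inv_into (carrier M) h \<in> gmodule_hom G N M"
proof -
  interpret M: group_module G M by fact
  let ?k = "inv_into (carrier M) h"
  have kc: "?k w \<in> carrier M" if "w \<in> carrier N" for w
    using that assms(3) by (metis bij_betw_def inv_into_into)
  have hk: "h (?k w) = w" if "w \<in> carrier N" for w
    using that assms(3) by (metis bij_betw_inv_into_right)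
  have kh: "?k (h v) = v" if "v \<in> carrier M" for v
    using that assms(3) by (metis bij_betw_inv_into_left)
  note h = gmodule_homD[OF assms(2)]
  show ?thesis
  proof (rule gmodule_homI)
    fix v w assume vw: "v \<in> carrier N" "w \<in> carrier N"
    have "?k (h (?k v \<oplus>\<^bsub>M\<^esub> ?k w)) = ?k v \<oplus>\<^bsub>M\<^esub> ?k w" using kc vw by (intro kh) auto
    then show "?k (v \<oplus>\<^bsub>N\<^esub> w) = ?k v \<oplus>\<^bsub>M\<^esub> ?k w" using kc vw by (simp add: h hk)
  next
    fix c v assume vw: "v \<in> carrier N"
    have "?k (h (c \<odot>\<^bsub>M\<^esub> ?k v)) = c \<odot>\<^bsub>M\<^esub> ?k v" using kc vw by (intro kh) auto
    then show "?k (c \<odot>\<^bsub>N\<^esub> v) = c \<odot>\<^bsub>M\<^esub> ?k v" using kc vw by (simp add: h hk)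
  next
    fix g v assume vw: "g \<in> carrier G" "v \<in> carrier N"
    have "?k (h (act M g (?k v))) = act M g (?k v)" using kc vw by (intro kh) (auto simp: M.act_closed)
    then show "?k (act N g v) = act M g (?k v)" using kc vw by (simp add: h hk)
  qed (rule kc)
qed

lemma gmodule_isomorphic_sym:
  assumes "group_module G M" "gmodule_isomorphic G M N" shows "gmodule_isomorphic G N M"
  using assms gmodule_hom_inverse bij_betw_inv_into unfolding gmodule_isomorphic_def by blast

lemma gmodule_isomorphic_card:
  "gmodule_isomorphic G M N \<Longrightarrow> card (carrier M) = card (carrier N)"
  by (auto simp: gmodule_isomorphic_def bij_betw_same_card)

lemma gmodule_isomorphic_finite:
  "gmodule_isomorphic G M N \<Longrightarrow> finite (carrier M) \<longleftrightarrow> finite (carrier N)"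
  by (auto simp: gmodule_isomorphic_def bij_betw_finite)

text \<open>A map from a finite set onto a set that is at least as large is injective. This replaces
  the construction of inverse maps for tensor products.\<close>

lemma gmodule_isomorphicI_card:
  assumes "h \<in> gmodule_hom G M N" "h ` carrier M = carrier N" "finite (carrier M)"
    "card (carrier M) \<le> card (carrier N)"
  shows "gmodule_isomorphic G M N"
proof (rule gmodule_isomorphicI[OF assms(1)])
  have "card (h ` carrier M) = card (carrier M)"
    using card_image_le[OF assms(3), of h] assms(2,4) by simp
  then have "inj_on h (carrier M)" by (rule eq_card_imp_inj_on[OF assms(3)])
  then show "bij_betw h (carrier M) (carrier N)" using assms(2) by (simp add: bij_betw_def)
qed

text \<open>Two preimages of a point under p differ by an element of its kernel, where h vanishes,
  so h of a preimage depends only on the point. Stated for any surjection rather than for a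
  canonical projection, the lemma serves tensor products as well as images of submodules.\<close>

lemma gmodule_hom_factor:
  assumes "group_module G M" "group_module G Q" "group_module G W"
    and p: "p \<in> gmodule_hom G M Q" "p ` carrier M = carrier Q"
    and h: "h \<in> gmodule_hom G M W" "\<And>v. v \<in> carrier M \<Longrightarrow> p v = \<zero>\<^bsub>Q\<^esub> \<Longrightarrow> h v = \<zero>\<^bsub>W\<^esub>"
  obtains k where "k \<in> gmodule_hom G Q W" "\<And>v. v \<in> carrier M \<Longrightarrow> k (p v) = h v"
proof -
  interpret M: group_module G M by fact
  interpret Q: group_module G Q by fact
  interpret W: group_module G W by fact
  have eq: "h v = h w" if "v \<in> carrier M" "w \<in> carrier M" "p v = p w" for v w
  proof -
    have "p (v \<ominus>\<^bsub>M\<^esub> w) = \<zero>\<^bsub>Q\<^esub>"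
      using gmodule_hom_diff[OF assms(1,2) p(1) that(1,2)] that gmodule_homD(1)[OF p(1)] by simp
    then have "h (v \<ominus>\<^bsub>M\<^esub> w) = \<zero>\<^bsub>W\<^esub>" using that h(2) by simp
    then have "h v \<ominus>\<^bsub>W\<^esub> h w = \<zero>\<^bsub>W\<^esub>" using gmodule_hom_diff[OF assms(1,3) h(1) that(1,2)] by simp
    then show ?thesis using that gmodule_homD(1)[OF h(1)] by simp
  qed
  define s where "s = inv_into (carrier M) p"
  have s: "s q \<in> carrier M" "p (s q) = q" if "q \<in> carrier Q" for q
    using that p(2) by (metis s_def inv_into_into, metis s_def f_inv_into_f)
  define k where "k = h \<circ> s"
  have kp: "k (p v) = h v" if "v \<in> carrier M" for v
  proof -
    have q: "p v \<in> carrier Q" using that p(2) by auto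
    show ?thesis unfolding k_def comp_def by (rule eq) (use s[OF q] that in auto)
  qed
  have "k \<in> gmodule_hom G Q W"
  proof (rule gmodule_homI)
    fix v w assume vw: "v \<in> carrier Q" "w \<in> carrier Q"
    have "k (p (s v \<oplus>\<^bsub>M\<^esub> s w)) = k v \<oplus>\<^bsub>W\<^esub> k w"
      using s vw by (subst kp) (auto simp: gmodule_homD[OF h(1)] k_def)
    then show "k (v \<oplus>\<^bsub>Q\<^esub> w) = k v \<oplus>\<^bsub>W\<^esub> k w" using s vw by (simp add: gmodule_homD[OF p(1)])
  next
    fix c v assume v: "v \<in> carrier Q"
    have "k (p (c \<odot>\<^bsub>M\<^esub> s v)) = c \<odot>\<^bsub>W\<^esub> k v"
      using s v by (subst kp) (auto simp: gmodule_homD[OF h(1)] k_def)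
    then show "k (c \<odot>\<^bsub>Q\<^esub> v) = c \<odot>\<^bsub>W\<^esub> k v" using s v by (simp add: gmodule_homD[OF p(1)])
  next
    fix g v assume v: "g \<in> carrier G" "v \<in> carrier Q"
    have "k (p (act M g (s v))) = act W g (k v)"
      using s v by (subst kp) (auto simp: gmodule_homD[OF h(1)] k_def M.act_closed)
    then show "k (act Q g v) = act W g (k v)" using s v by (simp add: gmodule_homD[OF p(1)])
  qed (auto simp: k_def gmodule_homD(1)[OF h(1)] s)
  then show thesis using that kp by blast
qed

section \<open>Quotient modules\<close>

definition gquot :: "('a::field, 'v, 'g) gmodule \<Rightarrow> 'v set \<Rightarrow> ('a, 'v set, 'g) gmodule"
  where "gquot F R = \<lparr>carrier = a_rcosets\<^bsub>F\<^esub> R, mult = undefined, one = undefined, zero = R,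
     add = set_add F,
     module.smult = (\<lambda>c Y. \<Union>f\<in>Y. R +>\<^bsub>F\<^esub> (c \<odot>\<^bsub>F\<^esub> f)),
     act = (\<lambda>g Y. \<Union>f\<in>Y. R +>\<^bsub>F\<^esub> (act F g f))\<rparr>"

context group_module begin

lemma coset_eq_iff:
  assumes "submodule R (scalars :: 'a ring) M" "v \<in> carrier M" "w \<in> carrier M"
  shows "R +>\<^bsub>M\<^esub> v = R +>\<^bsub>M\<^esub> w \<longleftrightarrow> v \<ominus>\<^bsub>M\<^esub> w \<in> R"
proof -
  interpret R: abelian_subgroup R M
    using assms(1) by (intro abelian_subgroupI3 additive_subgroupI M.abelian_group_axioms)
      (simp add: submodule_def)
  have "v \<in> R +>\<^bsub>M\<^esub> w \<longleftrightarrow> v \<ominus>\<^bsub>M\<^esub> w \<in> R"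
    unfolding a_minus_def by (rule R.a_rcos_module[OF assms(3,2)])
  moreover have "v \<in> R +>\<^bsub>M\<^esub> w \<longleftrightarrow> R +>\<^bsub>M\<^esub> v = R +>\<^bsub>M\<^esub> w"
    using R.a_rcos_self[OF assms(2)] R.a_repr_independence'[OF _ assms(3), of v] by metis
  ultimately show ?thesis by simp
qed

context
  fixes R assumes R: "gsubmodule G M R"
begin

lemma gquot_subgroup: "abelian_subgroup R M"
  using R by (intro abelian_subgroupI3 additive_subgroupI M.abelian_group_axioms)
      (simp add: submodule_def gsubmodule_def)

lemma gquot_simps:
  "carrier (gquot M R) = (\<lambda>v. R +>\<^bsub>M\<^esub> v) ` carrier M"
  "\<zero>\<^bsub>gquot M R\<^esub> = R +>\<^bsub>M\<^esub> \<zero>\<^bsub>M\<^esub>"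
  "v \<in> carrier M \<Longrightarrow> w \<in> carrier M \<Longrightarrow> (R +>\<^bsub>M\<^esub> v) \<oplus>\<^bsub>gquot M R\<^esub> (R +>\<^bsub>M\<^esub> w) = R +>\<^bsub>M\<^esub> (v \<oplus>\<^bsub>M\<^esub> w)"
  "v \<in> carrier M \<Longrightarrow> c \<odot>\<^bsub>gquot M R\<^esub> (R +>\<^bsub>M\<^esub> v) = R +>\<^bsub>M\<^esub> (c \<odot>\<^bsub>M\<^esub> v)"
  "v \<in> carrier M \<Longrightarrow> g \<in> carrier G \<Longrightarrow> act (gquot M R) g (R +>\<^bsub>M\<^esub> v) = R +>\<^bsub>M\<^esub> act M g v"
proof -
  interpret R: abelian_subgroup R M by (rule gquot_subgroup)
  have RM: "R \<subseteq> carrier M" by (rule R.a_subset)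
  show "carrier (gquot M R) = (\<lambda>v. R +>\<^bsub>M\<^esub> v) ` carrier M" by (auto simp: gquot_def A_RCOSETS_def')
  show "\<zero>\<^bsub>gquot M R\<^esub> = R +>\<^bsub>M\<^esub> \<zero>\<^bsub>M\<^esub>" using RM by (simp add: gquot_def)
  show "v \<in> carrier M \<Longrightarrow> w \<in> carrier M \<Longrightarrow> (R +>\<^bsub>M\<^esub> v) \<oplus>\<^bsub>gquot M R\<^esub> (R +>\<^bsub>M\<^esub> w) = R +>\<^bsub>M\<^esub> (v \<oplus>\<^bsub>M\<^esub> w)"
    by (simp add: gquot_def R.a_rcos_sum)
  have ex: "\<exists>r\<in>R. f = r \<oplus>\<^bsub>M\<^esub> v" if "f \<in> R +>\<^bsub>M\<^esub> v" for f v
    using that by (auto simp: a_r_coset_def')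
  have same: "R +>\<^bsub>M\<^esub> (r \<oplus>\<^bsub>M\<^esub> v) = R +>\<^bsub>M\<^esub> v" if "r \<in> R" "v \<in> carrier M" for r v
    using R.a_rcos_const[OF that(1)] M.a_coset_add_assoc[OF RM _ that(2), of r] that RM by auto
  show "v \<in> carrier M \<Longrightarrow> c \<odot>\<^bsub>gquot M R\<^esub> (R +>\<^bsub>M\<^esub> v) = R +>\<^bsub>M\<^esub> (c \<odot>\<^bsub>M\<^esub> v)"
  proof -
    assume v: "v \<in> carrier M"
    \<comment> \<open>The multiple of a coset is a union over its elements; all of them contribute
      the same coset, so the union collapses. The action is treated in the same way below.\<close>
    have "R +>\<^bsub>M\<^esub> (c \<odot>\<^bsub>M\<^esub> f) = R +>\<^bsub>M\<^esub> (c \<odot>\<^bsub>M\<^esub> v)" if f: "f \<in> R +>\<^bsub>M\<^esub> v" for f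
    proof -
      obtain r where r: "r \<in> R" "f = r \<oplus>\<^bsub>M\<^esub> v" using ex[OF f] by auto
      then have "c \<odot>\<^bsub>M\<^esub> f = c \<odot>\<^bsub>M\<^esub> r \<oplus>\<^bsub>M\<^esub> c \<odot>\<^bsub>M\<^esub> v" using RM v by (simp add: smult_add_right subset_iff)
      moreover have "c \<odot>\<^bsub>M\<^esub> r \<in> R" using R r by (simp add: gsubmodule_iff)
      ultimately show ?thesis using v by (simp add: same)
    qed
    then have "(\<Union>f\<in>R +>\<^bsub>M\<^esub> v. R +>\<^bsub>M\<^esub> (c \<odot>\<^bsub>M\<^esub> f)) = (\<Union>f\<in>R +>\<^bsub>M\<^esub> v. R +>\<^bsub>M\<^esub> (c \<odot>\<^bsub>M\<^esub> v))"
      by (rule SUP_cong[OF refl])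
    also have "\<dots> = R +>\<^bsub>M\<^esub> (c \<odot>\<^bsub>M\<^esub> v)" using R.a_rcos_self[OF v] by blast
    finally show ?thesis by (simp add: gquot_def)
  qed
  show "v \<in> carrier M \<Longrightarrow> g \<in> carrier G \<Longrightarrow> act (gquot M R) g (R +>\<^bsub>M\<^esub> v) = R +>\<^bsub>M\<^esub> act M g v"
  proof -
    assume v: "v \<in> carrier M" and g: "g \<in> carrier G"
    have "R +>\<^bsub>M\<^esub> (act M g f) = R +>\<^bsub>M\<^esub> (act M g v)" if f: "f \<in> R +>\<^bsub>M\<^esub> v" for f
    proof -
      obtain r where r: "r \<in> R" "f = r \<oplus>\<^bsub>M\<^esub> v" using ex[OF f] by auto
      then have "act M g f = act M g r \<oplus>\<^bsub>M\<^esub> act M g v" using RM v g by (simp add: act_add subset_iff)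
      moreover have "act M g r \<in> R" using R r g by (simp add: gsubmodule_iff)
      ultimately show ?thesis using v g by (simp add: same act_closed)
    qed
    then have "(\<Union>f\<in>R +>\<^bsub>M\<^esub> v. R +>\<^bsub>M\<^esub> act M g f) = (\<Union>f\<in>R +>\<^bsub>M\<^esub> v. R +>\<^bsub>M\<^esub> act M g v)"
      by (rule SUP_cong[OF refl])
    also have "\<dots> = R +>\<^bsub>M\<^esub> act M g v" using R.a_rcos_self[OF v] by blast
    finally show ?thesis by (simp add: gquot_def)
  qed
qed

lemma group_module_gquot: "group_module G (gquot M R)"
proof -
  note [simp] = gquot_simps(2-)
  show ?thesis
    by (rule group_moduleI; (unfold gquot_simps(1))?; (elim imageE)?;
        simp add: is_group smult_add_left smult_add_right smult_mult act_closed
        act_add act_smult act_one act_mult M.a_ac)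
qed

lemma gquot_proj_hom: "(\<lambda>v. R +>\<^bsub>M\<^esub> v) \<in> gmodule_hom G M (gquot M R)"
  by (rule gmodule_homI) (auto simp: gquot_simps)

lemma gquot_proj_eq_zero:
  assumes "v \<in> carrier M" shows "R +>\<^bsub>M\<^esub> v = \<zero>\<^bsub>gquot M R\<^esub> \<longleftrightarrow> v \<in> R"
  using coset_eq_iff[of R v "\<zero>\<^bsub>M\<^esub>"] R assms
  by (simp add: gquot_simps(2) gsubmodule_def diff_zero)

end

end


section \<open>Tensor products\<close>

context group_module begin

lemma finsum_smult:
  "finite A \<Longrightarrow> f \<in> A \<rightarrow> carrier M \<Longrightarrow> c \<odot>\<^bsub>M\<^esub> finsum M f A = finsum M (\<lambda>i. c \<odot>\<^bsub>M\<^esub> f i) A"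
  by (rule finsum_smult_ldistr) auto

lemma finsum_in [simp]: "(\<And>i. i \<in> A \<Longrightarrow> f i \<in> carrier M) \<Longrightarrow> finsum M f A \<in> carrier M"
  by (rule M.finsum_closed) auto

lemma finsum_eq:
  "(\<And>i. i \<in> A \<Longrightarrow> g i \<in> carrier M) \<Longrightarrow> (\<And>i. i \<in> A \<Longrightarrow> f i = g i) \<Longrightarrow> finsum M f A = finsum M g A"
  by (rule M.finsum_cong') auto

lemma finsum_delta:
  assumes "finite A" "j \<in> A" "v \<in> carrier M"
  shows "finsum M (\<lambda>i. if i = j then v else \<zero>\<^bsub>M\<^esub>) A = v"
  using M.finsum_singleton[of j A "\<lambda>_. v"] assms by (simp add: eq_commute[of j] cong: if_cong)

end

lemma hom_finsum:
  assumes "group_module G M" "group_module G' N" "h \<in> gmodule_hom G M N" "finite A"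
    and "\<And>i. i \<in> A \<Longrightarrow> f i \<in> carrier M"
  shows "h (finsum M f A) = finsum N (\<lambda>i. h (f i)) A"
proof -
  interpret M: group_module G M by fact
  interpret N: group_module G' N by fact
  show ?thesis using assms(4,5)
  proof (induction A)
    case empty
    then show ?case using gmodule_hom_zero[OF assms(1-3)] by simp
  next
    case (insert a A)
    then show ?case
      using gmodule_homD[OF assms(3)] by (subst M.M.finsum_insert N.M.finsum_insert; auto)+
  qed
qed

text \<open>A basis together with its dual basis. The forms \<open>co\<close> are linear but in
  general not equivariant; the cardinality stores the dimension n.\<close>

locale coordinates = group_module G M for G :: "'g monoid" and M :: "('a::{field,finite}, 'v, 'g) gmodule" +
  fixes n :: nat and b :: "nat \<Rightarrow> 'v" and co :: "nat \<Rightarrow> 'v \<Rightarrow> 'a"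
  assumes basis_in: "i < n \<Longrightarrow> b i \<in> carrier M"
    and co_add: "i < n \<Longrightarrow> v \<in> carrier M \<Longrightarrow> w \<in> carrier M \<Longrightarrow> co i (v \<oplus>\<^bsub>M\<^esub> w) = co i v + co i w"
    and co_smult: "i < n \<Longrightarrow> v \<in> carrier M \<Longrightarrow> co i (c \<odot>\<^bsub>M\<^esub> v) = c * co i v"
    and co_basis: "i < n \<Longrightarrow> j < n \<Longrightarrow> co i (b j) = (if i = j then 1 else 0)"
    and expansion: "v \<in> carrier M \<Longrightarrow> v = finsum M (\<lambda>i. co i v \<odot>\<^bsub>M\<^esub> b i) {..<n}"
    and card_carrier: "card (carrier M) = CARD('a) ^ n"

text \<open>An independent family of length n has \<open>CARD('a) ^ n\<close> distinct combinations,
  so its length is bounded by the size of the module and a longest family exists. It spans, because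
  a vector outside its span could be appended to it.\<close>

lemma exists_coordinates:
  fixes M :: "('a::{field,finite}, 'v, 'g) gmodule"
  assumes "group_module G M" "finite (carrier M)"
  shows "\<exists>n b co. coordinates G M n b co"
proof -
  interpret group_module G M by fact
  define comb where "comb n b c = finsum M (\<lambda>i. c i \<odot>\<^bsub>M\<^esub> b i) {..<n}" for n :: nat and b and c :: "nat \<Rightarrow> 'a"
  define indep where "indep n b \<longleftrightarrow> (\<forall>i<n. b i \<in> carrier M) \<and>
    (\<forall>c. comb n b c = \<zero>\<^bsub>M\<^esub> \<longrightarrow> (\<forall>i<n. c i = 0))" for n :: nat and b
  have comb_in: "comb n b c \<in> carrier M" if "\<forall>i<n. b i \<in> carrier M" for n b c
    unfolding comb_def using that by (intro finsum_in) auto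
  have comb_add: "comb n b (\<lambda>i. c i + d i) = comb n b c \<oplus>\<^bsub>M\<^esub> comb n b d" if "\<forall>i<n. b i \<in> carrier M" for n b c d
  proof -
    have "comb n b (\<lambda>i. c i + d i) = finsum M (\<lambda>i. c i \<odot>\<^bsub>M\<^esub> b i \<oplus>\<^bsub>M\<^esub> d i \<odot>\<^bsub>M\<^esub> b i) {..<n}"
      unfolding comb_def using that by (intro finsum_eq) (auto simp: smult_add_left)
    also have "\<dots> = comb n b c \<oplus>\<^bsub>M\<^esub> comb n b d"
      unfolding comb_def using that by (intro M.finsum_addf) auto
    finally show ?thesis .
  qed
  have comb_smult: "comb n b (\<lambda>i. e * c i) = e \<odot>\<^bsub>M\<^esub> comb n b c" if "\<forall>i<n. b i \<in> carrier M" for n b c e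
    unfolding comb_def using that
    by (subst finsum_smult) (auto intro!: finsum_eq simp: smult_mult)
  have inj: "inj_on (comb n b) (PiE {..<n} (\<lambda>_. UNIV))" if ind: "indep n b" for n b
  proof (rule inj_onI)
    fix c d :: "nat \<Rightarrow> 'a" assume c: "c \<in> PiE {..<n} (\<lambda>_. UNIV)" and d: "d \<in> PiE {..<n} (\<lambda>_. UNIV)"
      and eq: "comb n b c = comb n b d"
    have bM: "\<forall>i<n. b i \<in> carrier M" using ind by (simp add: indep_def)
    have "comb n b (\<lambda>i. c i + (-1) * d i) = comb n b d \<oplus>\<^bsub>M\<^esub> (-1) \<odot>\<^bsub>M\<^esub> comb n b d"
      using comb_add[OF bM, of c "\<lambda>i. (-1) * d i"] comb_smult[OF bM, of "-1" d] eq by simp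
    also have "\<dots> = \<zero>\<^bsub>M\<^esub>" using comb_in[OF bM] by (simp add: minus_one_smult M.r_neg)
    finally have "\<forall>i<n. c i + (-1) * d i = 0" using ind unfolding indep_def by blast
    then show "c = d" using c d by (intro PiE_ext[OF c d]) auto
  qed
  have bound: "CARD('a) ^ n \<le> card (carrier M)" if ind: "indep n b" for n b
  proof -
    have "card (PiE {..<n} (\<lambda>_. UNIV :: 'a set)) \<le> card (carrier M)"
      using ind by (intro card_inj_on_le[OF inj[OF ind] _ assms(2)]) (auto simp: indep_def intro!: comb_in)
    then show ?thesis by (simp add: card_PiE)
  qed
  have two: "2 \<le> CARD('a)"
    using card_mono[of "UNIV :: 'a set" "{0, 1}"] by simp
  have nb: "n < card (carrier M)" if "indep n b" for n b
    using bound[OF that] less_exp[of n] power_mono[OF two, of n] by linarith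
  have "indep 0 undefined" by (simp add: indep_def)
  then obtain n where n: "\<exists>b. indep n b" and max: "\<And>m. (\<exists>b. indep m b) \<Longrightarrow> m \<le> n"
    using ex_has_greatest_nat[of "\<lambda>n. \<exists>b. indep n b" 0 id "card (carrier M)"] nb by force
  then obtain b where ind: "indep n b" by auto
  have bM: "\<forall>i<n. b i \<in> carrier M" using ind by (simp add: indep_def)
  have surj: "\<exists>c. v = comb n b c" if v: "v \<in> carrier M" for v
  proof (rule ccontr)
    assume no: "\<not> ?thesis"
    define b' where "b' = b(n := v)"
    have eq: "comb (Suc n) b' c = c n \<odot>\<^bsub>M\<^esub> v \<oplus>\<^bsub>M\<^esub> comb n b c" for c
      unfolding comb_def lessThan_Suc using bM v
      by (subst M.finsum_insert) (auto simp: b'_def intro!: finsum_eq arg_cong2[where f = "add M"])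
    have "indep (Suc n) b'" unfolding indep_def
    proof (intro conjI allI impI)
      show "b' i \<in> carrier M" if "i < Suc n" for i using that bM v by (auto simp: b'_def less_Suc_eq)
      fix c i assume z: "comb (Suc n) b' c = \<zero>\<^bsub>M\<^esub>" and i: "i < Suc n"
      have "c n = 0"
      proof (rule ccontr)
        assume cn: "c n \<noteq> 0"
        have "c n \<odot>\<^bsub>M\<^esub> v = \<ominus>\<^bsub>M\<^esub> comb n b c"
          using z eq[of c] v comb_in[OF bM] by (metis M.minus_equality smult_in)
        also have "\<dots> = comb n b (\<lambda>i. (-1) * c i)"
          using comb_smult[OF bM, of "-1" c] comb_in[OF bM] by (simp add: minus_one_smult)
        finally have "inverse (c n) \<odot>\<^bsub>M\<^esub> (c n \<odot>\<^bsub>M\<^esub> v) = comb n b (\<lambda>i. inverse (c n) * ((-1) * c i))"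
          using comb_smult[OF bM, of "inverse (c n)" "\<lambda>i. (-1) * c i"] by simp
        moreover have "inverse (c n) \<odot>\<^bsub>M\<^esub> (c n \<odot>\<^bsub>M\<^esub> v) = v"
          using cn v by (simp flip: smult_mult)
        ultimately show False using no by metis
      qed
      then have "comb n b c = \<zero>\<^bsub>M\<^esub>" using z eq[of c] v comb_in[OF bM] by simp
      then have "\<forall>i<n. c i = 0" using ind by (simp add: indep_def)
      then show "c i = 0" using i \<open>c n = 0\<close> by (auto simp: less_Suc_eq)
    qed
    then show False using max[of "Suc n"] by auto
  qed
  define cf where "cf v = (SOME c. v = comb n b c)" for v
  have cf: "v = comb n b (cf v)" if "v \<in> carrier M" for v
    using someI_ex[OF surj[OF that]] unfolding cf_def .
  \<comment> \<open>Coefficients at indices from \<open>n\<close> on are arbitrary, so uniqueness is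
    claimed below \<open>n\<close> and obtained after \<open>restrict\<close>.\<close>
  have uniq: "c i = d i" if "comb n b c = comb n b d" "i < n" for c d i
  proof -
    have r: "comb n b (restrict c {..<n}) = comb n b c" for c
      unfolding comb_def using bM by (intro finsum_eq) auto
    have "restrict c {..<n} = restrict d {..<n}"
      by (rule inj_onD[OF inj[OF ind]]) (use that in \<open>auto simp: r\<close>)
    then show ?thesis using that(2) by (metis lessThan_iff restrict_apply')
  qed
  have "coordinates G M n b (\<lambda>i v. cf v i)"
  proof unfold_locales
    show "b i \<in> carrier M" if "i < n" for i using that bM by simp
    show "cf (v \<oplus>\<^bsub>M\<^esub> w) i = cf v i + cf w i" if "i < n" "v \<in> carrier M" "w \<in> carrier M" for i v w
      by (rule uniq[OF _ that(1)]) (use that in \<open>simp add: comb_add[OF bM] flip: cf\<close>)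
    show "cf (c \<odot>\<^bsub>M\<^esub> v) i = c * cf v i" if "i < n" "v \<in> carrier M" for i v c
      by (rule uniq[OF _ that(1)]) (use that in \<open>simp add: comb_smult[OF bM] flip: cf\<close>)
    show "cf (b j) i = (if i = j then 1 else 0)" if "i < n" "j < n" for i j
    proof (rule uniq[OF _ that(1)])
      have "comb n b (\<lambda>i. if i = j then 1 else 0) = finsum M (\<lambda>i. if i = j then b j else \<zero>\<^bsub>M\<^esub>) {..<n}"
        unfolding comb_def using bM by (intro finsum_eq) auto
      also have "\<dots> = b j" using that bM by (intro finsum_delta) auto
      finally show "comb n b (cf (b j)) = comb n b (\<lambda>i. if i = j then 1 else 0)"
        using that bM by (simp flip: cf)
    qed
    show "v = finsum M (\<lambda>i. cf v i \<odot>\<^bsub>M\<^esub> b i) {..<n}" if "v \<in> carrier M" for v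
      using cf[OF that] by (simp add: comb_def)
    have "comb n b ` PiE {..<n} (\<lambda>_. UNIV) = carrier M"
    proof (intro equalityI subsetI)
      fix v assume "v \<in> carrier M"
      then have "v = comb n b (restrict (cf v) {..<n})"
        using cf[of v] bM unfolding comb_def by (subst finsum_eq[of _ "\<lambda>i. cf v i \<odot>\<^bsub>M\<^esub> b i"]) auto
      moreover have "restrict (cf v) {..<n} \<in> PiE {..<n} (\<lambda>_. UNIV)" by simp
      ultimately show "v \<in> comb n b ` PiE {..<n} (\<lambda>_. UNIV)" by (rule image_eqI[where f = "comb n b"])
    qed (use comb_in[OF bM] in auto)
    then have "card (carrier M) = card (PiE {..<n} (\<lambda>_. UNIV :: 'a set))"
      using card_image[OF inj[OF ind]] by simp
    then show "card (carrier M) = CARD('a) ^ n" by (simp add: card_PiE)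
  qed
  then show ?thesis by blast
qed

text \<open>The pushforward of a finitely supported function along \<open>\<tau>\<close>. The
  diagonal action on \<open>tensor_free\<close> is of this form, so that its group laws reduce to
  \<open>push_push\<close> and \<open>push_ident\<close>.\<close>

definition push :: "('b \<Rightarrow> 'c) \<Rightarrow> ('b \<Rightarrow>\<^sub>0 'a::ab_group_add) \<Rightarrow> ('c \<Rightarrow>\<^sub>0 'a)"
  where "push \<tau> f = (\<Sum>x\<in>Poly_Mapping.keys f. Poly_Mapping.single (\<tau> x) (Poly_Mapping.lookup f x))"

lemma push_superset:
  "finite S \<Longrightarrow> Poly_Mapping.keys f \<subseteq> S \<Longrightarrow>
    push \<tau> f = (\<Sum>x\<in>S. Poly_Mapping.single (\<tau> x) (Poly_Mapping.lookup f x))"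
  unfolding push_def by (rule sum.mono_neutral_left) (auto simp: in_keys_iff)

lemma push_add: "push \<tau> (f + g) = push \<tau> f + push \<tau> g"
  using keys_add[of f g]
  by (simp add: push_superset[of "Poly_Mapping.keys f \<union> Poly_Mapping.keys g"] lookup_add single_add sum.distrib)

lemma push_zero [simp]: "push \<tau> 0 = 0"
  by (simp add: push_def)

lemma push_sum: "push \<tau> (sum F S) = (\<Sum>x\<in>S. push \<tau> (F x))"
  by (induction S rule: infinite_finite_induct) (auto simp: push_add)

lemma push_single [simp]: "push \<tau> (Poly_Mapping.single x c) = Poly_Mapping.single (\<tau> x) c"
  by (cases "c = 0") (simp_all add: push_def)

lemma push_push: "push \<sigma> (push \<tau> f) = push (\<sigma> \<circ> \<tau>) f"
  unfolding push_def[of \<tau>] push_def[of "\<sigma> \<circ> \<tau>"] by (simp add: push_sum)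

lemma sum_single_keys:
  "(\<Sum>x\<in>Poly_Mapping.keys f. Poly_Mapping.single x (Poly_Mapping.lookup f x)) = f"
proof (rule poly_mapping_eqI)
  fix k
  show "Poly_Mapping.lookup (\<Sum>x\<in>Poly_Mapping.keys f. Poly_Mapping.single x (Poly_Mapping.lookup f x)) k =
    Poly_Mapping.lookup f k"
    by (cases "k \<in> Poly_Mapping.keys f")
      (auto simp: lookup_sum lookup_single when_def in_keys_iff sum.delta' intro!: sum.neutral)
qed

lemma push_cong: "(\<And>x. x \<in> Poly_Mapping.keys f \<Longrightarrow> \<tau> x = \<sigma> x) \<Longrightarrow> push \<tau> f = push \<sigma> f"
  unfolding push_def by (rule sum.cong) auto

lemma push_ident: "(\<And>x. x \<in> Poly_Mapping.keys f \<Longrightarrow> \<tau> x = x) \<Longrightarrow> push \<tau> f = f"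
  using push_cong[of f \<tau> id] by (simp add: push_def sum_single_keys)

lemma keys_push: "Poly_Mapping.keys (push \<tau> f) \<subseteq> \<tau> ` Poly_Mapping.keys f"
  unfolding push_def by (rule order_trans[OF keys_sum]) auto

lemma lookup_scale: "Poly_Mapping.lookup (Poly_Mapping.map ((*) (c::'a::field)) f) x = c * Poly_Mapping.lookup f x"
  by (simp add: map.rep_eq when_def)

lemma keys_scale: "Poly_Mapping.keys (Poly_Mapping.map ((*) (c::'a::field)) f) \<subseteq> Poly_Mapping.keys f"
  by (auto simp: in_keys_iff lookup_scale)

lemma scale_single: "Poly_Mapping.map ((*) (c::'a::field)) (Poly_Mapping.single x d) = Poly_Mapping.single x (c * d)"
  by (rule poly_mapping_eqI) (simp add: lookup_scale lookup_single when_def)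

lemma scale_add: "Poly_Mapping.map ((*) (c::'a::field)) (f + g) = Poly_Mapping.map ((*) c) f + Poly_Mapping.map ((*) c) g"
  by (rule poly_mapping_eqI) (simp add: lookup_scale lookup_add algebra_simps)

lemma scale_zero [simp]: "Poly_Mapping.map ((*) (c::'a::field)) 0 = 0"
  by (rule poly_mapping_eqI) (simp add: lookup_scale)

lemma scale_sum: "Poly_Mapping.map ((*) (c::'a::field)) (sum F S) = (\<Sum>x\<in>S. Poly_Mapping.map ((*) c) (F x))"
  by (induction S rule: infinite_finite_induct) (auto simp: scale_add)

lemma push_scale: "push \<tau> (Poly_Mapping.map ((*) (c::'a::field)) f) = Poly_Mapping.map ((*) c) (push \<tau> f)"
  by (subst push_superset[OF _ keys_scale]) (auto simp: push_def lookup_scale scale_sum scale_single)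

section \<open>The free module, the relators and their quotient\<close>

lemma tensor_free_simps [simp]:
  "carrier (tensor_free M N) = {f. Poly_Mapping.keys f \<subseteq> carrier M \<times> carrier N}"
  "\<zero>\<^bsub>tensor_free M N\<^esub> = 0"
  "f \<oplus>\<^bsub>tensor_free M N\<^esub> f' = f + f'"
  "c \<odot>\<^bsub>tensor_free M N\<^esub> f = Poly_Mapping.map ((*) c) f"
  "act (tensor_free M N) g f = push (\<lambda>(v, w). (act M g v, act N g w)) f"
  by (auto simp: tensor_free_def push_def intro!: sum.cong)

lemma group_module_tensor_free:
  assumes "group_module G M" "group_module G N"
  shows "group_module G (tensor_free M N)"
proof -
  interpret M: group_module G M by fact
  interpret N: group_module G N by fact
  show ?thesis
  proof (rule group_module_typeI)
    show "group G" by (rule M.is_group)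
    show "add (tensor_free M N) = (+)" by (simp add: tensor_free_def)
  next
    fix g f assume "g \<in> carrier G" "f \<in> carrier (tensor_free M N)"
    then show "act (tensor_free M N) g f \<in> carrier (tensor_free M N)"
      using keys_push[of "\<lambda>(v, w). (act M g v, act N g w)" f]
      by (force simp: M.act_closed N.act_closed)
  next
    fix f assume "f \<in> carrier (tensor_free M N)"
    then show "act (tensor_free M N) \<one>\<^bsub>G\<^esub> f = f"
      by (auto intro!: push_ident simp: M.act_one N.act_one)
  next
    fix g h f assume "g \<in> carrier G" "h \<in> carrier G" "f \<in> carrier (tensor_free M N)"
    then show "act (tensor_free M N) (g \<otimes>\<^bsub>G\<^esub> h) f = act (tensor_free M N) g (act (tensor_free M N) h f)"
      by (auto intro!: push_cong simp: push_push M.act_mult N.act_mult)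
  next
    fix v w assume "v \<in> carrier (tensor_free M N)" "w \<in> carrier (tensor_free M N)"
    then show "v + w \<in> carrier (tensor_free M N)" using keys_add[of v w] by auto
  next
    fix c v assume "v \<in> carrier (tensor_free M N)"
    then show "c \<odot>\<^bsub>tensor_free M N\<^esub> v \<in> carrier (tensor_free M N)" using keys_scale[of c v] by auto
  qed (auto simp: push_add push_scale lookup_scale lookup_add algebra_simps intro!: poly_mapping_eqI)
qed

lemma tensor_free_diff:
  assumes "group_module G M" "group_module G N" "f \<in> carrier (tensor_free M N)" "f' \<in> carrier (tensor_free M N)"
  shows "f \<ominus>\<^bsub>tensor_free M N\<^esub> f' = f - f'"
proof -
  interpret F: group_module G "tensor_free M N" by (rule group_module_tensor_free[OF assms(1,2)])
  have "\<ominus>\<^bsub>tensor_free M N\<^esub> f' = - f'"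
    using F.minus_one_smult[OF assms(4)]
    by (auto intro!: poly_mapping_eqI simp flip: F.minus_one_smult[OF assms(4)] simp: lookup_scale)
  then show ?thesis by (simp add: a_minus_def)
qed

lemma tensor_relators_carrier:
  fixes M :: "('a::field, 'v, 'g) gmodule" and N :: "('a, 'w, 'g) gmodule"
  assumes "group_module G M" "group_module G N"
  shows "tensor_relators M N \<subseteq> carrier (tensor_free M N)"
proof -
  interpret M: group_module G M by fact
  interpret N: group_module G N by fact
  have s: "Poly_Mapping.keys (Poly_Mapping.single x c) \<subseteq> {x}" for x :: "'v \<times> 'w" and c :: 'a by simp
  have d: "Poly_Mapping.keys (f - f') \<subseteq> Poly_Mapping.keys f \<union> Poly_Mapping.keys f'" for f f' :: "('v \<times> 'w) \<Rightarrow>\<^sub>0 'a"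
    by (rule keys_diff)
  show ?thesis unfolding tensor_relators_def Let_def
    by (auto simp del: keys_single dest!: subsetD[OF d] subsetD[OF s])
qed

lemma tensor_relatorsI:
  "v \<in> carrier M \<Longrightarrow> v' \<in> carrier M \<Longrightarrow> w \<in> carrier N \<Longrightarrow>
      Poly_Mapping.single (v \<oplus>\<^bsub>M\<^esub> v', w) 1 - Poly_Mapping.single (v, w) 1 - Poly_Mapping.single (v', w) 1 \<in> tensor_relators M N"
  "v \<in> carrier M \<Longrightarrow> w \<in> carrier N \<Longrightarrow> w' \<in> carrier N \<Longrightarrow>
      Poly_Mapping.single (v, w \<oplus>\<^bsub>N\<^esub> w') 1 - Poly_Mapping.single (v, w) 1 - Poly_Mapping.single (v, w') 1 \<in> tensor_relators M N"
  "v \<in> carrier M \<Longrightarrow> w \<in> carrier N \<Longrightarrow>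
      Poly_Mapping.single (c \<odot>\<^bsub>M\<^esub> v, w) 1 - Poly_Mapping.single (v, w) c \<in> tensor_relators M N"
  "v \<in> carrier M \<Longrightarrow> w \<in> carrier N \<Longrightarrow>
      Poly_Mapping.single (v, c \<odot>\<^bsub>N\<^esub> w) 1 - Poly_Mapping.single (v, w) c \<in> tensor_relators M N"
  unfolding tensor_relators_def Let_def by blast+

lemma tensor_relatorsE:
  assumes "r \<in> tensor_relators M N"
  obtains (add_left) v v' w where "v \<in> carrier M" "v' \<in> carrier M" "w \<in> carrier N"
      "r = Poly_Mapping.single (v \<oplus>\<^bsub>M\<^esub> v', w) 1 - Poly_Mapping.single (v, w) 1 - Poly_Mapping.single (v', w) 1"
    | (add_right) v w w' where "v \<in> carrier M" "w \<in> carrier N" "w' \<in> carrier N"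
      "r = Poly_Mapping.single (v, w \<oplus>\<^bsub>N\<^esub> w') 1 - Poly_Mapping.single (v, w) 1 - Poly_Mapping.single (v, w') 1"
    | (smult_left) c v w where "v \<in> carrier M" "w \<in> carrier N"
      "r = Poly_Mapping.single (c \<odot>\<^bsub>M\<^esub> v, w) 1 - Poly_Mapping.single (v, w) c"
    | (smult_right) c v w where "v \<in> carrier M" "w \<in> carrier N"
      "r = Poly_Mapping.single (v, c \<odot>\<^bsub>N\<^esub> w) 1 - Poly_Mapping.single (v, w) c"
  using assms unfolding tensor_relators_def Let_def by blast

lemma tensor_relators_act:
  fixes M :: "('a::field, 'v, 'g) gmodule" and N :: "('a, 'w, 'g) gmodule"
  assumes "group_module G M" "group_module G N" "g \<in> carrier G" "r \<in> tensor_relators M N"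
  shows "act (tensor_free M N) g r \<in> tensor_relators M N"
proof -
  interpret M: group_module G M by fact
  interpret N: group_module G N by fact
  have pd: "push \<tau> (f - f') = push \<tau> f - push \<tau> f'" for \<tau> :: "'v \<times> 'w \<Rightarrow> 'v \<times> 'w" and f f' :: "('v \<times> 'w) \<Rightarrow>\<^sub>0 'a"
    using push_add[of \<tau> "f - f'" f'] by simp
  from assms(4) show ?thesis
    by (cases rule: tensor_relatorsE)
      (use assms(3) in \<open>auto simp: pd M.act_add N.act_add M.act_smult N.act_smult M.act_closed N.act_closed
        intro!: tensor_relatorsI\<close>)
qed

lemma tensor_kernel_lin_span: "tensor_kernel M N = lin_span (tensor_free M N) (tensor_relators M N)"
  by (simp add: tensor_kernel_def lin_span_def)

lemma gsubmodule_tensor_kernel: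
  assumes "group_module G M" "group_module G N"
  shows "gsubmodule G (tensor_free M N) (tensor_kernel M N)"
  unfolding tensor_kernel_lin_span
  by (rule group_module.gsubmodule_lin_span[OF group_module_tensor_free[OF assms]
        tensor_relators_carrier[OF assms] tensor_relators_act[OF assms]])

text \<open>\<open>gquot\<close> repeats the body of \<open>tensor\<close> for an arbitrary module
  and submodule, which makes the tensor product an instance of the general quotient.\<close>

lemma tensor_gquot: "tensor M N = gquot (tensor_free M N) (tensor_kernel M N)"
  by (simp add: tensor_def gquot_def Let_def)

lemma group_module_tensor:
  assumes "group_module G M" "group_module G N" shows "group_module G (tensor M N)"
  unfolding tensor_gquot
  by (rule group_module.group_module_gquot[OF group_module_tensor_free[OF assms] gsubmodule_tensor_kernel[OF assms]])

definition pure :: "('a::field, 'v, 'g) gmodule \<Rightarrow> ('a, 'w, 'g) gmodule \<Rightarrow> 'v \<Rightarrow> 'w \<Rightarrow> (('v \<times> 'w) \<Rightarrow>\<^sub>0 'a) set"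
  where "pure M N v w = tensor_kernel M N +>\<^bsub>tensor_free M N\<^esub> Poly_Mapping.single (v, w) 1"

text \<open>Equivariance for the diagonal action is part of the notion, so that the induced map on
  the tensor product is a homomorphism of modules. Maps that are only bilinear are treated over the
  one-element group.\<close>

definition bilinear_map ::
    "'g monoid \<Rightarrow> ('a::field, 'v, 'g) gmodule \<Rightarrow> ('a, 'w, 'g) gmodule \<Rightarrow> ('a, 'u, 'g) gmodule \<Rightarrow>
      ('v \<Rightarrow> 'w \<Rightarrow> 'u) \<Rightarrow> bool"
  where "bilinear_map G M N W \<beta> \<longleftrightarrow>
    (\<forall>v\<in>carrier M. \<forall>w\<in>carrier N. \<beta> v w \<in> carrier W) \<and>
    (\<forall>v\<in>carrier M. \<forall>v'\<in>carrier M. \<forall>w\<in>carrier N. \<beta> (v \<oplus>\<^bsub>M\<^esub> v') w = \<beta> v w \<oplus>\<^bsub>W\<^esub> \<beta> v' w) \<and>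
    (\<forall>v\<in>carrier M. \<forall>w\<in>carrier N. \<forall>w'\<in>carrier N. \<beta> v (w \<oplus>\<^bsub>N\<^esub> w') = \<beta> v w \<oplus>\<^bsub>W\<^esub> \<beta> v w') \<and>
    (\<forall>c. \<forall>v\<in>carrier M. \<forall>w\<in>carrier N. \<beta> (c \<odot>\<^bsub>M\<^esub> v) w = c \<odot>\<^bsub>W\<^esub> \<beta> v w) \<and>
    (\<forall>c. \<forall>v\<in>carrier M. \<forall>w\<in>carrier N. \<beta> v (c \<odot>\<^bsub>N\<^esub> w) = c \<odot>\<^bsub>W\<^esub> \<beta> v w) \<and>
    (\<forall>g\<in>carrier G. \<forall>v\<in>carrier M. \<forall>w\<in>carrier N. \<beta> (act M g v) (act N g w) = act W g (\<beta> v w))"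

lemma bilinear_mapD:
  assumes "bilinear_map G M N W \<beta>" "v \<in> carrier M" "w \<in> carrier N"
  shows "\<beta> v w \<in> carrier W"
    "v' \<in> carrier M \<Longrightarrow> \<beta> (v \<oplus>\<^bsub>M\<^esub> v') w = \<beta> v w \<oplus>\<^bsub>W\<^esub> \<beta> v' w"
    "w' \<in> carrier N \<Longrightarrow> \<beta> v (w \<oplus>\<^bsub>N\<^esub> w') = \<beta> v w \<oplus>\<^bsub>W\<^esub> \<beta> v w'"
    "\<beta> (c \<odot>\<^bsub>M\<^esub> v) w = c \<odot>\<^bsub>W\<^esub> \<beta> v w"
    "\<beta> v (c \<odot>\<^bsub>N\<^esub> w) = c \<odot>\<^bsub>W\<^esub> \<beta> v w"
    "g \<in> carrier G \<Longrightarrow> \<beta> (act M g v) (act N g w) = act W g (\<beta> v w)"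
  using assms by (auto simp: bilinear_map_def)

locale module_pair = M: group_module G M + N: group_module G N
  for G :: "'g monoid" and M :: "('a::field, 'v, 'g) gmodule" and N :: "('a, 'w, 'g) gmodule"
begin

sublocale F: group_module G "tensor_free M N"
  by (rule group_module_tensor_free) unfold_locales

sublocale T: group_module G "tensor M N"
  by (rule group_module_tensor) unfold_locales

lemma kernel_gsub: "gsubmodule G (tensor_free M N) (tensor_kernel M N)"
  by (rule gsubmodule_tensor_kernel) unfold_locales

lemma kernel_sub: "submodule (tensor_kernel M N) (scalars :: 'a ring) (tensor_free M N)"
  using kernel_gsub by (simp add: gsubmodule_def)

lemma proj_hom: "(\<lambda>f. tensor_kernel M N +>\<^bsub>tensor_free M N\<^esub> f) \<in> gmodule_hom G (tensor_free M N) (tensor M N)"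
  unfolding tensor_gquot by (rule F.gquot_proj_hom[OF kernel_gsub])

lemma proj_surj: "(\<lambda>f. tensor_kernel M N +>\<^bsub>tensor_free M N\<^esub> f) ` carrier (tensor_free M N) = carrier (tensor M N)"
  unfolding tensor_gquot F.gquot_simps(1)[OF kernel_gsub] ..

lemma proj_zero: "f \<in> carrier (tensor_free M N) \<Longrightarrow>
    tensor_kernel M N +>\<^bsub>tensor_free M N\<^esub> f = \<zero>\<^bsub>tensor M N\<^esub> \<longleftrightarrow> f \<in> tensor_kernel M N"
  unfolding tensor_gquot by (rule F.gquot_proj_eq_zero[OF kernel_gsub])

lemma relatorI:
  assumes "f \<in> carrier (tensor_free M N)" "f' \<in> carrier (tensor_free M N)" "f - f' \<in> tensor_relators M N"
  shows "tensor_kernel M N +>\<^bsub>tensor_free M N\<^esub> f = tensor_kernel M N +>\<^bsub>tensor_free M N\<^esub> f'"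
proof -
  have "f \<ominus>\<^bsub>tensor_free M N\<^esub> f' \<in> tensor_kernel M N"
    using assms lin_span_superset[of "tensor_relators M N" "tensor_free M N"]
    by (subst tensor_free_diff[of G]) (auto simp: tensor_kernel_lin_span M.group_module_axioms N.group_module_axioms)
  then show ?thesis using F.coset_eq_iff[OF kernel_sub assms(1,2)] by simp
qed

lemma bilinear_map_pure: "bilinear_map G M N (tensor M N) (pure M N)"
proof -
  let ?P = "\<lambda>f. tensor_kernel M N +>\<^bsub>tensor_free M N\<^esub> f"
  have sc: "Poly_Mapping.single (v, w) c \<in> carrier (tensor_free M N)" if "v \<in> carrier M" "w \<in> carrier N" for v w c
    using that by simp
  have plus: "f + f' \<in> carrier (tensor_free M N)" if "f \<in> carrier (tensor_free M N)" "f' \<in> carrier (tensor_free M N)" for f f'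
    using F.M.add.m_closed[OF that] by simp
  note P = gmodule_homD[OF proj_hom]
  show ?thesis
    unfolding bilinear_map_def
  proof (intro conjI ballI allI)
    fix v w assume vw: "v \<in> carrier M" "w \<in> carrier N"
    show "pure M N v w \<in> carrier (tensor M N)" unfolding pure_def by (rule P(1)[OF sc[OF vw]])
    fix c
    have s: "c \<odot>\<^bsub>tensor M N\<^esub> pure M N v w = ?P (Poly_Mapping.single (v, w) c)"
      unfolding pure_def using P(3)[OF sc[OF vw], of c 1] by (simp add: scale_single)
    show "pure M N (c \<odot>\<^bsub>M\<^esub> v) w = c \<odot>\<^bsub>tensor M N\<^esub> pure M N v w"
      unfolding s unfolding pure_def by (rule relatorI) (use vw in \<open>auto intro: tensor_relatorsI\<close>)
    show "pure M N v (c \<odot>\<^bsub>N\<^esub> w) = c \<odot>\<^bsub>tensor M N\<^esub> pure M N v w"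
      unfolding s unfolding pure_def by (rule relatorI) (use vw in \<open>auto intro: tensor_relatorsI\<close>)
  next
    fix v v' w assume vw: "v \<in> carrier M" "v' \<in> carrier M" "w \<in> carrier N"
    have "pure M N v w \<oplus>\<^bsub>tensor M N\<^esub> pure M N v' w = ?P (Poly_Mapping.single (v, w) 1 + Poly_Mapping.single (v', w) 1)"
      unfolding pure_def using P(2)[OF sc[OF vw(1,3)] sc[OF vw(2,3)], of 1 1] by simp
    also have "\<dots> = pure M N (v \<oplus>\<^bsub>M\<^esub> v') w" unfolding pure_def
      by (rule relatorI[symmetric]) (use vw tensor_relatorsI(1)[OF vw] plus sc in \<open>auto simp: diff_diff_eq simp del: tensor_free_simps(1)\<close>)
    finally show "pure M N (v \<oplus>\<^bsub>M\<^esub> v') w = pure M N v w \<oplus>\<^bsub>tensor M N\<^esub> pure M N v' w" ..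
  next
    fix v w w' assume vw: "v \<in> carrier M" "w \<in> carrier N" "w' \<in> carrier N"
    have "pure M N v w \<oplus>\<^bsub>tensor M N\<^esub> pure M N v w' = ?P (Poly_Mapping.single (v, w) 1 + Poly_Mapping.single (v, w') 1)"
      unfolding pure_def using P(2)[OF sc[OF vw(1,2)] sc[OF vw(1,3)], of 1 1] by simp
    also have "\<dots> = pure M N v (w \<oplus>\<^bsub>N\<^esub> w')" unfolding pure_def
      by (rule relatorI[symmetric]) (use vw tensor_relatorsI(2)[OF vw] plus sc in \<open>auto simp: diff_diff_eq simp del: tensor_free_simps(1)\<close>)
    finally show "pure M N v (w \<oplus>\<^bsub>N\<^esub> w') = pure M N v w \<oplus>\<^bsub>tensor M N\<^esub> pure M N v w'" ..
  next
    fix g v w assume "g \<in> carrier G" "v \<in> carrier M" "w \<in> carrier N"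
    then show "pure M N (act M g v) (act N g w) = act (tensor M N) g (pure M N v w)"
      unfolding pure_def using P(4)[OF _ sc, of g v w 1] by simp
  qed
qed

lemmas pure_closed = bilinear_mapD(1)[OF bilinear_map_pure]
lemmas pure_add_left = bilinear_mapD(2)[OF bilinear_map_pure]
lemmas pure_add_right = bilinear_mapD(3)[OF bilinear_map_pure]
lemmas pure_smult_left = bilinear_mapD(4)[OF bilinear_map_pure]
lemmas pure_smult_right = bilinear_mapD(5)[OF bilinear_map_pure]
lemmas pure_act = bilinear_mapD(6)[OF bilinear_map_pure]

text \<open>Scalars need no case of their own, because a multiple of a pure tensor is again pure: c
  (v \<otimes> w) = (c v) \<otimes> w.\<close>

lemma tensor_induct [consumes 1, case_names zero pure add]:
  assumes "t \<in> carrier (tensor M N)"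
    and zero: "P \<zero>\<^bsub>tensor M N\<^esub>"
    and pure: "\<And>v w. v \<in> carrier M \<Longrightarrow> w \<in> carrier N \<Longrightarrow> P (pure M N v w)"
    and add: "\<And>t t'. t \<in> carrier (tensor M N) \<Longrightarrow> t' \<in> carrier (tensor M N) \<Longrightarrow> P t \<Longrightarrow> P t' \<Longrightarrow>
      P (t \<oplus>\<^bsub>tensor M N\<^esub> t')"
  shows "P t"
proof -
  let ?P = "\<lambda>f. tensor_kernel M N +>\<^bsub>tensor_free M N\<^esub> f"
  note h = gmodule_homD[OF proj_hom]
  obtain f where f: "f \<in> carrier (tensor_free M N)" "t = ?P f"
    using assms(1) unfolding proj_surj[symmetric] by blast
  have "(\<Sum>x\<in>S. Poly_Mapping.single x (c x)) \<in> carrier (tensor_free M N) \<and> P (?P (\<Sum>x\<in>S. Poly_Mapping.single x (c x)))"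
    if "finite S" "S \<subseteq> carrier M \<times> carrier N" for S and c :: "'v \<times> 'w \<Rightarrow> 'a"
    using that
  proof (induction S)
    case empty
    then show ?case using zero gmodule_hom_zero[OF F.group_module_axioms T.group_module_axioms proj_hom] by simp
  next
    case (insert x S)
    obtain v w where x: "x = (v, w)" and vw: "v \<in> carrier M" "w \<in> carrier N" using insert.prems by (cases x) auto
    have s: "Poly_Mapping.single x (c x) \<in> carrier (tensor_free M N)" using vw x by simp
    have "?P (Poly_Mapping.single x (c x)) = pure M N (c x \<odot>\<^bsub>M\<^esub> v) w"
      using pure_smult_left[OF vw, of "c x"] h(3)[of "Poly_Mapping.single (v, w) 1" "c x"] vw
      by (simp add: x pure_def scale_single)
    then have "P (?P (Poly_Mapping.single x (c x)))" using pure vw by simp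
    moreover note insert
    ultimately show ?case
      using add[OF h(1)[OF s] h(1)] s F.M.add.m_closed[OF s] h(2)[OF s]
      by (simp del: tensor_free_simps(1))
  qed
  from this[of "Poly_Mapping.keys f" "Poly_Mapping.lookup f"] f show ?thesis by (simp add: sum_single_keys)
qed

text \<open>The linear extension \<open>h0\<close> of \<open>\<beta>\<close> to the free module
  commutes with the action, and it kills the relators because \<open>\<beta>\<close> is bilinear.
  Its kernel is a submodule, hence contains \<open>tensor_kernel\<close>, and \<open>h0\<close>
  factors through the quotient. Uniqueness of the factorisation is supplied where needed by
  \<open>tensor_induct\<close>.\<close>

lemma tensor_lift:
  assumes W: "group_module G W" and \<beta>: "bilinear_map G M N W \<beta>"
  obtains h where "h \<in> gmodule_hom G (tensor M N) W"
    "\<And>v w. v \<in> carrier M \<Longrightarrow> w \<in> carrier N \<Longrightarrow> h (pure M N v w) = \<beta> v w"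
proof -
  interpret W: group_module G W by (rule W)
  note B = bilinear_mapD[OF \<beta>]
  define b where "b = (\<lambda>(v, w). \<beta> v w)"
  have b: "b x \<in> carrier W" if "x \<in> carrier M \<times> carrier N" for x
    using that B(1) by (auto simp: b_def)
  define h0 where "h0 f = finsum W (\<lambda>x. Poly_Mapping.lookup f x \<odot>\<^bsub>W\<^esub> b x) (Poly_Mapping.keys f)" for f
  have h0S: "h0 f = finsum W (\<lambda>x. Poly_Mapping.lookup f x \<odot>\<^bsub>W\<^esub> b x) S"
    if "finite S" "Poly_Mapping.keys f \<subseteq> S" "S \<subseteq> carrier M \<times> carrier N" for f S
    unfolding h0_def using that b by (intro W.M.add.finprod_mono_neutral_cong_left) (auto simp: in_keys_iff)
  have h0_in: "h0 f \<in> carrier W" if "f \<in> carrier (tensor_free M N)" for f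
    unfolding h0_def using that b by (intro W.finsum_in) auto
  have h0_single: "h0 (Poly_Mapping.single (v, w) c) = c \<odot>\<^bsub>W\<^esub> \<beta> v w" if "v \<in> carrier M" "w \<in> carrier N" for v w c
    using that B(1) by (subst h0S[of "{(v, w)}"]) (auto simp: b_def)
  have h0_add: "h0 (f + f') = h0 f \<oplus>\<^bsub>W\<^esub> h0 f'"
    if ff: "f \<in> carrier (tensor_free M N)" "f' \<in> carrier (tensor_free M N)" for f f'
  proof -
    let ?S = "Poly_Mapping.keys f \<union> Poly_Mapping.keys f'"
    have S: "finite ?S" "?S \<subseteq> carrier M \<times> carrier N" using ff by auto
    have "h0 (f + f') = finsum W (\<lambda>x. Poly_Mapping.lookup f x \<odot>\<^bsub>W\<^esub> b x \<oplus>\<^bsub>W\<^esub> Poly_Mapping.lookup f' x \<odot>\<^bsub>W\<^esub> b x) ?S"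
      using S b by (subst h0S[OF S(1) keys_add S(2)]) (auto intro!: W.finsum_eq simp: lookup_add W.smult_add_left)
    also have "\<dots> = h0 f \<oplus>\<^bsub>W\<^esub> h0 f'"
      using S b by (subst W.M.finsum_addf) (auto simp: h0S[OF S(1) _ S(2)])
    finally show ?thesis .
  qed
  have h0_smult: "h0 (Poly_Mapping.map ((*) c) f) = c \<odot>\<^bsub>W\<^esub> h0 f" if f: "f \<in> carrier (tensor_free M N)" for f c
  proof -
    let ?S = "Poly_Mapping.keys f"
    have S: "finite ?S" "?S \<subseteq> carrier M \<times> carrier N" using f by auto
    have "h0 (Poly_Mapping.map ((*) c) f) = finsum W (\<lambda>x. c \<odot>\<^bsub>W\<^esub> (Poly_Mapping.lookup f x \<odot>\<^bsub>W\<^esub> b x)) ?S"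
      using S b by (subst h0S[OF S(1) keys_scale S(2)]) (auto intro!: W.finsum_eq simp: lookup_scale W.smult_mult)
    also have "\<dots> = c \<odot>\<^bsub>W\<^esub> h0 f" unfolding h0_def
      using S b by (subst W.finsum_smult) auto
    finally show ?thesis .
  qed
  have h0_act: "h0 (push (\<lambda>(v, w). (act M g v, act N g w)) f) = act W g (h0 f)"
    if g: "g \<in> carrier G" and f: "f \<in> carrier (tensor_free M N)" for g f
  proof -
    let ?\<tau> = "\<lambda>(v, w). (act M g v, act N g w)"
    have "(\<Sum>x\<in>S. Poly_Mapping.single x (c x)) \<in> carrier (tensor_free M N) \<and>
      h0 (push ?\<tau> (\<Sum>x\<in>S. Poly_Mapping.single x (c x))) = act W g (h0 (\<Sum>x\<in>S. Poly_Mapping.single x (c x)))"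
      if "finite S" "S \<subseteq> carrier M \<times> carrier N" for S and c :: "'v \<times> 'w \<Rightarrow> 'a"
      using that
    proof (induction S)
      case empty
      then show ?case using g by (simp add: h0_def)
    next
      case (insert x S)
      obtain v w where x: "x = (v, w)" and vw: "v \<in> carrier M" "w \<in> carrier N" using insert.prems by (cases x) auto
      have s: "Poly_Mapping.single x (c x) \<in> carrier (tensor_free M N)" using vw x by simp
      let ?f = "\<Sum>x\<in>S. Poly_Mapping.single x (c x)"
      have f: "?f \<in> carrier (tensor_free M N)" using insert by blast
      have 1: "push ?\<tau> (Poly_Mapping.single x (c x)) \<in> carrier (tensor_free M N)"
        "push ?\<tau> ?f \<in> carrier (tensor_free M N)"
        using F.act_closed[OF g s] F.act_closed[OF g f] by (simp_all del: push_single)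
      have 2: "h0 (push ?\<tau> (Poly_Mapping.single x (c x))) = act W g (h0 (Poly_Mapping.single x (c x)))"
        using vw g B(6)[OF vw g] B(1)[OF vw] by (simp add: x h0_single M.act_closed N.act_closed W.act_smult)
      have "h0 (push ?\<tau> (Poly_Mapping.single x (c x) + ?f)) = act W g (h0 (Poly_Mapping.single x (c x) + ?f))"
        using insert 2 g by (simp only: push_add h0_add[OF 1] h0_add[OF s f] W.act_add[OF g h0_in[OF s] h0_in[OF f]]) auto
      moreover have "Poly_Mapping.single x (c x) + ?f \<in> carrier (tensor_free M N)"
        using F.M.add.m_closed[OF s f] by simp
      ultimately show ?case using insert.hyps by simp
    qed
    from this[of "Poly_Mapping.keys f" "Poly_Mapping.lookup f"] f show ?thesis by (simp add: sum_single_keys)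
  qed
  have h0: "h0 \<in> gmodule_hom G (tensor_free M N) W"
  proof (rule gmodule_homI)
    fix f f' assume ff: "f \<in> carrier (tensor_free M N)" "f' \<in> carrier (tensor_free M N)"
    show "h0 (f \<oplus>\<^bsub>tensor_free M N\<^esub> f') = h0 f \<oplus>\<^bsub>W\<^esub> h0 f'" using h0_add[OF ff] by simp
  next
    fix c f assume f: "f \<in> carrier (tensor_free M N)"
    show "h0 (c \<odot>\<^bsub>tensor_free M N\<^esub> f) = c \<odot>\<^bsub>W\<^esub> h0 f" using h0_smult[OF f] by simp
  next
    fix g f assume g: "g \<in> carrier G" and f: "f \<in> carrier (tensor_free M N)"
    show "h0 (act (tensor_free M N) g f) = act W g (h0 f)" using h0_act[OF g f] by simp
  qed (rule h0_in)
  have diff: "h0 (f - f') = h0 f \<ominus>\<^bsub>W\<^esub> h0 f'" "f - f' \<in> carrier (tensor_free M N)"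
    if ff: "f \<in> carrier (tensor_free M N)" "f' \<in> carrier (tensor_free M N)" for f f'
  proof -
    have eq: "f \<ominus>\<^bsub>tensor_free M N\<^esub> f' = f - f'"
      using ff by (intro tensor_free_diff[of G]) unfold_locales
    show "h0 (f - f') = h0 f \<ominus>\<^bsub>W\<^esub> h0 f'" "f - f' \<in> carrier (tensor_free M N)"
      using gmodule_hom_diff[OF F.group_module_axioms W h0 ff] F.M.minus_closed[OF ff] unfolding eq by auto
  qed
  have ker: "h0 f = \<zero>\<^bsub>W\<^esub>" if "f \<in> tensor_kernel M N" for f
  proof -
    have sc: "Poly_Mapping.single (v, w) c \<in> carrier (tensor_free M N)" if "v \<in> carrier M" "w \<in> carrier N" for v w c
      using that by simp
    have "tensor_relators M N \<subseteq> {f \<in> carrier (tensor_free M N). h0 f = \<zero>\<^bsub>W\<^esub>}"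
    proof
      fix r assume r: "r \<in> tensor_relators M N"
      have "r \<in> carrier (tensor_free M N)"
        using tensor_relators_carrier[OF M.group_module_axioms N.group_module_axioms] r by blast
      moreover have "h0 r = \<zero>\<^bsub>W\<^esub>"
        using r
      proof (cases rule: tensor_relatorsE)
        case (add_left v v' w)
        then show ?thesis using B(1)[of v w] B(1)[of v' w]
          by (simp add: diff sc h0_single B(1,2) a_minus_def W.M.a_ac W.M.r_neg W.M.r_neg1 del: tensor_free_simps(1))
      next
        case (add_right v w w')
        then show ?thesis using B(1)[of v w] B(1)[of v w']
          by (simp add: diff sc h0_single B(1,3) a_minus_def W.M.a_ac W.M.r_neg W.M.r_neg1 del: tensor_free_simps(1))
      next
        case (smult_left c v w)
        then show ?thesis using B(1)[of v w]
          by (simp add: diff sc h0_single B(1,4) del: tensor_free_simps(1))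
      next
        case (smult_right c v w)
        then show ?thesis using B(1)[of v w]
          by (simp add: diff sc h0_single B(1,5) del: tensor_free_simps(1))
      qed
      ultimately show "r \<in> {f \<in> carrier (tensor_free M N). h0 f = \<zero>\<^bsub>W\<^esub>}" by simp
    qed
    then have "tensor_kernel M N \<subseteq> {f \<in> carrier (tensor_free M N). h0 f = \<zero>\<^bsub>W\<^esub>}"
      unfolding tensor_kernel_lin_span
      using gsubmodule_kernel[OF F.group_module_axioms W h0]
      by (intro lin_span_least) (auto simp: gsubmodule_def)
    then show ?thesis using that by blast
  qed
  obtain h where h: "h \<in> gmodule_hom G (tensor M N) W"
    "\<And>f. f \<in> carrier (tensor_free M N) \<Longrightarrow> h (tensor_kernel M N +>\<^bsub>tensor_free M N\<^esub> f) = h0 f"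
    using gmodule_hom_factor[OF F.group_module_axioms T.group_module_axioms W proj_hom proj_surj h0]
      ker proj_zero by metis
  have "h (pure M N v w) = \<beta> v w" if "v \<in> carrier M" "w \<in> carrier N" for v w
    unfolding pure_def using that B(1)[OF that] by (subst h(2)) (auto simp: h0_single)
  then show thesis using that h(1) by blast
qed

end

section \<open>Size and functoriality of the tensor product\<close>

context module_pair begin

lemma pure_zero_left: "w \<in> carrier N \<Longrightarrow> pure M N \<zero>\<^bsub>M\<^esub> w = \<zero>\<^bsub>tensor M N\<^esub>"
  using pure_smult_left[of "\<zero>\<^bsub>M\<^esub>" w 0] pure_closed[of "\<zero>\<^bsub>M\<^esub>" w] by simp

lemma pure_zero_right: "v \<in> carrier M \<Longrightarrow> pure M N v \<zero>\<^bsub>N\<^esub> = \<zero>\<^bsub>tensor M N\<^esub>"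
  using pure_smult_right[of v "\<zero>\<^bsub>N\<^esub>" 0] pure_closed[of v "\<zero>\<^bsub>N\<^esub>"] by simp

lemma pure_finsum_left:
  assumes "finite A" "\<And>i. i \<in> A \<Longrightarrow> f i \<in> carrier M" "w \<in> carrier N"
  shows "pure M N (finsum M f A) w = finsum (tensor M N) (\<lambda>i. pure M N (f i) w) A"
  using assms(1,2)
proof (induction A)
  case empty
  then show ?case using assms(3) by (simp add: pure_zero_left)
next
  case (insert a A)
  then have "pure M N (finsum M f (insert a A)) w = pure M N (f a) w \<oplus>\<^bsub>tensor M N\<^esub> pure M N (finsum M f A) w"
    using assms(3) by (subst M.M.finsum_insert) (auto simp: pure_add_left)
  then show ?case using insert assms(3) by (subst T.M.finsum_insert) (auto simp: pure_closed)
qed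

lemma tensor_submodule_full:
  assumes "gsubmodule G (tensor M N) U" "\<And>v w. v \<in> carrier M \<Longrightarrow> w \<in> carrier N \<Longrightarrow> pure M N v w \<in> U"
  shows "U = carrier (tensor M N)"
proof
  show "U \<subseteq> carrier (tensor M N)" using assms(1) by (simp add: T.gsubmodule_iff)
  show "carrier (tensor M N) \<subseteq> U"
  proof
    fix t assume "t \<in> carrier (tensor M N)"
    then show "t \<in> U"
      by (induction rule: tensor_induct) (use assms in \<open>auto simp: T.gsubmodule_iff\<close>)
  qed
qed

end

lemma module_pairI: "group_module G M \<Longrightarrow> group_module G N \<Longrightarrow> module_pair G M N"
  by (simp add: module_pair_def)

lemma card_field_ge_2: "2 \<le> CARD('a::{field,finite})"
  using card_mono[of "UNIV :: 'a set" "{0, 1}"] by simp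

text \<open>With a basis b_0, ..., b_(m-1) of M every tensor is uniquely a sum of the b_i \<otimes>
  w_i, so M \<otimes> N is in bijection with m-tuples of elements of N. Existence is an induction
  over tensors; uniqueness holds because v \<otimes> w to co_i(v) w recovers w_i.\<close>

lemma card_tensor:
  fixes M :: "('a::{field,finite}, 'v, 'g) gmodule" and N :: "('a, 'w, 'g) gmodule"
  assumes gm: "group_module G M" "group_module G N" and fin: "finite (carrier M)" "finite (carrier N)"
    and card: "card (carrier M) = CARD('a) ^ m"
  shows "finite (carrier (tensor M N))" and "card (carrier (tensor M N)) = card (carrier N) ^ m"
proof -
  interpret module_pair G M N using gm by (rule module_pairI)
  obtain n b co where "coordinates G M n b co" using exists_coordinates[OF gm(1) fin(1)] by auto
  then interpret C: coordinates G M n b co .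
  have nm: "n = m" using C.card_carrier card card_field_ge_2[where 'a = 'a] by simp
  define \<Theta> where "\<Theta> ws = finsum (tensor M N) (\<lambda>i. pure M N (b i) (ws i)) {..<n}" for ws
  let ?D = "PiE {..<n} (\<lambda>_. carrier N)"
  have "carrier (tensor M N) \<subseteq> \<Theta> ` ?D"
  proof
    fix t assume "t \<in> carrier (tensor M N)"
    then show "t \<in> \<Theta> ` ?D"
    proof (induction rule: tensor_induct)
      case zero
      have "\<Theta> (\<lambda>i\<in>{..<n}. \<zero>\<^bsub>N\<^esub>) = finsum (tensor M N) (\<lambda>i. \<zero>\<^bsub>tensor M N\<^esub>) {..<n}"
        unfolding \<Theta>_def by (rule T.finsum_eq) (auto simp: pure_zero_right C.basis_in)
      then have "\<zero>\<^bsub>tensor M N\<^esub> = \<Theta> (\<lambda>i\<in>{..<n}. \<zero>\<^bsub>N\<^esub>)" by (simp only: T.M.finsum_zero)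
      moreover have "(\<lambda>i\<in>{..<n}. \<zero>\<^bsub>N\<^esub>) \<in> ?D" by simp
      ultimately show ?case by (rule image_eqI[where f = \<Theta>])
    next
      case (pure v w)
      have "pure M N v w = pure M N (finsum M (\<lambda>i. co i v \<odot>\<^bsub>M\<^esub> b i) {..<n}) w"
        by (rule arg_cong[OF C.expansion[OF pure(1)]])
      also have "\<dots> = finsum (tensor M N) (\<lambda>i. pure M N (co i v \<odot>\<^bsub>M\<^esub> b i) w) {..<n}"
        using pure C.basis_in by (intro pure_finsum_left) auto
      also have "\<dots> = \<Theta> (\<lambda>i\<in>{..<n}. co i v \<odot>\<^bsub>N\<^esub> w)"
        unfolding \<Theta>_def using pure C.basis_in
        by (intro T.finsum_eq) (auto simp: pure_smult_left pure_smult_right pure_closed)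
      finally have eq: "pure M N v w = \<Theta> (\<lambda>i\<in>{..<n}. co i v \<odot>\<^bsub>N\<^esub> w)" .
      have "(\<lambda>i\<in>{..<n}. co i v \<odot>\<^bsub>N\<^esub> w) \<in> ?D" using pure by simp
      with eq show ?case by (rule image_eqI[where f = \<Theta>])
    next
      case (add t t')
      then obtain ws ws' where ws: "t = \<Theta> ws" "t' = \<Theta> ws'" "ws \<in> ?D" "ws' \<in> ?D" by blast
      have D: "ws i \<in> carrier N" "ws' i \<in> carrier N" if "i < n" for i using ws that by auto
      have "t \<oplus>\<^bsub>tensor M N\<^esub> t' = finsum (tensor M N) (\<lambda>i. pure M N (b i) (ws i) \<oplus>\<^bsub>tensor M N\<^esub> pure M N (b i) (ws' i)) {..<n}"
        unfolding ws(1,2) \<Theta>_def using D C.basis_in by (intro T.M.finsum_addf[symmetric]) (auto simp: pure_closed)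
      also have "\<dots> = \<Theta> (\<lambda>i\<in>{..<n}. ws i \<oplus>\<^bsub>N\<^esub> ws' i)"
        unfolding \<Theta>_def using D C.basis_in by (intro T.finsum_eq) (auto simp: pure_closed pure_add_right)
      finally have eq: "t \<oplus>\<^bsub>tensor M N\<^esub> t' = \<Theta> (\<lambda>i\<in>{..<n}. ws i \<oplus>\<^bsub>N\<^esub> ws' i)" .
      have "(\<lambda>i\<in>{..<n}. ws i \<oplus>\<^bsub>N\<^esub> ws' i) \<in> ?D" using D by simp
      with eq show ?case by (rule image_eqI[where f = \<Theta>])
    qed
  qed
  moreover have "\<Theta> ` ?D \<subseteq> carrier (tensor M N)"
    unfolding \<Theta>_def using C.basis_in by (intro image_subsetI T.finsum_in pure_closed) auto
  ultimately have im: "\<Theta> ` ?D = carrier (tensor M N)" by blast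
  \<comment> \<open>The coordinate forms do not commute with the group, so the maps that read off
    the w_i are built over the one-element group.\<close>
  let ?G = "G\<lparr>carrier := {\<one>\<^bsub>G\<^esub>}\<rparr>"
  interpret P: module_pair ?G M N
    by (rule module_pairI) (rule M.group_module_trivial_group N.group_module_trivial_group)+
  have inj: "inj_on \<Theta> ?D"
  proof (rule inj_onI)
    fix ws ws' assume ws: "ws \<in> ?D" "ws' \<in> ?D" "\<Theta> ws = \<Theta> ws'"
    have "ws i = ws' i" if i: "i < n" for i
    proof -
      have "bilinear_map ?G M N N (\<lambda>v w. co i v \<odot>\<^bsub>N\<^esub> w)"
        unfolding bilinear_map_def using i
        by (auto simp: C.co_add C.co_smult N.smult_add_left N.smult_add_right N.smult_mult M.act_one N.act_one)
          (simp flip: N.smult_mult add: mult.commute)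
      then obtain h where h: "h \<in> gmodule_hom ?G (tensor M N) N"
        "\<And>v w. v \<in> carrier M \<Longrightarrow> w \<in> carrier N \<Longrightarrow> h (pure M N v w) = co i v \<odot>\<^bsub>N\<^esub> w"
        using P.tensor_lift[OF P.N.group_module_axioms] by metis
      have "h (\<Theta> ws) = ws i" if "ws \<in> ?D" for ws
      proof -
        have w: "ws j \<in> carrier N" if "j < n" for j using \<open>ws \<in> ?D\<close> that by auto
        have "h (\<Theta> ws) = finsum N (\<lambda>j. h (pure M N (b j) (ws j))) {..<n}"
          unfolding \<Theta>_def using w C.basis_in
          by (intro hom_finsum[OF P.T.group_module_axioms P.N.group_module_axioms h(1)]) (auto simp: pure_closed)
        also have "\<dots> = finsum N (\<lambda>j. if j = i then ws i else \<zero>\<^bsub>N\<^esub>) {..<n}"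
          using w C.basis_in i by (intro N.finsum_eq) (auto simp: h(2) C.co_basis)
        also have "\<dots> = ws i" using i w by (intro N.finsum_delta) auto
        finally show ?thesis .
      qed
      then show ?thesis using ws by metis
    qed
    then show "ws = ws'" using ws(1,2) by (intro PiE_ext) auto
  qed
  have "bij_betw \<Theta> ?D (carrier (tensor M N))" using inj im by (simp add: bij_betw_def)
  moreover have "finite ?D" "card ?D = card (carrier N) ^ n" using fin(2) by (auto intro: finite_PiE simp: card_PiE)
  ultimately show "finite (carrier (tensor M N))" "card (carrier (tensor M N)) = card (carrier N) ^ m"
    using bij_betw_finite bij_betw_same_card nm by metis+
qed

lemma card_module:
  fixes M :: "('a::{field,finite}, 'v, 'g) gmodule"
  assumes "group_module G M" "finite (carrier M)"
  obtains m where "card (carrier M) = CARD('a) ^ m"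
  using exists_coordinates[OF assms] coordinates.card_carrier by blast

text \<open>Rank-nullity in multiplicative form: a set-theoretic section s of h writes each element
  uniquely as k + s w with k in the kernel.\<close>

lemma card_hom:
  assumes gm: "group_module G M" "group_module G N" and h: "h \<in> gmodule_hom G M N" "h ` carrier M = carrier N"
  shows "card (carrier M) = card {v \<in> carrier M. h v = \<zero>\<^bsub>N\<^esub>} * card (carrier N)"
proof -
  interpret M: group_module G M by fact
  interpret N: group_module G N by fact
  define s where "s = inv_into (carrier M) h"
  have s: "s w \<in> carrier M" "h (s w) = w" if "w \<in> carrier N" for w
    using that h(2) by (metis s_def inv_into_into, metis s_def f_inv_into_f)
  note H = gmodule_homD[OF h(1)]
  have "bij_betw (\<lambda>(k, w). k \<oplus>\<^bsub>M\<^esub> s w) ({v \<in> carrier M. h v = \<zero>\<^bsub>N\<^esub>} \<times> carrier N) (carrier M)"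
  proof (rule bij_betw_byWitness[where f' = "\<lambda>v. (v \<ominus>\<^bsub>M\<^esub> s (h v), h v)"])
    show "\<forall>a\<in>{v \<in> carrier M. h v = \<zero>\<^bsub>N\<^esub>} \<times> carrier N.
       (\<lambda>v. (v \<ominus>\<^bsub>M\<^esub> s (h v), h v)) ((\<lambda>(k, w). k \<oplus>\<^bsub>M\<^esub> s w) a) = a"
      using s by (auto simp: H a_minus_def M.M.a_assoc M.M.r_neg)
    show "\<forall>v\<in>carrier M. (\<lambda>(k, w). k \<oplus>\<^bsub>M\<^esub> s w) ((\<lambda>v. (v \<ominus>\<^bsub>M\<^esub> s (h v), h v)) v) = v"
      using s H(1) by (auto simp: a_minus_def M.M.a_assoc M.M.l_neg)
    show "(\<lambda>(k, w). k \<oplus>\<^bsub>M\<^esub> s w) ` ({v \<in> carrier M. h v = \<zero>\<^bsub>N\<^esub>} \<times> carrier N) \<subseteq> carrier M"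
      using s by auto
    show "(\<lambda>v. (v \<ominus>\<^bsub>M\<^esub> s (h v), h v)) ` carrier M \<subseteq> {v \<in> carrier M. h v = \<zero>\<^bsub>N\<^esub>} \<times> carrier N"
      using s H(1) by (auto simp: gmodule_hom_diff[OF gm h(1)])
  qed
  from bij_betw_same_card[OF this] show ?thesis by (simp add: card_cartesian_product)
qed

text \<open>The image of the induced map is a submodule containing all values of
  \<open>\<beta>\<close>, hence is everything, and the count then makes the map injective.
  Commutativity, unit, associativity and the models by functions all come from this
  criterion.\<close>

lemma tensor_isomorphicI:
  fixes M :: "('a::{field,finite}, 'v, 'g) gmodule" and N :: "('a, 'w, 'g) gmodule"
  assumes gm: "group_module G M" "group_module G N" "group_module G W"
    and fin: "finite (carrier M)" "finite (carrier N)"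
    and \<beta>: "bilinear_map G M N W \<beta>"
    and span: "\<And>U. gsubmodule G W U \<Longrightarrow> (\<And>v w. v \<in> carrier M \<Longrightarrow> w \<in> carrier N \<Longrightarrow> \<beta> v w \<in> U) \<Longrightarrow> carrier W \<subseteq> U"
    and card: "card (carrier (tensor M N)) \<le> card (carrier W)"
  shows "gmodule_isomorphic G (tensor M N) W"
proof -
  interpret module_pair G M N using gm(1,2) by (rule module_pairI)
  obtain h where h: "h \<in> gmodule_hom G (tensor M N) W"
    "\<And>v w. v \<in> carrier M \<Longrightarrow> w \<in> carrier N \<Longrightarrow> h (pure M N v w) = \<beta> v w"
    using tensor_lift[OF gm(3) \<beta>] by metis
  have "gsubmodule G W (h ` carrier (tensor M N))"
    by (rule gsubmodule_image[OF T.group_module_axioms gm(3) h(1) T.gsubmodule_carrier])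
  then have "carrier W \<subseteq> h ` carrier (tensor M N)"
    by (rule span) (metis h(2) imageI pure_closed)
  then have surj: "h ` carrier (tensor M N) = carrier W" using gmodule_homD(1)[OF h(1)] by auto
  obtain m where m: "card (carrier M) = CARD('a) ^ m" using card_module[OF gm(1) fin(1)] .
  show ?thesis
    by (rule gmodule_isomorphicI_card[OF h(1) surj card_tensor(1)[OF gm(1,2) fin m] card])
qed

lemma tensor_map:
  assumes gm: "group_module G M" "group_module G N" "group_module G M'" "group_module G N'"
    and h: "h \<in> gmodule_hom G M M'" and k: "k \<in> gmodule_hom G N N'"
  obtains t where "t \<in> gmodule_hom G (tensor M N) (tensor M' N')"
    "\<And>v w. v \<in> carrier M \<Longrightarrow> w \<in> carrier N \<Longrightarrow> t (pure M N v w) = pure M' N' (h v) (k w)"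
proof -
  interpret module_pair G M N using gm(1,2) by (rule module_pairI)
  interpret P: module_pair G M' N' using gm(3,4) by (rule module_pairI)
  note H = gmodule_homD[OF h] gmodule_homD[OF k]
  have "bilinear_map G M N (tensor M' N') (\<lambda>v w. pure M' N' (h v) (k w))"
    unfolding bilinear_map_def
    by (auto simp: H P.pure_closed P.pure_add_left P.pure_add_right P.pure_smult_left P.pure_smult_right P.pure_act)
  then show thesis using tensor_lift[OF P.T.group_module_axioms] that by metis
qed

lemma tensor_map_surj:
  assumes gm: "group_module G M" "group_module G N" "group_module G M'" "group_module G N'"
    and t: "t \<in> gmodule_hom G (tensor M N) (tensor M' N')"
      "\<And>v w. v \<in> carrier M \<Longrightarrow> w \<in> carrier N \<Longrightarrow> t (pure M N v w) = pure M' N' (h v) (k w)"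
    and surj: "h ` carrier M = carrier M'" "k ` carrier N = carrier N'"
  shows "t ` carrier (tensor M N) = carrier (tensor M' N')"
proof -
  interpret module_pair G M N using gm(1,2) by (rule module_pairI)
  interpret P: module_pair G M' N' using gm(3,4) by (rule module_pairI)
  show ?thesis
  proof (rule P.tensor_submodule_full)
    show "gsubmodule G (tensor M' N') (t ` carrier (tensor M N))"
      by (rule gsubmodule_image[OF T.group_module_axioms P.T.group_module_axioms t(1) T.gsubmodule_carrier])
    fix v w assume "v \<in> carrier M'" "w \<in> carrier N'"
    then obtain v' w' where "v = h v'" "w = k w'" "v' \<in> carrier M" "w' \<in> carrier N"
      using surj by (metis imageE)
    then show "pure M' N' v w \<in> t ` carrier (tensor M N)"
      using t(2) pure_closed by (metis imageI)
  qed
qed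

lemma card_tensor_eq:
  fixes M :: "('a::{field,finite}, 'v, 'g) gmodule" and M' :: "('a, 'v1, 'g) gmodule"
  assumes gm: "group_module G M" "group_module G N" "group_module G M'" "group_module G N'"
    and fin: "finite (carrier M)" "finite (carrier N)" "finite (carrier M')" "finite (carrier N')"
    and card: "card (carrier M) = card (carrier M')" "card (carrier N) = card (carrier N')"
  shows "card (carrier (tensor M N)) = card (carrier (tensor M' N'))"
proof -
  obtain m where "card (carrier M) = CARD('a) ^ m" using card_module[OF gm(1) fin(1)] .
  then show ?thesis using card_tensor(2)[OF gm(1,2) fin(1,2)] card_tensor(2)[OF gm(3,4) fin(3,4)] card by metis
qed

lemma tensor_isomorphic_cong:
  fixes M :: "('a::{field,finite}, 'v, 'g) gmodule" and M' :: "('a, 'v1, 'g) gmodule"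
  assumes gm: "group_module G M" "group_module G N" "group_module G M'" "group_module G N'"
    and fin: "finite (carrier M)" "finite (carrier N)"
    and iso: "gmodule_isomorphic G M M'" "gmodule_isomorphic G N N'"
  shows "gmodule_isomorphic G (tensor M N) (tensor M' N')"
proof -
  obtain h k where h: "h \<in> gmodule_hom G M M'" "bij_betw h (carrier M) (carrier M')"
    and k: "k \<in> gmodule_hom G N N'" "bij_betw k (carrier N) (carrier N')"
    using iso unfolding gmodule_isomorphic_def by blast
  have fin': "finite (carrier M')" "finite (carrier N')" using fin h k bij_betw_finite by metis+
  obtain t where t: "t \<in> gmodule_hom G (tensor M N) (tensor M' N')"
    "\<And>v w. v \<in> carrier M \<Longrightarrow> w \<in> carrier N \<Longrightarrow> t (pure M N v w) = pure M' N' (h v) (k w)"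
    using tensor_map[OF gm h(1) k(1)] by metis
  have "t ` carrier (tensor M N) = carrier (tensor M' N')"
    by (rule tensor_map_surj[OF gm t]) (use h k in \<open>auto simp: bij_betw_def\<close>)
  moreover have "card (carrier (tensor M N)) = card (carrier (tensor M' N'))"
    using card_tensor_eq[OF gm fin fin'] h k bij_betw_same_card by metis
  moreover obtain m where m: "card (carrier M) = CARD('a) ^ m" using card_module[OF gm(1) fin(1)] .
  ultimately show ?thesis
    using gmodule_isomorphicI_card[OF t(1) _ card_tensor(1)[OF gm(1,2) fin m]] by simp
qed

lemma tensor_commute:
  fixes M :: "('a::{field,finite}, 'v, 'g) gmodule" and N :: "('a, 'w, 'g) gmodule"
  assumes gm: "group_module G M" "group_module G N" and fin: "finite (carrier M)" "finite (carrier N)"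
  shows "gmodule_isomorphic G (tensor M N) (tensor N M)"
proof -
  interpret P: module_pair G N M using gm by (intro module_pairI)
  obtain m where m: "card (carrier M) = CARD('a) ^ m" using card_module[OF gm(1) fin(1)] .
  obtain n where n: "card (carrier N) = CARD('a) ^ n" using card_module[OF gm(2) fin(2)] .
  show ?thesis
  proof (rule tensor_isomorphicI[OF gm P.T.group_module_axioms fin])
    show "bilinear_map G M N (tensor N M) (\<lambda>v w. pure N M w v)"
      unfolding bilinear_map_def
      by (auto simp: P.pure_closed P.pure_add_left P.pure_add_right P.pure_smult_left P.pure_smult_right P.pure_act)
    show "carrier (tensor N M) \<subseteq> U" if "gsubmodule G (tensor N M) U"
      "\<And>v w. v \<in> carrier M \<Longrightarrow> w \<in> carrier N \<Longrightarrow> pure N M w v \<in> U" for U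
      using P.tensor_submodule_full[OF that(1)] that(2) by auto
    show "card (carrier (tensor M N)) \<le> card (carrier (tensor N M))"
      using card_tensor(2)[OF gm fin m] card_tensor(2)[OF gm(2,1) fin(2,1) n]
      by (simp add: m n mult.commute flip: power_mult)
  qed
qed

lemma group_module_trivial: "group G \<Longrightarrow> group_module G trivial_module"
  by (rule group_module_typeI) (auto simp: trivial_module_def algebra_simps)

lemma tensor_trivial:
  fixes M :: "('a::{field,finite}, 'v, 'g) gmodule"
  assumes gm: "group_module G M" and fin: "finite (carrier M)"
  shows "gmodule_isomorphic G (tensor trivial_module M) M"
proof -
  interpret M: group_module G M by fact
  have triv: "group_module G (trivial_module :: ('a, 'a, 'g) gmodule)"
    by (rule group_module_trivial) (rule M.is_group)
  show ?thesis
  proof (rule tensor_isomorphicI[OF triv gm gm _ fin])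
    show "bilinear_map G trivial_module M M (\<lambda>c v. c \<odot>\<^bsub>M\<^esub> v)"
      unfolding bilinear_map_def
      by (auto simp: trivial_module_def M.smult_add_left M.smult_add_right M.smult_mult M.act_smult)
        (simp flip: M.smult_mult add: mult.commute)
    show "carrier M \<subseteq> U" if "\<And>c v. c \<in> carrier (trivial_module :: ('a, 'a, 'g) gmodule) \<Longrightarrow> v \<in> carrier M \<Longrightarrow> c \<odot>\<^bsub>M\<^esub> v \<in> U" for U
      using that[of 1] by (auto simp: trivial_module_def)
    show "card (carrier (tensor (trivial_module :: ('a, 'a, 'g) gmodule) M)) \<le> card (carrier M)"
      by (subst card_tensor(2)[OF triv gm _ fin, of 1]) (auto simp: trivial_module_def)
  qed (simp add: trivial_module_def)
qed

text \<open>For a fixed l the map v \<otimes> w to v \<otimes> (w \<otimes> l) is linear but not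
  equivariant, because l stays put; it is therefore obtained over the one-element group. Letting l
  vary restores equivariance, since then g moves l as well, and \<open>tensor_isomorphicI\<close>
  applies to the resulting bilinear map.\<close>

lemma tensor_assoc:
  fixes M :: "('a::{field,finite}, 'v, 'g) gmodule" and N :: "('a, 'w, 'g) gmodule" and L :: "('a, 'u, 'g) gmodule"
  assumes gm: "group_module G M" "group_module G N" "group_module G L"
    and fin: "finite (carrier M)" "finite (carrier N)" "finite (carrier L)"
  shows "gmodule_isomorphic G (tensor (tensor M N) L) (tensor M (tensor N L))"
proof -
  interpret MN: module_pair G M N using gm(1,2) by (rule module_pairI)
  interpret NL: module_pair G N L using gm(2,3) by (rule module_pairI)
  interpret R: module_pair G M "tensor N L" using gm(1) NL.T.group_module_axioms by (rule module_pairI)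
  let ?G = "G\<lparr>carrier := {\<one>\<^bsub>G\<^esub>}\<rparr>"
  note triv = group_module.group_module_trivial_group
  interpret P: module_pair ?G M N by (rule module_pairI) (rule triv[OF gm(1)] triv[OF gm(2)])+
  note R_simps = R.pure_closed R.pure_add_left R.pure_add_right R.pure_smult_left R.pure_smult_right R.pure_act
  note NL_simps = NL.pure_closed NL.pure_add_left NL.pure_add_right NL.pure_smult_left NL.pure_smult_right NL.pure_act
  have "\<exists>h\<in>gmodule_hom ?G (tensor M N) (tensor M (tensor N L)).
      \<forall>v\<in>carrier M. \<forall>w\<in>carrier N. h (pure M N v w) = pure M (tensor N L) v (pure N L w l)"
    if l: "l \<in> carrier L" for l
  proof -
    have "bilinear_map ?G M N (tensor M (tensor N L)) (\<lambda>v w. pure M (tensor N L) v (pure N L w l))"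
      unfolding bilinear_map_def using l by (auto simp: R_simps NL_simps MN.M.act_one MN.N.act_one R.T.act_one)
    then show ?thesis using P.tensor_lift[OF triv[OF R.T.group_module_axioms]] by metis
  qed
  then obtain h where h: "\<And>l. l \<in> carrier L \<Longrightarrow> h l \<in> gmodule_hom ?G (tensor M N) (tensor M (tensor N L))"
    "\<And>l v w. l \<in> carrier L \<Longrightarrow> v \<in> carrier M \<Longrightarrow> w \<in> carrier N \<Longrightarrow>
       h l (pure M N v w) = pure M (tensor N L) v (pure N L w l)"
    by metis
  note H = gmodule_homD(1-3)[OF h(1)]
  have h_zero: "h l \<zero>\<^bsub>tensor M N\<^esub> = \<zero>\<^bsub>tensor M (tensor N L)\<^esub>" if "l \<in> carrier L" for l
    by (rule gmodule_hom_zero[OF triv[OF MN.T.group_module_axioms] triv[OF R.T.group_module_axioms] h(1)[OF that]])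
  have "bilinear_map G (tensor M N) L (tensor M (tensor N L)) (\<lambda>t l. h l t)"
    unfolding bilinear_map_def
  proof (intro conjI ballI allI)
    fix t l l' assume "t \<in> carrier (tensor M N)" and l: "l \<in> carrier L" "l' \<in> carrier L"
    then show "h (l \<oplus>\<^bsub>L\<^esub> l') t = h l t \<oplus>\<^bsub>tensor M (tensor N L)\<^esub> h l' t"
    proof (induction rule: MN.tensor_induct)
      case zero then show ?case by (simp add: h_zero)
    next
      case (pure v w) then show ?case by (simp add: h(2) R_simps NL_simps)
    next
      case (add t t') then show ?case by (simp add: H R.T.M.a_ac)
    qed
  next
    fix c t l assume "t \<in> carrier (tensor M N)" and l: "l \<in> carrier L"
    then show "h (c \<odot>\<^bsub>L\<^esub> l) t = c \<odot>\<^bsub>tensor M (tensor N L)\<^esub> h l t"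
    proof (induction rule: MN.tensor_induct)
      case zero then show ?case by (simp add: h_zero)
    next
      case (pure v w) then show ?case by (simp add: h(2) R_simps NL_simps)
    next
      case (add t t') then show ?case by (simp add: H R.T.smult_add_right)
    qed
  next
    fix g t l assume "g \<in> carrier G" "t \<in> carrier (tensor M N)" "l \<in> carrier L"
    from this(2,1,3) show "h (act L g l) (act (tensor M N) g t) = act (tensor M (tensor N L)) g (h l t)"
    proof (induction rule: MN.tensor_induct)
      case zero then show ?case by (simp add: h_zero NL.N.act_closed)
    next
      case (pure v w) then show ?case
        by (simp add: h(2) NL.N.act_closed MN.N.act_closed MN.M.act_closed flip: R_simps(6) NL_simps(6) MN.pure_act)
          (simp add: R.pure_act NL.pure_act flip: R.pure_act NL_simps(6) add: NL.pure_closed)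
    next
      case (add t t') then show ?case
        by (simp add: H R.T.act_add MN.T.act_add MN.T.act_closed NL.N.act_closed)
    qed
  qed (auto simp: H)
  moreover obtain m where m: "card (carrier M) = CARD('a) ^ m" using card_module[OF gm(1) fin(1)] .
  moreover obtain n where n: "card (carrier N) = CARD('a) ^ n" using card_module[OF gm(2) fin(2)] .
  moreover have finMN: "finite (carrier (tensor M N))" by (rule card_tensor(1)[OF gm(1,2) fin(1,2) m])
  moreover have finNL: "finite (carrier (tensor N L))" by (rule card_tensor(1)[OF gm(2,3) fin(2,3) n])
  moreover have "card (carrier (tensor M N)) = CARD('a) ^ (n * m)"
    by (simp add: card_tensor(2)[OF gm(1,2) fin(1,2) m] n power_mult)
  then have "card (carrier (tensor (tensor M N) L)) = card (carrier L) ^ (n * m)"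
    by (rule card_tensor(2)[OF MN.T.group_module_axioms gm(3) finMN fin(3)])
  moreover have "card (carrier (tensor M (tensor N L))) = card (carrier L) ^ (n * m)"
    using card_tensor(2)[OF gm(1) NL.T.group_module_axioms fin(1) finNL m]
      card_tensor(2)[OF gm(2,3) fin(2,3) n] by (simp add: power_mult)
  moreover have "carrier (tensor M (tensor N L)) \<subseteq> U"
    if U: "gsubmodule G (tensor M (tensor N L)) U"
      and in_U: "\<And>t l. t \<in> carrier (tensor M N) \<Longrightarrow> l \<in> carrier L \<Longrightarrow> h l t \<in> U" for U
  proof -
    have "pure M (tensor N L) v s \<in> U" if v: "v \<in> carrier M" and s: "s \<in> carrier (tensor N L)" for v s
      using s
    proof (induction rule: NL.tensor_induct)
      case zero
      then show ?case using U v by (simp add: R.pure_zero_right R.T.gsubmodule_iff)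
    next
      case (pure w l)
      then show ?case using in_U[OF MN.pure_closed[OF v pure(1)] pure(2)] h(2) v by simp
    next
      case (add t t')
      then show ?case using U v by (simp add: R.pure_add_right R.T.gsubmodule_iff)
    qed
    then show ?thesis using R.tensor_submodule_full[OF U] by auto
  qed
  ultimately show ?thesis
    by (intro tensor_isomorphicI[OF MN.T.group_module_axioms gm(3) R.T.group_module_axioms finMN fin(3)]) auto
qed

section \<open>Exactness of the tensor product\<close>

lemma card_short_exact:
  assumes gm: "group_module G A" "group_module G B" "group_module G C" and ex: "short_exact G A B C i p"
  shows "card (carrier B) = card (carrier A) * card (carrier C)"
proof -
  have "card (carrier B) = card {v \<in> carrier B. p v = \<zero>\<^bsub>C\<^esub>} * card (carrier C)"
    using ex by (intro card_hom[OF gm(2,3)]) (auto simp: short_exact_def)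
  also have "card {v \<in> carrier B. p v = \<zero>\<^bsub>C\<^esub>} = card (carrier A)"
    using ex card_image[of i "carrier A"] unfolding short_exact_def by simp
  finally show ?thesis .
qed

text \<open>Exactness in the middle is shown by inverting the map from (B \<otimes> N) / I to C
  \<otimes> N, where I is the image of A \<otimes> N: an element v \<otimes> w is sent to the class
  of a lift of v, tensored with w. Injectivity on the left then follows by comparing
  cardinalities.\<close>

lemma tensor_short_exact:
  fixes A :: "('a::{field,finite}, 'u, 'g) gmodule" and B :: "('a, 'v, 'g) gmodule"
    and C :: "('a, 'w, 'g) gmodule" and N :: "('a, 'x, 'g) gmodule"
  assumes gm: "group_module G A" "group_module G B" "group_module G C" "group_module G N"
    and fin: "finite (carrier A)" "finite (carrier B)" "finite (carrier C)" "finite (carrier N)"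
    and ex: "short_exact G A B C i p"
  shows "\<exists>i' p'. short_exact G (tensor A N) (tensor B N) (tensor C N) i' p'"
proof -
  interpret A: module_pair G A N using gm(1,4) by (rule module_pairI)
  interpret B: module_pair G B N using gm(2,4) by (rule module_pairI)
  interpret C: module_pair G C N using gm(3,4) by (rule module_pairI)
  have i: "i \<in> gmodule_hom G A B" and p: "p \<in> gmodule_hom G B C" and surj: "p ` carrier B = carrier C"
    and img: "i ` carrier A = {v \<in> carrier B. p v = \<zero>\<^bsub>C\<^esub>}" using ex by (auto simp: short_exact_def)
  have id: "id \<in> gmodule_hom G N N" by (auto simp: gmodule_hom_def)
  obtain i' where i': "i' \<in> gmodule_hom G (tensor A N) (tensor B N)"
    "\<And>v w. v \<in> carrier A \<Longrightarrow> w \<in> carrier N \<Longrightarrow> i' (pure A N v w) = pure B N (i v) (id w)"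
    using tensor_map[OF gm(1,4) gm(2,4) i id] by metis
  obtain p' where p': "p' \<in> gmodule_hom G (tensor B N) (tensor C N)"
    "\<And>v w. v \<in> carrier B \<Longrightarrow> w \<in> carrier N \<Longrightarrow> p' (pure B N v w) = pure C N (p v) (id w)"
    using tensor_map[OF gm(2,4) gm(3,4) p id] by metis
  have surj': "p' ` carrier (tensor B N) = carrier (tensor C N)"
    by (rule tensor_map_surj[OF gm(2,4) gm(3,4) p']) (simp_all add: surj)
  define I where "I = i' ` carrier (tensor A N)"
  define K where "K = {t \<in> carrier (tensor B N). p' t = \<zero>\<^bsub>tensor C N\<^esub>}"
  have I: "gsubmodule G (tensor B N) I" unfolding I_def
    by (rule gsubmodule_image[OF A.T.group_module_axioms B.T.group_module_axioms i'(1) A.T.gsubmodule_carrier])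
  have p'_zero: "p' \<zero>\<^bsub>tensor B N\<^esub> = \<zero>\<^bsub>tensor C N\<^esub>"
    by (rule gmodule_hom_zero[OF B.T.group_module_axioms C.T.group_module_axioms p'(1)])
  have i'_zero: "i' \<zero>\<^bsub>tensor A N\<^esub> = \<zero>\<^bsub>tensor B N\<^esub>"
    by (rule gmodule_hom_zero[OF A.T.group_module_axioms B.T.group_module_axioms i'(1)])
  have IK: "I \<subseteq> K"
  proof
    fix s assume "s \<in> I"
    then obtain t where t: "t \<in> carrier (tensor A N)" "s = i' t" by (auto simp: I_def)
    from t(1) have "p' (i' t) = \<zero>\<^bsub>tensor C N\<^esub>"
    proof (induction rule: A.tensor_induct)
      case zero then show ?case by (simp add: p'_zero i'_zero)
    next
      case (pure v w)
      then have "i v \<in> carrier B" "p (i v) = \<zero>\<^bsub>C\<^esub>" using img by auto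
      then show ?case using pure by (simp add: i' p' C.pure_zero_left)
    next
      case (add t t') then show ?case by (simp add: gmodule_homD[OF i'(1)] gmodule_homD[OF p'(1)])
    qed
    then show "s \<in> K" using t gmodule_homD(1)[OF i'(1)] by (simp add: K_def)
  qed
  let ?Q = "gquot (tensor B N) I"
  let ?c = "\<lambda>t. I +>\<^bsub>tensor B N\<^esub> t"
  note c_hom = B.T.gquot_proj_hom[OF I]
  interpret Q: group_module G ?Q by (rule B.T.group_module_gquot[OF I])
  \<comment> \<open>Two lifts of the same element differ by some i a, and i a \<otimes> w lies in
    \<open>I\<close>; hence the class modulo \<open>I\<close> does not depend on the lift.\<close>
  have c_eq: "?c (pure B N v w) = ?c (pure B N v' w)"
    if v: "v \<in> carrier B" "v' \<in> carrier B" "p v = p v'" and w: "w \<in> carrier N" for v v' w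
  proof -
    have "p (v \<ominus>\<^bsub>B\<^esub> v') = \<zero>\<^bsub>C\<^esub>"
      using gmodule_hom_diff[OF gm(2,3) p v(1,2)] v gmodule_homD(1)[OF p] by simp
    then have "v \<ominus>\<^bsub>B\<^esub> v' \<in> i ` carrier A" using v unfolding img by simp
    then obtain a where a: "a \<in> carrier A" "v \<ominus>\<^bsub>B\<^esub> v' = i a" by blast
    have v_eq: "v = i a \<oplus>\<^bsub>B\<^esub> v'"
      using v by (simp add: a_minus_def B.M.M.a_assoc B.M.M.l_neg flip: a(2))
    have "pure B N v w = i' (pure A N a w) \<oplus>\<^bsub>tensor B N\<^esub> pure B N v' w"
      using v_eq a v w gmodule_homD(1)[OF i] by (simp add: B.pure_add_left i')
    moreover have I1: "i' (pure A N a w) \<in> I" using a w by (simp add: I_def A.pure_closed)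
    moreover have I2: "i' (pure A N a w) \<in> carrier (tensor B N)"
      by (rule gmodule_homD(1)[OF i'(1) A.pure_closed[OF a(1) w]])
    moreover have "?c (i' (pure A N a w)) = \<zero>\<^bsub>?Q\<^esub>" using B.T.gquot_proj_eq_zero[OF I I2] I1 by simp
    ultimately show ?thesis
      using gmodule_homD(1,2)[OF c_hom] B.pure_closed[OF v(2) w] by simp
  qed
  define s where "s = inv_into (carrier B) p"
  have s: "s w \<in> carrier B" "p (s w) = w" if "w \<in> carrier C" for w
    using that surj by (metis s_def inv_into_into, metis s_def f_inv_into_f)
  note P = gmodule_homD[OF p]
  note PB = B.pure_closed B.pure_add_left B.pure_add_right B.pure_smult_left B.pure_smult_right B.pure_act
  note cs = gmodule_homD(2-)[OF c_hom, symmetric]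
  have "bilinear_map G C N ?Q (\<lambda>v w. ?c (pure B N (s v) w))"
    unfolding bilinear_map_def
  proof (intro conjI ballI allI)
    fix v w assume "v \<in> carrier C" "w \<in> carrier N"
    then show "?c (pure B N (s v) w) \<in> carrier ?Q" by (intro gmodule_homD(1)[OF c_hom] PB(1) s)
  next
    fix v v' w assume "v \<in> carrier C" "v' \<in> carrier C" "w \<in> carrier N"
    then show "?c (pure B N (s (v \<oplus>\<^bsub>C\<^esub> v')) w) = ?c (pure B N (s v) w) \<oplus>\<^bsub>?Q\<^esub> ?c (pure B N (s v') w)"
      using c_eq[of "s (v \<oplus>\<^bsub>C\<^esub> v')" "s v \<oplus>\<^bsub>B\<^esub> s v'" w] by (simp add: s P cs PB)
  next
    fix v w w' assume "v \<in> carrier C" "w \<in> carrier N" "w' \<in> carrier N"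
    then show "?c (pure B N (s v) (w \<oplus>\<^bsub>N\<^esub> w')) = ?c (pure B N (s v) w) \<oplus>\<^bsub>?Q\<^esub> ?c (pure B N (s v) w')"
      by (simp add: s P cs PB)
  next
    fix k v w assume "v \<in> carrier C" "w \<in> carrier N"
    then show "?c (pure B N (s (k \<odot>\<^bsub>C\<^esub> v)) w) = k \<odot>\<^bsub>?Q\<^esub> ?c (pure B N (s v) w)"
      using c_eq[of "s (k \<odot>\<^bsub>C\<^esub> v)" "k \<odot>\<^bsub>B\<^esub> s v" w] by (simp add: s P cs PB)
  next
    fix k v w assume "v \<in> carrier C" "w \<in> carrier N"
    then show "?c (pure B N (s v) (k \<odot>\<^bsub>N\<^esub> w)) = k \<odot>\<^bsub>?Q\<^esub> ?c (pure B N (s v) w)"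
      by (simp add: s P cs PB)
  next
    fix g v w assume "g \<in> carrier G" "v \<in> carrier C" "w \<in> carrier N"
    then show "?c (pure B N (s (act C g v)) (act N g w)) = act ?Q g (?c (pure B N (s v) w))"
      using c_eq[of "s (act C g v)" "act B g (s v)" "act N g w"]
      by (simp add: s P cs PB B.M.act_closed C.M.act_closed A.N.act_closed flip: PB(6))
  qed
  then obtain k where k: "k \<in> gmodule_hom G (tensor C N) ?Q"
    "\<And>v w. v \<in> carrier C \<Longrightarrow> w \<in> carrier N \<Longrightarrow> k (pure C N v w) = ?c (pure B N (s v) w)"
    using C.tensor_lift[OF B.T.group_module_gquot[OF I]] by metis
  have kp: "k (p' t) = ?c t" if "t \<in> carrier (tensor B N)" for t
    using that
  proof (induction rule: B.tensor_induct)
    case zero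
    then show ?case
      using gmodule_hom_zero[OF C.T.group_module_axioms B.T.group_module_gquot[OF I] k(1)]
        gmodule_hom_zero[OF B.T.group_module_axioms B.T.group_module_gquot[OF I] c_hom] by (simp add: p'_zero)
  next
    case (pure v w)
    then show ?case using c_eq[of "s (p v)" v w] by (simp add: p' k P s)
  next
    case (add t t')
    then show ?case by (simp add: gmodule_homD[OF p'(1)] gmodule_homD[OF k(1)] cs)
  qed
  have "K \<subseteq> I"
  proof
    fix t assume t: "t \<in> K"
    then have "?c t = k \<zero>\<^bsub>tensor C N\<^esub>" using kp[of t] by (auto simp: K_def)
    also have "\<dots> = \<zero>\<^bsub>?Q\<^esub>"
      by (rule gmodule_hom_zero[OF C.T.group_module_axioms B.T.group_module_gquot[OF I] k(1)])
    finally show "t \<in> I" using t B.T.gquot_proj_eq_zero[OF I] by (auto simp: K_def)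
  qed
  with IK have IK: "I = K" by blast
  \<comment> \<open>With \<open>a\<close> and \<open>c\<close> the dimensions of A and C, that of B
    is a + c. Dividing the sizes of B \<otimes> N and C \<otimes> N leaves a kernel of the size of A
    \<otimes> N, so the map onto this kernel is injective.\<close>
  obtain a where a: "card (carrier A) = CARD('a) ^ a" using card_module[OF gm(1) fin(1)] .
  obtain c where c: "card (carrier C) = CARD('a) ^ c" using card_module[OF gm(3) fin(3)] .
  have b: "card (carrier B) = CARD('a) ^ (a + c)"
    using card_short_exact[OF gm(1-3) ex] a c by (simp add: power_add)
  have "card (carrier (tensor B N)) = card K * card (carrier (tensor C N))"
    unfolding K_def by (rule card_hom[OF B.T.group_module_axioms C.T.group_module_axioms p'(1) surj'])
  then have "card K * card (carrier N) ^ c = card (carrier N) ^ a * card (carrier N) ^ c"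
    by (auto simp: card_tensor(2)[OF gm(2,4) fin(2,4) b] card_tensor(2)[OF gm(3,4) fin(3,4) c] power_add)
  moreover have "carrier N \<noteq> {}" using A.N.M.zero_closed by blast
  then have "card (carrier N) \<noteq> 0" using fin(4) by simp
  ultimately have "card K = card (carrier N) ^ a" by auto
  then have "card (i' ` carrier (tensor A N)) = card (carrier (tensor A N))"
    using IK by (simp add: I_def card_tensor(2)[OF gm(1,4) fin(1,4) a])
  then have "inj_on i' (carrier (tensor A N))"
    by (intro eq_card_imp_inj_on card_tensor(1)[OF gm(1,4) fin(1,4) a])
  then show ?thesis
    unfolding short_exact_def using i'(1) p'(1) surj' IK by (auto simp: I_def K_def)
qed


section \<open>The Grothendieck ring of a finite group\<close>

lemma exists_nat_copy:
  assumes gm: "group_module G M" and fin: "finite (carrier M)"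
  shows "\<exists>N :: ('a::field, nat, 'g) gmodule. group_module G N \<and> gmodule_isomorphic G (M :: ('a, 'v, 'g) gmodule) N"
proof -
  interpret M: group_module G M by fact
  obtain f :: "'v \<Rightarrow> nat" and n where f: "bij_betw f (carrier M) {..<n}"
    using ex_bij_betw_finite_nat[OF fin] by (metis atLeast0LessThan)
  define k where "k = inv_into (carrier M) f"
  have kf [simp]: "k (f v) = v" if "v \<in> carrier M" for v
    using that f by (simp add: k_def bij_betw_def)
  define N :: "('a, nat, 'g) gmodule" where
    "N = \<lparr>carrier = f ` carrier M, mult = undefined, one = undefined, zero = f \<zero>\<^bsub>M\<^esub>,
      add = (\<lambda>x y. f (k x \<oplus>\<^bsub>M\<^esub> k y)), module.smult = (\<lambda>c x. f (c \<odot>\<^bsub>M\<^esub> k x)),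
      act = (\<lambda>g x. f (act M g (k x)))\<rparr>"
  have N [simp]: "carrier N = f ` carrier M" "\<zero>\<^bsub>N\<^esub> = f \<zero>\<^bsub>M\<^esub>" "x \<oplus>\<^bsub>N\<^esub> y = f (k x \<oplus>\<^bsub>M\<^esub> k y)"
    "c \<odot>\<^bsub>N\<^esub> x = f (c \<odot>\<^bsub>M\<^esub> k x)" "act N g x = f (act M g (k x))" for x y c g
    by (simp_all add: N_def)
  have "group_module G N"
    by (rule group_moduleI; (unfold N(1))?; (elim imageE)?;
        simp add: M.is_group M.smult_add_left M.smult_add_right M.smult_mult M.act_closed
        M.act_add M.act_smult M.act_one M.act_mult M.M.a_ac)
  moreover have "gmodule_isomorphic G M N"
    using f by (intro gmodule_isomorphicI[of f] gmodule_homI) (auto simp: bij_betw_def M.act_closed)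
  ultimately show ?thesis by blast
qed

lemma short_exact_isomorphic:
  assumes gm: "group_module G A" "group_module G B" "group_module G C" "group_module G C'"
    and ex: "short_exact G A B C i p"
    and iso: "gmodule_isomorphic G A A'" "gmodule_isomorphic G B B'" "gmodule_isomorphic G C C'"
  shows "\<exists>i' p'. short_exact G A' B' C' i' p'"
proof -
  obtain a where a: "a \<in> gmodule_hom G A A'" "bij_betw a (carrier A) (carrier A')"
    using iso(1) by (auto simp: gmodule_isomorphic_def)
  obtain b where b: "b \<in> gmodule_hom G B B'" "bij_betw b (carrier B) (carrier B')"
    using iso(2) by (auto simp: gmodule_isomorphic_def)
  obtain c where c: "c \<in> gmodule_hom G C C'" "bij_betw c (carrier C) (carrier C')"
    using iso(3) by (auto simp: gmodule_isomorphic_def)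
  define a' where "a' = inv_into (carrier A) a"
  define b' where "b' = inv_into (carrier B) b"
  have a': "a' \<in> gmodule_hom G A' A" "bij_betw a' (carrier A') (carrier A)"
    unfolding a'_def by (rule gmodule_hom_inverse[OF gm(1) a], rule bij_betw_inv_into[OF a(2)])
  have b': "b' \<in> gmodule_hom G B' B" "bij_betw b' (carrier B') (carrier B)"
    unfolding b'_def by (rule gmodule_hom_inverse[OF gm(2) b], rule bij_betw_inv_into[OF b(2)])
  have b'b: "b' (b v) = v" if "v \<in> carrier B" for v
    unfolding b'_def using that b(2) by (simp add: bij_betw_def)
  have bb': "b (b' v) = v" if "v \<in> carrier B'" for v
    unfolding b'_def using that b(2) by (simp add: bij_betw_inv_into_right)
  have i: "i \<in> gmodule_hom G A B" and p: "p \<in> gmodule_hom G B C" and inj: "inj_on i (carrier A)"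
    and surj: "p ` carrier B = carrier C" and img: "i ` carrier A = {v \<in> carrier B. p v = \<zero>\<^bsub>C\<^esub>}"
    using ex by (auto simp: short_exact_def)
  have c0: "c v = \<zero>\<^bsub>C'\<^esub> \<longleftrightarrow> v = \<zero>\<^bsub>C\<^esub>" if "v \<in> carrier C" for v
    using gmodule_hom_inj_iff[OF gm(3,4) c(1)] gmodule_hom_zero[OF gm(3,4) c(1)] c(2) that
    by (auto simp: bij_betw_def)
  have "short_exact G A' B' C' (b \<circ> (i \<circ> a')) (c \<circ> (p \<circ> b'))"
    unfolding short_exact_def
  proof (intro conjI)
    show "b \<circ> (i \<circ> a') \<in> gmodule_hom G A' B'" "c \<circ> (p \<circ> b') \<in> gmodule_hom G B' C'"
      by (rule gmodule_hom_comp[OF gmodule_hom_comp[OF a'(1) i] b(1)],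
          rule gmodule_hom_comp[OF gmodule_hom_comp[OF b'(1) p] c(1)])
    have im1: "a' ` carrier A' = carrier A" and im2: "b' ` carrier B' = carrier B"
      using a' b' by (auto simp: bij_betw_def)
    show "inj_on (b \<circ> (i \<circ> a')) (carrier A')"
    proof (intro comp_inj_on)
      show "inj_on a' (carrier A')" using a'(2) by (simp add: bij_betw_def)
      show "inj_on i (a' ` carrier A')" using inj im1 by simp
      have "i ` a' ` carrier A' \<subseteq> carrier B" using im1 img by auto
      then show "inj_on b ((i \<circ> a') ` carrier A')"
        using b(2) by (auto simp: bij_betw_def image_comp intro: inj_on_subset)
    qed
    show "(c \<circ> (p \<circ> b')) ` carrier B' = carrier C'"
      unfolding image_comp[symmetric] im2 surj using c(2) by (simp add: bij_betw_def)
    have "(b \<circ> (i \<circ> a')) ` carrier A' = b ` {v \<in> carrier B. p v = \<zero>\<^bsub>C\<^esub>}"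
      unfolding image_comp[symmetric] im1 img ..
    also have "\<dots> = {w \<in> carrier B'. p (b' w) = \<zero>\<^bsub>C\<^esub>}"
    proof (intro equalityI subsetI)
      fix w assume w: "w \<in> {w \<in> carrier B'. p (b' w) = \<zero>\<^bsub>C\<^esub>}"
      then have "b' w \<in> {v \<in> carrier B. p v = \<zero>\<^bsub>C\<^esub>}" using gmodule_homD(1)[OF b'(1)] by simp
      moreover have "w = b (b' w)" using w bb' by simp
      ultimately show "w \<in> b ` {v \<in> carrier B. p v = \<zero>\<^bsub>C\<^esub>}" by (rule image_eqI[rotated])
    qed (use b'b gmodule_homD(1)[OF b(1)] in auto)
    also have "\<dots> = {w \<in> carrier B'. (c \<circ> (p \<circ> b')) w = \<zero>\<^bsub>C'\<^esub>}"
      using c0 gmodule_homD(1)[OF b'(1)] gmodule_homD(1)[OF p] by auto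
    finally show "(b \<circ> (i \<circ> a')) ` carrier A' = {w \<in> carrier B'. (c \<circ> (p \<circ> b')) w = \<zero>\<^bsub>C'\<^esub>}" .
  qed
  then show ?thesis by blast
qed

lemma short_exact_submodule:
  assumes "group_module G M" "gsubmodule G M N"
  shows "short_exact G (M\<lparr>carrier := N\<rparr>) M (gquot M N) id (\<lambda>v. N +>\<^bsub>M\<^esub> v)"
proof -
  interpret group_module G M by fact
  have "N \<subseteq> carrier M" using assms(2) by (simp add: gsubmodule_iff)
  then have "id \<in> gmodule_hom G (M\<lparr>carrier := N\<rparr>) M"
    and "{v \<in> carrier M. N +>\<^bsub>M\<^esub> v = \<zero>\<^bsub>gquot M N\<^esub>} = N"
    using gquot_proj_eq_zero[OF assms(2)] by (auto intro!: gmodule_homI)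
  then show ?thesis
    using gquot_proj_hom[OF assms(2)] gquot_simps(1)[OF assms(2)] by (simp add: short_exact_def)
qed

text \<open>\<open>K0_free\<close> is not a ring: its product is associative, commutative and unital
  only up to elements of I, because a tensor product is determined only up to isomorphism. So the
  theory of quotients of a ring by an ideal does not apply, and the laws of the quotient are derived
  from laws that hold modulo I.\<close>

lemma quotient_criterion:
  fixes R :: "'f::ab_group_add ring"
  assumes R: "add R = (+)" "\<zero>\<^bsub>R\<^esub> = 0"
    and C: "0 \<in> carrier R" "\<And>x y. x \<in> carrier R \<Longrightarrow> y \<in> carrier R \<Longrightarrow> x - y \<in> carrier R"
    and mult: "\<And>x y. x \<in> carrier R \<Longrightarrow> y \<in> carrier R \<Longrightarrow> x \<otimes>\<^bsub>R\<^esub> y \<in> carrier R"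
    and diff_l: "\<And>x y z. (x - y) \<otimes>\<^bsub>R\<^esub> z = x \<otimes>\<^bsub>R\<^esub> z - y \<otimes>\<^bsub>R\<^esub> z"
    and diff_r: "\<And>x y z. x \<otimes>\<^bsub>R\<^esub> (y - z) = x \<otimes>\<^bsub>R\<^esub> y - x \<otimes>\<^bsub>R\<^esub> z"
    and I: "I \<subseteq> carrier R" "0 \<in> I" "\<And>x y. x \<in> I \<Longrightarrow> y \<in> I \<Longrightarrow> x - y \<in> I"
    and ideal: "\<And>x y. x \<in> I \<Longrightarrow> y \<in> carrier R \<Longrightarrow> x \<otimes>\<^bsub>R\<^esub> y \<in> I"
    and comm: "\<And>x y. x \<in> carrier R \<Longrightarrow> y \<in> carrier R \<Longrightarrow> x \<otimes>\<^bsub>R\<^esub> y - y \<otimes>\<^bsub>R\<^esub> x \<in> I"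
    and assoc: "\<And>x y z. x \<in> carrier R \<Longrightarrow> y \<in> carrier R \<Longrightarrow> z \<in> carrier R \<Longrightarrow>
      (x \<otimes>\<^bsub>R\<^esub> y) \<otimes>\<^bsub>R\<^esub> z - x \<otimes>\<^bsub>R\<^esub> (y \<otimes>\<^bsub>R\<^esub> z) \<in> I"
    and one: "\<one>\<^bsub>R\<^esub> \<in> carrier R" "\<And>x. x \<in> carrier R \<Longrightarrow> \<one>\<^bsub>R\<^esub> \<otimes>\<^bsub>R\<^esub> x - x \<in> I"
  shows "cring (R Quot I)"
    and "carrier (R Quot I) = (\<lambda>x. I +>\<^bsub>R\<^esub> x) ` carrier R"
    and "\<And>x y. x \<in> carrier R \<Longrightarrow> y \<in> carrier R \<Longrightarrow> I +>\<^bsub>R\<^esub> x = I +>\<^bsub>R\<^esub> y \<longleftrightarrow> x - y \<in> I"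
    and "\<And>x y. x \<in> carrier R \<Longrightarrow> y \<in> carrier R \<Longrightarrow> (I +>\<^bsub>R\<^esub> x) \<oplus>\<^bsub>R Quot I\<^esub> (I +>\<^bsub>R\<^esub> y) = I +>\<^bsub>R\<^esub> (x + y)"
    and "\<And>x y. x \<in> carrier R \<Longrightarrow> y \<in> carrier R \<Longrightarrow> (I +>\<^bsub>R\<^esub> x) \<otimes>\<^bsub>R Quot I\<^esub> (I +>\<^bsub>R\<^esub> y) = I +>\<^bsub>R\<^esub> (x \<otimes>\<^bsub>R\<^esub> y)"
    and "\<zero>\<^bsub>R Quot I\<^esub> = I +>\<^bsub>R\<^esub> 0" and "\<one>\<^bsub>R Quot I\<^esub> = I +>\<^bsub>R\<^esub> \<one>\<^bsub>R\<^esub>"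
proof -
  have Cm: "- x \<in> carrier R" if "x \<in> carrier R" for x using C(2)[OF C(1) that] by simp
  have Cp: "x + y \<in> carrier R" if "x \<in> carrier R" "y \<in> carrier R" for x y
    using C(2)[OF that(1) Cm[OF that(2)]] by simp
  have Im: "- x \<in> I" if "x \<in> I" for x using I(3)[OF I(2) that] by simp
  have Ip: "x + y \<in> I" if "x \<in> I" "y \<in> I" for x y
    using I(3)[OF that(1) Im[OF that(2)]] by simp
  \<comment> \<open>Absorption is assumed on one side; the other side follows because the two
    products differ by an element of I.\<close>
  have ideal': "x \<otimes>\<^bsub>R\<^esub> y \<in> I" if "x \<in> carrier R" "y \<in> I" for x y
  proof -
    have "y \<in> carrier R" using that I(1) by blast
    from Ip[OF comm[OF that(1) this] ideal[OF that(2,1)]] show ?thesis by simp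
  qed
  have add_l: "(x + y) \<otimes>\<^bsub>R\<^esub> z = x \<otimes>\<^bsub>R\<^esub> z + y \<otimes>\<^bsub>R\<^esub> z" for x y z
    using diff_l[of "x + y" y z] by simp
  have coset: "I +>\<^bsub>R\<^esub> x = (\<lambda>i. i + x) ` I" for x by (auto simp: a_r_coset_def' R)
  have coset_eq: "I +>\<^bsub>R\<^esub> x = I +>\<^bsub>R\<^esub> y \<longleftrightarrow> x - y \<in> I" for x y
  proof
    assume "I +>\<^bsub>R\<^esub> x = I +>\<^bsub>R\<^esub> y"
    moreover have "0 + x \<in> I +>\<^bsub>R\<^esub> x" unfolding coset using I(2) by (rule imageI)
    ultimately obtain i where "i \<in> I" "x = i + y" by (auto simp: coset)
    then show "x - y \<in> I" by simp
  next
    assume xy: "x - y \<in> I"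
    have "i + x \<in> (\<lambda>i. i + y) ` I" if "i \<in> I" for i
      by (rule image_eqI[OF _ Ip[OF that xy]]) simp
    moreover have "i + y \<in> (\<lambda>i. i + x) ` I" if "i \<in> I" for i
      by (rule image_eqI[OF _ I(3)[OF that xy]]) simp
    ultimately show "I +>\<^bsub>R\<^esub> x = I +>\<^bsub>R\<^esub> y" unfolding coset by blast
  qed
  have eqI: "I +>\<^bsub>R\<^esub> x = I +>\<^bsub>R\<^esub> y" if "x - y \<in> I" for x y using that coset_eq by simp
  show carr: "carrier (R Quot I) = (\<lambda>x. I +>\<^bsub>R\<^esub> x) ` carrier R"
    by (auto simp: FactRing_def A_RCOSETS_def')
  show "\<And>x y. x \<in> carrier R \<Longrightarrow> y \<in> carrier R \<Longrightarrow> I +>\<^bsub>R\<^esub> x = I +>\<^bsub>R\<^esub> y \<longleftrightarrow> x - y \<in> I"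
    by (rule coset_eq)
  show add: "(I +>\<^bsub>R\<^esub> x) \<oplus>\<^bsub>R Quot I\<^esub> (I +>\<^bsub>R\<^esub> y) = I +>\<^bsub>R\<^esub> (x + y)" for x y
  proof -
    have "(I +>\<^bsub>R\<^esub> x) \<oplus>\<^bsub>R Quot I\<^esub> (I +>\<^bsub>R\<^esub> y) = (\<Union>i\<in>I. \<Union>j\<in>I. {(i + x) + (j + y)})"
      by (auto simp: FactRing_def set_add_def' coset R)
    also have "\<dots> = (\<lambda>i. i + (x + y)) ` I"
    proof (intro equalityI subsetI)
      fix z assume "z \<in> (\<Union>i\<in>I. \<Union>j\<in>I. {(i + x) + (j + y)})"
      then obtain i j where "i \<in> I" "j \<in> I" "z = (i + j) + (x + y)" by (auto simp: algebra_simps)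
      then show "z \<in> (\<lambda>i. i + (x + y)) ` I" using Ip by blast
    next
      fix z assume "z \<in> (\<lambda>i. i + (x + y)) ` I"
      then obtain i where "i \<in> I" "z = (i + x) + (0 + y)" by (auto simp: algebra_simps)
      then show "z \<in> (\<Union>i\<in>I. \<Union>j\<in>I. {(i + x) + (j + y)})" using I(2) by blast
    qed
    finally show ?thesis by (simp add: coset)
  qed
  show mul: "(I +>\<^bsub>R\<^esub> x) \<otimes>\<^bsub>R Quot I\<^esub> (I +>\<^bsub>R\<^esub> y) = I +>\<^bsub>R\<^esub> (x \<otimes>\<^bsub>R\<^esub> y)"
    if x: "x \<in> carrier R" and y: "y \<in> carrier R" for x y
  proof -
    \<comment> \<open>The product of two cosets is a union over representatives; all the cosets in
      it coincide.\<close>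
    have "I +>\<^bsub>R\<^esub> ((i + x) \<otimes>\<^bsub>R\<^esub> (j + y)) = I +>\<^bsub>R\<^esub> (x \<otimes>\<^bsub>R\<^esub> y)" if "i \<in> I" "j \<in> I" for i j
    proof (rule eqI)
      have ij: "i \<in> carrier R" "j \<in> carrier R" using that I(1) by auto
      have "(i + x) \<otimes>\<^bsub>R\<^esub> (j + y) - x \<otimes>\<^bsub>R\<^esub> y = i \<otimes>\<^bsub>R\<^esub> (j + y) + x \<otimes>\<^bsub>R\<^esub> j"
        using diff_r[of x "j + y" y] by (simp add: add_l)
      also have "\<dots> \<in> I" by (intro Ip ideal ideal' Cp that ij x y)
      finally show "(i + x) \<otimes>\<^bsub>R\<^esub> (j + y) - x \<otimes>\<^bsub>R\<^esub> y \<in> I" .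
    qed
    moreover have "(I +>\<^bsub>R\<^esub> x) \<otimes>\<^bsub>R Quot I\<^esub> (I +>\<^bsub>R\<^esub> y) = (\<Union>i\<in>I. \<Union>j\<in>I. I +>\<^bsub>R\<^esub> ((i + x) \<otimes>\<^bsub>R\<^esub> (j + y)))"
      by (simp add: FactRing_def rcoset_mult_def coset[of x] coset[of y])
    ultimately show ?thesis using I(2) by auto
  qed
  show zero: "\<zero>\<^bsub>R Quot I\<^esub> = I +>\<^bsub>R\<^esub> 0" by (simp add: FactRing_def coset)
  show one': "\<one>\<^bsub>R Quot I\<^esub> = I +>\<^bsub>R\<^esub> \<one>\<^bsub>R\<^esub>" by (simp add: FactRing_def)
  show "cring (R Quot I)"
  proof (rule cringI)
    show "abelian_group (R Quot I)"
    proof (rule abelian_groupI)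
      fix u assume "u \<in> carrier (R Quot I)"
      then show "\<exists>v\<in>carrier (R Quot I). v \<oplus>\<^bsub>R Quot I\<^esub> u = \<zero>\<^bsub>R Quot I\<^esub>"
        unfolding carr by (elim imageE, intro bexI[OF _ imageI[OF Cm]]) (simp_all add: add zero)
    qed (unfold carr; (elim imageE)?; simp add: add zero C Cp add_ac)+
    show "Group.comm_monoid (R Quot I)"
    proof (rule comm_monoidI)
      show "\<one>\<^bsub>R Quot I\<^esub> \<in> carrier (R Quot I)" using one by (simp add: carr one')
    next
      fix u v assume "u \<in> carrier (R Quot I)" "v \<in> carrier (R Quot I)"
      then obtain x y where "x \<in> carrier R" "y \<in> carrier R" "u = I +>\<^bsub>R\<^esub> x" "v = I +>\<^bsub>R\<^esub> y"
        unfolding carr by blast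
      then show "u \<otimes>\<^bsub>R Quot I\<^esub> v \<in> carrier (R Quot I)" "u \<otimes>\<^bsub>R Quot I\<^esub> v = v \<otimes>\<^bsub>R Quot I\<^esub> u"
        using imageI[OF mult, of x y "\<lambda>x. I +>\<^bsub>R\<^esub> x"] by (simp_all add: carr mul mult coset_eq comm)
    next
      fix u v w assume "u \<in> carrier (R Quot I)" "v \<in> carrier (R Quot I)" "w \<in> carrier (R Quot I)"
      then obtain x y z where "x \<in> carrier R" "y \<in> carrier R" "z \<in> carrier R"
        "u = I +>\<^bsub>R\<^esub> x" "v = I +>\<^bsub>R\<^esub> y" "w = I +>\<^bsub>R\<^esub> z"
        unfolding carr by blast
      then show "u \<otimes>\<^bsub>R Quot I\<^esub> v \<otimes>\<^bsub>R Quot I\<^esub> w = u \<otimes>\<^bsub>R Quot I\<^esub> (v \<otimes>\<^bsub>R Quot I\<^esub> w)"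
        by (simp add: mul mult coset_eq assoc)
    next
      fix u assume "u \<in> carrier (R Quot I)"
      then obtain x where "x \<in> carrier R" "u = I +>\<^bsub>R\<^esub> x" unfolding carr by blast
      then show "\<one>\<^bsub>R Quot I\<^esub> \<otimes>\<^bsub>R Quot I\<^esub> u = u"
        by (simp add: mul mult coset_eq one' one)
    qed
    fix u v w assume "u \<in> carrier (R Quot I)" "v \<in> carrier (R Quot I)" "w \<in> carrier (R Quot I)"
    then obtain x y z where "x \<in> carrier R" "y \<in> carrier R" "z \<in> carrier R"
      "u = I +>\<^bsub>R\<^esub> x" "v = I +>\<^bsub>R\<^esub> y" "w = I +>\<^bsub>R\<^esub> z"
      unfolding carr by blast
    then show "(u \<oplus>\<^bsub>R Quot I\<^esub> v) \<otimes>\<^bsub>R Quot I\<^esub> w = u \<otimes>\<^bsub>R Quot I\<^esub> w \<oplus>\<^bsub>R Quot I\<^esub> v \<otimes>\<^bsub>R Quot I\<^esub> w"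
      by (simp add: mul mult add Cp add_l)
  qed
qed

lemma frag_extend_diff_fun: "frag_extend (\<lambda>x. f x - g x) c = frag_extend f c - frag_extend g c"
proof -
  have "c \<in> {c. Poly_Mapping.keys c \<subseteq> UNIV}" by simp
  have "Poly_Mapping.keys c \<subseteq> UNIV" by simp
  then show ?thesis
    by (induction c rule: frag_induction) (auto simp: frag_extend_diff)
qed

section \<open>Ring laws modulo the relations\<close>

locale finite_group = group G for G :: "'g monoid" +
  assumes finite_carrier: "finite (carrier G)"
begin

lemma fg_iff: "fg_module G (M :: ('a::{field,finite}, 'v, 'g) gmodule) \<longleftrightarrow> group_module G M \<and> finite (carrier M)"
  by (rule fg_module_iff_finite[OF finite_carrier])

lemma nat_copy_props:
  fixes M :: "('a::{field,finite}, 'v, 'g) gmodule"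
  assumes "fg_module G M"
  shows "fg_module G (nat_copy G M)" "gmodule_isomorphic G M (nat_copy G M)"
proof -
  have "\<exists>N :: ('a, nat, 'g) gmodule. fg_module G N \<and> gmodule_isomorphic G M N"
    using exists_nat_copy[of G M] assms gmodule_isomorphic_finite[of G M] by (auto simp: fg_iff)
  then have "fg_module G (nat_copy G M) \<and> gmodule_isomorphic G M (nat_copy G M)"
    unfolding nat_copy_def by (rule someI_ex)
  then show "fg_module G (nat_copy G M)" "gmodule_isomorphic G M (nat_copy G M)" by auto
qed

lemma fg_tensor:
  fixes M :: "('a::{field,finite}, 'v, 'g) gmodule" and N :: "('a, 'w, 'g) gmodule"
  assumes "fg_module G M" "fg_module G N" shows "fg_module G (tensor M N)"
proof -
  obtain m where "card (carrier M) = CARD('a) ^ m" using card_module[of G M] assms by (auto simp: fg_iff)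
  then show ?thesis using assms card_tensor(1)[of G M N m] group_module_tensor[of G M N] by (simp add: fg_iff)
qed

lemma fg_trivial: "fg_module G (trivial_module :: ('a::{field,finite}, 'a, 'g) gmodule)"
  by (simp add: fg_iff group_module_trivial is_group)

context
  fixes T :: "'a::{field,finite} itself"
begin

abbreviation (input) "KF \<equiv> K0_free TYPE('a) G"
abbreviation (input) "KI \<equiv> K0_relations TYPE('a) G"
abbreviation (input) "FG \<equiv> {M :: ('a, nat, 'g) gmodule. fg_module G M}"

lemma KF_simps:
  "carrier KF = {c. Poly_Mapping.keys c \<subseteq> FG}" "\<zero>\<^bsub>KF\<^esub> = 0" "add KF = (+)"
  "\<one>\<^bsub>KF\<^esub> = frag_of (nat_copy G trivial_module)"
  "c \<otimes>\<^bsub>KF\<^esub> d = frag_extend (\<lambda>M. frag_extend (\<lambda>N. frag_of (nat_copy G (tensor M N))) d) c"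
  by (simp_all add: K0_free_def)

lemma KF_group: "group (add_monoid KF)"
proof (rule groupI)
  fix x assume "x \<in> carrier (add_monoid KF)"
  then show "\<exists>y\<in>carrier (add_monoid KF). y \<otimes>\<^bsub>add_monoid KF\<^esub> x = \<one>\<^bsub>add_monoid KF\<^esub>"
    by (intro bexI[of _ "- x"]) (simp_all add: KF_simps)
next
  fix x y assume "x \<in> carrier (add_monoid KF)" "y \<in> carrier (add_monoid KF)"
  then show "x \<otimes>\<^bsub>add_monoid KF\<^esub> y \<in> carrier (add_monoid KF)"
    using keys_add[of x y] by (auto simp: KF_simps)
qed (simp_all add: KF_simps add.assoc)

lemma KF_inv: "x \<in> carrier KF \<Longrightarrow> inv\<^bsub>add_monoid KF\<^esub> x = - x"
  by (rule group.inv_equality[OF KF_group]) (auto simp: KF_simps)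

abbreviation (input) "Rels \<equiv> {frag_of B - frag_of A - frag_of C | A B C :: ('a, nat, 'g) gmodule.
       fg_module G A \<and> fg_module G B \<and> fg_module G C \<and> (\<exists>i p. short_exact G A B C i p)}"

lemma Rels_carrier: "Rels \<subseteq> carrier KF"
  by (auto simp: KF_simps dest!: subsetD[OF keys_diff])

lemma KI_subgroup: "subgroup KI (add_monoid KF)"
  unfolding K0_relations_def
  by (rule group.generate_is_subgroup[OF KF_group]) (use Rels_carrier in simp)

lemma KI_carrier: "KI \<subseteq> carrier KF"
  using subgroup.subset[OF KI_subgroup] by simp

lemma KI_zero: "0 \<in> KI"
  using subgroup.one_closed[OF KI_subgroup] by (simp add: KF_simps)

lemma KI_add: "x \<in> KI \<Longrightarrow> y \<in> KI \<Longrightarrow> x + y \<in> KI"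
  using subgroup.m_closed[OF KI_subgroup, of x y] by (simp add: KF_simps)

lemma KI_minus: "x \<in> KI \<Longrightarrow> - x \<in> KI"
  using subgroup.m_inv_closed[OF KI_subgroup, of x] KF_inv[of x] KI_carrier by auto

lemma KI_diff: "x \<in> KI \<Longrightarrow> y \<in> KI \<Longrightarrow> x - y \<in> KI"
  using KI_add[of x "- y"] KI_minus[of y] by simp

lemma KI_rel: "x \<in> Rels \<Longrightarrow> x \<in> KI"
  unfolding K0_relations_def by (rule generate.incl)

lemma KI_induct [consumes 1, case_names zero rel diff]:
  assumes "x \<in> KI" and zero: "P 0" and rel: "\<And>r. r \<in> Rels \<Longrightarrow> P r"
    and diff: "\<And>x y. P x \<Longrightarrow> P y \<Longrightarrow> P (x - y)"
  shows "P x"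
proof -
  have minus: "P (- x)" if "P x" for x using diff[OF zero that] by simp
  have plus: "P (x + y)" if "P x" "P y" for x y using diff[OF that(1) minus[OF that(2)]] by simp
  from assms(1) show ?thesis unfolding K0_relations_def
  proof (induction rule: generate.induct)
    case one then show ?case using zero by (simp add: KF_simps)
  next
    case (incl h) then show ?case by (rule rel)
  next
    case (inv h)
    then have "inv\<^bsub>add_monoid KF\<^esub> h = - h" using Rels_carrier by (intro KF_inv) blast
    then show ?case using minus[OF rel[OF inv]] by simp
  next
    case (eng h1 h2) then show ?case using plus by (simp add: KF_simps)
  qed
qed

text \<open>Relations are declared only between modules on natural numbers. Exactness passes to
  copies along isomorphisms, which makes sequences between modules on arbitrary types
  usable.\<close>

lemma KI_exact:
  fixes A :: "('a, 'u, 'g) gmodule" and B :: "('a, 'v, 'g) gmodule" and C :: "('a, 'w, 'g) gmodule"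
  assumes "fg_module G A" "fg_module G B" "fg_module G C" "short_exact G A B C i p"
  shows "frag_of (nat_copy G B) - frag_of (nat_copy G A) - frag_of (nat_copy G C) \<in> KI"
proof -
  have "\<exists>i' p'. short_exact G (nat_copy G A) (nat_copy G B) (nat_copy G C) i' p'"
    using assms nat_copy_props(2)[OF assms(1)] nat_copy_props(2)[OF assms(2)] nat_copy_props[OF assms(3)]
    by (intro short_exact_isomorphic[of G A B C _ i p]) (auto simp: fg_iff)
  then show ?thesis using assms(1-3) nat_copy_props(1)[OF assms(1)] nat_copy_props(1)[OF assms(2)]
      nat_copy_props(1)[OF assms(3)] by (intro KI_rel) blast
qed

text \<open>The sequence with three zero modules shows that the class of zero is a relation by
  itself, and 0 -> M -> N with an isomorphism on the right is then a short exact sequence whose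
  relation reduces to M - N.\<close>

lemma KI_isomorphic:
  fixes M N :: "('a, nat, 'g) gmodule"
  assumes "fg_module G M" "fg_module G N" "gmodule_isomorphic G M N"
  shows "frag_of M - frag_of N \<in> KI"
proof -
  interpret M: group_module G M using assms(1) by (simp add: fg_iff)
  interpret N: group_module G N using assms(2) by (simp add: fg_iff)
  let ?Z = "M\<lparr>carrier := {\<zero>\<^bsub>M\<^esub>}\<rparr>"
  have Z: "fg_module G ?Z" using M.group_module_submodule[OF M.gsubmodule_zero] by (simp add: fg_iff)
  have "short_exact G ?Z ?Z ?Z id id"
    by (auto simp: short_exact_def gmodule_hom_def)
  then have "frag_of ?Z - frag_of ?Z - frag_of ?Z \<in> KI" using Z by (intro KI_rel CollectI exI conjI) auto
  then have 1: "- frag_of ?Z \<in> KI" by simp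
  obtain h where h: "h \<in> gmodule_hom G M N" "bij_betw h (carrier M) (carrier N)"
    using assms(3) by (auto simp: gmodule_isomorphic_def)
  have "h v = \<zero>\<^bsub>N\<^esub> \<longleftrightarrow> v = \<zero>\<^bsub>M\<^esub>" if "v \<in> carrier M" for v
    using gmodule_hom_inj_iff[OF M.group_module_axioms N.group_module_axioms h(1)]
      gmodule_hom_zero[OF M.group_module_axioms N.group_module_axioms h(1)] h(2) that
    by (auto simp: bij_betw_def)
  then have "short_exact G ?Z M N id h"
    using h by (auto simp: short_exact_def gmodule_hom_def bij_betw_def)
  then have "frag_of M - frag_of ?Z - frag_of N \<in> KI" using Z assms by (intro KI_rel CollectI exI conjI) auto
  from KI_diff[OF this 1] show ?thesis by simp
qed

lemma KI_nat_copy_isomorphic: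
  fixes M :: "('a, 'v, 'g) gmodule" and N :: "('a, 'w, 'g) gmodule"
  assumes "fg_module G M" "fg_module G N" "gmodule_isomorphic G M N"
  shows "frag_of (nat_copy G M) - frag_of (nat_copy G N) \<in> KI"
proof (rule KI_isomorphic)
  have "gmodule_isomorphic G (nat_copy G M) M"
    using assms(1) by (intro gmodule_isomorphic_sym[OF _ nat_copy_props(2)[OF assms(1)]]) (simp add: fg_iff)
  then show "gmodule_isomorphic G (nat_copy G M) (nat_copy G N)"
    by (rule gmodule_isomorphic_trans[OF _ gmodule_isomorphic_trans[OF assms(3) nat_copy_props(2)[OF assms(2)]]])
qed (use assms nat_copy_props in auto)

lemma mult_of: "frag_of M \<otimes>\<^bsub>KF\<^esub> frag_of N = frag_of (nat_copy G (tensor M N))"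
  by (simp add: KF_simps)

lemma mult_diff_left: "(x - y) \<otimes>\<^bsub>KF\<^esub> z = x \<otimes>\<^bsub>KF\<^esub> z - y \<otimes>\<^bsub>KF\<^esub> z"
  by (simp add: KF_simps frag_extend_diff)

lemma mult_diff_right: "x \<otimes>\<^bsub>KF\<^esub> (y - z) = x \<otimes>\<^bsub>KF\<^esub> y - x \<otimes>\<^bsub>KF\<^esub> z"
  by (simp add: KF_simps frag_extend_diff frag_extend_diff_fun)

lemma mult_zero_left: "0 \<otimes>\<^bsub>KF\<^esub> z = 0" and mult_zero_right: "z \<otimes>\<^bsub>KF\<^esub> 0 = 0"
  using mult_diff_left[of 0 0 z] mult_diff_right[of z 0 0] by auto

lemma KF_diff: "x \<in> carrier KF \<Longrightarrow> y \<in> carrier KF \<Longrightarrow> x - y \<in> carrier KF"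
  using keys_diff[of x y] by (auto simp: KF_simps)

lemma KF_of: "fg_module G M \<Longrightarrow> frag_of M \<in> carrier KF"
  by (simp add: KF_simps)

lemma KF_induct [consumes 1, case_names zero of diff]:
  assumes "x \<in> carrier KF" "P 0" "\<And>M. fg_module G M \<Longrightarrow> P (frag_of M)"
    "\<And>x y. P x \<Longrightarrow> P y \<Longrightarrow> P (x - y)"
  shows "P x"
proof -
  have "Poly_Mapping.keys x \<subseteq> FG" using assms(1) by (simp add: KF_simps)
  then show ?thesis by (induction x rule: frag_induction) (use assms in auto)
qed

lemma mult_closed:
  assumes "x \<in> carrier KF" "y \<in> carrier KF" shows "x \<otimes>\<^bsub>KF\<^esub> y \<in> carrier KF"
  using assms(1)
proof (induction rule: KF_induct)
  case zero then show ?case by (simp add: mult_zero_left KF_simps(1))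
next
  case (of M)
  show ?case using assms(2)
    by (induction rule: KF_induct)
      (use of in \<open>auto simp: mult_zero_right mult_of mult_diff_right KF_diff intro!: KF_of nat_copy_props fg_tensor, simp add: KF_simps\<close>)
next
  case (diff x y) then show ?case by (simp add: mult_diff_left KF_diff)
qed

lemma diff_swap: "a - b - (c - d) = a - c - (b - d)" for a b c d :: "'x::ab_group_add"
  by (simp add: algebra_simps)

text \<open>Exactness of the tensor product enters here: a relation times a module is the relation
  of the tensored sequence.\<close>

lemma KI_mult:
  assumes "x \<in> KI" "y \<in> carrier KF" shows "x \<otimes>\<^bsub>KF\<^esub> y \<in> KI"
  using assms(1)
proof (induction rule: KI_induct)
  case zero then show ?case by (simp add: mult_zero_left KI_zero)
next
  case (rel r)
  then obtain A B C i p where r: "r = frag_of B - frag_of A - frag_of C" and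
    fg: "fg_module G A" "fg_module G B" "fg_module G C" and ex: "short_exact G A B C i p" by auto
  show ?case using assms(2)
  proof (induction rule: KF_induct)
    case zero then show ?case by (simp add: mult_zero_right KI_zero)
  next
    case (of N)
    obtain i' p' where "short_exact G (tensor A N) (tensor B N) (tensor C N) i' p'"
      using tensor_short_exact[of G A B C N i p] fg of ex by (auto simp: fg_iff)
    then show ?case unfolding r mult_diff_left mult_of
      by (intro KI_exact) (use fg of fg_tensor in auto)
  next
    case (diff x y) then show ?case by (simp add: mult_diff_right KI_diff)
  qed
next
  case (diff x y) then show ?case by (simp add: mult_diff_left KI_diff)
qed

lemma mult_commute:
  assumes "x \<in> carrier KF" "y \<in> carrier KF" shows "x \<otimes>\<^bsub>KF\<^esub> y - y \<otimes>\<^bsub>KF\<^esub> x \<in> KI"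
  using assms(1)
proof (induction rule: KF_induct)
  case zero then show ?case by (simp add: mult_zero_left mult_zero_right KI_zero)
next
  case (of M)
  show ?case using assms(2)
  proof (induction rule: KF_induct)
    case zero then show ?case by (simp add: mult_zero_left mult_zero_right KI_zero)
  next
    case (of N)
    then show ?case unfolding mult_of using \<open>fg_module G M\<close>
      by (intro KI_nat_copy_isomorphic fg_tensor tensor_commute) (auto simp: fg_iff)
  next
    case (diff x y)
    from KI_diff[OF this] show ?case by (simp add: mult_diff_right mult_diff_left diff_swap)
  qed
next
  case (diff x y) from KI_diff[OF this] show ?case by (simp add: mult_diff_left mult_diff_right diff_swap)
qed

lemma mult_assoc:
  assumes "x \<in> carrier KF" "y \<in> carrier KF" "z \<in> carrier KF"
  shows "(x \<otimes>\<^bsub>KF\<^esub> y) \<otimes>\<^bsub>KF\<^esub> z - x \<otimes>\<^bsub>KF\<^esub> (y \<otimes>\<^bsub>KF\<^esub> z) \<in> KI"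
  using assms(1)
proof (induction rule: KF_induct)
  case zero then show ?case by (simp add: mult_zero_left KI_zero)
next
  case (of M)
  show ?case using assms(2)
  proof (induction rule: KF_induct)
    case zero then show ?case by (simp add: mult_zero_left mult_zero_right KI_zero)
  next
    case (of N)
    show ?case using assms(3)
    proof (induction rule: KF_induct)
      case zero then show ?case by (simp add: mult_zero_left mult_zero_right KI_zero)
    next
      case (of L)
      note fg = \<open>fg_module G M\<close> \<open>fg_module G N\<close> \<open>fg_module G L\<close>
      note t = fg_tensor[OF fg(1,2)] fg_tensor[OF fg(2,3)]
      note tc = nat_copy_props[OF t(1)] nat_copy_props[OF t(2)]
      note gm = fg[unfolded fg_iff] t[unfolded fg_iff] tc(1,3)[unfolded fg_iff]
      \<comment> \<open>Each product in \<open>K0_free\<close> is replaced by a copy, so the copies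
        are removed and inserted again on either side of the associativity isomorphism.\<close>
      have i1: "gmodule_isomorphic G (tensor (nat_copy G (tensor M N)) L) (tensor (tensor M N) L)"
        using gm by (intro tensor_isomorphic_cong gmodule_isomorphic_refl gmodule_isomorphic_sym[OF _ tc(2)]) auto
      have i2: "gmodule_isomorphic G (tensor (tensor M N) L) (tensor M (tensor N L))"
        using gm by (intro tensor_assoc) auto
      have i3: "gmodule_isomorphic G (tensor M (tensor N L)) (tensor M (nat_copy G (tensor N L)))"
        using gm by (intro tensor_isomorphic_cong[OF _ _ _ _ _ _ gmodule_isomorphic_refl tc(4)]) auto
      have "gmodule_isomorphic G (tensor (nat_copy G (tensor M N)) L) (tensor M (nat_copy G (tensor N L)))"
        by (rule gmodule_isomorphic_trans[OF i1 gmodule_isomorphic_trans[OF i2 i3]])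
      then show ?case unfolding mult_of using fg tc
        by (intro KI_nat_copy_isomorphic fg_tensor) auto
    next
      case (diff x y)
      from KI_diff[OF this] show ?case by (simp add: mult_diff_right mult_diff_left diff_swap)
    qed
  next
    case (diff x y)
    from KI_diff[OF this] show ?case by (simp add: mult_diff_right mult_diff_left diff_swap)
  qed
next
  case (diff x y) from KI_diff[OF this] show ?case by (simp add: mult_diff_left mult_diff_right diff_swap)
qed

lemma KF_one: "\<one>\<^bsub>KF\<^esub> \<in> carrier KF"
  unfolding KF_simps(4) by (intro KF_of nat_copy_props fg_trivial)

lemma mult_one:
  assumes "x \<in> carrier KF" shows "\<one>\<^bsub>KF\<^esub> \<otimes>\<^bsub>KF\<^esub> x - x \<in> KI"
  using assms
proof (induction rule: KF_induct)
  case zero then show ?case by (simp add: mult_zero_right KI_zero)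
next
  case (of M)
  note tc = nat_copy_props[OF fg_trivial[where 'a = 'a]]
  have iso: "gmodule_isomorphic G (tensor (nat_copy G (trivial_module :: ('a, 'a, 'g) gmodule)) M) M"
    using of tc fg_trivial[where 'a = 'a]
    by (intro gmodule_isomorphic_trans[OF tensor_isomorphic_cong[OF _ _ _ _ _ _ gmodule_isomorphic_sym
              gmodule_isomorphic_refl] tensor_trivial])
      (auto simp: fg_iff)
  have fg: "fg_module G (tensor (nat_copy G (trivial_module :: ('a, 'a, 'g) gmodule)) M)"
    using tc of by (intro fg_tensor)
  then have "gmodule_isomorphic G (nat_copy G (tensor (nat_copy G (trivial_module :: ('a, 'a, 'g) gmodule)) M)) M"
    using gmodule_isomorphic_trans[OF gmodule_isomorphic_sym[OF _ nat_copy_props(2)[OF fg]] iso] by (simp add: fg_iff)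
  then show ?case unfolding KF_simps(4) mult_of
    by (intro KI_isomorphic nat_copy_props fg of)
next
  case (diff x y) from KI_diff[OF this] show ?case by (simp add: mult_diff_right diff_swap)
qed

lemma KF_zero: "0 \<in> carrier KF"
  by (simp add: KF_simps)

section \<open>Classes of modules in the quotient\<close>

lemma K0_props:
  "cring (K0 TYPE('a) G)"
  "carrier (K0 TYPE('a) G) = (\<lambda>x. KI +>\<^bsub>KF\<^esub> x) ` carrier KF"
  "x \<in> carrier KF \<Longrightarrow> y \<in> carrier KF \<Longrightarrow> KI +>\<^bsub>KF\<^esub> x = KI +>\<^bsub>KF\<^esub> y \<longleftrightarrow> x - y \<in> KI"
  "x \<in> carrier KF \<Longrightarrow> y \<in> carrier KF \<Longrightarrow>
    (KI +>\<^bsub>KF\<^esub> x) \<oplus>\<^bsub>K0 TYPE('a) G\<^esub> (KI +>\<^bsub>KF\<^esub> y) = KI +>\<^bsub>KF\<^esub> (x + y)"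
  "x \<in> carrier KF \<Longrightarrow> y \<in> carrier KF \<Longrightarrow>
    (KI +>\<^bsub>KF\<^esub> x) \<otimes>\<^bsub>K0 TYPE('a) G\<^esub> (KI +>\<^bsub>KF\<^esub> y) = KI +>\<^bsub>KF\<^esub> (x \<otimes>\<^bsub>KF\<^esub> y)"
  "\<zero>\<^bsub>K0 TYPE('a) G\<^esub> = KI +>\<^bsub>KF\<^esub> 0"
  "\<one>\<^bsub>K0 TYPE('a) G\<^esub> = KI +>\<^bsub>KF\<^esub> \<one>\<^bsub>KF\<^esub>"
  by (rule quotient_criterion[OF KF_simps(3,2) KF_zero KF_diff mult_closed mult_diff_left mult_diff_right
    KI_carrier KI_zero KI_diff KI_mult mult_commute mult_assoc KF_one mult_one, folded K0_def]; assumption)+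

lemma cring_K0: "cring (K0 TYPE('a) G)"
  by (rule K0_props(1))

lemma K0_class_closed:
  fixes M :: "('a, 'v, 'g) gmodule"
  assumes "fg_module G M" shows "K0_class G M \<in> carrier (K0 TYPE('a) G)"
  unfolding K0_class_def K0_props(2) by (intro imageI KF_of nat_copy_props assms)

lemma K0_class_exact:
  fixes A :: "('a, 'u, 'g) gmodule" and B :: "('a, 'v, 'g) gmodule" and C :: "('a, 'w, 'g) gmodule"
  assumes fg: "fg_module G A" "fg_module G B" "fg_module G C" and ex: "short_exact G A B C i p"
  shows "K0_class G B = K0_class G A \<oplus>\<^bsub>K0 TYPE('a) G\<^esub> K0_class G C"
proof -
  note c = KF_of[OF nat_copy_props(1)[OF fg(1)]] KF_of[OF nat_copy_props(1)[OF fg(2)]] KF_of[OF nat_copy_props(1)[OF fg(3)]]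
  have "frag_of (nat_copy G A) + frag_of (nat_copy G C) \<in> carrier KF"
    using KF_diff[OF c(1) KF_diff[OF KF_zero c(3)]] by simp
  then show ?thesis
    using KI_exact[OF fg ex] c
    unfolding K0_class_def by (subst K0_props(4)) (simp_all add: K0_props(3) diff_diff_eq)
qed

lemma K0_class_isomorphic:
  fixes M :: "('a, 'v, 'g) gmodule" and N :: "('a, 'w, 'g) gmodule"
  assumes "fg_module G M" "fg_module G N" "gmodule_isomorphic G M N"
  shows "K0_class G M = K0_class G N"
  unfolding K0_class_def using KI_nat_copy_isomorphic[OF assms] assms
  by (subst K0_props(3)) (auto intro!: KF_of nat_copy_props)

lemma K0_class_nat:
  fixes M :: "('a, nat, 'g) gmodule"
  assumes "fg_module G M" shows "KI +>\<^bsub>KF\<^esub> frag_of M = K0_class G M"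
  unfolding K0_class_def using KI_isomorphic[OF assms nat_copy_props[OF assms]] assms
  by (subst K0_props(3)) (auto intro!: KF_of nat_copy_props)

lemma K0_class_tensor:
  fixes M :: "('a, 'v, 'g) gmodule" and N :: "('a, 'w, 'g) gmodule"
  assumes "fg_module G M" "fg_module G N"
  shows "K0_class G (tensor M N) = K0_class G M \<otimes>\<^bsub>K0 TYPE('a) G\<^esub> K0_class G N"
proof -
  note c = nat_copy_props[OF assms(1)] nat_copy_props[OF assms(2)]
  have "K0_class G M \<otimes>\<^bsub>K0 TYPE('a) G\<^esub> K0_class G N = K0_class G (tensor (nat_copy G M) (nat_copy G N))"
    unfolding K0_class_def by (subst K0_props(5)) (auto simp: mult_of intro!: KF_of c)
  moreover have "gmodule_isomorphic G (tensor M N) (tensor (nat_copy G M) (nat_copy G N))"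
    using assms c by (intro tensor_isomorphic_cong) (auto simp: fg_iff)
  then have "K0_class G (tensor M N) = K0_class G (tensor (nat_copy G M) (nat_copy G N))"
    by (rule K0_class_isomorphic[rotated 2]) (intro fg_tensor assms c)+
  ultimately show ?thesis by simp
qed

lemma K0_class_trivial: "\<one>\<^bsub>K0 TYPE('a) G\<^esub> = K0_class G (trivial_module :: ('a, 'a, 'g) gmodule)"
  unfolding K0_class_def K0_props(7) by (simp add: KF_simps)

text \<open>The universal property of the Grothendieck group for integer values: the linear
  extension of an additive function kills every relation, hence is constant on cosets and may be
  evaluated on a chosen representative.\<close>

lemma K0_functional:
  fixes \<mu> :: "('a, nat, 'g) gmodule \<Rightarrow> int"
  assumes additive: "\<And>A B C i p. fg_module G A \<Longrightarrow> fg_module G B \<Longrightarrow> fg_module G C \<Longrightarrow>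
    short_exact G A B C i p \<Longrightarrow> \<mu> B = \<mu> A + \<mu> C"
  obtains m where "\<And>x y. x \<in> carrier (K0 TYPE('a) G) \<Longrightarrow> y \<in> carrier (K0 TYPE('a) G) \<Longrightarrow>
      m (x \<oplus>\<^bsub>K0 TYPE('a) G\<^esub> y) = m x + m y"
    "\<And>M. fg_module G M \<Longrightarrow> m (K0_class G M) = \<mu> M"
proof -
  \<comment> \<open>The free abelian group on the single element \<open>()\<close> plays the
    integers here, so that \<open>frag_extend\<close> can extend \<open>\<mu>\<close>
    linearly.\<close>
  define \<phi> where "\<phi> x = Poly_Mapping.lookup (frag_extend (\<lambda>M. frag_cmul (\<mu> M) (frag_of ())) x) ()" for x
  have \<phi>_diff: "\<phi> (x - y) = \<phi> x - \<phi> y" for x y by (simp add: \<phi>_def frag_extend_diff lookup_minus)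
  have \<phi>_add: "\<phi> (x + y) = \<phi> x + \<phi> y" for x y using \<phi>_diff[of "x + y" y] by simp
  have \<phi>_of: "\<phi> (frag_of M) = \<mu> M" for M by (simp add: \<phi>_def)
  have \<phi>_KI: "\<phi> x = 0" if "x \<in> KI" for x
    using that
  proof (induction rule: KI_induct)
    case zero show ?case using \<phi>_diff[of 0 0] by simp
  next
    case (rel r) then show ?case using additive by (auto simp: \<phi>_diff \<phi>_of)
  next
    case (diff x y) then show ?case by (simp add: \<phi>_diff)
  qed
  define m where "m u = \<phi> (SOME x. x \<in> carrier KF \<and> KI +>\<^bsub>KF\<^esub> x = u)" for u
  have m: "m (KI +>\<^bsub>KF\<^esub> x) = \<phi> x" if x: "x \<in> carrier KF" for x
  proof -
    have "(SOME y. y \<in> carrier KF \<and> KI +>\<^bsub>KF\<^esub> y = KI +>\<^bsub>KF\<^esub> x) \<in> carrier KF \<and>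
      KI +>\<^bsub>KF\<^esub> (SOME y. y \<in> carrier KF \<and> KI +>\<^bsub>KF\<^esub> y = KI +>\<^bsub>KF\<^esub> x) = KI +>\<^bsub>KF\<^esub> x"
      by (rule someI[of _ x]) (use x in simp)
    then obtain y where y: "y \<in> carrier KF" "KI +>\<^bsub>KF\<^esub> y = KI +>\<^bsub>KF\<^esub> x" "m (KI +>\<^bsub>KF\<^esub> x) = \<phi> y"
      unfolding m_def by blast
    then have "\<phi> (y - x) = 0" using x K0_props(3)[of y x] by (intro \<phi>_KI) simp
    then show ?thesis by (simp add: \<phi>_diff y(3))
  qed
  show thesis
  proof (rule that[of m])
    fix u v assume "u \<in> carrier (K0 TYPE('a) G)" "v \<in> carrier (K0 TYPE('a) G)"
    then obtain x y where xy: "x \<in> carrier KF" "y \<in> carrier KF" "u = KI +>\<^bsub>KF\<^esub> x" "v = KI +>\<^bsub>KF\<^esub> y"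
      unfolding K0_props(2) by blast
    have "x + y \<in> carrier KF" using KF_diff[OF xy(1) KF_diff[OF KF_zero xy(2)]] by simp
    then show "m (u \<oplus>\<^bsub>K0 TYPE('a) G\<^esub> v) = m u + m v"
      using xy by (simp add: K0_props(4) m \<phi>_add)
  next
    fix M :: "('a, nat, 'g) gmodule" assume "fg_module G M"
    then show "m (K0_class G M) = \<mu> M" using m[OF KF_of] by (simp add: K0_class_nat \<phi>_of)
  qed
qed

lemma K0_induct_classes [consumes 1, case_names zero cls diff]:
  assumes "u \<in> carrier (K0 TYPE('a) G)" and zero: "P \<zero>\<^bsub>K0 TYPE('a) G\<^esub>"
    and cls: "\<And>M :: ('a, nat, 'g) gmodule. fg_module G M \<Longrightarrow> P (K0_class G M)"
    and diff: "\<And>u v. u \<in> carrier (K0 TYPE('a) G) \<Longrightarrow> v \<in> carrier (K0 TYPE('a) G) \<Longrightarrow>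
      P u \<Longrightarrow> P v \<Longrightarrow> P (u \<ominus>\<^bsub>K0 TYPE('a) G\<^esub> v)"
  shows "P u"
proof -
  interpret K: cring "K0 TYPE('a) G" by (rule cring_K0)
  obtain x where x: "x \<in> carrier KF" "u = KI +>\<^bsub>KF\<^esub> x"
    using assms(1) unfolding K0_props(2) by blast
  have in_K: "KI +>\<^bsub>KF\<^esub> x \<in> carrier (K0 TYPE('a) G)" if "x \<in> carrier KF" for x
    unfolding K0_props(2) using that by (rule imageI)
  from x(1) have "x \<in> carrier KF \<and> P (KI +>\<^bsub>KF\<^esub> x)"
  proof (induction rule: KF_induct)
    case zero then show ?case using assms(2) KF_zero by (simp add: K0_props(6))
  next
    case (of M) then show ?case using cls[OF of] KF_of[OF of] by (simp add: K0_class_nat)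
  next
    case (diff x y)
    have d: "x - y \<in> carrier KF" using diff KF_diff by blast
    then have "(KI +>\<^bsub>KF\<^esub> (x - y)) \<oplus>\<^bsub>K0 TYPE('a) G\<^esub> (KI +>\<^bsub>KF\<^esub> y) = KI +>\<^bsub>KF\<^esub> x"
      using diff by (subst K0_props(4)) auto
    then have "KI +>\<^bsub>KF\<^esub> (x - y) = (KI +>\<^bsub>KF\<^esub> x) \<ominus>\<^bsub>K0 TYPE('a) G\<^esub> (KI +>\<^bsub>KF\<^esub> y)"
      using in_K[OF d] in_K[of x] in_K[of y] diff
      by (auto simp: a_minus_def K.a_assoc K.r_neg dest!: sym[of _ "KI +>\<^bsub>KF\<^esub> x"])
    then show ?case using d diff in_K assms(4)[of "KI +>\<^bsub>KF\<^esub> x" "KI +>\<^bsub>KF\<^esub> y"] by simp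
  qed
  then show ?thesis using x(2) by simp
qed

end

end

section \<open>Generation by the simple modules\<close>

definition gsimple :: "'g monoid \<Rightarrow> ('a::field, 'v, 'g) gmodule \<Rightarrow> bool"
  where "gsimple G M \<longleftrightarrow> group_module G M \<and> carrier M \<noteq> {\<zero>\<^bsub>M\<^esub>} \<and>
    (\<forall>N. gsubmodule G M N \<longrightarrow> N = {\<zero>\<^bsub>M\<^esub>} \<or> N = carrier M)"

context finite_group begin

text \<open>For the zero module the constant sequence M, M, M is exact, so its class is twice
  itself.\<close>

lemma K0_class_zero:
  fixes M :: "('a::{field,finite}, 'v, 'g) gmodule"
  assumes "group_module G M" "carrier M = {\<zero>\<^bsub>M\<^esub>}"
  shows "K0_class G M = \<zero>\<^bsub>K0 TYPE('a) G\<^esub>"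
proof -
  interpret K: cring "K0 TYPE('a) G" by (rule cring_K0)
  have fg: "fg_module G M" using assms by (simp add: fg_iff)
  have "short_exact G M M M id id"
    using assms(2) by (auto simp: short_exact_def gmodule_hom_def)
  from K0_class_exact[OF fg fg fg this] show ?thesis
    using K0_class_closed[OF fg] by (metis K.add.r_cancel_one')
qed

text \<open>A module that is neither zero nor simple has a proper nonzero submodule N, and its class
  is the sum of those of N and of the quotient, both of smaller cardinality.\<close>

lemma K0_induct [consumes 1, case_names zero simple diff]:
  assumes "u \<in> carrier (K0 TYPE('a::{field,finite}) G)" and zero: "P \<zero>\<^bsub>K0 TYPE('a) G\<^esub>"
    and simple: "\<And>M :: ('a, nat, 'g) gmodule. fg_module G M \<Longrightarrow> gsimple G M \<Longrightarrow> P (K0_class G M)"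
    and diff: "\<And>u v. u \<in> carrier (K0 TYPE('a) G) \<Longrightarrow> v \<in> carrier (K0 TYPE('a) G) \<Longrightarrow>
      P u \<Longrightarrow> P v \<Longrightarrow> P (u \<ominus>\<^bsub>K0 TYPE('a) G\<^esub> v)"
  shows "P u"
proof -
  interpret K: cring "K0 TYPE('a) G" by (rule cring_K0)
  have add: "P (u \<oplus>\<^bsub>K0 TYPE('a) G\<^esub> v)" if uv: "u \<in> carrier (K0 TYPE('a) G)" "v \<in> carrier (K0 TYPE('a) G)"
    "P u" "P v" for u v
    using diff[OF uv(1) _ uv(3) diff[OF K.zero_closed uv(2) zero uv(4)]] uv
    by (simp add: a_minus_def)
  have cls: "P (K0_class G M)" if "fg_module G M" for M :: "('a, nat, 'g) gmodule"
    using that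
  proof (induction "card (carrier M)" arbitrary: M rule: less_induct)
    case less
    then interpret M: group_module G M by (simp add: fg_iff)
    have fin: "finite (carrier M)" using less.prems by (simp add: fg_iff)
    consider "carrier M = {\<zero>\<^bsub>M\<^esub>}" | "gsimple G M"
      | N where "gsubmodule G M N" "N \<noteq> {\<zero>\<^bsub>M\<^esub>}" "N \<noteq> carrier M"
      using M.group_module_axioms by (auto simp: gsimple_def)
    then show ?case
    proof cases
      case 1 then show ?thesis using K0_class_zero[OF M.group_module_axioms] zero by simp
    next
      case 2 then show ?thesis by (rule simple[OF less.prems])
    next
      case (3 N)
      have N: "N \<subseteq> carrier M" "\<zero>\<^bsub>M\<^esub> \<in> N" using 3(1) by (auto simp: M.gsubmodule_iff)
      let ?A = "M\<lparr>carrier := N\<rparr>" and ?C = "gquot M N"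
      have gmA: "group_module G ?A" and gmC: "group_module G ?C"
        by (rule M.group_module_submodule[OF 3(1)], rule M.group_module_gquot[OF 3(1)])
      have fg: "fg_module G ?A" "fg_module G ?C"
        using gmA gmC N(1) fin finite_subset M.gquot_simps(1)[OF 3(1)] by (auto simp: fg_iff)
      have ex: "short_exact G ?A M ?C id (\<lambda>v. N +>\<^bsub>M\<^esub> v)"
        by (rule short_exact_submodule[OF M.group_module_axioms 3(1)])
      have card: "card (carrier M) = card (carrier ?A) * card (carrier ?C)"
        by (rule card_short_exact[OF gmA M.group_module_axioms gmC ex])
      have A: "card (carrier ?A) < card (carrier M)"
        using N 3(3) fin by (simp add: psubset_card_mono psubsetI)
      have "finite N" using N(1) fin by (rule finite_subset)
      then have "card {\<zero>\<^bsub>M\<^esub>} < card N" using N 3(2) by (intro psubset_card_mono) auto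
      then have "1 < card (carrier ?A)" by simp
      moreover have "card (carrier M) > 0" using fin M.M.zero_closed by (auto simp: card_gt_0_iff)
      ultimately have C: "card (carrier ?C) < card (carrier M)" unfolding card by simp
      have "P (K0_class G ?A)" using less.hyps[OF A fg(1)] .
      moreover have "P (K0_class G ?C)"
      proof -
        \<comment> \<open>The quotient lives on cosets, outside the type over which the induction
          runs; the hypothesis is applied to its copy, which has the same size and class.\<close>
        note c = nat_copy_props[OF fg(2)]
        have "card (carrier (nat_copy G ?C)) < card (carrier M)" using C gmodule_isomorphic_card[OF c(2)] by simp
        from less.hyps[OF this c(1)] show ?thesis using K0_class_isomorphic[OF fg(2) c] by simp
      qed
      ultimately show ?thesis unfolding K0_class_exact[OF fg(1) less.prems fg(2) ex]
        by (intro add K0_class_closed fg)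
    qed
  qed
  from assms(1) show ?thesis
    by (induction rule: K0_induct_classes) (use zero cls diff in auto)
qed

end


section \<open>Composition multiplicities\<close>

text \<open>The quotient B / A is compared with S through a surjection from B with kernel A, which
  avoids carrying cosets through the lattice arguments.\<close>

definition factor_of ::
    "'g monoid \<Rightarrow> ('a::field, 'v, 'g) gmodule \<Rightarrow> ('a, 'w, 'g) gmodule \<Rightarrow> 'v set \<Rightarrow> 'v set \<Rightarrow> bool"
  where "factor_of G M S A B \<longleftrightarrow>
    (\<exists>h\<in>gmodule_hom G (M\<lparr>carrier := B\<rparr>) S. h ` B = carrier S \<and> {v \<in> B. h v = \<zero>\<^bsub>S\<^esub>} = A)"

definition covers :: "'g monoid \<Rightarrow> ('a::field, 'v, 'g) gmodule \<Rightarrow> 'v set \<Rightarrow> 'v set \<Rightarrow> bool"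
  where "covers G M A B \<longleftrightarrow> gsubmodule G M A \<and> gsubmodule G M B \<and> A \<subset> B \<and>
    (\<forall>N. gsubmodule G M N \<longrightarrow> A \<subseteq> N \<longrightarrow> N \<subseteq> B \<longrightarrow> N = A \<or> N = B)"

text \<open>A derivation is a composition series that ends in its third argument's submodule. That
  the number found does not depend on the series is \<open>comp_mult_unique\<close>.\<close>

inductive comp_mult ::
    "'g monoid \<Rightarrow> ('a::field, 'v, 'g) gmodule \<Rightarrow> ('a, 'w, 'g) gmodule \<Rightarrow> 'v set \<Rightarrow> nat \<Rightarrow> bool"
  for G M S where
    zero: "comp_mult G M S {\<zero>\<^bsub>M\<^esub>} 0"
  | step: "comp_mult G M S A k \<Longrightarrow> covers G M A B \<Longrightarrow>
      comp_mult G M S B (k + (if factor_of G M S A B then 1 else 0))"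

context group_module begin

lemma comp_mult_gsubmodule: "comp_mult G M S A k \<Longrightarrow> gsubmodule G M A"
  by (induction rule: comp_mult.induct) (auto simp: gsubmodule_zero covers_def)

section \<open>The lattice of submodules\<close>

lemma gsubmodule_Int: "gsubmodule G M A \<Longrightarrow> gsubmodule G M B \<Longrightarrow> gsubmodule G M (A \<inter> B)"
  by (auto simp: gsubmodule_iff)

definition msum :: "'v set \<Rightarrow> 'v set \<Rightarrow> 'v set"
  where "msum A B = {a \<oplus>\<^bsub>M\<^esub> b | a b. a \<in> A \<and> b \<in> B}"

lemma msum_superset:
  assumes "gsubmodule G M A" "gsubmodule G M B" shows "A \<subseteq> msum A B" "B \<subseteq> msum A B"
proof -
  have c: "A \<subseteq> carrier M" "B \<subseteq> carrier M" "\<zero>\<^bsub>M\<^esub> \<in> A" "\<zero>\<^bsub>M\<^esub> \<in> B" using assms by (auto simp: gsubmodule_iff)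
  show "A \<subseteq> msum A B"
  proof
    fix a assume "a \<in> A"
    then have "a = a \<oplus>\<^bsub>M\<^esub> \<zero>\<^bsub>M\<^esub>" "a \<in> A" using c by auto
    then show "a \<in> msum A B" using c unfolding msum_def by blast
  qed
  show "B \<subseteq> msum A B"
  proof
    fix b assume "b \<in> B"
    then have "b = \<zero>\<^bsub>M\<^esub> \<oplus>\<^bsub>M\<^esub> b" "b \<in> B" using c by auto
    then show "b \<in> msum A B" using c unfolding msum_def by blast
  qed
qed

lemma gsubmodule_msum:
  assumes "gsubmodule G M A" "gsubmodule G M B" shows "gsubmodule G M (msum A B)"
proof -
  have A: "A \<subseteq> carrier M" "\<zero>\<^bsub>M\<^esub> \<in> A" "\<And>v w. v \<in> A \<Longrightarrow> w \<in> A \<Longrightarrow> v \<oplus>\<^bsub>M\<^esub> w \<in> A"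
    "\<And>c v. v \<in> A \<Longrightarrow> c \<odot>\<^bsub>M\<^esub> v \<in> A" "\<And>g v. g \<in> carrier G \<Longrightarrow> v \<in> A \<Longrightarrow> act M g v \<in> A"
    using assms(1) by (auto simp: gsubmodule_iff)
  have B: "B \<subseteq> carrier M" "\<zero>\<^bsub>M\<^esub> \<in> B" "\<And>v w. v \<in> B \<Longrightarrow> w \<in> B \<Longrightarrow> v \<oplus>\<^bsub>M\<^esub> w \<in> B"
    "\<And>c v. v \<in> B \<Longrightarrow> c \<odot>\<^bsub>M\<^esub> v \<in> B" "\<And>g v. g \<in> carrier G \<Longrightarrow> v \<in> B \<Longrightarrow> act M g v \<in> B"
    using assms(2) by (auto simp: gsubmodule_iff)
  have mem: "v \<in> msum A B" if "v = a \<oplus>\<^bsub>M\<^esub> b" "a \<in> A" "b \<in> B" for v a b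
    using that by (auto simp: msum_def)
  note AB = subsetD[OF A(1)] subsetD[OF B(1)]
  show ?thesis unfolding gsubmodule_iff
  proof (intro conjI allI ballI)
    show "msum A B \<subseteq> carrier M" using AB by (auto simp: msum_def)
    show "\<zero>\<^bsub>M\<^esub> \<in> msum A B" by (rule mem[OF _ A(2) B(2)]) simp
  next
    fix v w assume "v \<in> msum A B" "w \<in> msum A B"
    then obtain a b a' b' where "v = a \<oplus>\<^bsub>M\<^esub> b" "w = a' \<oplus>\<^bsub>M\<^esub> b'" "a \<in> A" "a' \<in> A" "b \<in> B" "b' \<in> B"
      by (auto simp: msum_def)
    then show "v \<oplus>\<^bsub>M\<^esub> w \<in> msum A B"
      by (intro mem[of _ "a \<oplus>\<^bsub>M\<^esub> a'" "b \<oplus>\<^bsub>M\<^esub> b'"] A B) (simp add: AB M.a_ac)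
  next
    fix c v assume "v \<in> msum A B"
    then obtain a b where "v = a \<oplus>\<^bsub>M\<^esub> b" "a \<in> A" "b \<in> B" by (auto simp: msum_def)
    then show "c \<odot>\<^bsub>M\<^esub> v \<in> msum A B"
      by (intro mem[of _ "c \<odot>\<^bsub>M\<^esub> a" "c \<odot>\<^bsub>M\<^esub> b"] A B) (simp add: AB smult_add_right)
  next
    fix g v assume "g \<in> carrier G" "v \<in> msum A B"
    moreover from this obtain a b where "v = a \<oplus>\<^bsub>M\<^esub> b" "a \<in> A" "b \<in> B" by (auto simp: msum_def)
    ultimately show "act M g v \<in> msum A B"
      by (intro mem[of _ "act M g a" "act M g b"] A B) (simp_all add: AB act_add)
  qed
qed

lemma msum_least:
  "gsubmodule G M C \<Longrightarrow> A \<subseteq> C \<Longrightarrow> B \<subseteq> C \<Longrightarrow> msum A B \<subseteq> C"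
  unfolding msum_def gsubmodule_iff by blast

lemma modular:
  assumes "gsubmodule G M A" "gsubmodule G M B" "gsubmodule G M C" "A \<subseteq> C"
  shows "msum A B \<inter> C = msum A (B \<inter> C)"
proof
  show "msum A (B \<inter> C) \<subseteq> msum A B \<inter> C"
    using assms by (auto simp: msum_def gsubmodule_iff)
  show "msum A B \<inter> C \<subseteq> msum A (B \<inter> C)"
  proof
    fix v assume v: "v \<in> msum A B \<inter> C"
    then obtain a b where ab: "v = a \<oplus>\<^bsub>M\<^esub> b" "a \<in> A" "b \<in> B" by (auto simp: msum_def)
    have c: "a \<in> carrier M" "b \<in> carrier M" using ab assms(1,2) by (auto simp: gsubmodule_iff)
    have "(-1) \<odot>\<^bsub>M\<^esub> a \<in> C" using ab assms(3,4) by (auto simp: gsubmodule_iff)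
    then have "(-1) \<odot>\<^bsub>M\<^esub> a \<oplus>\<^bsub>M\<^esub> v \<in> C" using v assms(3) by (auto simp: gsubmodule_iff)
    moreover have "(-1) \<odot>\<^bsub>M\<^esub> a \<oplus>\<^bsub>M\<^esub> v = b" using c by (simp add: ab(1) minus_one_smult M.r_neg1)
    ultimately show "v \<in> msum A (B \<inter> C)" using ab by (auto simp: msum_def)
  qed
qed

text \<open>A submodule C between A \<inter> B and B gives A + C between A and N, so A + C is A or
  N; intersecting with B recovers C by the modular law. And A + B lies strictly above one of two
  distinct maximal submodules, hence is N.\<close>

lemma covers_diamond:
  assumes A: "covers G M A N" and B: "covers G M B N" and ne: "A \<noteq> B"
  shows "covers G M (A \<inter> B) B" "msum A B = N"
proof -
  have gA: "gsubmodule G M A" "A \<subset> N" "gsubmodule G M N" and gB: "gsubmodule G M B" "B \<subset> N"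
    using A B by (auto simp: covers_def)
  have s: "gsubmodule G M (msum A B)" by (rule gsubmodule_msum[OF gA(1) gB(1)])
  have sub: "A \<subseteq> msum A B" "B \<subseteq> msum A B" by (rule msum_superset[OF gA(1) gB(1)])+
  have le: "msum A B \<subseteq> N" using gA gB by (intro msum_least) auto
  show sum: "msum A B = N"
  proof (rule ccontr)
    assume "msum A B \<noteq> N"
    then have "msum A B = A" "msum A B = B" using A B s sub le by (auto simp: covers_def)
    then show False using ne by simp
  qed
  show "covers G M (A \<inter> B) B"
    unfolding covers_def
  proof (intro conjI allI impI)
    show "gsubmodule G M (A \<inter> B)" by (rule gsubmodule_Int[OF gA(1) gB(1)])
    show "gsubmodule G M B" by (rule gB)
    have "\<not> B \<subseteq> A"
    proof
      assume "B \<subseteq> A"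
      then have "msum A B \<subseteq> A" using gA by (intro msum_least) auto
      then show False using sum gA(2) by auto
    qed
    then show "A \<inter> B \<subset> B" by auto
    fix C assume C: "gsubmodule G M C" "A \<inter> B \<subseteq> C" "C \<subseteq> B"
    have AC: "gsubmodule G M (msum A C)" "A \<subseteq> msum A C" "C \<subseteq> msum A C" "msum A C \<subseteq> N"
      using gsubmodule_msum[OF gA(1) C(1)] msum_superset[OF gA(1) C(1)] msum_least[OF gA(3), of A C] gA gB C by auto
    then have "msum A C = A \<or> msum A C = N" using A by (auto simp: covers_def)
    moreover have "msum C A \<inter> B = msum C (A \<inter> B)" by (rule modular[OF C(1) gA(1) gB(1) C(3)])
    moreover have "msum C (A \<inter> B) = C"
      using msum_superset(1)[OF C(1) gsubmodule_Int[OF gA(1) gB(1)]] msum_least[OF C(1), of C "A \<inter> B"] C(2) by auto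
    moreover have "msum C A = msum A C"
    proof -
      have "C \<subseteq> carrier M" "A \<subseteq> carrier M" using C gA by (auto simp: gsubmodule_iff)
      then have "a \<oplus>\<^bsub>M\<^esub> c = c \<oplus>\<^bsub>M\<^esub> a" if "a \<in> A" "c \<in> C" for a c using that by (auto intro: M.a_comm)
      then show ?thesis unfolding msum_def by metis
    qed
    ultimately show "C = A \<inter> B \<or> C = B" using AC gB by auto
  qed
qed

text \<open>The second isomorphism theorem, (A + B) / A = B / (A \<inter> B). One direction
  restricts the surjection to B; the other extends it by zero on A.\<close>

lemma factor_of_diamond:
  assumes gm: "group_module G S" and A: "gsubmodule G M A" and B: "gsubmodule G M B"
  shows "factor_of G M S A (msum A B) \<longleftrightarrow> factor_of G M S (A \<inter> B) B"
proof
  have cA: "A \<subseteq> carrier M" and cB: "B \<subseteq> carrier M" using A B by (auto simp: gsubmodule_iff)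
  note sub = msum_superset[OF A B]
  have gs: "gsubmodule G M (msum A B)" by (rule gsubmodule_msum[OF A B])
  interpret S: group_module G S by (rule gm)
  {
    assume "factor_of G M S A (msum A B)"
    then obtain h where h: "h \<in> gmodule_hom G (M\<lparr>carrier := msum A B\<rparr>) S" "h ` msum A B = carrier S"
      "{v \<in> msum A B. h v = \<zero>\<^bsub>S\<^esub>} = A" by (auto simp: factor_of_def)
    have "h \<in> gmodule_hom G (M\<lparr>carrier := B\<rparr>) S"
      using h(1) sub by (auto simp: gmodule_hom_def subset_iff)
    moreover have "h ` B = carrier S"
    proof (intro equalityI subsetI)
      fix s assume "s \<in> carrier S"
      then obtain v where v: "v \<in> msum A B" "s = h v" using h(2) by auto
      then obtain a b where ab: "v = a \<oplus>\<^bsub>M\<^esub> b" "a \<in> A" "b \<in> B" by (auto simp: msum_def)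
      have "h a = \<zero>\<^bsub>S\<^esub>" using h(3) ab by auto
      moreover have "h v = h a \<oplus>\<^bsub>S\<^esub> h b" "h b \<in> carrier S"
        using gmodule_homD[OF h(1), simplified] subsetD[OF sub(1) ab(2)] subsetD[OF sub(2) ab(3)] ab(1) by auto
      ultimately show "s \<in> h ` B" using v ab by simp
    qed (use h(2) sub in blast)
    moreover have "{v \<in> B. h v = \<zero>\<^bsub>S\<^esub>} = A \<inter> B" using h(3) sub by auto
    ultimately show "factor_of G M S (A \<inter> B) B" by (auto simp: factor_of_def)
  }
  {
    assume "factor_of G M S (A \<inter> B) B"
    then obtain h where h: "h \<in> gmodule_hom G (M\<lparr>carrier := B\<rparr>) S" "h ` B = carrier S"
      "{v \<in> B. h v = \<zero>\<^bsub>S\<^esub>} = A \<inter> B" by (auto simp: factor_of_def)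
    note H = gmodule_homD[OF h(1), simplified]
    have gmB: "group_module G (M\<lparr>carrier := B\<rparr>)" by (rule group_module_submodule[OF B])
    \<comment> \<open>If a + b = a' + b', then b - b' lies in A \<inter> B, where \<open>h\<close>
      vanishes, so the choice of the summand in B is immaterial.\<close>
    define k where "k v = h (SOME b. b \<in> B \<and> (\<exists>a\<in>A. v = a \<oplus>\<^bsub>M\<^esub> b))" for v
    have k: "k (a \<oplus>\<^bsub>M\<^esub> b) = h b" if ab: "a \<in> A" "b \<in> B" for a b
    proof -
      let ?P = "\<lambda>b'. b' \<in> B \<and> (\<exists>a'\<in>A. a \<oplus>\<^bsub>M\<^esub> b = a' \<oplus>\<^bsub>M\<^esub> b')"
      have "?P (SOME b'. ?P b')" by (rule someI[of ?P b]) (use ab in auto)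
      then obtain a' b' where b': "b' \<in> B" "a' \<in> A" "a \<oplus>\<^bsub>M\<^esub> b = a' \<oplus>\<^bsub>M\<^esub> b'" "k (a \<oplus>\<^bsub>M\<^esub> b) = h b'"
        unfolding k_def by blast
      have c: "a \<in> carrier M" "a' \<in> carrier M" "b \<in> carrier M" "b' \<in> carrier M" using ab b' cA cB by auto
      define d where "d = a' \<oplus>\<^bsub>M\<^esub> (-1) \<odot>\<^bsub>M\<^esub> a"
      have dA: "d \<in> A" using ab b' A by (auto simp: d_def gsubmodule_iff)
      have bd: "b = d \<oplus>\<^bsub>M\<^esub> b'"
      proof -
        have "b = (-1) \<odot>\<^bsub>M\<^esub> a \<oplus>\<^bsub>M\<^esub> (a \<oplus>\<^bsub>M\<^esub> b)" using c by (simp add: minus_one_smult M.r_neg1)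
        also have "\<dots> = d \<oplus>\<^bsub>M\<^esub> b'" using c unfolding b'(3) d_def by (simp add: M.a_ac)
        finally show ?thesis .
      qed
      have "d = b \<oplus>\<^bsub>M\<^esub> (-1) \<odot>\<^bsub>M\<^esub> b'"
        using c cA dA by (simp add: bd minus_one_smult M.a_assoc M.r_neg subset_iff)
      then have "d \<in> B" using ab b' B by (auto simp: gsubmodule_iff)
      then have "h d = \<zero>\<^bsub>S\<^esub>" using dA h(3) by auto
      moreover have "h b = h d \<oplus>\<^bsub>S\<^esub> h b'" unfolding bd by (rule H(2)[OF \<open>d \<in> B\<close> b'(1)])
      ultimately show ?thesis using H(1)[OF b'(1)] b'(4) by simp
    qed
    have E: "\<exists>a b. a \<in> A \<and> b \<in> B \<and> v = a \<oplus>\<^bsub>M\<^esub> b" if "v \<in> carrier (M\<lparr>carrier := msum A B\<rparr>)" for v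
      using that by (auto simp: msum_def)
    have "k \<in> gmodule_hom G (M\<lparr>carrier := msum A B\<rparr>) S"
    proof (rule gmodule_homI)
      fix v assume "v \<in> carrier (M\<lparr>carrier := msum A B\<rparr>)"
      then obtain a b where "a \<in> A" "b \<in> B" "v = a \<oplus>\<^bsub>M\<^esub> b" using E[of v] by blast
      then show "k v \<in> carrier S" by (simp add: k H(1))
    next
      fix v w assume "v \<in> carrier (M\<lparr>carrier := msum A B\<rparr>)" "w \<in> carrier (M\<lparr>carrier := msum A B\<rparr>)"
      then obtain a b a' b' where *: "a \<in> A" "b \<in> B" "v = a \<oplus>\<^bsub>M\<^esub> b" "a' \<in> A" "b' \<in> B" "w = a' \<oplus>\<^bsub>M\<^esub> b'"
        using E[of v] E[of w] by blast
      then have "v \<oplus>\<^bsub>M\<^esub> w = (a \<oplus>\<^bsub>M\<^esub> a') \<oplus>\<^bsub>M\<^esub> (b \<oplus>\<^bsub>M\<^esub> b')"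
        using cA cB by (simp add: subset_iff M.a_ac)
      moreover have "a \<oplus>\<^bsub>M\<^esub> a' \<in> A" "b \<oplus>\<^bsub>M\<^esub> b' \<in> B" using * A B by (auto simp: gsubmodule_iff)
      ultimately show "k (v \<oplus>\<^bsub>M\<lparr>carrier := msum A B\<rparr>\<^esub> w) = k v \<oplus>\<^bsub>S\<^esub> k w"
        using * by (simp add: k H(2))
    next
      fix c v assume "v \<in> carrier (M\<lparr>carrier := msum A B\<rparr>)"
      then obtain a b where *: "a \<in> A" "b \<in> B" "v = a \<oplus>\<^bsub>M\<^esub> b" using E[of v] by blast
      then have "c \<odot>\<^bsub>M\<^esub> v = c \<odot>\<^bsub>M\<^esub> a \<oplus>\<^bsub>M\<^esub> c \<odot>\<^bsub>M\<^esub> b" using cA cB by (simp add: subset_iff smult_add_right)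
      moreover have "c \<odot>\<^bsub>M\<^esub> a \<in> A" "c \<odot>\<^bsub>M\<^esub> b \<in> B" using * A B by (auto simp: gsubmodule_iff)
      ultimately show "k (c \<odot>\<^bsub>M\<lparr>carrier := msum A B\<rparr>\<^esub> v) = c \<odot>\<^bsub>S\<^esub> k v" using * by (simp add: k H(3))
    next
      fix g v assume g: "g \<in> carrier G" and "v \<in> carrier (M\<lparr>carrier := msum A B\<rparr>)"
      then obtain a b where *: "a \<in> A" "b \<in> B" "v = a \<oplus>\<^bsub>M\<^esub> b" using E[of v] by blast
      then have "act M g v = act M g a \<oplus>\<^bsub>M\<^esub> act M g b" using cA cB g by (simp add: subset_iff act_add)
      moreover have "act M g a \<in> A" "act M g b \<in> B" using * A B g by (auto simp: gsubmodule_iff)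
      ultimately show "k (act (M\<lparr>carrier := msum A B\<rparr>) g v) = act S g (k v)" using * g by (simp add: k H(4))
    qed
    moreover have "k ` msum A B = carrier S"
    proof
      show "k ` msum A B \<subseteq> carrier S" using k H(1) by (auto simp: msum_def)
      show "carrier S \<subseteq> k ` msum A B"
      proof
        fix s assume "s \<in> carrier S"
        then obtain b where "b \<in> B" "s = h b" using h(2) by auto
        moreover have "\<zero>\<^bsub>M\<^esub> \<in> A" using A by (auto simp: gsubmodule_iff)
        ultimately have "s = k b" "b \<in> msum A B" using k[of "\<zero>\<^bsub>M\<^esub>" b] cB sub by auto
        then show "s \<in> k ` msum A B" by (rule image_eqI)
      qed
    qed
    moreover have "{v \<in> msum A B. k v = \<zero>\<^bsub>S\<^esub>} = A"
    proof (intro equalityI subsetI)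
      fix v assume "v \<in> {v \<in> msum A B. k v = \<zero>\<^bsub>S\<^esub>}"
      then obtain a b where *: "a \<in> A" "b \<in> B" "v = a \<oplus>\<^bsub>M\<^esub> b" "k v = \<zero>\<^bsub>S\<^esub>" using E[of v] by auto
      then have "h b = \<zero>\<^bsub>S\<^esub>" by (simp add: k)
      then have "b \<in> A" using h(3) * by auto
      then show "v \<in> A" using A * by (simp add: gsubmodule_iff)
    next
      fix a assume a: "a \<in> A"
      have "\<zero>\<^bsub>M\<^esub> \<in> B" using B by (auto simp: gsubmodule_iff)
      moreover have "h \<zero>\<^bsub>M\<^esub> = \<zero>\<^bsub>S\<^esub>" using gmodule_hom_zero[OF gmB gm h(1)] by simp
      ultimately have "k a = \<zero>\<^bsub>S\<^esub>" using k[OF a, of "\<zero>\<^bsub>M\<^esub>"] a cA by (simp add: subset_iff)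
      then show "a \<in> {v \<in> msum A B. k v = \<zero>\<^bsub>S\<^esub>}" using a sub by auto
    qed
    ultimately show "factor_of G M S A (msum A B)" by (auto simp: factor_of_def)
  }
qed

lemma exists_cover:
  assumes fin: "finite (carrier M)" and B: "gsubmodule G M B" "B \<noteq> {\<zero>\<^bsub>M\<^esub>}"
    and C: "gsubmodule G M C" "C \<subset> B"
  shows "\<exists>A. covers G M A B \<and> C \<subseteq> A"
proof -
  have finB: "finite B" using B(1) fin finite_subset by (auto simp: gsubmodule_iff)
  obtain A where A: "gsubmodule G M A" "A \<subset> B" "C \<subseteq> A"
    "\<And>A'. gsubmodule G M A' \<Longrightarrow> A' \<subset> B \<Longrightarrow> C \<subseteq> A' \<Longrightarrow> card A' \<le> card A"
  proof -
    have "\<forall>N. gsubmodule G M N \<and> N \<subset> B \<and> C \<subseteq> N \<longrightarrow> card N < Suc (card B)"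
      using finB by (auto simp: less_Suc_eq_le intro: card_mono)
    then have "\<exists>A. (gsubmodule G M A \<and> A \<subset> B \<and> C \<subseteq> A) \<and>
      (\<forall>N. gsubmodule G M N \<and> N \<subset> B \<and> C \<subseteq> N \<longrightarrow> card N \<le> card A)"
      by (intro ex_has_greatest_nat[of _ C]) (use C in auto)
    then show thesis using that by blast
  qed
  have "covers G M A B" unfolding covers_def
  proof (intro conjI allI impI)
    fix N assume N: "gsubmodule G M N" "A \<subseteq> N" "N \<subseteq> B"
    show "N = A \<or> N = B"
    proof (rule ccontr)
      assume "\<not> ?thesis"
      then have "N \<subset> B" "A \<subset> N" using N by auto
      then have "card N \<le> card A" "card A < card N"
        using A(3,4) N finB finite_subset psubset_card_mono[of N A] by blast+
      then show False by simp
    qed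
  qed (use A B in auto)
  then show ?thesis using A by auto
qed

lemma comp_mult_exists:
  assumes fin: "finite (carrier M)" and B: "gsubmodule G M B"
  shows "\<exists>k. comp_mult G M S B k"
  using B
proof (induction "card B" arbitrary: B rule: less_induct)
  case less
  show ?case
  proof (cases "B = {\<zero>\<^bsub>M\<^esub>}")
    case True then show ?thesis using comp_mult.zero by blast
  next
    case False
    have "{\<zero>\<^bsub>M\<^esub>} \<subset> B" using less.prems False by (auto simp: gsubmodule_iff)
    then obtain A where A: "covers G M A B"
      using exists_cover[OF fin less.prems False gsubmodule_zero] by auto
    have "finite B" using less.prems fin finite_subset by (auto simp: gsubmodule_iff)
    then have "card A < card B" using A by (auto simp: covers_def intro: psubset_card_mono)
    moreover have "gsubmodule G M A" using A by (simp add: covers_def)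
    ultimately obtain k where "comp_mult G M S A k" using less.hyps by blast
    then show ?thesis using comp_mult.step A by blast
  qed
qed

text \<open>The Jordan-Hoelder theorem. When the two series have distinct last terms A and A' below
  B, both are compared with series through A \<inter> A'. By the diamond the pair of top factors is
  the same along both routes, only in the opposite order.\<close>

lemma comp_mult_unique:
  assumes fin: "finite (carrier M)" and gm: "group_module G S"
  shows "comp_mult G M S B k \<Longrightarrow> comp_mult G M S B l \<Longrightarrow> k = l"
proof (induction "card B" arbitrary: B k l rule: less_induct)
  case less
  have no_cover_zero: False if "covers G M A {\<zero>\<^bsub>M\<^esub>}" for A
    using that by (auto simp: covers_def gsubmodule_iff)
  have gB: "gsubmodule G M B" by (rule comp_mult_gsubmodule[OF less.prems(1)])
  have finB: "finite B" using gB fin finite_subset by (auto simp: gsubmodule_iff)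
  have smaller: "card A < card B" if "covers G M A B" for A
    using that finB by (auto simp: covers_def intro: psubset_card_mono)
  from less.prems(1) show ?case
  proof cases
    case zero
    from less.prems(2) show ?thesis
      by cases (use zero no_cover_zero in auto)
  next
    case (step A a)
    note stA = step
    from less.prems(2) show ?thesis
    proof cases
      case zero
      then show ?thesis using step no_cover_zero by auto
    next
      case (step A' a')
      show ?thesis
      proof (cases "A = A'")
        case True
        then show ?thesis using less.hyps[OF smaller[OF stA(3)] stA(2)] step stA by auto
      next
        case False
        have g: "gsubmodule G M A" "gsubmodule G M A'" using stA(3) step(3) by (auto simp: covers_def)
        note d = covers_diamond[OF stA(3) step(3) False] covers_diamond[OF step(3) stA(3) False[symmetric]]
        obtain c where c: "comp_mult G M S (A \<inter> A') c"
          using comp_mult_exists[OF fin gsubmodule_Int[OF g]] by blast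
        have c': "comp_mult G M S (A' \<inter> A) c" using c by (simp add: Int_commute)
        \<comment> \<open>The induction hypothesis for A, applied to its given series and to the one
          passing through the intersection.\<close>
        have "a = c + (if factor_of G M S (A' \<inter> A) A then 1 else 0)"
          by (rule less.hyps[OF smaller[OF stA(3)] stA(2) comp_mult.step[OF c' d(3)]])
        moreover have "a' = c + (if factor_of G M S (A \<inter> A') A' then 1 else 0)"
          by (rule less.hyps[OF smaller[OF step(3)] step(2) comp_mult.step[OF c d(1)]])
        moreover have "factor_of G M S A B \<longleftrightarrow> factor_of G M S (A \<inter> A') A'"
          using factor_of_diamond[OF gm g] d(2) by simp
        moreover have "factor_of G M S A' B \<longleftrightarrow> factor_of G M S (A' \<inter> A) A"
          using factor_of_diamond[OF gm g(2,1)] d(4) by simp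
        ultimately show ?thesis using stA(1) step(1) by simp
      qed
    qed
  qed
qed

end

section \<open>Additivity of multiplicities in exact sequences\<close>

lemma image_vimage_surj: "U \<subseteq> q ` A \<Longrightarrow> q ` {v \<in> A. q v \<in> U} = U"
  by blast

text \<open>A homomorphism changes no factor V / U as long as its kernel inside V lies in U. The
  condition on the kernel covers both uses: an injective map, and preimages under a surjective
  one.\<close>

lemma factor_of_image:
  assumes gm: "group_module G M" "group_module G N" "group_module G S"
    and q: "q \<in> gmodule_hom G M N" and U: "gsubmodule G M U" and V: "gsubmodule G M V" and UV: "U \<subseteq> V"
    and ker: "\<And>v. v \<in> V \<Longrightarrow> q v = \<zero>\<^bsub>N\<^esub> \<Longrightarrow> v \<in> U"
  shows "factor_of G M S U V \<longleftrightarrow> factor_of G N S (q ` U) (q ` V)"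
proof
  interpret M: group_module G M by fact
  interpret N: group_module G N by fact
  interpret S: group_module G S by fact
  have VM: "V \<subseteq> carrier M" using V by (auto simp: M.gsubmodule_iff)
  have gV: "group_module G (M\<lparr>carrier := V\<rparr>)" by (rule M.group_module_submodule[OF V])
  have gqV: "gsubmodule G N (q ` V)" by (rule gsubmodule_image[OF gm(1,2) q V])
  have qV: "q \<in> gmodule_hom G (M\<lparr>carrier := V\<rparr>) (N\<lparr>carrier := q ` V\<rparr>)"
    by (rule gmodule_hom_restrict[OF q VM]) simp
  {
    assume "factor_of G M S U V"
    then obtain h where h: "h \<in> gmodule_hom G (M\<lparr>carrier := V\<rparr>) S" "h ` V = carrier S"
      "{v \<in> V. h v = \<zero>\<^bsub>S\<^esub>} = U" by (auto simp: factor_of_def)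
    obtain k where k: "k \<in> gmodule_hom G (N\<lparr>carrier := q ` V\<rparr>) S" "\<And>v. v \<in> V \<Longrightarrow> k (q v) = h v"
      using gmodule_hom_factor[OF gV N.group_module_submodule[OF gqV] gm(3) qV _ h(1)] ker h(3) by auto
    have "k ` q ` V = carrier S" using k(2) h(2) by (simp add: image_image)
    moreover have "{w \<in> q ` V. k w = \<zero>\<^bsub>S\<^esub>} = q ` U" using k(2) h(3) by auto
    ultimately show "factor_of G N S (q ` U) (q ` V)" using k(1) by (auto simp: factor_of_def)
  }
  {
    assume "factor_of G N S (q ` U) (q ` V)"
    then obtain h where h: "h \<in> gmodule_hom G (N\<lparr>carrier := q ` V\<rparr>) S" "h ` q ` V = carrier S"
      "{v \<in> q ` V. h v = \<zero>\<^bsub>S\<^esub>} = q ` U" by (auto simp: factor_of_def)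
    have "h \<circ> q \<in> gmodule_hom G (M\<lparr>carrier := V\<rparr>) S" by (rule gmodule_hom_comp[OF qV h(1)])
    moreover have "(h \<circ> q) ` V = carrier S" using h(2) by (simp add: image_comp)
    moreover have "{v \<in> V. (h \<circ> q) v = \<zero>\<^bsub>S\<^esub>} = U"
    proof (intro equalityI subsetI)
      fix v assume "v \<in> {v \<in> V. (h \<circ> q) v = \<zero>\<^bsub>S\<^esub>}"
      then have v: "v \<in> V" "q v \<in> q ` U" using h(3) by auto
      then obtain u where u: "u \<in> U" "q v = q u" by auto
      have c: "v \<in> carrier M" "u \<in> carrier M" using v u UV VM by auto
      have "v \<ominus>\<^bsub>M\<^esub> u = v \<oplus>\<^bsub>M\<^esub> (-1) \<odot>\<^bsub>M\<^esub> u" using c by (simp add: a_minus_def M.minus_one_smult)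
      also have "\<dots> \<in> V" using V v u UV by (auto simp: M.gsubmodule_iff)
      finally have "v \<ominus>\<^bsub>M\<^esub> u \<in> V" .
      moreover have "q (v \<ominus>\<^bsub>M\<^esub> u) = \<zero>\<^bsub>N\<^esub>"
        using gmodule_hom_diff[OF gm(1,2) q c] u gmodule_homD(1)[OF q c(2)] by simp
      ultimately have "v \<ominus>\<^bsub>M\<^esub> u \<in> U" by (rule ker)
      then have "(v \<ominus>\<^bsub>M\<^esub> u) \<oplus>\<^bsub>M\<^esub> u \<in> U" using U u by (auto simp: M.gsubmodule_iff)
      then show "v \<in> U" using c by (simp add: a_minus_def M.M.a_assoc M.M.l_neg)
    qed (use h(3) UV in auto)
    ultimately show "factor_of G M S U V" unfolding factor_of_def by blast
  }
qed

lemma kernel_image_mem: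
  assumes gm: "group_module G M" "group_module G N" and q: "q \<in> gmodule_hom G M N"
    and U: "gsubmodule G M U" and v: "v \<in> carrier M" "q v \<in> q ` U"
    and ker: "\<And>w. w \<in> carrier M \<Longrightarrow> q w = \<zero>\<^bsub>N\<^esub> \<Longrightarrow> w \<in> U"
  shows "v \<in> U"
proof -
  interpret M: group_module G M by fact
  interpret N: group_module G N by fact
  obtain u where u: "u \<in> U" "q v = q u" using v(2) by auto
  have c: "u \<in> carrier M" using u U by (auto simp: M.gsubmodule_iff)
  have "q (v \<ominus>\<^bsub>M\<^esub> u) = \<zero>\<^bsub>N\<^esub>"
    using gmodule_hom_diff[OF gm q v(1) c] u gmodule_homD(1)[OF q c] by simp
  then have "v \<ominus>\<^bsub>M\<^esub> u \<in> U" using v c by (intro ker) auto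
  then have "(v \<ominus>\<^bsub>M\<^esub> u) \<oplus>\<^bsub>M\<^esub> u \<in> U" using U u by (auto simp: M.gsubmodule_iff)
  then show ?thesis using v c by (simp add: a_minus_def M.M.a_assoc M.M.l_neg)
qed

lemma covers_inj_image:
  assumes gm: "group_module G M" "group_module G N" and q: "q \<in> gmodule_hom G M N"
    and inj: "inj_on q (carrier M)" and cov: "covers G M U V"
  shows "covers G N (q ` U) (q ` V)"
proof -
  interpret M: group_module G M by fact
  interpret N: group_module G N by fact
  have UV: "gsubmodule G M U" "gsubmodule G M V" "U \<subset> V" using cov by (auto simp: covers_def)
  have sub: "U \<subseteq> carrier M" "V \<subseteq> carrier M" using UV by (auto simp: M.gsubmodule_iff)
  show ?thesis unfolding covers_def
  proof (intro conjI allI impI)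
    show "gsubmodule G N (q ` U)" "gsubmodule G N (q ` V)"
      using UV by (auto intro: gsubmodule_image[OF gm q])
    have "q ` U \<noteq> q ` V" using inj_on_image_eq_iff[OF inj sub] UV by auto
    then show "q ` U \<subset> q ` V" using UV by auto
    fix W assume W: "gsubmodule G N W" "q ` U \<subseteq> W" "W \<subseteq> q ` V"
    define W' where "W' = {v \<in> carrier M. q v \<in> W} \<inter> V"
    have "gsubmodule G M W'" unfolding W'_def
      by (intro M.gsubmodule_Int gsubmodule_vimage[OF gm q W(1)] UV)
    moreover have "U \<subseteq> W'" "W' \<subseteq> V" using W UV sub by (auto simp: W'_def)
    ultimately have "W' = U \<or> W' = V" using cov by (auto simp: covers_def)
    moreover have "W = q ` W'" using W(3) sub unfolding W'_def by blast
    ultimately show "W = q ` U \<or> W = q ` V" by auto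
  qed
qed

text \<open>Submodules that contain the kernel of a surjection correspond to submodules of the
  target, and this correspondence respects inclusion. \<open>kernel_image_mem\<close> shows that
  such a submodule is the preimage of its image.\<close>

lemma covers_vimage:
  assumes gm: "group_module G M" "group_module G N" and q: "q \<in> gmodule_hom G M N"
    and surj: "q ` carrier M = carrier N" and cov: "covers G N U V"
  shows "covers G M {v \<in> carrier M. q v \<in> U} {v \<in> carrier M. q v \<in> V}"
proof -
  interpret M: group_module G M by fact
  interpret N: group_module G N by fact
  have UV: "gsubmodule G N U" "gsubmodule G N V" "U \<subset> V" using cov by (auto simp: covers_def)
  have sub: "U \<subseteq> carrier N" "V \<subseteq> carrier N" using UV by (auto simp: N.gsubmodule_iff)
  have img: "q ` {v \<in> carrier M. q v \<in> A} = A" if "A \<subseteq> carrier N" for A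
    using that surj by (intro image_vimage_surj) simp
  show ?thesis unfolding covers_def
  proof (intro conjI allI impI)
    show "gsubmodule G M {v \<in> carrier M. q v \<in> U}" "gsubmodule G M {v \<in> carrier M. q v \<in> V}"
      using UV by (auto intro: gsubmodule_vimage[OF gm q])
    have "{v \<in> carrier M. q v \<in> U} \<noteq> {v \<in> carrier M. q v \<in> V}"
      using img[OF sub(1)] img[OF sub(2)] UV(3) by (metis less_irrefl)
    then show "{v \<in> carrier M. q v \<in> U} \<subset> {v \<in> carrier M. q v \<in> V}" using UV(3) by blast
    fix W assume W: "gsubmodule G M W" "{v \<in> carrier M. q v \<in> U} \<subseteq> W" "W \<subseteq> {v \<in> carrier M. q v \<in> V}"
    have WM: "W \<subseteq> carrier M" using W(1) by (auto simp: M.gsubmodule_iff)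
    have z: "\<zero>\<^bsub>N\<^esub> \<in> U" using UV by (auto simp: N.gsubmodule_iff)
    have "gsubmodule G N (q ` W)" by (rule gsubmodule_image[OF gm q W(1)])
    moreover have "U \<subseteq> q ` W" using image_mono[OF W(2), of q] unfolding img[OF sub(1)] .
    moreover have "q ` W \<subseteq> V" using W(3) by auto
    ultimately have "q ` W = U \<or> q ` W = V" using cov by (auto simp: covers_def)
    moreover have "W = {v \<in> carrier M. q v \<in> q ` W}"
    proof (intro equalityI subsetI)
      fix v assume v: "v \<in> {v \<in> carrier M. q v \<in> q ` W}"
      have kW: "w \<in> W" if "w \<in> carrier M" "q w = \<zero>\<^bsub>N\<^esub>" for w
      proof -
        have "q w \<in> U" using that z by simp
        then show ?thesis using that(1) W(2) by blast
      qed
      have "v \<in> carrier M" "q v \<in> q ` W" using v by simp_all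
      then show "v \<in> W" by (rule kernel_image_mem[OF gm q W(1) _ _ kW])
    qed (use WM in blast)
    then have W_eq: "W = {v \<in> carrier M. q v \<in> Z}" if "q ` W = Z" for Z unfolding that .
    ultimately show "W = {v \<in> carrier M. q v \<in> U} \<or> W = {v \<in> carrier M. q v \<in> V}"
      by (elim disjE) (rule disjI1[OF W_eq], assumption, rule disjI2[OF W_eq], assumption)
  qed
qed

text \<open>A composition series of B is made by concatenation: the image of a series of A climbs to
  the kernel of p, and the preimages of a series of C continue from there to B.\<close>

lemma comp_mult_exact:
  assumes gm: "group_module G A" "group_module G B" "group_module G C" "group_module G S"
    and ex: "short_exact G A B C i p"
    and k: "comp_mult G A S (carrier A) k" and l: "comp_mult G C S (carrier C) l"
  shows "comp_mult G B S (carrier B) (k + l)"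
proof -
  interpret A: group_module G A by fact
  interpret B: group_module G B by fact
  interpret C: group_module G C by fact
  have i: "i \<in> gmodule_hom G A B" "inj_on i (carrier A)" and p: "p \<in> gmodule_hom G B C" "p ` carrier B = carrier C"
    and img: "i ` carrier A = {v \<in> carrier B. p v = \<zero>\<^bsub>C\<^esub>}" using ex by (auto simp: short_exact_def)
  have i0: "v = \<zero>\<^bsub>A\<^esub>" if "v \<in> carrier A" "i v = \<zero>\<^bsub>B\<^esub>" for v
    using gmodule_hom_inj_iff[OF gm(1,2) i(1)] i(2) that by blast
  have "comp_mult G B S (i ` U) k" if "comp_mult G A S U k" for U k
    using that
  proof induction
    case zero
    then show ?case using gmodule_hom_zero[OF gm(1,2) i(1)] comp_mult.zero[of G B S] by simp
  next
    case (step U k V)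
    have UV: "gsubmodule G A U" "gsubmodule G A V" "U \<subseteq> V" using step by (auto simp: covers_def)
    have "factor_of G A S U V \<longleftrightarrow> factor_of G B S (i ` U) (i ` V)"
      by (rule factor_of_image[OF gm(1,2,4) i(1) UV]) (use i0 UV in \<open>auto simp: A.gsubmodule_iff subset_iff\<close>)
    then show ?case
      using comp_mult.step[OF step.IH covers_inj_image[OF gm(1,2) i step.hyps(2)]] by simp
  qed
  from this[OF k] have ker: "comp_mult G B S {v \<in> carrier B. p v = \<zero>\<^bsub>C\<^esub>} k" unfolding img .
  have "comp_mult G B S {v \<in> carrier B. p v \<in> U} (k + l)" if "comp_mult G C S U l" for U l
    using that
  proof induction
    case zero
    then show ?case using ker by simp
  next
    case (step U l V)
    have UV: "gsubmodule G C U" "gsubmodule G C V" "U \<subseteq> V" using step by (auto simp: covers_def)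
    have im: "p ` {v \<in> carrier B. p v \<in> W} = W" if "W \<subseteq> carrier C" for W
      using that p(2) by (intro image_vimage_surj) simp
    have "factor_of G B S {v \<in> carrier B. p v \<in> U} {v \<in> carrier B. p v \<in> V} \<longleftrightarrow>
      factor_of G C S (p ` {v \<in> carrier B. p v \<in> U}) (p ` {v \<in> carrier B. p v \<in> V})"
      by (rule factor_of_image[OF gm(2,3,4) p(1)])
        (use UV gsubmodule_vimage[OF gm(2,3) p(1)] in \<open>auto simp: C.gsubmodule_iff\<close>)
    also have "\<dots> \<longleftrightarrow> factor_of G C S U V"
      using UV by (subst (1 2) im) (auto simp: C.gsubmodule_iff)
    finally show ?case
      using comp_mult.step[OF step.IH covers_vimage[OF gm(2,3) p step.hyps(2)]]
      by (simp add: add.assoc split del: if_split)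
  qed
  from this[OF l] have "comp_mult G B S {v \<in> carrier B. p v \<in> carrier C} (k + l)" .
  moreover have "{v \<in> carrier B. p v \<in> carrier C} = carrier B" using p(2) by auto
  ultimately show ?thesis by simp
qed

lemma gsimple_isomorphic:
  assumes M: "gsimple G M" and N: "group_module G N" and iso: "gmodule_isomorphic G M N"
  shows "gsimple G N"
proof -
  interpret M: group_module G M using M by (simp add: gsimple_def)
  interpret N: group_module G N by fact
  obtain h where h: "h \<in> gmodule_hom G M N" "bij_betw h (carrier M) (carrier N)"
    using iso by (auto simp: gmodule_isomorphic_def)
  note gm = M.group_module_axioms N
  have h0: "h \<zero>\<^bsub>M\<^esub> = \<zero>\<^bsub>N\<^esub>" by (rule gmodule_hom_zero[OF gm h(1)])
  have inj: "inj_on h (carrier M)" and surj: "h ` carrier M = carrier N" using h(2) by (auto simp: bij_betw_def)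
  show ?thesis unfolding gsimple_def
  proof (intro conjI allI impI N)
    show "carrier N \<noteq> {\<zero>\<^bsub>N\<^esub>}"
    proof
      assume "carrier N = {\<zero>\<^bsub>N\<^esub>}"
      then have "h ` carrier M = h ` {\<zero>\<^bsub>M\<^esub>}" using surj h0 by simp
      then have "carrier M = {\<zero>\<^bsub>M\<^esub>}" using inj_on_image_eq_iff[OF inj, of "carrier M" "{\<zero>\<^bsub>M\<^esub>}"] by simp
      then show False using M by (simp add: gsimple_def)
    qed
    fix U assume U: "gsubmodule G N U"
    let ?V = "{v \<in> carrier M. h v \<in> U}"
    have "gsubmodule G M ?V" by (rule gsubmodule_vimage[OF gm h(1) U])
    then have "?V = {\<zero>\<^bsub>M\<^esub>} \<or> ?V = carrier M" using M by (auto simp: gsimple_def)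
    moreover have "h ` ?V = U" using U surj by (intro image_vimage_surj) (simp add: N.gsubmodule_iff)
    ultimately show "U = {\<zero>\<^bsub>N\<^esub>} \<or> U = carrier N" using h0 surj by auto
  qed
qed

lemma factor_of_whole:
  assumes gm: "group_module G M" "group_module G S"
  shows "factor_of G M S {\<zero>\<^bsub>M\<^esub>} (carrier M) \<longleftrightarrow> gmodule_isomorphic G M S"
proof -
  interpret M: group_module G M by fact
  have "(h ` carrier M = carrier S \<and> {v \<in> carrier M. h v = \<zero>\<^bsub>S\<^esub>} = {\<zero>\<^bsub>M\<^esub>}) \<longleftrightarrow> bij_betw h (carrier M) (carrier S)"
    if h: "h \<in> gmodule_hom G M S" for h
    using gmodule_hom_inj_iff[OF gm h] gmodule_hom_zero[OF gm h] by (auto simp: bij_betw_def)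
  then show ?thesis by (auto simp: factor_of_def gmodule_isomorphic_def)
qed

lemma comp_mult_simple:
  assumes M: "gsimple G M" and S: "group_module G S"
  shows "comp_mult G M S (carrier M) (if gmodule_isomorphic G M S then 1 else 0)"
proof -
  interpret M: group_module G M using M by (simp add: gsimple_def)
  have "covers G M {\<zero>\<^bsub>M\<^esub>} (carrier M)"
    using M M.gsubmodule_carrier M.gsubmodule_zero by (auto simp: covers_def gsimple_def)
  from comp_mult.step[OF comp_mult.zero this, of S] show ?thesis
    by (simp add: factor_of_whole[OF M.group_module_axioms S])
qed

text \<open>The multiplicity of S is well defined by Jordan-Hoelder and additive on exact sequences,
  so it descends to the Grothendieck group. These functionals are what separates classes of simple
  modules.\<close>

lemma (in finite_group) simple_functional:
  fixes S :: "('a::{field,finite}, 'w, 'g) gmodule"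
  assumes S: "group_module G S"
  obtains m :: "_ \<Rightarrow> int" where "\<And>u v. u \<in> carrier (K0 TYPE('a) G) \<Longrightarrow> v \<in> carrier (K0 TYPE('a) G) \<Longrightarrow>
      m (u \<oplus>\<^bsub>K0 TYPE('a) G\<^esub> v) = m u + m v"
    "\<And>M :: ('a, 'v, 'g) gmodule. fg_module G M \<Longrightarrow> gsimple G M \<Longrightarrow>
      m (K0_class G M) = (if gmodule_isomorphic G M S then 1 else 0)"
proof -
  define \<mu> :: "('a, nat, 'g) gmodule \<Rightarrow> nat" where "\<mu> M = (THE k. comp_mult G M S (carrier M) k)" for M
  have \<mu>_eq: "\<mu> M = k" if "fg_module G M" "comp_mult G M S (carrier M) k" for M k
    unfolding \<mu>_def using that group_module.comp_mult_unique[of G M S] S by (intro the_equality) (auto simp: fg_iff)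
  have \<mu>: "comp_mult G M S (carrier M) (\<mu> M)" if M: "fg_module G M" for M
  proof -
    interpret M: group_module G M using M by (simp add: fg_iff)
    show ?thesis using M.comp_mult_exists[OF _ M.gsubmodule_carrier, of S] \<mu>_eq[OF M] M by (auto simp: fg_iff)
  qed
  have "int (\<mu> B) = int (\<mu> A) + int (\<mu> C)"
    if fg: "fg_module G A" "fg_module G B" "fg_module G C" and ex: "short_exact G A B C i p" for A B C i p
    using comp_mult_exact[OF _ _ _ S ex \<mu>[OF fg(1)] \<mu>[OF fg(3)]] fg by (simp add: \<mu>_eq fg_iff)
  then obtain m where m: "\<And>u v. u \<in> carrier (K0 TYPE('a) G) \<Longrightarrow> v \<in> carrier (K0 TYPE('a) G) \<Longrightarrow>
      m (u \<oplus>\<^bsub>K0 TYPE('a) G\<^esub> v) = m u + m v"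
    "\<And>M. fg_module G M \<Longrightarrow> m (K0_class G M) = int (\<mu> M)"
    using K0_functional[of "\<lambda>M. int (\<mu> M)"] by metis
  have "m (K0_class G M) = (if gmodule_isomorphic G M S then 1 else 0)"
    if M: "fg_module G M" "gsimple G M" for M :: "('a, 'v, 'g) gmodule"
  proof -
    note c = nat_copy_props[OF M(1)]
    have gm: "group_module G M" "group_module G (nat_copy G M)" using M c by (auto simp: fg_iff)
    have iff: "gmodule_isomorphic G (nat_copy G M) S \<longleftrightarrow> gmodule_isomorphic G M S"
      using gmodule_isomorphic_trans[OF c(2)] gmodule_isomorphic_trans[OF gmodule_isomorphic_sym[OF gm(1) c(2)]] by blast
    have "m (K0_class G M) = int (\<mu> (nat_copy G M))"
      using K0_class_isomorphic[OF M(1) c] m(2)[OF c(1)] by simp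
    also have "\<mu> (nat_copy G M) = (if gmodule_isomorphic G (nat_copy G M) S then 1 else 0)"
      by (rule \<mu>_eq[OF c(1) comp_mult_simple[OF gsimple_isomorphic[OF M(2) gm(2) c(2)] S]])
    finally show ?thesis by (simp add: iff)
  qed
  then show thesis using that m(1) by blast
qed


section \<open>The Grothendieck ring of \<open>SL2\<close>\<close>

lemma group_SL2: "group (SL2 :: ('a::field ^ 2 ^ 2) monoid)"
proof (rule groupI)
  fix A :: "'a ^ 2 ^ 2" assume "A \<in> carrier SL2"
  then have A: "det A = 1" by (simp add: SL2_def)
  then have "invertible A" by (simp add: invertible_det_nz)
  then obtain B where B: "A ** B = mat 1" "B ** A = mat 1" by (auto simp: invertible_def)
  have "det (B ** A) = 1" by (simp add: B)
  then have "det B = 1" using A by (simp add: det_mul)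
  then show "\<exists>B\<in>carrier SL2. B \<otimes>\<^bsub>SL2\<^esub> A = \<one>\<^bsub>SL2\<^esub>" using B by (auto simp: SL2_def)
qed (simp_all add: SL2_def det_mul matrix_mul_assoc)

interpretation SL2: finite_group "SL2 :: ('a::{field,finite} ^ 2 ^ 2) monoid"
  by (intro finite_group.intro finite_group_axioms.intro group_SL2) simp

text \<open>A type for the elements of the Grothendieck ring, so that integer polynomials can be
  evaluated with type-class arithmetic and the simplifier works with ring terms.\<close>

typedef (overloaded) ('a::"{field,finite}") k0 = "carrier (K0 TYPE('a) (SL2 :: ('a ^ 2 ^ 2) monoid))"
  using abelian_monoid.zero_closed[OF abelian_group.axioms(1)[OF ring.axioms(1)[OF cring.axioms(1)[OF SL2.cring_K0]]]]
  by blast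

abbreviation k0_ring :: "'a::{field,finite} itself \<Rightarrow> (('a, nat, 'a ^ 2 ^ 2) gmodule \<Rightarrow>\<^sub>0 int) set ring"
  where "k0_ring T \<equiv> K0 T (SL2 :: ('a ^ 2 ^ 2) monoid)"

lemma gsimple_trivial:
  assumes "group G" shows "gsimple G (trivial_module :: ('a::field, 'a, 'g) gmodule)"
proof -
  have gm: "group_module G (trivial_module :: ('a, 'a, 'g) gmodule)" by (rule group_module_trivial[OF assms])
  interpret group_module G "trivial_module :: ('a, 'a, 'g) gmodule" by (rule gm)
  show ?thesis unfolding gsimple_def
  proof (intro conjI allI impI gm)
    have "(UNIV :: 'a set) \<noteq> {0}" by (metis UNIV_I one_neq_zero singletonD)
    then show "carrier (trivial_module :: ('a, 'a, 'g) gmodule) \<noteq> {\<zero>\<^bsub>(trivial_module :: ('a, 'a, 'g) gmodule)\<^esub>}"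
      by (simp add: trivial_module_def)
    fix N assume N: "gsubmodule G (trivial_module :: ('a, 'a, 'g) gmodule) N"
    have z: "0 \<in> N" "\<And>c v. v \<in> N \<Longrightarrow> c * v \<in> N"
      using N[unfolded gsubmodule_iff] by (simp_all add: trivial_module_def)
    show "N = {\<zero>\<^bsub>(trivial_module :: ('a, 'a, 'g) gmodule)\<^esub>} \<or> N = carrier (trivial_module :: ('a, 'a, 'g) gmodule)"
    proof (cases "N = {0}")
      case False
      then obtain v where v: "v \<in> N" "v \<noteq> 0" using z(1) by auto
      then have "w \<in> N" for w using z(2)[OF v(1), of "w / v"] by simp
      then show ?thesis by (auto simp: trivial_module_def)
    qed (simp add: trivial_module_def)
  qed
qed

instantiation k0 :: ("{field,finite}") comm_ring_1
begin

definition zero_k0 :: "'a k0" where "0 = Abs_k0 \<zero>\<^bsub>k0_ring TYPE('a)\<^esub>"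
definition one_k0 :: "'a k0" where "1 = Abs_k0 \<one>\<^bsub>k0_ring TYPE('a)\<^esub>"
definition plus_k0 :: "'a k0 \<Rightarrow> 'a k0 \<Rightarrow> 'a k0" where "u + v = Abs_k0 (Rep_k0 u \<oplus>\<^bsub>k0_ring TYPE('a)\<^esub> Rep_k0 v)"
definition times_k0 :: "'a k0 \<Rightarrow> 'a k0 \<Rightarrow> 'a k0" where "u * v = Abs_k0 (Rep_k0 u \<otimes>\<^bsub>k0_ring TYPE('a)\<^esub> Rep_k0 v)"
definition uminus_k0 :: "'a k0 \<Rightarrow> 'a k0" where "- u = Abs_k0 (\<ominus>\<^bsub>k0_ring TYPE('a)\<^esub> Rep_k0 u)"
definition minus_k0 :: "'a k0 \<Rightarrow> 'a k0 \<Rightarrow> 'a k0" where "u - v = Abs_k0 (Rep_k0 u \<ominus>\<^bsub>k0_ring TYPE('a)\<^esub> Rep_k0 v)"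

instance
proof -
  interpret K: cring "k0_ring TYPE('a)" by (rule SL2.cring_K0)
  note defs = zero_k0_def one_k0_def plus_k0_def times_k0_def uminus_k0_def minus_k0_def
  note [simp] = Rep_k0 Abs_k0_inverse Rep_k0_inverse
  show "OFCLASS('a k0, comm_ring_1_class)"
  proof
    fix a b c :: "'a k0"
    show "a + b + c = a + (b + c)" by (simp add: defs K.a_assoc)
    show "a + b = b + a" by (simp add: defs K.a_comm)
    show "0 + a = a" by (simp add: defs)
    show "- a + a = 0" by (simp add: defs K.l_neg)
    show "a - b = a + - b" by (simp add: defs a_minus_def)
    show "a * b * c = a * (b * c)" by (simp add: defs K.m_assoc)
    show "a * b = b * a" by (simp add: defs K.m_comm)
    show "1 * a = a" by (simp add: defs)
    show "(a + b) * c = a * c + b * c" by (simp add: defs K.l_distr)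
    \<comment> \<open>Nontriviality needs an invariant: the multiplicity of the trivial module is 0
      on the zero class and 1 on the unit.\<close>
    show "(0 :: 'a k0) \<noteq> 1"
    proof
      let ?T = "trivial_module :: ('a, 'a, 'a ^ 2 ^ 2) gmodule"
      have triv: "group_module SL2 ?T" by (rule group_module_trivial[OF group_SL2])
      assume "(0 :: 'a k0) = 1"
      then have eq: "\<zero>\<^bsub>k0_ring TYPE('a)\<^esub> = K0_class SL2 ?T"
        by (simp add: defs Abs_k0_inject SL2.K0_class_trivial[where 'a = 'a, symmetric])
      obtain m :: "_ \<Rightarrow> int" where m: "\<And>u v. u \<in> carrier (k0_ring TYPE('a)) \<Longrightarrow> v \<in> carrier (k0_ring TYPE('a)) \<Longrightarrow>
          m (u \<oplus>\<^bsub>k0_ring TYPE('a)\<^esub> v) = m u + m v"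
        "\<And>M :: ('a, 'a, 'a ^ 2 ^ 2) gmodule. fg_module SL2 M \<Longrightarrow> gsimple SL2 M \<Longrightarrow>
          m (K0_class SL2 M) = (if gmodule_isomorphic SL2 M ?T then 1 else 0)"
        by (rule SL2.simple_functional[OF triv]) (rule that)
      have "m \<zero>\<^bsub>k0_ring TYPE('a)\<^esub> = 0" using m(1)[OF K.zero_closed K.zero_closed] by simp
      moreover have "m (K0_class SL2 ?T) = 1"
        using m(2)[OF SL2.fg_trivial gsimple_trivial[OF group_SL2]] gmodule_isomorphic_refl by auto
      ultimately show False using eq by simp
    qed
  qed
qed

end

section \<open>Classes as elements of a commutative ring type\<close>

definition cl :: "('a::{field,finite}, 'v, 'a ^ 2 ^ 2) gmodule \<Rightarrow> 'a k0"
  where "cl M = Abs_k0 (K0_class SL2 M)"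

lemma Rep_cl: "fg_module SL2 M \<Longrightarrow> Rep_k0 (cl M) = K0_class SL2 M"
  by (simp add: cl_def Abs_k0_inverse SL2.K0_class_closed)

lemma cl_exact:
  assumes "fg_module SL2 A" "fg_module SL2 B" "fg_module SL2 C" "short_exact SL2 A B C i p"
  shows "cl B = cl A + cl C"
  unfolding plus_k0_def using assms by (simp add: Rep_cl SL2.K0_class_exact[OF assms]) (simp add: cl_def SL2.K0_class_exact[OF assms])

lemma cl_isomorphic:
  "fg_module SL2 M \<Longrightarrow> fg_module SL2 N \<Longrightarrow> gmodule_isomorphic SL2 M N \<Longrightarrow> cl M = cl N"
  unfolding cl_def by (subst SL2.K0_class_isomorphic) auto

lemma cl_tensor:
  "fg_module SL2 M \<Longrightarrow> fg_module SL2 N \<Longrightarrow> cl (tensor M N) = cl M * cl N"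
  unfolding times_k0_def by (simp add: Rep_cl flip: SL2.K0_class_tensor) (simp add: cl_def)

lemma cl_trivial: "cl (trivial_module :: ('a::{field,finite}, 'a, 'a ^ 2 ^ 2) gmodule) = 1"
  by (simp add: cl_def one_k0_def SL2.K0_class_trivial[where 'a = 'a])

lemma k0_induct [case_names zero simple diff]:
  fixes u :: "'a::{field,finite} k0"
  assumes zero: "P 0"
    and simple: "\<And>M :: ('a, nat, 'a ^ 2 ^ 2) gmodule. fg_module SL2 M \<Longrightarrow> gsimple SL2 M \<Longrightarrow> P (cl M)"
    and diff: "\<And>u v. P u \<Longrightarrow> P v \<Longrightarrow> P (u - v)"
  shows "P u"
proof -
  have "P (Abs_k0 x)" if "x \<in> carrier (k0_ring TYPE('a))" for x
    using that
  proof (induction rule: SL2.K0_induct)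
    case zero then show ?case using assms(1) by (simp add: zero_k0_def)
  next
    case (simple M) then show ?case using assms(2) by (simp add: cl_def)
  next
    case (diff u v) then show ?case using assms(3)[of "Abs_k0 u" "Abs_k0 v"] by (simp add: minus_k0_def Abs_k0_inverse)
  qed
  from this[OF Rep_k0] show ?thesis by (simp add: Rep_k0_inverse)
qed

lemma cl_functional:
  fixes S :: "('a::{field,finite}, 'w, 'a ^ 2 ^ 2) gmodule"
  assumes S: "group_module SL2 S"
  obtains m :: "'a k0 \<Rightarrow> int" where "\<And>u v. m (u + v) = m u + m v"
    "\<And>M :: ('a, 'v, 'a ^ 2 ^ 2) gmodule. fg_module SL2 M \<Longrightarrow> gsimple SL2 M \<Longrightarrow>
      m (cl M) = (if gmodule_isomorphic SL2 M S then 1 else 0)"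
proof -
  obtain m :: "_ \<Rightarrow> int" where m: "\<And>u v. u \<in> carrier (k0_ring TYPE('a)) \<Longrightarrow> v \<in> carrier (k0_ring TYPE('a)) \<Longrightarrow>
      m (u \<oplus>\<^bsub>k0_ring TYPE('a)\<^esub> v) = m u + m v"
    "\<And>M :: ('a, 'v, 'a ^ 2 ^ 2) gmodule. fg_module SL2 M \<Longrightarrow> gsimple SL2 M \<Longrightarrow>
      m (K0_class SL2 M) = (if gmodule_isomorphic SL2 M S then 1 else 0)"
    by (rule SL2.simple_functional[OF S]) (rule that)
  interpret K: cring "k0_ring TYPE('a)" by (rule SL2.cring_K0)
  show thesis
    by (rule that[of "m \<circ> Rep_k0"]) (simp_all add: plus_k0_def Abs_k0_inverse Rep_k0 m Rep_cl)
qed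


section \<open>Chebyshev polynomials\<close>

definition evalz :: "int poly \<Rightarrow> 'r::comm_ring_1 \<Rightarrow> 'r"
  where "evalz f u = poly (map_poly of_int f) u"

lemma evalz_0 [simp]: "evalz 0 u = 0"
  by (simp add: evalz_def)

lemma evalz_pCons [simp]: "evalz (pCons a f) u = of_int a + u * evalz f u"
  by (cases "a = 0 \<and> f = 0") (auto simp: evalz_def map_poly_pCons)

lemma evalz_1 [simp]: "evalz 1 u = 1"
  by (simp add: one_pCons)

lemma evalz_add [simp]: "evalz (f + g) u = evalz f u + evalz g u"
  by (induction f g rule: poly_induct2) (simp_all add: algebra_simps)

lemma evalz_smult [simp]: "evalz (smult c f) u = of_int c * evalz f u"
  by (induction f) (simp_all add: algebra_simps)

lemma evalz_uminus [simp]: "evalz (- f) u = - evalz f u"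
  by (induction f) (simp_all add: algebra_simps)

lemma evalz_diff [simp]: "evalz (f - g) u = evalz f u - evalz g u"
  using evalz_add[of f "- g" u] by simp

lemma evalz_mult [simp]: "evalz (f * g) u = evalz f u * evalz g u"
  by (induction f) (simp_all add: algebra_simps)

lemma evalz_sum: "evalz (sum F A) u = (\<Sum>i\<in>A. evalz (F i) u)"
  by (induction A rule: infinite_finite_induct) auto

lemma evalz_pcompose [simp]: "evalz (pcompose f g) u = evalz f (evalz g u)"
  by (induction f) (simp_all add: pcompose_pCons)

text \<open>With x = t + 1/t this is t^n + t^(n-2) + ... + t^(-n), the character of the n-th
  symmetric power on a diagonal matrix with entries t and 1/t. The recursion is the Clebsch-Gordan
  rule.\<close>

fun cheb :: "nat \<Rightarrow> int poly" where
  "cheb 0 = 1"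
| "cheb (Suc 0) = [:0, 1:]"
| "cheb (Suc (Suc n)) = [:0, 1:] * cheb (Suc n) - cheb n"

lemma coeff_cheb_eq_0: "n < k \<or> odd (n + k) \<Longrightarrow> coeff (cheb n) k = 0"
proof (induction n arbitrary: k rule: cheb.induct)
  case 1 then show ?case by (cases k) auto
next
  case 2 then show ?case by (cases k rule: nat.exhaust; cases "k - 1" rule: nat.exhaust) (auto simp: coeff_pCons split: nat.splits)
next
  case (3 n)
  show ?case
  proof (cases k)
    case 0 then show ?thesis using 3(2)[of 0] 3(3) by simp
  next
    case (Suc l) then show ?thesis using 3(1)[of l] 3(2)[of "Suc l"] 3(3) by auto
  qed
qed

text \<open>Writing the index as k + 2 j builds in the parity of the nonzero coefficients, and the
  recursion of \<open>cheb\<close> turns into Pascal's rule.\<close>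

lemma coeff_cheb: "coeff (cheb (k + 2 * j)) k = (-1) ^ j * int ((k + j) choose j)"
proof (induction "k + 2 * j" arbitrary: k j rule: cheb.induct)
  case 1 then show ?case by simp
next
  case 2
  then have "k = 1" "j = 0" by auto
  then show ?case by simp
next
  case (3 n)
  show ?case
  proof (cases k)
    case 0
    then obtain i where i: "j = Suc i" "n = 2 * i" using 3(3) by (cases j) auto
    have "coeff (cheb (Suc (Suc n))) 0 = - coeff (cheb (0 + 2 * i)) 0" by (simp add: i)
    also have "\<dots> = (-1) ^ j * int ((0 + j) choose j)" using 3(2)[of 0 i] i by simp
    finally show ?thesis using 0 3(3) by simp
  next
    case (Suc l)
    have 1: "coeff (cheb (Suc n)) l = (-1) ^ j * int ((l + j) choose j)"
      using 3(1)[of l j] 3(3) Suc by simp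
    have eq: "coeff (cheb (Suc (Suc n))) k = coeff (cheb (Suc n)) l - coeff (cheb n) k" by (simp add: Suc)
    show ?thesis unfolding 3(3)[symmetric] eq
    proof (cases j)
      case 0
      then have "coeff (cheb n) k = 0" using 3(3) Suc by (intro coeff_cheb_eq_0) auto
      then show "coeff (cheb (Suc n)) l - coeff (cheb n) k = (- 1) ^ j * int ((k + j) choose j)"
        using 1 0 by simp
    next
      case (Suc i)
      then have 2: "coeff (cheb n) k = (-1) ^ i * int ((k + i) choose i)"
        using 3(2)[of k i] 3(3) by simp
      have "(k + j) choose j = ((l + j) choose j) + ((k + i) choose i)"
        using Suc \<open>k = Suc l\<close> by simp
      then show "coeff (cheb (Suc n)) l - coeff (cheb n) k = (- 1) ^ j * int ((k + j) choose j)"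
        unfolding 1 2 by (simp add: Suc algebra_simps del: binomial_Suc_Suc)
    qed
  qed
qed

lemma coeff_f_poly:
  assumes "p > 0"
  shows "coeff (f_poly p) k = (if k \<le> p \<and> even (p + k) then f_coeff p ((p - k) div 2) else 0)"
proof -
  have "coeff (f_poly p) k = (\<Sum>j = 0..p div 2. if p - 2 * j = k then f_coeff p j else 0)"
    by (simp add: f_poly_def coeff_sum coeff_monom)
  also have "\<dots> = (\<Sum>j = 0..p div 2. if j = (p - k) div 2 \<and> k \<le> p \<and> even (p + k) then f_coeff p j else 0)"
  proof (rule sum.cong)
    fix j assume "j \<in> {0..p div 2}"
    then have j: "2 * j \<le> p" by auto
    have "p - 2 * j = k \<longleftrightarrow> j = (p - k) div 2 \<and> k \<le> p \<and> even (p + k)"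
    proof
      assume "p - 2 * j = k"
      then have "p = k + 2 * j" using j by simp
      then show "j = (p - k) div 2 \<and> k \<le> p \<and> even (p + k)" by simp
    next
      assume a: "j = (p - k) div 2 \<and> k \<le> p \<and> even (p + k)"
      then have "even (p - k)" by simp
      then have "2 * j = p - k" using a by simp
      then show "p - 2 * j = k" using a by simp
    qed
    then show "(if p - 2 * j = k then f_coeff p j else 0) =
      (if j = (p - k) div 2 \<and> k \<le> p \<and> even (p + k) then f_coeff p j else 0)" by simp
  qed simp
  also have "\<dots> = (if k \<le> p \<and> even (p + k) then f_coeff p ((p - k) div 2) else 0)"
  proof (cases "k \<le> p \<and> even (p + k)")
    case True
    moreover have "(p - k) div 2 \<le> p div 2" by (rule div_le_mono) simp
    ultimately show ?thesis by (simp add: sum.delta')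
  qed (auto intro!: sum.neutral)
  finally show ?thesis .
qed

text \<open>Split p as (p - j) + j and absorb j into the binomial: j C(p-j, j) = (p-j) C(p-j-1,
  j-1). Division by p - j leaves a sum of two binomials, up to sign the coefficients of two
  Chebyshev polynomials.\<close>

lemma f_coeff_Suc:
  assumes "p = k + 2 * Suc i"
  shows "f_coeff p (Suc i) = (-1) ^ Suc i * (int ((k + Suc i) choose Suc i) + int ((k + i) choose i))"
proof -
  have pi: "p - Suc i = k + Suc i" using assms by simp
  have "p * ((k + Suc i) choose Suc i) =
    (k + Suc i) * ((k + Suc i) choose Suc i) + Suc i * ((k + Suc i) choose Suc i)"
    by (simp add: assms algebra_simps)
  also have "Suc i * ((k + Suc i) choose Suc i) = (k + Suc i) * ((k + i) choose i)"
    using Suc_times_binomial_eq[of "k + i" i] by (simp add: mult.commute)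
  finally have "p * ((k + Suc i) choose Suc i) = (k + Suc i) * (((k + Suc i) choose Suc i) + ((k + i) choose i))"
    by (simp add: algebra_simps)
  then have "p * ((k + Suc i) choose Suc i) div (k + Suc i) = ((k + Suc i) choose Suc i) + ((k + i) choose i)"
    by (simp only: nonzero_mult_div_cancel_left)
  then show ?thesis unfolding f_coeff_def pi by simp
qed

text \<open>In terms of x = t + 1/t the right-hand side is t^p + t^(-p), so f is the Dickson
  polynomial that carries the character of the standard module to that of its Frobenius
  twist.\<close>

lemma f_poly_cheb:
  assumes "p \<ge> 2" shows "f_poly p = cheb p - cheb (p - 2)"
proof (rule poly_eqI)
  fix k
  show "coeff (f_poly p) k = coeff (cheb p - cheb (p - 2)) k"
  proof (cases "k \<le> p \<and> even (p + k)")
    case False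
    then have "coeff (cheb p) k = 0" "coeff (cheb (p - 2)) k = 0"
      using assms by (auto intro!: coeff_cheb_eq_0)
    then show ?thesis using False assms by (auto simp: coeff_f_poly)
  next
    case True
    then have "even (p - k)" "p = k + (p - k)" by simp_all
    then obtain j where j: "p = k + 2 * j" by (metis evenE)
    have "coeff (f_poly p) k = f_coeff p ((p - k) div 2)" using True assms coeff_f_poly[of p k] by simp
    then have "coeff (f_poly p) k = f_coeff p j" by (simp add: j)
    also have "\<dots> = coeff (cheb p - cheb (p - 2)) k"
    proof (cases j)
      case 0
      then have "coeff (cheb (p - 2)) k = 0" using assms j by (intro coeff_cheb_eq_0) auto
      moreover have "coeff (cheb p) k = 1" using coeff_cheb[of k 0] j 0 by simp
      ultimately show ?thesis using assms 0 by (simp add: f_coeff_def)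
    next
      case (Suc i)
      have c1: "coeff (cheb p) k = (-1) ^ Suc i * int ((k + Suc i) choose Suc i)"
        unfolding j Suc by (rule coeff_cheb)
      have "p - 2 = k + 2 * i" using j Suc by simp
      then have c2: "coeff (cheb (p - 2)) k = (-1) ^ i * int ((k + i) choose i)"
        by (simp only: coeff_cheb)
      have c3: "f_coeff p j = (-1) ^ Suc i * (int ((k + Suc i) choose Suc i) + int ((k + i) choose i))"
        unfolding Suc by (rule f_coeff_Suc) (simp only: j Suc)
      show ?thesis unfolding coeff_diff c1 c2 c3 by (simp add: algebra_simps del: binomial_Suc_Suc)
    qed
    finally show ?thesis .
  qed
qed

lemma cheb_monic: "degree (cheb n) = n" "lead_coeff (cheb n) = 1"
proof -
  have 1: "coeff (cheb n) n = 1" using coeff_cheb[of n 0] by simp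
  show "degree (cheb n) = n"
    by (rule antisym) (auto intro!: degree_le le_degree coeff_cheb_eq_0 simp: 1)
  then show "lead_coeff (cheb n) = 1" using 1 by simp
qed

lemma f_poly_monic:
  assumes "p \<ge> 2" shows "degree (f_poly p) = p" "lead_coeff (f_poly p) = 1"
proof -
  have 1: "coeff (f_poly p) p = 1" using assms by (simp add: coeff_f_poly f_coeff_def)
  show "degree (f_poly p) = p"
    by (rule antisym) (use assms in \<open>auto intro!: degree_le le_degree simp: 1 coeff_f_poly\<close>)
  then show "lead_coeff (f_poly p) = 1" using 1 by simp
qed

lemma f_iter_Suc: "f_iter p (Suc n) = pcompose (f_poly p) (f_iter p n)"
  by (simp add: f_iter_def)

lemma f_iter_monic:
  assumes "p \<ge> 2" shows "degree (f_iter p n) = p ^ n" "lead_coeff (f_iter p n) = 1"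
proof -
  have "degree (f_iter p n) = p ^ n \<and> lead_coeff (f_iter p n) = 1"
  proof (induction n)
    case 0 then show ?case by (simp add: f_iter_def)
  next
    case (Suc n)
    have d: "degree (f_iter p n) = p ^ n" using Suc by simp
    have "coeff (f_iter p n) (p ^ n) = 1" using Suc by (simp flip: d)
    moreover have "degree (f_iter p n) > 0" using d assms by simp
    ultimately show ?case
      using Suc lead_coeff_comp[of "f_iter p n" "f_poly p"] f_poly_monic[OF assms]
      by (simp add: f_iter_Suc degree_pcompose)
  qed
  then show "degree (f_iter p n) = p ^ n" "lead_coeff (f_iter p n) = 1" by auto
qed

text \<open>If m has base p digits m_i, this is the product over i of \<open>cheb\<close> at m_i
  composed with the i-fold iterate of f, the polynomial shadow of Steinberg's tensor product
  theorem. The guard on \<open>p\<close> secures termination.\<close>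

function ebasis :: "nat \<Rightarrow> nat \<Rightarrow> int poly" where
  "ebasis p m = (if m = 0 \<or> p < 2 then 1 else cheb (m mod p) * pcompose (ebasis p (m div p)) (f_poly p))"
  by pat_completeness auto
termination by (relation "measure snd") (auto simp: div_less_dividend)

declare ebasis.simps [simp del]

lemma ebasis_monic:
  assumes "p \<ge> 2" shows "degree (ebasis p m) = m \<and> lead_coeff (ebasis p m) = 1"
proof (induction m rule: less_induct)
  case (less m)
  show ?case
  proof (cases "m = 0")
    case True then show ?thesis by (simp add: ebasis.simps)
  next
    case False
    let ?E = "ebasis p (m div p)"
    have IH: "degree ?E = m div p" "lead_coeff ?E = 1" using less[of "m div p"] False assms by auto
    have c: "lead_coeff (pcompose ?E (f_poly p)) = 1"
      using lead_coeff_comp[of "f_poly p" ?E] f_poly_monic[OF assms] IH assms by simp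
    have d: "degree (pcompose ?E (f_poly p)) = m div p * p"
      using IH f_poly_monic[OF assms] by (simp add: degree_pcompose)
    have nz: "cheb (m mod p) \<noteq> 0" "pcompose ?E (f_poly p) \<noteq> 0"
      using cheb_monic(2)[of "m mod p"] c by auto
    have "degree (ebasis p m) = m mod p + m div p * p"
      using False assms nz d cheb_monic(1) by (simp add: ebasis.simps[of p m] degree_mult_eq)
    moreover have "lead_coeff (ebasis p m) = 1"
      using False assms c cheb_monic(2)[of "m mod p"] by (simp add: ebasis.simps[of p m] lead_coeff_mult)
    ultimately show ?thesis by simp
  qed
qed

text \<open>There is one monic polynomial in each degree, so leading terms can be removed one at a
  time with integer coefficients.\<close>

lemma ebasis_expansion:
  assumes "p \<ge> 2" "degree f < n"
  shows "\<exists>c. f = (\<Sum>m<n. smult (c m) (ebasis p m))"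
  using assms(2)
proof (induction n arbitrary: f)
  case (Suc n)
  define g where "g = f - smult (coeff f n) (ebasis p n)"
  have f: "f = g + smult (coeff f n) (ebasis p n)" by (simp add: g_def)
  have E: "degree (ebasis p n) = n" "coeff (ebasis p n) n = 1" using ebasis_monic[OF assms(1), of n] by auto
  have gz: "coeff g k = 0" if "k \<ge> n" for k
    using that Suc.prems E coeff_eq_0[of f k] coeff_eq_0[of "ebasis p n" k] by (cases "k = n") (auto simp: g_def)
  show ?case
  proof (cases n)
    case 0
    then have "g = 0" using gz by (intro poly_eqI) simp
    then show ?thesis using 0 f by (intro exI[of _ "\<lambda>_. coeff f n"]) simp
  next
    case (Suc k)
    then have "degree g \<le> k" using gz by (intro degree_le) auto
    then obtain c where c: "g = (\<Sum>m<n. smult (c m) (ebasis p m))" using Suc.IH[of g] Suc by auto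
    have "(\<Sum>m<Suc n. smult ((c(n := coeff f n)) m) (ebasis p m)) = g + smult (coeff f n) (ebasis p n)"
      unfolding c by (auto intro!: sum.cong)
    then show ?thesis using f by metis
  qed
qed simp


section \<open>Binary forms\<close>

text \<open>The group moves the points and thereby acts on functions by precomposition. The values
  lie in a ring that may be larger than the field of scalars, which acts through
  \<open>\<iota>\<close>.\<close>

definition funmod :: "('g \<Rightarrow> 'y \<Rightarrow> 'y) \<Rightarrow> ('a::field \<Rightarrow> 'k::comm_ring_1) \<Rightarrow> ('y \<Rightarrow> 'k) set \<Rightarrow> ('a, 'y \<Rightarrow> 'k, 'g) gmodule"
  where "funmod \<rho> \<iota> V = \<lparr>carrier = V, mult = undefined, one = undefined, zero = (\<lambda>y. 0),
    add = (\<lambda>\<phi> \<psi> y. \<phi> y + \<psi> y), module.smult = (\<lambda>c \<phi> y. \<iota> c * \<phi> y), act = (\<lambda>g \<phi> y. \<phi> (\<rho> g y))\<rparr>"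

lemma funmod_simps [simp]:
  "carrier (funmod \<rho> \<iota> V) = V" "\<zero>\<^bsub>funmod \<rho> \<iota> V\<^esub> = (\<lambda>y. 0)"
  "\<phi> \<oplus>\<^bsub>funmod \<rho> \<iota> V\<^esub> \<psi> = (\<lambda>y. \<phi> y + \<psi> y)" "c \<odot>\<^bsub>funmod \<rho> \<iota> V\<^esub> \<phi> = (\<lambda>y. \<iota> c * \<phi> y)"
  "act (funmod \<rho> \<iota> V) g \<phi> = (\<lambda>y. \<phi> (\<rho> g y))"
  by (simp_all add: funmod_def)

text \<open>The points carry a right action, because precomposition reverses the order and the
  functions have to form a left module.\<close>

definition point_action :: "'g monoid \<Rightarrow> ('g \<Rightarrow> 'y \<Rightarrow> 'y) \<Rightarrow> bool"
  where "point_action G \<rho> \<longleftrightarrow> (\<forall>y. \<rho> \<one>\<^bsub>G\<^esub> y = y) \<and>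
    (\<forall>g\<in>carrier G. \<forall>h\<in>carrier G. \<forall>y. \<rho> (g \<otimes>\<^bsub>G\<^esub> h) y = \<rho> h (\<rho> g y))"

definition fun_subspace :: "('a::field \<Rightarrow> 'k::comm_ring_1) \<Rightarrow> ('y \<Rightarrow> 'k) set \<Rightarrow> bool"
  where "fun_subspace \<iota> V \<longleftrightarrow> (\<lambda>y. 0) \<in> V \<and> (\<forall>\<phi>\<in>V. \<forall>\<psi>\<in>V. (\<lambda>y. \<phi> y + \<psi> y) \<in> V) \<and>
    (\<forall>c. \<forall>\<phi>\<in>V. (\<lambda>y. \<iota> c * \<phi> y) \<in> V)"

lemma fun_subspaceD:
  assumes "fun_subspace \<iota> V"
  shows "(\<lambda>y. 0) \<in> V" "\<phi> \<in> V \<Longrightarrow> \<psi> \<in> V \<Longrightarrow> (\<lambda>y. \<phi> y + \<psi> y) \<in> V" "\<phi> \<in> V \<Longrightarrow> (\<lambda>y. \<iota> c * \<phi> y) \<in> V"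
  using assms by (auto simp: fun_subspace_def)

lemma fun_subspace_sum:
  assumes "fun_subspace \<iota> V" "\<And>i. i \<in> A \<Longrightarrow> F i \<in> V"
  shows "(\<lambda>y. \<Sum>i\<in>A. F i y) \<in> V"
  using assms(2)
proof (induction A rule: infinite_finite_induct)
  case (insert i A)
  then show ?case using fun_subspaceD(2)[OF assms(1), of "F i" "\<lambda>y. \<Sum>i\<in>A. F i y"] by simp
qed (simp_all add: fun_subspaceD(1)[OF assms(1)])

text \<open>Two embeddings occur: the identity of the finite field, and the constants in its
  polynomial ring. The second supplies infinitely many values, so that forms of any degree are
  determined as functions.\<close>

locale coeff_embedding =
  fixes \<iota> :: "'a::{field,finite} \<Rightarrow> 'k::idom"
  assumes \<iota>_add: "\<iota> (a + b) = \<iota> a + \<iota> b" and \<iota>_mult: "\<iota> (a * b) = \<iota> a * \<iota> b" and \<iota>_one [simp]: "\<iota> 1 = 1"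
begin

lemma \<iota>_zero [simp]: "\<iota> 0 = 0"
  using \<iota>_add[of 0 0] by (simp only: add_0 add_cancel_right_right)

lemma \<iota>_minus: "\<iota> (- a) = - \<iota> a"
  using \<iota>_add[of a "- a"] by (simp add: eq_neg_iff_add_eq_0 add.commute)

lemma \<iota>_diff: "\<iota> (a - b) = \<iota> a - \<iota> b"
  using \<iota>_add[of a "- b"] by (simp add: \<iota>_minus)

lemma \<iota>_eq_0_iff [simp]: "\<iota> a = 0 \<longleftrightarrow> a = 0"
proof
  assume "\<iota> a = 0"
  then have "\<iota> (a * inverse a) = 0" by (simp add: \<iota>_mult)
  then show "a = 0" by (cases "a = 0") auto
qed simp

lemma \<iota>_eq_iff [simp]: "\<iota> a = \<iota> b \<longleftrightarrow> a = b"
  using \<iota>_eq_0_iff[of "a - b"] by (simp add: \<iota>_diff)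

lemma \<iota>_power: "\<iota> (a ^ n) = \<iota> a ^ n"
  by (induction n) (simp_all add: \<iota>_mult)

lemma group_module_funmod:
  assumes "group G" "point_action G \<rho>" "fun_subspace \<iota> V"
    and "\<And>g \<phi>. g \<in> carrier G \<Longrightarrow> \<phi> \<in> V \<Longrightarrow> (\<lambda>y. \<phi> (\<rho> g y)) \<in> V"
  shows "group_module G (funmod \<rho> \<iota> V)"
  using assms
  by (intro group_moduleI) (simp_all add: fun_subspace_def point_action_def \<iota>_add \<iota>_mult algebra_simps)

lemma gsubmodule_funmod_iff:
  assumes "group_module G (funmod \<rho> \<iota> V)"
  shows "gsubmodule G (funmod \<rho> \<iota> V) U \<longleftrightarrow> U \<subseteq> V \<and> fun_subspace \<iota> U \<and>
    (\<forall>g\<in>carrier G. \<forall>\<phi>\<in>U. (\<lambda>y. \<phi> (\<rho> g y)) \<in> U)"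
  unfolding group_module.gsubmodule_iff[OF assms] by (auto simp: fun_subspace_def)

text \<open>A product of functions, pulled back along equivariant maps, realises a tensor product as soon
  as it has the right size.\<close>

lemma tensor_funmod:
  fixes \<rho> :: "'g \<Rightarrow> 'y \<Rightarrow> 'y" and \<rho>' :: "'g \<Rightarrow> 'z \<Rightarrow> 'z" and \<rho>'' :: "'g \<Rightarrow> 'w \<Rightarrow> 'w"
  assumes gm: "group_module G (funmod \<rho> \<iota> V)" "group_module G (funmod \<rho>' \<iota> V')" "group_module G (funmod \<rho>'' \<iota> W)"
    and fin: "finite V" "finite V'" and card: "card V = CARD('a) ^ m" "card W = card V' ^ m"
    and \<pi>: "\<And>g w. g \<in> carrier G \<Longrightarrow> \<pi> (\<rho>'' g w) = \<rho> g (\<pi> w)"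
      "\<And>g w. g \<in> carrier G \<Longrightarrow> \<pi>' (\<rho>'' g w) = \<rho>' g (\<pi>' w)"
    and prod: "\<And>\<phi> \<psi>. \<phi> \<in> V \<Longrightarrow> \<psi> \<in> V' \<Longrightarrow> (\<lambda>w. \<phi> (\<pi> w) * \<psi> (\<pi>' w)) \<in> W"
    and span: "\<And>U. fun_subspace \<iota> U \<Longrightarrow>
      (\<And>\<phi> \<psi>. \<phi> \<in> V \<Longrightarrow> \<psi> \<in> V' \<Longrightarrow> (\<lambda>w. \<phi> (\<pi> w) * \<psi> (\<pi>' w)) \<in> U) \<Longrightarrow> W \<subseteq> U"
  shows "gmodule_isomorphic G (tensor (funmod \<rho> \<iota> V) (funmod \<rho>' \<iota> V')) (funmod \<rho>'' \<iota> W)"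
proof (rule tensor_isomorphicI[OF gm])
  show "finite (carrier (funmod \<rho> \<iota> V))" "finite (carrier (funmod \<rho>' \<iota> V'))" using fin by simp_all
  show "bilinear_map G (funmod \<rho> \<iota> V) (funmod \<rho>' \<iota> V') (funmod \<rho>'' \<iota> W) (\<lambda>\<phi> \<psi> w. \<phi> (\<pi> w) * \<psi> (\<pi>' w))"
    unfolding bilinear_map_def using prod by (auto simp: algebra_simps \<pi>)
  show "card (carrier (tensor (funmod \<rho> \<iota> V) (funmod \<rho>' \<iota> V'))) \<le> card (carrier (funmod \<rho>'' \<iota> W))"
    using card_tensor(2)[OF gm(1,2), of m] fin card by simp
  fix U assume "gsubmodule G (funmod \<rho>'' \<iota> W) U"
    "\<And>\<phi> \<psi>. \<phi> \<in> carrier (funmod \<rho> \<iota> V) \<Longrightarrow> \<psi> \<in> carrier (funmod \<rho>' \<iota> V') \<Longrightarrow> (\<lambda>w. \<phi> (\<pi> w) * \<psi> (\<pi>' w)) \<in> U"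
  then show "carrier (funmod \<rho>'' \<iota> W) \<subseteq> U"
    unfolding gsubmodule_funmod_iff[OF gm(3)] using span[of U] by simp
qed

end

section \<open>Forms as homogenised polynomials\<close>

definition supp_polys :: "nat set \<Rightarrow> 'a::zero poly set"
  where "supp_polys D = {f. \<forall>a. a \<notin> D \<longrightarrow> coeff f a = 0}"

lemma supp_polys_atMost: "f \<in> supp_polys {..n} \<longleftrightarrow> degree f \<le> n"
  by (auto simp: supp_polys_def intro: degree_le coeff_eq_0)

lemma card_supp_polys:
  assumes "finite D"
  shows "finite (supp_polys D :: 'a::{comm_monoid_add,finite} poly set)"
    and "card (supp_polys D :: 'a poly set) = CARD('a) ^ card D"
proof -
  have bij: "bij_betw (\<lambda>c. \<Sum>a\<in>D. monom (c a) a) (PiE D (\<lambda>_. UNIV)) (supp_polys D :: 'a poly set)"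
    by (rule bij_betw_byWitness[where f' = "\<lambda>f. restrict (coeff f) D"])
      (use assms in \<open>auto simp: supp_polys_def coeff_sum coeff_monom sum.delta' fun_eq_iff PiE_def extensional_def
        intro!: poly_eqI sum.neutral\<close>)
  moreover have "finite (PiE D (\<lambda>_. UNIV :: 'a set))" using assms by (intro finite_PiE) auto
  moreover have "card (PiE D (\<lambda>_. UNIV :: 'a set)) = CARD('a) ^ card D" using assms by (simp add: card_PiE)
  ultimately show "finite (supp_polys D :: 'a poly set)" "card (supp_polys D :: 'a poly set) = CARD('a) ^ card D"
    using bij_betw_finite[OF bij] bij_betw_same_card[OF bij] by simp_all
qed

text \<open>More points than a polynomial of degree n can have roots: under this condition a form of
  degree n may be identified with a function.\<close>

definition large :: "'k itself \<Rightarrow> nat \<Rightarrow> bool"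
  where "large T n \<longleftrightarrow> infinite (UNIV :: 'k set) \<or> n < CARD('k)"

lemma large_mono: "large T n \<Longrightarrow> m \<le> n \<Longrightarrow> large T m"
  by (auto simp: large_def)

lemma poly_zero_large:
  fixes f :: "'k::idom poly"
  assumes "large TYPE('k) n" "degree f \<le> n" "\<And>x. poly f x = 0"
  shows "f = 0"
proof (rule ccontr)
  assume f: "f \<noteq> 0"
  then have "finite {x. poly f x = 0}" "card {x. poly f x = 0} \<le> degree f"
    by (auto simp: poly_roots_finite intro: card_poly_roots_bound)
  then show False using assms by (auto simp: large_def)
qed

definition rowact :: "('a \<Rightarrow> 'k) \<Rightarrow> 'a ^ 2 ^ 2 \<Rightarrow> 'k \<times> 'k \<Rightarrow> 'k::comm_ring_1 \<times> 'k"
  where "rowact \<iota> A v = (fst v * \<iota> (A $ 1 $ 1) + snd v * \<iota> (A $ 2 $ 1), fst v * \<iota> (A $ 1 $ 2) + snd v * \<iota> (A $ 2 $ 2))"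

text \<open>The homogenisation y^n f(x/y) with coefficients embedded by \<open>\<iota>\<close>.
  Forms are thus stored as polynomials in one variable, together with a degree that the polynomial
  does not reveal.\<close>

definition hom_poly :: "('a::zero \<Rightarrow> 'k::comm_ring_1) \<Rightarrow> nat \<Rightarrow> 'a poly \<Rightarrow> 'k \<times> 'k \<Rightarrow> 'k"
  where "hom_poly \<iota> n f v = (\<Sum>a\<le>n. \<iota> (coeff f a) * fst v ^ a * snd v ^ (n - a))"

definition forms :: "('a::zero \<Rightarrow> 'k::comm_ring_1) \<Rightarrow> nat \<Rightarrow> nat set \<Rightarrow> ('k \<times> 'k \<Rightarrow> 'k) set"
  where "forms \<iota> n D = hom_poly \<iota> n ` supp_polys D"

text \<open>Substitution of A into a form, dehomogenised: the two linear polynomials are the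
  coordinates of the row vector (x, 1) times A. That this is the action is
  \<open>hom_poly_rowact\<close>.\<close>

definition subst_poly :: "'a::comm_ring_1 ^ 2 ^ 2 \<Rightarrow> nat \<Rightarrow> 'a poly \<Rightarrow> 'a poly"
  where "subst_poly A n f =
    (\<Sum>a\<le>n. smult (coeff f a) ([:A $ 2 $ 1, A $ 1 $ 1:] ^ a * [:A $ 2 $ 2, A $ 1 $ 2:] ^ (n - a)))"

lemma degree_linear_power: "degree ([:b, a:] ^ n) \<le> n"
  using order_trans[OF degree_power_le, of "[:b, a:]" n n] by simp

lemma degree_subst_poly: "degree (subst_poly A n f) \<le> n"
  unfolding subst_poly_def
proof (rule degree_sum_le)
  fix a assume a: "a \<in> {..n}"
  have "degree ([:A $ 2 $ 1, A $ 1 $ 1:] ^ a * [:A $ 2 $ 2, A $ 1 $ 2:] ^ (n - a)) \<le> a + (n - a)"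
    by (rule order_trans[OF degree_mult_le add_mono[OF degree_linear_power degree_linear_power]])
  then show "degree (smult (coeff f a) ([:A $ 2 $ 1, A $ 1 $ 1:] ^ a * [:A $ 2 $ 2, A $ 1 $ 2:] ^ (n - a))) \<le> n"
    using a order_trans[OF degree_smult_le] by fastforce
qed simp

context coeff_embedding begin

lemma hom_poly_add: "hom_poly \<iota> n (f + g) v = hom_poly \<iota> n f v + hom_poly \<iota> n g v"
  by (simp add: hom_poly_def \<iota>_add sum.distrib algebra_simps)

lemma hom_poly_smult: "hom_poly \<iota> n (smult c f) v = \<iota> c * hom_poly \<iota> n f v"
  by (simp add: hom_poly_def \<iota>_mult sum_distrib_left algebra_simps)

lemma hom_poly_zero [simp]: "hom_poly \<iota> n 0 v = 0"
  by (simp add: hom_poly_def)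

lemma hom_poly_diff: "hom_poly \<iota> n (f - g) v = hom_poly \<iota> n f v - hom_poly \<iota> n g v"
  using hom_poly_add[of n "f - g" g v] by simp

lemma hom_poly_sum: "hom_poly \<iota> n (sum F A) v = (\<Sum>i\<in>A. hom_poly \<iota> n (F i) v)"
  by (induction A rule: infinite_finite_induct) (simp_all add: hom_poly_add)

lemma hom_poly_monom: "a \<le> n \<Longrightarrow> hom_poly \<iota> n (monom c a) v = \<iota> c * fst v ^ a * snd v ^ (n - a)"
proof -
  assume a: "a \<le> n"
  have "hom_poly \<iota> n (monom c a) v = (\<Sum>b\<le>n. if b = a then \<iota> c * fst v ^ a * snd v ^ (n - a) else 0)"
    unfolding hom_poly_def by (rule sum.cong) (auto simp: coeff_monom)
  then show ?thesis using a by (simp add: sum.delta')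
qed

lemma hom_poly_mult:
  assumes "degree f \<le> m" "degree g \<le> n"
  shows "hom_poly \<iota> (m + n) (f * g) v = hom_poly \<iota> m f v * hom_poly \<iota> n g v"
proof -
  have "f * g = (\<Sum>a\<le>m. \<Sum>b\<le>n. monom (coeff f a * coeff g b) (a + b))"
    by (subst (1) poly_as_sum_of_monoms'[OF assms(1), symmetric], subst (1) poly_as_sum_of_monoms'[OF assms(2), symmetric])
      (simp add: sum_product mult_monom)
  then have "hom_poly \<iota> (m + n) (f * g) v =
    (\<Sum>a\<le>m. \<Sum>b\<le>n. \<iota> (coeff f a * coeff g b) * fst v ^ (a + b) * snd v ^ (m + n - (a + b)))"
    by (simp add: hom_poly_sum hom_poly_monom)
  also have "\<dots> = (\<Sum>a\<le>m. \<Sum>b\<le>n. (\<iota> (coeff f a) * fst v ^ a * snd v ^ (m - a)) * (\<iota> (coeff g b) * fst v ^ b * snd v ^ (n - b)))"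
  proof (intro sum.cong refl)
    fix a b assume "a \<in> {..m}" "b \<in> {..n}"
    then have "m + n - (a + b) = (m - a) + (n - b)" by auto
    then show "\<iota> (coeff f a * coeff g b) * fst v ^ (a + b) * snd v ^ (m + n - (a + b)) =
      (\<iota> (coeff f a) * fst v ^ a * snd v ^ (m - a)) * (\<iota> (coeff g b) * fst v ^ b * snd v ^ (n - b))"
      by (simp add: \<iota>_mult power_add algebra_simps)
  qed
  also have "\<dots> = hom_poly \<iota> m f v * hom_poly \<iota> n g v" by (simp add: hom_poly_def sum_product)
  finally show ?thesis .
qed

lemma hom_poly_linear: "hom_poly \<iota> 1 [:b, a:] v = fst v * \<iota> a + snd v * \<iota> b"
  by (simp add: hom_poly_def algebra_simps)

lemma hom_poly_linear_power: "hom_poly \<iota> n ([:b, a:] ^ n) v = (fst v * \<iota> a + snd v * \<iota> b) ^ n"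
proof (induction n)
  case (Suc n)
  have "hom_poly \<iota> (1 + n) ([:b, a:] * [:b, a:] ^ n) v = hom_poly \<iota> 1 [:b, a:] v * hom_poly \<iota> n ([:b, a:] ^ n) v"
    by (rule hom_poly_mult) (auto intro: degree_linear_power)
  then show ?case using Suc hom_poly_linear by simp
qed (simp add: hom_poly_def)

lemma hom_poly_rowact: "hom_poly \<iota> n f (rowact \<iota> A v) = hom_poly \<iota> n (subst_poly A n f) v"
proof -
  have "hom_poly \<iota> n (subst_poly A n f) v =
    (\<Sum>a\<le>n. \<iota> (coeff f a) * hom_poly \<iota> (a + (n - a)) ([:A $ 2 $ 1, A $ 1 $ 1:] ^ a * [:A $ 2 $ 2, A $ 1 $ 2:] ^ (n - a)) v)"
    by (simp add: subst_poly_def hom_poly_sum hom_poly_smult)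
  also have "\<dots> = hom_poly \<iota> n f (rowact \<iota> A v)"
    unfolding hom_poly_def[of _ n f "rowact \<iota> A v"]
  proof (rule sum.cong)
    fix a assume "a \<in> {..n}"
    have "hom_poly \<iota> (a + (n - a)) ([:A $ 2 $ 1, A $ 1 $ 1:] ^ a * [:A $ 2 $ 2, A $ 1 $ 2:] ^ (n - a)) v =
      fst (rowact \<iota> A v) ^ a * snd (rowact \<iota> A v) ^ (n - a)"
      by (subst hom_poly_mult) (simp_all add: degree_linear_power hom_poly_linear_power rowact_def)
    then show "\<iota> (coeff f a) * hom_poly \<iota> (a + (n - a)) ([:A $ 2 $ 1, A $ 1 $ 1:] ^ a * [:A $ 2 $ 2, A $ 1 $ 2:] ^ (n - a)) v =
      \<iota> (coeff f a) * fst (rowact \<iota> A v) ^ a * snd (rowact \<iota> A v) ^ (n - a)"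
      by (simp only: mult.assoc)
  qed simp
  finally show ?thesis ..
qed

lemma degree_map_poly_embed: "degree f \<le> n \<Longrightarrow> degree (map_poly \<iota> f) \<le> n"
  by (rule degree_le) (auto simp: coeff_map_poly intro: coeff_eq_0)

lemma hom_poly_dehom: "degree f \<le> n \<Longrightarrow> hom_poly \<iota> n f (x, 1) = poly (map_poly \<iota> f) x"
  unfolding hom_poly_def poly_altdef using degree_map_poly_embed[of f n]
  by (intro sum.mono_neutral_cong_right) (auto simp: coeff_map_poly not_le intro: le_degree)

lemma hom_poly_inj:
  assumes "large TYPE('k) n" "degree f \<le> n" "degree g \<le> n" "\<And>x. hom_poly \<iota> n f (x, 1) = hom_poly \<iota> n g (x, 1)"
  shows "f = g"
proof -
  have d: "degree (map_poly \<iota> (f - g)) \<le> n" "degree (f - g) \<le> n"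
    using assms(2,3) by (auto intro: degree_diff_le degree_map_poly_embed)
  have "map_poly \<iota> (f - g) = 0"
  proof (rule poly_zero_large[OF assms(1) d(1)])
    show "poly (map_poly \<iota> (f - g)) x = 0" for x
      using assms(4)[of x] hom_poly_dehom[OF d(2), of x] by (simp add: hom_poly_diff)
  qed
  then have "\<iota> (coeff (f - g) a) = 0" for a by (metis coeff_0 coeff_map_poly \<iota>_zero)
  then show ?thesis by (auto intro: poly_eqI)
qed

lemma fun_subspace_forms: "fun_subspace \<iota> (forms \<iota> n D)"
  unfolding fun_subspace_def forms_def
proof (intro conjI ballI allI)
  have "(0 :: 'a poly) \<in> supp_polys D" by (simp add: supp_polys_def)
  then show "(\<lambda>y. 0) \<in> hom_poly \<iota> n ` supp_polys D" by (intro image_eqI[of _ _ 0]) auto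
next
  fix \<phi> \<psi> assume "\<phi> \<in> hom_poly \<iota> n ` supp_polys D" "\<psi> \<in> hom_poly \<iota> n ` supp_polys D"
  then obtain f g where "\<phi> = hom_poly \<iota> n f" "\<psi> = hom_poly \<iota> n g" "f \<in> supp_polys D" "g \<in> supp_polys D" by auto
  then show "(\<lambda>y. \<phi> y + \<psi> y) \<in> hom_poly \<iota> n ` supp_polys D"
    by (intro image_eqI[of _ _ "f + g"]) (auto simp: hom_poly_add supp_polys_def)
next
  fix c \<phi> assume "\<phi> \<in> hom_poly \<iota> n ` supp_polys D"
  then obtain f where "\<phi> = hom_poly \<iota> n f" "f \<in> supp_polys D" by auto
  then show "(\<lambda>y. \<iota> c * \<phi> y) \<in> hom_poly \<iota> n ` supp_polys D"
    by (intro image_eqI[of _ _ "smult c f"]) (auto simp: hom_poly_smult supp_polys_def)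
qed

lemma card_forms:
  assumes "D \<subseteq> {..n}" "large TYPE('k) n"
  shows "finite (forms \<iota> n D)" "card (forms \<iota> n D) = CARD('a) ^ card D"
proof -
  have fin: "finite D" using assms(1) finite_subset by blast
  then show "finite (forms \<iota> n D)" by (simp add: forms_def card_supp_polys)
  have "supp_polys D \<subseteq> (supp_polys {..n} :: 'a poly set)" using assms(1) by (auto simp: supp_polys_def)
  then have deg: "degree f \<le> n" if "f \<in> supp_polys D" for f :: "'a poly"
    using that supp_polys_atMost by blast
  have "inj_on (hom_poly \<iota> n) (supp_polys D)"
    by (rule inj_onI) (metis hom_poly_inj[OF assms(2)] deg)
  then show "card (forms \<iota> n D) = CARD('a) ^ card D"
    using fin by (simp add: forms_def card_image card_supp_polys)
qed

lemma forms_atMost: "\<phi> \<in> forms \<iota> n {..n} \<longleftrightarrow> (\<exists>f. degree f \<le> n \<and> \<phi> = hom_poly \<iota> n f)"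
  by (auto simp: forms_def image_iff supp_polys_atMost)

lemma forms_atMost_rowact:
  assumes "\<phi> \<in> forms \<iota> n {..n}" shows "(\<lambda>v. \<phi> (rowact \<iota> A v)) \<in> forms \<iota> n {..n}"
proof -
  obtain f where "\<phi> = hom_poly \<iota> n f" using assms unfolding forms_atMost by blast
  then show ?thesis unfolding forms_atMost
    by (intro exI[of _ "subst_poly A n f"]) (simp add: hom_poly_rowact degree_subst_poly)
qed

lemma point_action_rowact:
  assumes "\<sigma> \<in> hom (SL2 :: ('a ^ 2 ^ 2) monoid) (SL2 :: ('a ^ 2 ^ 2) monoid)"
  shows "point_action SL2 (\<lambda>A. rowact \<iota> (\<sigma> A))"
proof -
  interpret h: group_hom "SL2 :: ('a ^ 2 ^ 2) monoid" "SL2 :: ('a ^ 2 ^ 2) monoid" \<sigma>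
    using assms by (simp add: group_hom_def group_hom_axioms_def group_SL2)
  have mult: "rowact \<iota> (A ** B) v = rowact \<iota> B (rowact \<iota> A v)" for A B and v :: "'k \<times> 'k"
    by (simp add: rowact_def matrix_matrix_mult_def sum_2 \<iota>_add \<iota>_mult algebra_simps)
  have one: "rowact \<iota> (mat 1) v = v" for v :: "'k \<times> 'k" by (simp add: rowact_def mat_def)
  show ?thesis unfolding point_action_def
    using h.hom_one h.hom_mult mult one by (auto simp: SL2_def)
qed

end

section \<open>Modules of forms and their twists\<close>

lemma id_hom_SL2: "id \<in> hom (SL2 :: ('a::field ^ 2 ^ 2) monoid) SL2"
  by (auto simp: hom_def)

definition twist :: "('g \<Rightarrow> 'g) \<Rightarrow> ('a::field, 'v, 'g) gmodule \<Rightarrow> ('a, 'v, 'g) gmodule"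
  where "twist \<sigma> M = M\<lparr>act := (\<lambda>g. act M (\<sigma> g))\<rparr>"

definition Hmod :: "('a::field \<Rightarrow> 'k::comm_ring_1) \<Rightarrow> ('a ^ 2 ^ 2 \<Rightarrow> 'a ^ 2 ^ 2) \<Rightarrow> nat \<Rightarrow> ('a, 'k \<times> 'k \<Rightarrow> 'k, 'a ^ 2 ^ 2) gmodule"
  where "Hmod \<iota> \<sigma> n = funmod (\<lambda>A. rowact \<iota> (\<sigma> A)) \<iota> (forms \<iota> n {..n})"

lemma group_module_standard: "group_module SL2 (standard_module :: ('a::field, 'a ^ 2, 'a ^ 2 ^ 2) gmodule)"
  by (rule group_module_typeI[OF group_SL2])
    (simp_all add: standard_module_def SL2_def vec_eq_iff matrix_vector_mult_def matrix_matrix_mult_def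
      mat_def sum_2 forall_2 algebra_simps)

lemma group_module_twist:
  assumes "group_module G M" "\<sigma> \<in> hom G G" shows "group_module G (twist \<sigma> M)"
proof -
  interpret M: group_module G M by fact
  interpret h: group_hom G G \<sigma>
    using assms(2) by (simp add: group_hom_def group_hom_axioms_def M.is_group)
  show ?thesis
    by (rule group_moduleI)
      (simp_all add: twist_def M.is_group M.M.a_ac M.smult_add_left M.smult_add_right M.smult_mult
        M.act_closed M.act_add M.act_smult M.act_one M.act_mult)
qed

locale twisted_forms = coeff_embedding \<iota> for \<iota> :: "'a::{field,finite} \<Rightarrow> 'k::idom" +
  fixes \<sigma> :: "'a ^ 2 ^ 2 \<Rightarrow> 'a ^ 2 ^ 2"
  assumes \<sigma>_hom: "\<sigma> \<in> hom (SL2 :: ('a ^ 2 ^ 2) monoid) SL2"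
begin

abbreviation "H \<equiv> Hmod \<iota> \<sigma>"
abbreviation "F n \<equiv> forms \<iota> n {..n}"

lemma det_\<sigma>: "A \<in> carrier SL2 \<Longrightarrow> det (\<sigma> A) = 1"
  using hom_carrier[OF \<sigma>_hom] by (auto simp: SL2_def)

lemma group_module_H: "group_module SL2 (H n)"
  unfolding Hmod_def
  by (intro group_module_funmod group_SL2 point_action_rowact \<sigma>_hom fun_subspace_forms forms_atMost_rowact)

lemma fg_H: "fg_module SL2 (H n)"
  using group_module_H by (simp add: SL2.fg_iff) (simp add: Hmod_def forms_def card_supp_polys)

lemma carrier_H [simp]: "carrier (H n) = F n"
  by (simp add: Hmod_def)

lemma cl_H_0: "cl (H 0) = 1"
proof -
  have "gmodule_isomorphic SL2 (trivial_module :: ('a, 'a, 'a ^ 2 ^ 2) gmodule) (H 0)"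
  proof (rule gmodule_isomorphicI)
    show "(\<lambda>c v. \<iota> c) \<in> gmodule_hom SL2 (trivial_module :: ('a, 'a, 'a ^ 2 ^ 2) gmodule) (H 0)"
    proof (rule gmodule_homI)
      show "(\<lambda>v. \<iota> c) \<in> carrier (H 0)" for c
        unfolding carrier_H forms_atMost by (rule exI[of _ "[:c:]"]) (simp add: hom_poly_def fun_eq_iff)
    qed (simp_all add: trivial_module_def Hmod_def \<iota>_add \<iota>_mult)
    show "bij_betw (\<lambda>c (v :: 'k \<times> 'k). \<iota> c) (carrier (trivial_module :: ('a, 'a, 'a ^ 2 ^ 2) gmodule)) (carrier (H 0))"
    proof (rule bij_betw_imageI)
      show "inj_on (\<lambda>c (v :: 'k \<times> 'k). \<iota> c) (carrier (trivial_module :: ('a, 'a, 'a ^ 2 ^ 2) gmodule))"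
        by (rule inj_onI) (simp add: fun_eq_iff)
      show "(\<lambda>c (v :: 'k \<times> 'k). \<iota> c) ` carrier (trivial_module :: ('a, 'a, 'a ^ 2 ^ 2) gmodule) = carrier (H 0)"
      proof (intro equalityI subsetI)
        fix \<phi> assume "\<phi> \<in> carrier (H 0)"
        then obtain f where "degree f \<le> 0" "\<phi> = hom_poly \<iota> 0 f" unfolding carrier_H forms_atMost by blast
        then show "\<phi> \<in> (\<lambda>c v. \<iota> c) ` carrier (trivial_module :: ('a, 'a, 'a ^ 2 ^ 2) gmodule)"
          by (intro image_eqI[of _ _ "coeff f 0"]) (simp_all add: hom_poly_def fun_eq_iff trivial_module_def)
      next
        fix \<phi> assume "\<phi> \<in> (\<lambda>c (v :: 'k \<times> 'k). \<iota> c) ` carrier (trivial_module :: ('a, 'a, 'a ^ 2 ^ 2) gmodule)"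
        then obtain c where "\<phi> = (\<lambda>v. \<iota> c)" by auto
        then show "\<phi> \<in> carrier (H 0)"
          unfolding carrier_H forms_atMost by (intro exI[of _ "[:c:]"]) (simp add: hom_poly_def fun_eq_iff)
      qed
    qed
  qed
  from cl_isomorphic[OF SL2.fg_trivial fg_H this] show ?thesis by (simp add: cl_trivial)
qed

lemma F1: "\<phi> \<in> F 1 \<longleftrightarrow> (\<exists>a b. \<phi> = (\<lambda>v. fst v * \<iota> a + snd v * \<iota> b))"
proof
  assume "\<phi> \<in> F 1"
  then obtain f where f: "degree f \<le> 1" "\<phi> = hom_poly \<iota> 1 f" unfolding forms_atMost by blast
  then have "\<phi> = (\<lambda>v. fst v * \<iota> (coeff f 1) + snd v * \<iota> (coeff f 0))"
    by (simp add: fun_eq_iff hom_poly_def algebra_simps)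
  then show "\<exists>a b. \<phi> = (\<lambda>v. fst v * \<iota> a + snd v * \<iota> b)" by blast
next
  assume "\<exists>a b. \<phi> = (\<lambda>v. fst v * \<iota> a + snd v * \<iota> b)"
  then obtain a b where "\<phi> = (\<lambda>v. fst v * \<iota> a + snd v * \<iota> b)" by blast
  then have "\<phi> = hom_poly \<iota> 1 [:b, a:]" by (simp add: fun_eq_iff hom_poly_linear del: One_nat_def)
  then show "\<phi> \<in> F 1" unfolding forms_atMost by (intro exI[of _ "[:b, a:]"]) simp
qed

lemma fg_twist_standard: "fg_module SL2 (twist \<sigma> (standard_module :: ('a, 'a ^ 2, 'a ^ 2 ^ 2) gmodule))"
  using group_module_twist[OF group_module_standard \<sigma>_hom] by (simp add: SL2.fg_iff)

lemma cl_H_1: "cl (H 1) = cl (twist \<sigma> (standard_module :: ('a, 'a ^ 2, 'a ^ 2 ^ 2) gmodule))"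
proof -
  let ?S = "twist \<sigma> (standard_module :: ('a, 'a ^ 2, 'a ^ 2 ^ 2) gmodule)"
  let ?h = "\<lambda>(w :: 'a ^ 2) (v :: 'k \<times> 'k). fst v * \<iota> (w $ 1) + snd v * \<iota> (w $ 2)"
  have "gmodule_isomorphic SL2 ?S (H 1)"
  proof (rule gmodule_isomorphicI)
    show "?h \<in> gmodule_hom SL2 ?S (H 1)"
    proof (rule gmodule_homI)
      show "?h w \<in> carrier (H 1)" for w unfolding carrier_H F1 by blast
    qed (simp_all add: twist_def standard_module_def Hmod_def \<iota>_add \<iota>_mult matrix_vector_mult_def sum_2
          rowact_def algebra_simps)
    show "bij_betw ?h (carrier ?S) (carrier (H 1))"
    proof (rule bij_betw_imageI)
      show "inj_on ?h (carrier ?S)"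
      proof (rule inj_onI)
        fix u w assume eq: "?h u = ?h w"
        then have "?h u (1, 0) = ?h w (1, 0)" "?h u (0, 1) = ?h w (0, 1)" by metis+
        then show "u = w" by (simp add: vec_eq_iff forall_2)
      qed
      show "?h ` carrier ?S = carrier (H 1)"
      proof (intro equalityI subsetI)
        fix \<phi> assume "\<phi> \<in> carrier (H 1)"
        then obtain a b where "\<phi> = (\<lambda>v. fst v * \<iota> a + snd v * \<iota> b)" unfolding carrier_H F1 by blast
        then show "\<phi> \<in> ?h ` carrier ?S"
          by (intro image_eqI[of _ _ "vector [a, b]"]) (simp_all add: twist_def standard_module_def)
      next
        fix \<phi> assume "\<phi> \<in> ?h ` carrier ?S"
        then show "\<phi> \<in> carrier (H 1)" unfolding carrier_H F1 by blast
      qed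
    qed
  qed
  from cl_isomorphic[OF fg_twist_standard fg_H this] show ?thesis ..
qed

lemma F_mult_fst: "\<phi> \<in> F n \<Longrightarrow> (\<lambda>v. fst v * \<phi> v) \<in> F (Suc n)"
proof -
  assume "\<phi> \<in> F n"
  then obtain f where f: "degree f \<le> n" "\<phi> = hom_poly \<iota> n f" unfolding forms_atMost by blast
  have "(\<lambda>v. fst v * \<phi> v) = hom_poly \<iota> (1 + n) ([:0, 1:] * f)"
    using hom_poly_mult[of "[:0, 1:]" 1 f n] f by (simp add: fun_eq_iff hom_poly_linear del: One_nat_def)
  moreover have "degree ([:0, 1:] * f) \<le> Suc n" using f by (intro order_trans[OF degree_mult_le]) simp
  ultimately show ?thesis unfolding forms_atMost by (intro exI[of _ "[:0, 1:] * f"]) simp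
qed

lemma F_mult_snd: "\<phi> \<in> F n \<Longrightarrow> (\<lambda>v. snd v * \<phi> v) \<in> F (Suc n)"
proof -
  assume "\<phi> \<in> F n"
  then obtain f where f: "degree f \<le> n" "\<phi> = hom_poly \<iota> n f" unfolding forms_atMost by blast
  have "(\<lambda>v. snd v * \<phi> v) = hom_poly \<iota> (1 + n) ([:1, 0:] * f)"
    using hom_poly_mult[of "[:1, 0:]" 1 f n] hom_poly_linear[of 1 0] f by (simp add: fun_eq_iff del: One_nat_def)
  moreover have "degree ([:1, 0:] * f) \<le> Suc n" using f by simp
  ultimately show ?thesis unfolding forms_atMost by (intro exI[of _ "[:1, 0:] * f"]) simp
qed

lemma F_Suc_decompose:
  assumes "\<phi> \<in> F (Suc n)"
  obtains \<psi> \<theta> where "\<psi> \<in> F n" "\<theta> \<in> F n" "\<phi> = (\<lambda>v. fst v * \<psi> v + snd v * \<theta> v)"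
proof -
  obtain f where f: "degree f \<le> Suc n" "\<phi> = hom_poly \<iota> (Suc n) f" using assms unfolding forms_atMost by blast
  obtain c g where g: "f = pCons c g" by (cases f) auto
  have dg: "degree g \<le> n" using f g by (cases "g = 0") auto
  \<comment> \<open>As forms of degree 1 the factors \<open>[:0, 1:]\<close> and
    \<open>[:1, 0:]\<close> are x and y. The constant term c becomes c y^(n+1), a multiple of y, and
    all other terms are divisible by x.\<close>
  have "f = [:0, 1:] * g + [:1, 0:] * [:c:]" using g by simp
  then have "\<phi> v = hom_poly \<iota> (1 + n) ([:0, 1:] * g) v + hom_poly \<iota> (1 + n) ([:1, 0:] * [:c:]) v" for v
    using f hom_poly_add[of "1 + n"] by (metis plus_1_eq_Suc)
  also have "\<dots> v = fst v * hom_poly \<iota> n g v + snd v * hom_poly \<iota> n [:c:] v" for v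
    using hom_poly_mult[of "[:0, 1:]" 1 g n v] hom_poly_mult[of "[:1, 0:]" 1 "[:c:]" n v] dg
      hom_poly_linear[of 1 0 v] hom_poly_linear[of 0 1 v] by simp
  finally have "\<phi> = (\<lambda>v. fst v * hom_poly \<iota> n g v + snd v * hom_poly \<iota> n [:c:] v)" by (simp add: fun_eq_iff)
  moreover have "hom_poly \<iota> n g \<in> F n" "hom_poly \<iota> n [:c:] \<in> F n"
    using dg unfolding forms_atMost by (blast, intro exI[of _ "[:c:]"]) simp
  ultimately show thesis using that by blast
qed

lemma F_rowact: "\<phi> \<in> F n \<Longrightarrow> (\<lambda>v. \<phi> (rowact \<iota> A v)) \<in> F n"
  by (rule forms_atMost_rowact)

lemmas F_zero = fun_subspaceD(1)[OF fun_subspace_forms]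
lemmas F_add = fun_subspaceD(2)[OF fun_subspace_forms]
lemmas F_smult = fun_subspaceD(3)[OF fun_subspace_forms]

lemma F_uminus: "\<phi> \<in> F n \<Longrightarrow> (\<lambda>v. - \<phi> v) \<in> F n"
  using F_smult[of \<phi> n _ "-1"] by (simp add: \<iota>_minus)

lemma card_F: "large TYPE('k) n \<Longrightarrow> card (F n) = CARD('a) ^ Suc n"
  using card_forms(2)[of "{..n}" n] by simp

lemma finite_F: "finite (F n)"
  by (simp add: forms_def card_supp_polys)

text \<open>Forms of bidegree (1, n) in two points of the plane, the model by functions of the
  tensor product of \<open>H 1\<close> and \<open>H n\<close>.\<close>

definition bform :: "('k \<times> 'k \<Rightarrow> 'k) \<Rightarrow> ('k \<times> 'k \<Rightarrow> 'k) \<Rightarrow> ('k \<times> 'k) \<times> ('k \<times> 'k) \<Rightarrow> 'k"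
  where "bform \<phi> \<psi> z = fst (fst z) * \<phi> (snd z) + snd (fst z) * \<psi> (snd z)"

definition bforms :: "nat \<Rightarrow> (('k \<times> 'k) \<times> ('k \<times> 'k) \<Rightarrow> 'k) set"
  where "bforms n = (\<lambda>(\<phi>, \<psi>). bform \<phi> \<psi>) ` (F n \<times> F n)"

definition diagact :: "'a ^ 2 ^ 2 \<Rightarrow> ('k \<times> 'k) \<times> ('k \<times> 'k) \<Rightarrow> ('k \<times> 'k) \<times> ('k \<times> 'k)"
  where "diagact A z = (rowact \<iota> (\<sigma> A) (fst z), rowact \<iota> (\<sigma> A) (snd z))"

lemma bformsI: "\<phi> \<in> F n \<Longrightarrow> \<psi> \<in> F n \<Longrightarrow> \<Phi> = bform \<phi> \<psi> \<Longrightarrow> \<Phi> \<in> bforms n"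
  by (auto simp: bforms_def)

lemma bformsE:
  assumes "\<Phi> \<in> bforms n" obtains \<phi> \<psi> where "\<phi> \<in> F n" "\<psi> \<in> F n" "\<Phi> = bform \<phi> \<psi>"
  using assms by (auto simp: bforms_def)

lemma card_bforms: "card (bforms n) = card (F n) ^ 2" "finite (bforms n)"
proof -
  have "inj_on (\<lambda>(\<phi>, \<psi>). bform \<phi> \<psi>) (F n \<times> F n)"
  proof (intro inj_onI, clarify)
    fix \<phi> \<psi> \<phi>' \<psi>' assume eq: "bform \<phi> \<psi> = bform \<phi>' \<psi>'"
    have "bform \<phi> \<psi> ((1, 0), v) = bform \<phi>' \<psi>' ((1, 0), v)" "bform \<phi> \<psi> ((0, 1), v) = bform \<phi>' \<psi>' ((0, 1), v)" for v
      using eq by metis+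
    then show "\<phi> = \<phi>' \<and> \<psi> = \<psi>'" by (simp add: bform_def fun_eq_iff)
  qed
  then show "card (bforms n) = card (F n) ^ 2"
    by (simp add: bforms_def card_image card_cartesian_product power2_eq_square)
  show "finite (bforms n)" using finite_F by (simp add: bforms_def)
qed

lemma group_module_bforms: "group_module SL2 (funmod diagact \<iota> (bforms n))"
proof (rule group_module_funmod[OF group_SL2])
  show "point_action SL2 diagact"
    using point_action_rowact[OF \<sigma>_hom] by (simp add: point_action_def diagact_def)
  show "fun_subspace \<iota> (bforms n)" unfolding fun_subspace_def
  proof (intro conjI ballI allI)
    show "(\<lambda>y. 0) \<in> bforms n"
      by (rule bformsI[OF F_zero F_zero]) (simp add: bform_def fun_eq_iff)
  next
    fix \<Phi> \<Psi> assume "\<Phi> \<in> bforms n" "\<Psi> \<in> bforms n"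
    then obtain \<phi> \<psi> \<phi>' \<psi>' where "\<phi> \<in> F n" "\<psi> \<in> F n" "\<Phi> = bform \<phi> \<psi>" "\<phi>' \<in> F n" "\<psi>' \<in> F n" "\<Psi> = bform \<phi>' \<psi>'"
      by (metis bformsE)
    then show "(\<lambda>y. \<Phi> y + \<Psi> y) \<in> bforms n"
      by (intro bformsI[OF F_add[of \<phi> n _ \<phi>'] F_add[of \<psi> n _ \<psi>']]) (auto simp: bform_def fun_eq_iff algebra_simps)
  next
    fix c \<Phi> assume "\<Phi> \<in> bforms n"
    then obtain \<phi> \<psi> where "\<phi> \<in> F n" "\<psi> \<in> F n" "\<Phi> = bform \<phi> \<psi>" by (metis bformsE)
    then show "(\<lambda>y. \<iota> c * \<Phi> y) \<in> bforms n"
      by (intro bformsI[OF F_smult[of \<phi> n _ c] F_smult[of \<psi> n _ c]]) (auto simp: bform_def fun_eq_iff algebra_simps)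
  qed
  fix A \<Phi> assume "\<Phi> \<in> bforms n"
  then obtain \<phi> \<psi> where \<Phi>: "\<phi> \<in> F n" "\<psi> \<in> F n" "\<Phi> = bform \<phi> \<psi>" by (metis bformsE)
  let ?A = "\<sigma> A"
  let ?\<phi> = "\<lambda>v. \<phi> (rowact \<iota> ?A v)" and ?\<psi> = "\<lambda>v. \<psi> (rowact \<iota> ?A v)"
  have "?\<phi> \<in> F n" "?\<psi> \<in> F n" using \<Phi> by (auto intro: F_rowact)
  then have "(\<lambda>v. \<iota> (?A $ 1 $ 1) * ?\<phi> v + \<iota> (?A $ 1 $ 2) * ?\<psi> v) \<in> F n"
    "(\<lambda>v. \<iota> (?A $ 2 $ 1) * ?\<phi> v + \<iota> (?A $ 2 $ 2) * ?\<psi> v) \<in> F n"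
    by (auto intro!: F_add F_smult)
  then show "(\<lambda>z. \<Phi> (diagact A z)) \<in> bforms n"
    by (rule bformsI) (simp add: \<Phi> bform_def fun_eq_iff diagact_def, simp add: rowact_def algebra_simps)
qed

text \<open>The Clebsch-Gordan sequence: restriction of a bihomogeneous form to the diagonal, whose kernel
  consists of the multiples of the invariant symplectic form.\<close>

lemma cl_H_Suc:
  assumes large: "large TYPE('k) (Suc (Suc n))"
  shows "cl (H 1) * cl (H (Suc n)) = cl (H n) + cl (H (Suc (Suc n)))"
proof -
  let ?N = "Suc n"
  let ?W = "funmod diagact \<iota> (bforms ?N)"
  have fgW: "fg_module SL2 ?W" using group_module_bforms card_bforms(2) by (simp add: SL2.fg_iff)
  have "gmodule_isomorphic SL2 (tensor (H 1) (H ?N)) ?W"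
    unfolding Hmod_def
  proof (rule tensor_funmod[where m = 2 and \<pi> = fst and \<pi>' = snd])
    show "group_module SL2 (funmod (\<lambda>A. rowact \<iota> (\<sigma> A)) \<iota> (F 1))" "group_module SL2 (funmod (\<lambda>A. rowact \<iota> (\<sigma> A)) \<iota> (F ?N))"
      using group_module_H by (simp_all add: Hmod_def)
    show "card (F 1) = CARD('a) ^ 2" using card_F[OF large_mono[OF large, of 1]] by (simp add: numeral_2_eq_2)
    show "(\<lambda>w. \<phi> (fst w) * \<psi> (snd w)) \<in> bforms ?N" if \<phi>\<psi>: "\<phi> \<in> F 1" "\<psi> \<in> F ?N" for \<phi> \<psi>
    proof -
      obtain a b where "\<phi> = (\<lambda>v. fst v * \<iota> a + snd v * \<iota> b)" using \<phi>\<psi>(1) unfolding F1 by blast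
      then show ?thesis
        by (intro bformsI[OF F_smult[OF \<phi>\<psi>(2), of a] F_smult[OF \<phi>\<psi>(2), of b]])
          (simp add: bform_def fun_eq_iff algebra_simps)
    qed
    show "bforms ?N \<subseteq> U" if U: "fun_subspace \<iota> U"
      "\<And>\<phi> \<psi>. \<phi> \<in> F 1 \<Longrightarrow> \<psi> \<in> F ?N \<Longrightarrow> (\<lambda>w. \<phi> (fst w) * \<psi> (snd w)) \<in> U" for U
    proof
      fix \<Phi> assume "\<Phi> \<in> bforms ?N"
      then obtain \<phi> \<psi> where \<Phi>: "\<phi> \<in> F ?N" "\<psi> \<in> F ?N" "\<Phi> = bform \<phi> \<psi>" by (metis bformsE)
      have "(\<lambda>v. fst v * \<iota> 1 + snd v * \<iota> 0) \<in> F 1" "(\<lambda>v. fst v * \<iota> 0 + snd v * \<iota> 1) \<in> F 1"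
        unfolding F1 by blast+
      from fun_subspaceD(2)[OF U(1) U(2)[OF this(1) \<Phi>(1)] U(2)[OF this(2) \<Phi>(2)]]
      show "\<Phi> \<in> U" by (simp add: \<Phi>(3) bform_def[abs_def])
    qed
  qed (simp_all add: group_module_bforms finite_F card_bforms diagact_def)
  then have tensor: "cl (H 1) * cl (H ?N) = cl ?W"
    using cl_isomorphic[OF SL2.fg_tensor[OF fg_H fg_H] fgW] by (simp add: cl_tensor fg_H)
  \<comment> \<open>Multiplication by the symplectic form u_1 v_2 - u_2 v_1, which vanishes on the
    diagonal u = v.\<close>
  define i where "i = (\<lambda>\<theta> (z :: ('k \<times> 'k) \<times> ('k \<times> 'k)). (fst (fst z) * snd (snd z) - snd (fst z) * fst (snd z)) * \<theta> (snd z))"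
  define p where "p = (\<lambda>\<Phi> (v :: 'k \<times> 'k). \<Phi> (v, v) :: 'k)"
  have i_hom: "i \<in> gmodule_hom SL2 (H n) ?W"
  proof (rule gmodule_homI)
    fix \<theta> assume "\<theta> \<in> carrier (H n)"
    then have "(\<lambda>v. snd v * \<theta> v) \<in> F ?N" "(\<lambda>v. - (fst v * \<theta> v)) \<in> F ?N"
      by (auto intro: F_mult_fst F_mult_snd F_uminus)
    then show "i \<theta> \<in> carrier ?W" unfolding funmod_simps
      by (rule bformsI) (simp add: i_def bform_def fun_eq_iff algebra_simps)
  next
    fix A :: "'a ^ 2 ^ 2" and \<theta> assume A: "A \<in> carrier SL2" and "\<theta> \<in> carrier (H n)"
    have "\<iota> (\<sigma> A $ 1 $ 1) * \<iota> (\<sigma> A $ 2 $ 2) - \<iota> (\<sigma> A $ 1 $ 2) * \<iota> (\<sigma> A $ 2 $ 1) = 1"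
      using det_\<sigma>[OF A] by (simp add: det_2 flip: \<iota>_mult \<iota>_diff)
    \<comment> \<open>The transformed symplectic form is the old one times the determinant; the
      determinant identity is multiplied by an arbitrary factor so that it fits the expanded
      expression.\<close>
    then have "\<omega> * (\<iota> (\<sigma> A $ 1 $ 1) * \<iota> (\<sigma> A $ 2 $ 2) - \<iota> (\<sigma> A $ 1 $ 2) * \<iota> (\<sigma> A $ 2 $ 1)) = \<omega>" for \<omega> by simp
    then have "fst (rowact \<iota> (\<sigma> A) u) * snd (rowact \<iota> (\<sigma> A) v) - snd (rowact \<iota> (\<sigma> A) u) * fst (rowact \<iota> (\<sigma> A) v) =
      fst u * snd v - snd u * fst v" for u v :: "'k \<times> 'k"
      using \<open>\<And>\<omega>. \<omega> * (\<iota> (\<sigma> A $ 1 $ 1) * \<iota> (\<sigma> A $ 2 $ 2) - \<iota> (\<sigma> A $ 1 $ 2) * \<iota> (\<sigma> A $ 2 $ 1)) = \<omega>\<close>[of "fst u * snd v - snd u * fst v"]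
      by (simp add: rowact_def algebra_simps)
    then show "i (act (H n) A \<theta>) = act ?W A (i \<theta>)"
      by (simp add: i_def fun_eq_iff diagact_def Hmod_def)
  qed (simp_all add: i_def Hmod_def fun_eq_iff algebra_simps)
  have p_in: "p (bform \<phi> \<psi>) = (\<lambda>v. fst v * \<phi> v + snd v * \<psi> v)" for \<phi> \<psi> by (simp add: p_def bform_def fun_eq_iff)
  have p_hom: "p \<in> gmodule_hom SL2 ?W (H (Suc ?N))"
  proof (rule gmodule_homI)
    fix \<Phi> assume "\<Phi> \<in> carrier ?W"
    then obtain \<phi> \<psi> where "\<phi> \<in> F ?N" "\<psi> \<in> F ?N" "\<Phi> = bform \<phi> \<psi>" by (metis bformsE funmod_simps(1))
    then show "p \<Phi> \<in> carrier (H (Suc ?N))" by (auto simp: p_in intro: F_add F_mult_fst F_mult_snd)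
  qed (simp_all add: p_def diagact_def Hmod_def)
  have p_surj: "p ` carrier ?W = carrier (H (Suc ?N))"
  proof
    show "p ` carrier ?W \<subseteq> carrier (H (Suc ?N))" using gmodule_homD(1)[OF p_hom] by blast
    show "carrier (H (Suc ?N)) \<subseteq> p ` carrier ?W"
    proof
      fix \<phi> assume "\<phi> \<in> carrier (H (Suc ?N))"
      then have "\<phi> \<in> F (Suc ?N)" by simp
      then obtain \<psi> \<theta> where "\<psi> \<in> F ?N" "\<theta> \<in> F ?N" "\<phi> = (\<lambda>v. fst v * \<psi> v + snd v * \<theta> v)"
        by (rule F_Suc_decompose)
      then have "\<phi> = p (bform \<psi> \<theta>)" "bform \<psi> \<theta> \<in> carrier ?W" by (auto simp: p_in intro: bformsI)
      then show "\<phi> \<in> p ` carrier ?W" by (rule image_eqI)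
    qed
  qed
  have i_inj: "inj_on i (carrier (H n))"
  proof (rule inj_onI)
    fix \<theta> \<theta>' assume c: "\<theta> \<in> carrier (H n)" "\<theta>' \<in> carrier (H n)" "i \<theta> = i \<theta>'"
    then obtain f f' where f: "degree f \<le> n" "\<theta> = hom_poly \<iota> n f" "degree f' \<le> n" "\<theta>' = hom_poly \<iota> n f'"
      unfolding carrier_H forms_atMost by blast
    have "i \<theta> ((1, 0), (x, 1)) = i \<theta>' ((1, 0), (x, 1))" for x using c(3) by simp
    then have "f = f'"
      using f by (intro hom_poly_inj[OF large_mono[OF large, of n]]) (auto simp: i_def)
    then show "\<theta> = \<theta>'" using f by simp
  qed
  let ?K = "{\<Phi> \<in> carrier ?W. p \<Phi> = \<zero>\<^bsub>H (Suc ?N)\<^esub>}"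
  have sub: "i ` carrier (H n) \<subseteq> ?K"
    using gmodule_homD(1)[OF i_hom] by (auto simp: i_def p_def Hmod_def algebra_simps)
  have "card (carrier ?W) = card ?K * card (carrier (H (Suc ?N)))"
    by (rule card_hom[OF group_module_bforms group_module_H p_hom p_surj])
  \<comment> \<open>The dimensions satisfy 2 (n + 2) = (n + 1) + (n + 3), so the kernel has as many
    elements as \<open>H n\<close>.\<close>
  then have "CARD('a) ^ (Suc n) * CARD('a) ^ (Suc (Suc ?N)) = card ?K * CARD('a) ^ (Suc (Suc ?N))"
    using card_F[OF large] card_F[OF large_mono[OF large, of ?N]] card_bforms(1)[of ?N]
    by (simp add: power2_eq_square algebra_simps)
  then have "card ?K = CARD('a) ^ Suc n" by simp
  then have "card (i ` carrier (H n)) = card ?K"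
    using card_F[OF large_mono[OF large, of n]] unfolding card_image[OF i_inj] by simp
  moreover have "finite ?K" using card_bforms(2) by simp
  ultimately have "i ` carrier (H n) = ?K" using sub by (intro card_subset_eq)
  then have "short_exact SL2 (H n) ?W (H (Suc ?N)) i p"
    using i_hom p_hom i_inj p_surj by (simp add: short_exact_def)
  from cl_exact[OF fg_H fgW fg_H this] show ?thesis using tensor by simp
qed

lemma cl_H:
  "large TYPE('k) n \<Longrightarrow> cl (H n) = evalz (cheb n) (cl (twist \<sigma> (standard_module :: ('a, 'a ^ 2, 'a ^ 2 ^ 2) gmodule)))"
proof (induction n rule: cheb.induct)
  case 1 then show ?case by (simp add: cl_H_0)
next
  case 2 then show ?case using cl_H_1 by simp
next
  case (3 n)
  have "cl (H (Suc (Suc n))) = cl (H 1) * cl (H (Suc n)) - cl (H n)"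
    using cl_H_Suc[OF 3(3)] by simp
  then show ?case using 3 large_mono[OF 3(3)] cl_H_1 by simp
qed

end


section \<open>The Frobenius twist\<close>

text \<open>Translation by 1 permutes the field, so it leaves the sum of all elements unchanged
  while adding 1 to each of them.\<close>

lemma of_nat_CARD: "of_nat CARD('a::{field,finite}) = (0 :: 'a)"
proof -
  have "(\<Sum>x\<in>(UNIV :: 'a set). x + 1) = (\<Sum>x\<in>(UNIV :: 'a set). x)"
    by (rule sum.reindex_bij_witness[of _ "\<lambda>x. x - 1" "\<lambda>x. x + 1"]) auto
  then show ?thesis by (simp add: sum.distrib)
qed

lemma CHAR_field_card:
  assumes "prime p" "CARD('a::{field,finite}) = p ^ g"
  shows "CHAR('a) = p"
proof -
  have "CHAR('a) dvd p ^ g"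
    using of_nat_CARD[where 'a = 'a] unfolding assms(2)[symmetric] of_nat_eq_0_iff_char_dvd .
  moreover have "prime CHAR('a)" by (intro prime_CHAR_semidom finite_imp_CHAR_pos) simp
  ultimately show ?thesis using assms(1) prime_dvd_power primes_dvd_imp_eq by blast
qed

text \<open>Multiplication by x permutes the units, so it leaves their nonzero product unchanged
  while multiplying it by x^(q-1).\<close>

lemma field_power_card:
  fixes x :: "'a::{field,finite}"
  assumes "x \<noteq> 0" shows "x ^ (CARD('a) - 1) = 1"
proof -
  have "(\<Prod>y\<in>UNIV-{0}. x * y) = (\<Prod>y\<in>UNIV-{0}. y)"
    by (rule prod.reindex_bij_witness[of _ "\<lambda>y. y / x" "\<lambda>y. x * y"]) (use assms in auto)
  then have "x ^ (CARD('a) - 1) * \<Prod>(UNIV-{0}) = 1 * \<Prod>(UNIV-{0})" by (simp add: prod.distrib)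
  then show ?thesis by (subst (asm) mult_right_cancel) simp_all
qed

lemma field_power_card_same: "x ^ CARD('a) = (x :: 'a::{field,finite})"
proof (cases "x = 0")
  case False
  have "x ^ Suc (CARD('a) - 1) = x" using field_power_card[OF False] by (simp only: power_Suc mult_1_right)
  moreover have "Suc (CARD('a) - 1) = CARD('a)" by (rule Suc_diff_1) simp
  ultimately show ?thesis by (simp only:)
qed simp

lemma power_additive_diff:
  fixes x y :: "'a::comm_ring_1"
  assumes "\<And>x y :: 'a. (x + y) ^ p = x ^ p + y ^ p"
  shows "(x - y) ^ p = x ^ p - y ^ p"
  using assms[of "x - y" y] by simp

definition frob :: "nat \<Rightarrow> 'a::comm_ring_1 ^ 'n ^ 'm \<Rightarrow> 'a ^ 'n ^ 'm"
  where "frob p A = (\<chi> i j. A $ i $ j ^ p)"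

lemma frob_nth [simp]: "frob p A $ i $ j = A $ i $ j ^ p"
  by (simp add: frob_def)

lemma frob_hom:
  assumes "\<And>x y :: 'a::field. (x + y) ^ p = x ^ p + y ^ p"
  shows "frob p \<in> hom (SL2 :: ('a ^ 2 ^ 2) monoid) SL2"
proof (rule homI)
  fix A B :: "'a ^ 2 ^ 2"
  show "frob p (A \<otimes>\<^bsub>SL2\<^esub> B) = frob p A \<otimes>\<^bsub>SL2\<^esub> frob p B"
    by (simp add: SL2_def vec_eq_iff matrix_matrix_mult_def sum_2 assms power_mult_distrib)
  assume "A \<in> carrier SL2"
  then have "(A $ 1 $ 1 * A $ 2 $ 2 - A $ 1 $ 2 * A $ 2 $ 1) ^ p = 1" by (simp add: SL2_def det_2)
  then show "frob p A \<in> carrier SL2"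
    by (simp add: SL2_def det_2 power_additive_diff[OF assms] power_mult_distrib)
qed

lemma (in coeff_embedding) CHAR_eq: "CHAR('k) = CHAR('a)"
proof (rule CHAR_eqI)
  have \<iota>: "\<iota> (of_nat n) = of_nat n" for n by (induction n) (simp_all add: \<iota>_add)
  show "of_nat CHAR('a) = (0 :: 'k)" unfolding \<iota>[symmetric] by simp
  show "CHAR('a) dvd n" if "of_nat n = (0 :: 'k)" for n
    using that unfolding \<iota>[symmetric] by (simp add: of_nat_eq_0_iff_char_dvd)
qed

section \<open>The derivation on forms of degree p\<close>

lemma pderiv_sum: "pderiv (sum F A) = (\<Sum>i\<in>A. pderiv (F i))"
  by (induction A rule: infinite_finite_induct) (simp_all add: pderiv_add)

lemma pderiv_power_mult_power:
  fixes l m :: "'a::idom poly"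
  shows "pderiv (l ^ Suc b * m ^ Suc c) = smult (of_nat (Suc b)) (l ^ b * m ^ c * (m * pderiv l)) +
    smult (of_nat (Suc c)) (l ^ b * m ^ c * (l * pderiv m))"
  unfolding pderiv_mult pderiv_power_Suc by (simp add: mult_ac del: of_nat_Suc)

text \<open>Let l and m be the two linear polynomials of the substitution. In l^(b+1) m^(p-1-b) the
  exponents add up to p = 0, so its derivative is (b+1) l^b m^(p-2-b) (l' m - l m'), and l' m - l m'
  = det A = 1. This is why the derivation is equivariant exactly from degree p to degree p -
  2.\<close>

lemma pderiv_subst_poly:
  fixes f :: "'a::field poly"
  assumes "det A = 1" "CHAR('a) = Suc (Suc r)"
  shows "pderiv (subst_poly A (Suc (Suc r)) f) = subst_poly A r (pderiv f)"
proof -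
  let ?l = "[:A $ 2 $ 1, A $ 1 $ 1:]" and ?m = "[:A $ 2 $ 2, A $ 1 $ 2:]"
  have zero: "of_nat (Suc (Suc r)) = (0 :: 'a)" using of_nat_CHAR[where 'a = 'a] unfolding assms(2) .
  have det: "?m * [:A $ 1 $ 1:] - ?l * [:A $ 1 $ 2:] = 1"
    using assms(1) by (simp add: det_2 one_pCons algebra_simps)
  have mid: "pderiv (?l ^ Suc b * ?m ^ (Suc (Suc r) - Suc b)) = smult (of_nat (Suc b)) (?l ^ b * ?m ^ (r - b))" if "b \<le> r" for b
  proof -
    have e: "Suc (Suc r) - Suc b = Suc (r - b)" using that by simp
    have n: "of_nat (Suc (r - b)) = - (of_nat (Suc b) :: 'a)"
    proof -
      have "of_nat (Suc (r - b)) + of_nat (Suc b) = (of_nat (Suc (Suc r)) :: 'a)"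
        using that by (simp only: of_nat_add[symmetric]) simp
      then show ?thesis unfolding zero eq_neg_iff_add_eq_0 .
    qed
    have "pderiv (?l ^ Suc b * ?m ^ (Suc (Suc r) - Suc b)) =
        smult (of_nat (Suc b)) (?l ^ b * ?m ^ (r - b) * (?m * [:A $ 1 $ 1:] - ?l * [:A $ 1 $ 2:]))"
      unfolding e pderiv_power_mult_power n right_diff_distrib smult_diff_right
      by (simp add: pderiv_pCons del: of_nat_Suc)
    then show ?thesis unfolding det by simp
  qed
  \<comment> \<open>The two extreme terms are p-th powers of linear polynomials, whose derivatives
    vanish.\<close>
  have first: "pderiv (?l ^ 0 * ?m ^ (Suc (Suc r) - 0)) = 0"
    using zero unfolding pderiv_mult by (simp add: pderiv_power_Suc del: of_nat_Suc power_Suc)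
  have last: "pderiv (?l ^ Suc (Suc r) * ?m ^ (Suc (Suc r) - Suc (Suc r))) = 0"
    using zero unfolding pderiv_mult by (simp add: pderiv_power_Suc del: of_nat_Suc power_Suc)
  have "pderiv (subst_poly A (Suc (Suc r)) f) =
      (\<Sum>a\<le>Suc (Suc r). smult (coeff f a) (pderiv (?l ^ a * ?m ^ (Suc (Suc r) - a))))"
    by (simp only: subst_poly_def pderiv_sum pderiv_smult)
  also have "\<dots> = (\<Sum>b\<le>r. smult (coeff f (Suc b)) (pderiv (?l ^ Suc b * ?m ^ (Suc (Suc r) - Suc b))))"
    unfolding sum.atMost_Suc_shift[of _ "Suc r"] sum.atMost_Suc[of _ r] first last by simp
  also have "\<dots> = (\<Sum>b\<le>r. smult (coeff (pderiv f) b) (?l ^ b * ?m ^ (r - b)))"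
    by (rule sum.cong) (simp_all only: mid atMost_iff coeff_pderiv smult_smult mult.commute)
  finally show ?thesis by (simp only: subst_poly_def)
qed

context twisted_forms begin

lemma H_exact_frobenius:
  assumes "prime p" "CHAR('a) = p" "large TYPE('k) p"
  shows "cl (H p) = cl (Hmod \<iota> (frob p \<circ> \<sigma>) 1) + cl (H (p - 2))"
proof -
  obtain r where r: "p = Suc (Suc r)"
    using prime_ge_2_nat[OF assms(1)] by (metis Suc_diff_Suc Suc_1 less_eq_Suc_le diff_Suc_Suc minus_nat.diff_0 le_add_diff_inverse plus_1_eq_Suc add_2_eq_Suc)
  have add_a: "(x + y) ^ p = x ^ p + y ^ p" for x y :: 'a
    by (rule freshmans_dream) (use assms in simp_all)
  have add_k: "(x + y) ^ p = x ^ p + y ^ p" for x y :: 'k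
    by (rule freshmans_dream) (use assms CHAR_eq in simp_all)
  interpret T: twisted_forms \<iota> "frob p \<circ> \<sigma>"
    by unfold_locales (rule hom_compose[OF \<sigma>_hom frob_hom[OF add_a]])
  have zero: "of_nat p = (0 :: 'a)" using of_nat_CHAR[where 'a = 'a] unfolding assms(2) .
  define j where "j = (\<lambda>\<phi> (v :: 'k \<times> 'k). \<phi> (fst v ^ p, snd v ^ p) :: 'k)"
  \<comment> \<open>Recovers the polynomial from the function; it is unique because the value ring
    is large enough for degree p.\<close>
  define c where "c = (\<lambda>\<phi>. THE f. degree f \<le> p \<and> \<phi> = hom_poly \<iota> p f)"
  define d where "d = (\<lambda>\<phi>. hom_poly \<iota> r (pderiv (c \<phi>)))"
  have c: "c (hom_poly \<iota> p f) = f" if "degree f \<le> p" for f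
    unfolding c_def using that by (intro the_equality) (auto intro: hom_poly_inj[OF assms(3)])
  have d: "d (hom_poly \<iota> p f) = hom_poly \<iota> r (pderiv f)" if "degree f \<le> p" for f
    unfolding d_def c[OF that] ..
  \<comment> \<open>A derivative has degree at most p - 1, and its coefficient there is p times the
    top coefficient, hence zero.\<close>
  have deg_pderiv: "degree (pderiv f) \<le> r" if "degree f \<le> p" for f :: "'a poly"
  proof (rule degree_le, intro allI impI)
    fix i assume "r < i"
    then consider "i = Suc r" | "i > Suc r" by linarith
    then show "coeff (pderiv f) i = 0"
    proof cases
      case 1 then show ?thesis using zero unfolding coeff_pderiv r by simp
    next
      case 2 then show ?thesis using that r by (simp add: coeff_pderiv coeff_eq_0)
    qed
  qed
  have Fp: "\<exists>f. degree f \<le> p \<and> \<phi> = hom_poly \<iota> p f" if "\<phi> \<in> F p" for \<phi> using that unfolding forms_atMost .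
  have Frr: "hom_poly \<iota> n f \<in> F n" if "degree f \<le> n" for f n using that unfolding forms_atMost by blast
  have j_form: "j (\<lambda>v. fst v * \<iota> a + snd v * \<iota> b) = hom_poly \<iota> p (monom a p + monom b 0)" for a b
    by (simp add: j_def fun_eq_iff hom_poly_add hom_poly_monom algebra_simps)
  have deg_ab: "degree (monom a p + monom b 0 :: 'a poly) \<le> p" for a b
    by (intro degree_add_le) (auto intro: order_trans[OF degree_monom_le])
  have j_hom: "j \<in> gmodule_hom SL2 (T.H 1) (H p)"
  proof (rule gmodule_homI)
    fix \<phi> assume "\<phi> \<in> carrier (T.H 1)"
    then obtain a b where "\<phi> = (\<lambda>v. fst v * \<iota> a + snd v * \<iota> b)" unfolding T.carrier_H F1 by blast
    then show "j \<phi> \<in> carrier (H p)" unfolding carrier_H using j_form Frr[OF deg_ab] by simp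
  next
    fix A :: "'a ^ 2 ^ 2" and \<phi>
    have "rowact \<iota> (frob p (\<sigma> A)) (fst v ^ p, snd v ^ p) =
      (fst (rowact \<iota> (\<sigma> A) v) ^ p, snd (rowact \<iota> (\<sigma> A) v) ^ p)" for v
      by (simp add: rowact_def add_k power_mult_distrib \<iota>_power)
    then show "j (act (T.H 1) A \<phi>) = act (H p) A (j \<phi>)" by (simp add: j_def Hmod_def)
  qed (simp_all add: j_def Hmod_def)
  have d_hom: "d \<in> gmodule_hom SL2 (H p) (H r)"
  proof (rule gmodule_homI)
    fix \<phi> assume "\<phi> \<in> carrier (H p)"
    then obtain f where "degree f \<le> p" "\<phi> = hom_poly \<iota> p f" using Fp by auto
    then show "d \<phi> \<in> carrier (H r)" unfolding carrier_H using d Frr[OF deg_pderiv] by simp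
  next
    fix \<phi> \<psi> assume "\<phi> \<in> carrier (H p)" "\<psi> \<in> carrier (H p)"
    then obtain f g where f: "degree f \<le> p" "\<phi> = hom_poly \<iota> p f" and g: "degree g \<le> p" "\<psi> = hom_poly \<iota> p g"
      using Fp by (metis carrier_H)
    have "(\<lambda>y. \<phi> y + \<psi> y) = hom_poly \<iota> p (f + g)" using f g by (simp add: hom_poly_add fun_eq_iff)
    then show "d (\<phi> \<oplus>\<^bsub>H p\<^esub> \<psi>) = d \<phi> \<oplus>\<^bsub>H r\<^esub> d \<psi>"
      using f g d[of f] d[of g] d[of "f + g"]
      by (simp add: Hmod_def degree_add_le pderiv_add) (simp add: hom_poly_add fun_eq_iff)
  next
    fix e \<phi> assume "\<phi> \<in> carrier (H p)"
    then obtain f where f: "degree f \<le> p" "\<phi> = hom_poly \<iota> p f" using Fp by auto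
    have "(\<lambda>y. \<iota> e * \<phi> y) = hom_poly \<iota> p (smult e f)" using f by (simp add: hom_poly_smult fun_eq_iff)
    then show "d (e \<odot>\<^bsub>H p\<^esub> \<phi>) = e \<odot>\<^bsub>H r\<^esub> d \<phi>"
      using f d[of f] d[of "smult e f"] order_trans[OF degree_smult_le f(1), of e]
      by (simp add: Hmod_def pderiv_smult) (simp add: hom_poly_smult fun_eq_iff)
  next
    fix A :: "'a ^ 2 ^ 2" and \<phi> assume A: "A \<in> carrier SL2" and "\<phi> \<in> carrier (H p)"
    then obtain f where f: "degree f \<le> p" "\<phi> = hom_poly \<iota> p f" using Fp by auto
    have "(\<lambda>v. \<phi> (rowact \<iota> (\<sigma> A) v)) = hom_poly \<iota> p (subst_poly (\<sigma> A) p f)"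
      by (simp add: f(2) hom_poly_rowact)
    then have "d (\<lambda>v. \<phi> (rowact \<iota> (\<sigma> A) v)) = hom_poly \<iota> r (pderiv (subst_poly (\<sigma> A) p f))"
      using d[OF degree_subst_poly] by simp
    also have "\<dots> = hom_poly \<iota> r (subst_poly (\<sigma> A) r (pderiv f))"
      using pderiv_subst_poly[OF det_\<sigma>[OF A], of r f] assms(2) unfolding r by simp
    also have "\<dots> = (\<lambda>v. d \<phi> (rowact \<iota> (\<sigma> A) v))"
      using d[OF f(1)] by (simp add: f(2) hom_poly_rowact)
    finally show "d (act (H p) A \<phi>) = act (H r) A (d \<phi>)" by (simp add: Hmod_def)
  qed
  have d_surj: "d ` carrier (H p) = carrier (H r)"
  proof
    show "d ` carrier (H p) \<subseteq> carrier (H r)" using gmodule_homD(1)[OF d_hom] by blast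
    show "carrier (H r) \<subseteq> d ` carrier (H p)"
    proof
      fix \<phi> assume "\<phi> \<in> carrier (H r)"
      then obtain g where g: "degree g \<le> r" "\<phi> = hom_poly \<iota> r g" unfolding carrier_H forms_atMost by blast
      \<comment> \<open>An antiderivative: the denominators a + 1 are at most p - 1 and so
        invertible.\<close>
      define f where "f = (\<Sum>a\<le>r. monom (coeff g a / of_nat (Suc a)) (Suc a))"
      have df: "degree f \<le> p" unfolding f_def
        by (rule degree_sum_le) (auto simp: r intro: order_trans[OF degree_monom_le])
      have nz: "of_nat (Suc a) \<noteq> (0 :: 'a)" if "a \<le> r" for a
        using that assms(2) r by (auto simp: of_nat_eq_0_iff_char_dvd simp del: of_nat_Suc dest: dvd_imp_le)
      have "pderiv f = (\<Sum>a\<le>r. monom (coeff g a) a)"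
        unfolding f_def pderiv_sum pderiv_monom using nz by (intro sum.cong) (simp_all del: of_nat_Suc)
      then have "pderiv f = g" using poly_as_sum_of_monoms'[OF g(1)] by simp
      then have "\<phi> = d (hom_poly \<iota> p f)" using d[OF df] g by simp
      then show "\<phi> \<in> d ` carrier (H p)" unfolding carrier_H using Frr[OF df] by (rule image_eqI)
    qed
  qed
  have j_inj: "inj_on j (carrier (T.H 1))"
  proof (rule inj_onI)
    fix \<phi> \<psi> assume "\<phi> \<in> carrier (T.H 1)" "\<psi> \<in> carrier (T.H 1)" and eq: "j \<phi> = j \<psi>"
    then obtain a b a' b' where ab: "\<phi> = (\<lambda>v. fst v * \<iota> a + snd v * \<iota> b)" "\<psi> = (\<lambda>v. fst v * \<iota> a' + snd v * \<iota> b')"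
      unfolding T.carrier_H F1 by blast
    have "j \<phi> (1, 0) = j \<psi> (1, 0)" "j \<phi> (0, 1) = j \<psi> (0, 1)" using eq by simp_all
    then have "a = a'" "b = b'" using r by (simp_all add: j_def ab)
    then show "\<phi> = \<psi>" using ab by simp
  qed
  let ?K = "{\<phi> \<in> carrier (H p). d \<phi> = \<zero>\<^bsub>H r\<^esub>}"
  have sub: "j ` carrier (T.H 1) \<subseteq> ?K"
  proof (rule image_subsetI)
    fix \<phi> assume \<phi>: "\<phi> \<in> carrier (T.H 1)"
    then obtain a b where ab: "\<phi> = (\<lambda>v. fst v * \<iota> a + snd v * \<iota> b)" unfolding T.carrier_H F1 by blast
    have "pderiv (monom a p + monom b 0) = 0" using zero by (simp add: pderiv_add pderiv_monom)
    then have "d (j \<phi>) = \<zero>\<^bsub>H r\<^esub>" unfolding ab j_form d[OF deg_ab] by (simp add: Hmod_def fun_eq_iff)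
    then show "j \<phi> \<in> ?K" using gmodule_homD(1)[OF j_hom \<phi>] by simp
  qed
  have "card (carrier (H p)) = card ?K * card (carrier (H r))"
    by (rule card_hom[OF group_module_H group_module_H d_hom d_surj])
  then have "CARD('a) ^ Suc (Suc (Suc r)) = card ?K * CARD('a) ^ Suc r"
    using card_F[OF assms(3)] card_F[OF large_mono[OF assms(3), of r]] by (simp add: r)
  then have "CARD('a) ^ 2 * CARD('a) ^ Suc r = card ?K * CARD('a) ^ Suc r" by (simp add: power2_eq_square)
  then have "card ?K = CARD('a) ^ 2" by simp
  moreover have "large TYPE('k) 1" using large_mono[OF assms(3), of 1] r by simp
  then have "card (carrier (T.H 1)) = CARD('a) ^ 2"
    unfolding T.carrier_H by (simp only: card_F) (simp add: power2_eq_square)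
  ultimately have "card (j ` carrier (T.H 1)) = card ?K" by (simp only: card_image[OF j_inj])
  moreover have "finite ?K" using finite_F by simp
  ultimately have "j ` carrier (T.H 1) = ?K" using sub by (intro card_subset_eq)
  then have "short_exact SL2 (T.H 1) (H p) (H r) j d"
    using j_hom d_hom j_inj d_surj by (simp add: short_exact_def)
  from cl_exact[OF T.fg_H fg_H fg_H this] show ?thesis by (simp add: r)
qed

end

section \<open>Iterated Frobenius twists\<close>

abbreviation twisted_class :: "nat \<Rightarrow> 'a::{field,finite} k0"
  where "twisted_class m \<equiv> cl (twist (frob m) (standard_module :: ('a, 'a ^ 2, 'a ^ 2 ^ 2) gmodule))"

lemma frob_1 [simp]: "frob (Suc 0) = id"
  by (simp add: frob_def fun_eq_iff vec_eq_iff)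

lemma frob_comp: "frob p \<circ> frob m = (frob (m * p) :: 'a::comm_ring_1 ^ 'n ^ 'm \<Rightarrow> _)"
  by (simp add: fun_eq_iff vec_eq_iff power_mult)

lemma infinite_UNIV_poly: "infinite (UNIV :: 'a::comm_ring_1 poly set)"
proof
  assume "finite (UNIV :: 'a poly set)"
  then have "finite (range (monom (1 :: 'a)))" by (rule finite_subset[rotated]) simp
  moreover have "inj (monom (1 :: 'a))" by (rule injI) (metis degree_monom_eq one_neq_zero)
  ultimately show False using finite_imageD infinite_UNIV_nat by blast
qed

lemma frob_power_hom:
  assumes "prime p" "CHAR('a::{field,finite}) = p"
  shows "frob (p ^ i) \<in> hom (SL2 :: ('a ^ 2 ^ 2) monoid) SL2"
  by (rule frob_hom, rule freshmans_dream') (use assms in auto)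

lemma twisted_class_frob:
  assumes "prime p" "CHAR('a::{field,finite}) = p"
  shows "(twisted_class (p ^ i) :: 'a k0) = evalz (f_iter p i) (twisted_class 1)"
proof (induction i)
  case 0 then show ?case by (simp add: f_iter_def)
next
  case (Suc i)
  \<comment> \<open>Values are taken in the polynomial ring, because over the field itself degree p
    is too large when q = p.\<close>
  interpret twisted_forms "\<lambda>c :: 'a. [:c:]" "frob (p ^ i)"
    by unfold_locales (simp_all add: frob_power_hom[OF assms] one_pCons)
  interpret T: twisted_forms "\<lambda>c :: 'a. [:c:]" "frob p \<circ> frob (p ^ i)"
    using frob_power_hom[OF assms, of "Suc i"] by unfold_locales (simp add: frob_comp mult.commute)
  have large: "large TYPE('a poly) n" for n by (simp add: large_def infinite_UNIV_poly)
  have "twisted_class (p ^ Suc i) = cl (T.H 1)"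
    unfolding T.cl_H_1 unfolding frob_comp by (simp add: mult.commute)
  also have "\<dots> = cl (H p) - cl (H (p - 2))"
    using H_exact_frobenius[OF assms large] by simp
  also have "\<dots> = evalz (f_poly p) (twisted_class (p ^ i))"
    unfolding cl_H[OF large] using f_poly_cheb[OF prime_ge_2_nat[OF assms(1)]] by simp
  finally show ?case by (simp add: Suc f_iter_Suc)
qed

lemma twist_id [simp]: "twist id M = M" by (simp add: twist_def)

lemma f_iter_relation:
  assumes "prime p" "CARD('a::{field,finite}) = p ^ g"
  shows "evalz (f_iter p g - [:0, 1:]) (twisted_class 1 :: 'a k0) = 0"
proof -
  have "frob (p ^ g) = (id :: 'a ^ 2 ^ 2 \<Rightarrow> _)"
    by (simp add: fun_eq_iff vec_eq_iff field_power_card_same flip: assms(2))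
  then show ?thesis
    using twisted_class_frob[OF assms(1) CHAR_field_card[OF assms], of g] by simp
qed


section \<open>Truncated binary forms\<close>

lemma fun_subspace_comp: "fun_subspace \<iota> U \<Longrightarrow> fun_subspace \<iota> {\<phi>. (\<lambda>y. \<phi> (\<pi> y)) \<in> U}"
  by (auto simp: fun_subspace_def)

lemma fun_subspace_mult:
  fixes \<theta> :: "'y \<Rightarrow> 'k::comm_ring_1"
  assumes "fun_subspace \<iota> U" shows "fun_subspace \<iota> {\<phi>. (\<lambda>y. \<phi> (\<pi> y) * \<theta> y) \<in> U}"
  using assms by (simp add: fun_subspace_def distrib_right mult.assoc)

context coeff_embedding begin

lemma monomial_in_forms:
  assumes "a \<in> D" "a \<le> n" shows "(\<lambda>v. fst v ^ a * snd v ^ (n - a)) \<in> forms \<iota> n D"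
proof -
  have "(\<lambda>v. fst v ^ a * snd v ^ (n - a)) = hom_poly \<iota> n (monom 1 a)"
    using assms(2) by (simp add: hom_poly_monom fun_eq_iff)
  moreover have "monom (1 :: 'a) a \<in> supp_polys D" using assms(1) by (auto simp: supp_polys_def coeff_monom)
  ultimately show ?thesis unfolding forms_def by blast
qed

lemma forms_subset:
  assumes "D \<subseteq> {..n}" "fun_subspace \<iota> U" "\<And>a. a \<in> D \<Longrightarrow> (\<lambda>v. fst v ^ a * snd v ^ (n - a)) \<in> U"
  shows "forms \<iota> n D \<subseteq> U"
proof
  fix \<phi> assume "\<phi> \<in> forms \<iota> n D"
  then obtain f where f: "f \<in> supp_polys D" "\<phi> = hom_poly \<iota> n f" by (auto simp: forms_def)
  have "hom_poly \<iota> n f v = (\<Sum>a\<in>D. \<iota> (coeff f a) * (fst v ^ a * snd v ^ (n - a)))" for v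
    unfolding hom_poly_def using assms(1) f(1)
    by (intro sum.mono_neutral_cong_right) (auto simp: supp_polys_def mult.assoc)
  then have "\<phi> = (\<lambda>v. \<Sum>a\<in>D. \<iota> (coeff f a) * (fst v ^ a * snd v ^ (n - a)))" using f(2) by (simp add: fun_eq_iff)
  also have "\<dots> \<in> U" by (rule fun_subspace_sum[OF assms(2)]) (rule fun_subspaceD(3)[OF assms(2) assms(3)])
  finally show "\<phi> \<in> U" .
qed

end

text \<open>Otherwise X^(d+1) - X would vanish on the whole field although its degree d + 1 is below
  q.\<close>

lemma unit_power_neq_1:
  assumes "0 < d" "d < CARD('a::{field,finite}) - 1"
  obtains u :: "'a::{field,finite}" where "u \<noteq> 0" "u ^ d \<noteq> 1"
proof (rule ccontr)
  assume "\<not> thesis"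
  then have 1: "u ^ d = 1" if "u \<noteq> 0" for u :: 'a using that \<open>\<And>u. u \<noteq> 0 \<Longrightarrow> u ^ d \<noteq> 1 \<Longrightarrow> thesis\<close> by blast
  let ?f = "monom 1 (Suc d) - monom 1 (Suc 0) :: 'a poly"
  have "?f = 0"
  proof (rule poly_zero_large)
    show "large TYPE('a) (Suc d)" using assms by (simp add: large_def)
    show "degree ?f \<le> Suc d" by (intro degree_diff_le) (auto intro: order_trans[OF degree_monom_le])
    show "poly ?f x = 0" for x using 1[of x] by (cases "x = 0") (simp_all add: poly_monom)
  qed
  then have "coeff ?f (Suc d) = 0" by simp
  then show False using assms(1) by (simp add: coeff_monom)
qed

lemma unit_power_neq:
  assumes "a < b" "b - a < CARD('a::{field,finite}) - 1"
  obtains u :: "'a::{field,finite}" where "u \<noteq> 0" "u ^ a \<noteq> u ^ b"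
proof -
  obtain u :: 'a where u: "u \<noteq> 0" "u ^ (b - a) \<noteq> 1" using unit_power_neq_1[of "b - a"] assms by auto
  have "u ^ b = u ^ a * u ^ (b - a)" using assms(1) by (simp flip: power_add)
  then show thesis using that[of u] u by auto
qed

lemma of_nat_CARD_minus_1: "of_nat (CARD('a::{field,finite}) - Suc 0) = (- 1 :: 'a)"
  using of_nat_CARD[where 'a = 'a] card_field_ge_2[where 'a = 'a] by (simp add: of_nat_diff)

text \<open>Orthogonality of the characters t^a and t^b of the unit group. Replacing t by u t
  multiplies the sum by u^(b-a), and some u makes this factor different from 1 because the exponents
  differ by less than q - 1.\<close>

lemma sum_units_power:
  assumes "a \<noteq> b" "a < b + (CARD('a::{field,finite}) - 1)" "b < a + (CARD('a) - 1)"
  shows "(\<Sum>t\<in>UNIV - {0 :: 'a}. inverse t ^ a * t ^ b) = 0"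
proof -
  obtain u :: 'a where u: "u \<noteq> 0" "u ^ a \<noteq> u ^ b"
  proof (cases "a < b")
    case True
    then have "b - a < CARD('a) - 1" using assms by linarith
    from unit_power_neq[OF True this] that show thesis by blast
  next
    case False
    then have "b < a" using assms(1) by simp
    then have "a - b < CARD('a) - 1" using assms by linarith
    from unit_power_neq[OF \<open>b < a\<close> this] that show thesis by metis
  qed
  let ?S = "\<Sum>t\<in>UNIV - {0 :: 'a}. inverse t ^ a * t ^ b"
  have "?S = (\<Sum>t\<in>UNIV - {0}. inverse (u * t) ^ a * (u * t) ^ b)"
    by (rule sum.reindex_bij_witness[of _ "\<lambda>t. u * t" "\<lambda>t. t / u"]) (use u in auto)
  also have "\<dots> = inverse u ^ a * u ^ b * ?S"
    by (simp add: sum_distrib_left power_mult_distrib mult_ac)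
  finally have "u ^ a * ?S = u ^ a * (inverse u ^ a * u ^ b * ?S)" by (rule arg_cong)
  also have "\<dots> = (u * inverse u) ^ a * (u ^ b * ?S)" by (simp only: power_mult_distrib mult_ac)
  also have "\<dots> = u ^ b * ?S" using u by simp
  finally show ?thesis using u by (simp only: mult_cancel_right) simp
qed

lemma sum_units_power_self: "(\<Sum>t\<in>UNIV - {0 :: 'a::{field,finite}}. inverse t ^ a * t ^ a) = - 1"
proof -
  have "(\<Sum>t\<in>UNIV - {0 :: 'a}. inverse t ^ a * t ^ a) = (\<Sum>t\<in>UNIV - {0 :: 'a}. 1)"
    by (rule sum.cong) (auto simp flip: power_mult_distrib)
  then show ?thesis using of_nat_CARD_minus_1[where 'a = 'a] by (simp add: card_Diff_singleton)
qed

locale finite_char =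
  fixes p g :: nat and T :: "'a::{field,finite} itself"
  assumes prime_p: "prime p" and g_pos: "g > 0" and card_field: "CARD('a) = p ^ g"
begin

sublocale coeff_embedding "\<lambda>c :: 'a. c"
  by unfold_locales simp_all

text \<open>For the identity embedding these rules rewrite a term to itself.\<close>

declare \<iota>_zero [simp del] \<iota>_one [simp del] \<iota>_eq_0_iff [simp del] \<iota>_eq_iff [simp del]

lemma CHAR_p: "CHAR('a) = p"
  by (rule CHAR_field_card[OF prime_p card_field])

text \<open>The exponents that survive in the m-th power of a linear form. By Lucas's theorem they
  are those whose base p digits do not exceed the digits of m.\<close>

definition binom_support :: "nat \<Rightarrow> nat set"
  where "binom_support m = {a. of_nat (m choose a) \<noteq> (0 :: 'a)}"

text \<open>Spanned by monomials, which makes the size visible. For m < q it is also the span of the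
  powers \<open>pw m\<close>, by \<open>pw_in_lforms\<close> and
  \<open>lforms_subset\<close>.\<close>

definition lforms :: "nat \<Rightarrow> ('a \<times> 'a \<Rightarrow> 'a) set"
  where "lforms m = forms (\<lambda>c. c) m (binom_support m)"

abbreviation pw :: "nat \<Rightarrow> 'a \<Rightarrow> 'a \<Rightarrow> 'a \<times> 'a \<Rightarrow> 'a"
  where "pw m \<alpha> \<beta> \<equiv> \<lambda>v. (fst v * \<alpha> + snd v * \<beta>) ^ m"

lemma binom_support_subset: "binom_support m \<subseteq> {..m}"
proof
  fix a assume "a \<in> binom_support m"
  then show "a \<in> {..m}" by (cases "a \<le> m") (simp_all add: binom_support_def binomial_eq_0 not_le)
qed

lemma fun_subspace_lforms: "fun_subspace (\<lambda>c. c) (lforms m)"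
  unfolding lforms_def by (rule fun_subspace_forms)

lemma finite_lforms: "finite (lforms m)"
  unfolding lforms_def forms_def
  using card_supp_polys(1)[OF finite_subset[OF binom_support_subset]] by simp

lemma card_lforms: "m < CARD('a) \<Longrightarrow> card (lforms m) = CARD('a) ^ card (binom_support m)"
  unfolding lforms_def by (rule card_forms(2)[OF binom_support_subset]) (simp add: large_def)

lemma pw_in_lforms: "pw m \<alpha> \<beta> \<in> lforms m"
proof -
  have "pw m \<alpha> \<beta> = hom_poly (\<lambda>c. c) m ([:\<beta>, \<alpha>:] ^ m)" by (rule ext) (rule hom_poly_linear_power[symmetric])
  moreover have "[:\<beta>, \<alpha>:] ^ m \<in> supp_polys (binom_support m)"
    unfolding supp_polys_def
  proof (intro CollectI allI impI)
    fix a assume a: "a \<notin> binom_support m"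
    show "coeff ([:\<beta>, \<alpha>:] ^ m) a = 0"
    proof (cases "a \<le> m")
      case True
      then show ?thesis using a unfolding coeff_linear_poly_power[OF True] by (simp add: binom_support_def)
    next
      case False
      then show ?thesis using degree_linear_power[of \<beta> \<alpha> m] by (intro coeff_eq_0) simp
    qed
  qed
  ultimately show ?thesis unfolding lforms_def forms_def by blast
qed

text \<open>A monomial is extracted from powers by a character sum: the sum of t^(-a) (t x + y)^m
  over the units t is - C(m, a) x^a y^(m-a), and the binomial is invertible on the support.\<close>

lemma lforms_subset:
  assumes m: "m < CARD('a)" and U: "fun_subspace (\<lambda>c. c) U" "\<And>\<alpha> \<beta>. pw m \<alpha> \<beta> \<in> U"
  shows "lforms m \<subseteq> U"
  unfolding lforms_def
proof (rule forms_subset[OF binom_support_subset U(1)])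
  fix a assume a: "a \<in> binom_support m"
  then have am: "a \<le> m" and nz: "of_nat (m choose a) \<noteq> (0 :: 'a)"
    using binom_support_subset by (auto simp: binom_support_def)
  \<comment> \<open>The exponents 0 and m are indistinguishable on units when m = q - 1; the two
    outer monomials are handled apart, being powers themselves.\<close>
  consider "a = 0" | "a = m" | "0 < a" "a < m" using am by linarith
  then show "(\<lambda>v. fst v ^ a * snd v ^ (m - a)) \<in> U"
  proof cases
    case 1 then show ?thesis using U(2)[of 0 1] by simp
  next
    case 2 then show ?thesis using U(2)[of 1 0] by simp
  next
    case 3
    have "(\<Sum>t\<in>UNIV - {0}. inverse t ^ a * pw m t 1 v) = - of_nat (m choose a) * (fst v ^ a * snd v ^ (m - a))" for v :: "'a \<times> 'a"
    proof -
      let ?c = "\<lambda>b. of_nat (m choose b) * fst v ^ b * snd v ^ (m - b)"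
      have "(\<Sum>t\<in>UNIV - {0}. inverse t ^ a * pw m t 1 v) =
          (\<Sum>t\<in>UNIV - {0}. \<Sum>b\<le>m. ?c b * (inverse t ^ a * t ^ b))"
        by (intro sum.cong refl) (simp add: binomial_ring sum_distrib_left power_mult_distrib mult_ac)
      also have "\<dots> = (\<Sum>b\<le>m. ?c b * (\<Sum>t\<in>UNIV - {0}. inverse t ^ a * t ^ b))"
        by (subst sum.swap) (simp add: sum_distrib_left)
      also have "\<dots> = (\<Sum>b\<le>m. if b = a then - ?c a else 0)"
      proof (intro sum.cong refl)
        fix b assume "b \<in> {..m}"
        then show "?c b * (\<Sum>t\<in>UNIV - {0}. inverse t ^ a * t ^ b) = (if b = a then - ?c a else 0)"
          using 3 m sum_units_power[of a b, where 'a = 'a] sum_units_power_self[of a, where 'a = 'a] by auto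
      qed
      also have "\<dots> = - ?c a" using am by simp
      finally show ?thesis by simp
    qed
    then have "(\<lambda>v. fst v ^ a * snd v ^ (m - a)) =
      (\<lambda>v. (- inverse (of_nat (m choose a))) * (\<Sum>t\<in>UNIV - {0}. inverse t ^ a * pw m t 1 v))"
      using nz by (simp add: fun_eq_iff)
    also have "\<dots> \<in> U"
      by (intro fun_subspaceD(3)[OF U(1)] fun_subspace_sum[OF U(1)] U(2))
    finally show ?thesis .
  qed
qed

lemma lforms_rowact:
  assumes "m < CARD('a)" "\<phi> \<in> lforms m"
  shows "(\<lambda>v. \<phi> (rowact (\<lambda>c. c) A v)) \<in> lforms m"
proof -
  have "lforms m \<subseteq> {\<phi>. (\<lambda>v. \<phi> (rowact (\<lambda>c. c) A v)) \<in> lforms m}"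
  proof (rule lforms_subset[OF assms(1) fun_subspace_comp[OF fun_subspace_lforms]])
    fix \<alpha> \<beta>
    have "(\<lambda>v. pw m \<alpha> \<beta> (rowact (\<lambda>c. c) A v)) =
        pw m (A $ 1 $ 1 * \<alpha> + A $ 1 $ 2 * \<beta>) (A $ 2 $ 1 * \<alpha> + A $ 2 $ 2 * \<beta>)"
      by (simp add: rowact_def fun_eq_iff algebra_simps)
    then show "pw m \<alpha> \<beta> \<in> {\<phi>. (\<lambda>v. \<phi> (rowact (\<lambda>c. c) A v)) \<in> lforms m}"
      using pw_in_lforms by simp
  qed
  then show ?thesis using assms(2) by blast
qed

section \<open>Base p digits and tensor products\<close>

lemma freshman: "(x + y) ^ p = x ^ p + (y :: 'a) ^ p"
  by (rule freshmans_dream) (simp_all add: CHAR_p prime_p)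

text \<open>Lucas's theorem for the lowest digit: (1 + X)^(r + p n) = (1 + X)^r (1 + X^p)^n in
  characteristic p, and k = i + p j with i < p determines i and j.\<close>

lemma choose_digits:
  assumes "r < p"
  shows "of_nat ((r + p * n) choose k) = (of_nat (r choose (k mod p)) * of_nat (n choose (k div p)) :: 'a)"
proof -
  interpret P: coeff_embedding "\<lambda>c :: 'a. [:c:]" by unfold_locales (simp_all add: one_pCons)
  have pow: "([:1, 1:] :: 'a poly) ^ l = (\<Sum>i\<le>l. monom (of_nat (l choose i)) i)" for l
  proof (rule poly_eqI)
    fix i show "coeff (([:1, 1:] :: 'a poly) ^ l) i = coeff (\<Sum>i\<le>l. monom (of_nat (l choose i)) i) i"
    proof (cases "i \<le> l")
      case True
      show ?thesis unfolding coeff_linear_poly_power[OF True] using True by (simp add: coeff_sum coeff_monom)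
    next
      case False
      then show ?thesis using degree_linear_power[of "1 :: 'a" 1 l]
        by (subst coeff_eq_0) (simp_all add: coeff_sum coeff_monom)
    qed
  qed
  have "[:1, 1:] = monom 1 1 + (1 :: 'a poly)"
    by (rule poly_eqI) (simp add: coeff_pCons coeff_monom coeff_1 split: nat.split)
  then have "([:1, 1:] :: 'a poly) ^ p = (monom 1 1 + 1) ^ p" by (simp only:)
  also have "\<dots> = monom 1 p + 1"
    by (subst freshmans_dream) (simp_all add: P.CHAR_eq CHAR_p prime_p monom_power)
  finally have fr: "([:1, 1:] :: 'a poly) ^ p = monom 1 p + 1" .
  have "([:1, 1:] :: 'a poly) ^ (p * n) = (\<Sum>j\<le>n. monom (of_nat (n choose j)) (p * j))"
    unfolding power_mult fr binomial_ring
    by (simp add: monom_power of_nat_poly smult_monom mult.commute)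
  then have "([:1, 1:] :: 'a poly) ^ (r + p * n) =
      (\<Sum>i\<le>r. \<Sum>j\<le>n. monom (of_nat (r choose i) * of_nat (n choose j)) (i + p * j))"
    by (simp only: power_add pow[of r] sum_product mult_monom)
  then have "coeff (([:1, 1:] :: 'a poly) ^ (r + p * n)) k =
      (\<Sum>i\<le>r. \<Sum>j\<le>n. if i + p * j = k then of_nat (r choose i) * of_nat (n choose j) else 0)"
    by (simp add: coeff_sum coeff_monom)
  also have "\<dots> = (\<Sum>i\<le>r. if i = k mod p then (\<Sum>j\<le>n. if j = k div p then of_nat (r choose i) * of_nat (n choose j) else 0) else 0)"
  proof (intro sum.cong refl)
    fix i assume "i \<in> {..r}"
    then have i: "i < p" using assms by simp
    have "i + p * j = k \<longleftrightarrow> i = k mod p \<and> j = k div p" for j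
    proof
      assume "i + p * j = k"
      then show "i = k mod p \<and> j = k div p" using i by auto
    qed simp
    then show "(\<Sum>j\<le>n. if i + p * j = k then of_nat (r choose i) * of_nat (n choose j) else 0) =
      (if i = k mod p then (\<Sum>j\<le>n. if j = k div p then of_nat (r choose i) * of_nat (n choose j) else 0) else (0 :: 'a))"
      by simp
  qed
  also have "\<dots> = of_nat (r choose (k mod p)) * of_nat (n choose (k div p))"
    by (auto simp: not_le binomial_eq_0)
  finally have *: "coeff (([:1, 1:] :: 'a poly) ^ (r + p * n)) k =
    of_nat (r choose (k mod p)) * of_nat (n choose (k div p))" .
  have "coeff (([:1, 1:] :: 'a poly) ^ l) k = of_nat (l choose k)" for l
    unfolding pow by (simp add: coeff_sum coeff_monom not_le binomial_eq_0)
  then show ?thesis using * by simp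
qed

lemma of_nat_choose_neq_0: "r < p \<Longrightarrow> of_nat (r choose i) \<noteq> (0 :: 'a) \<longleftrightarrow> i \<le> r"
proof (cases "i \<le> r")
  case True
  assume "r < p"
  have "\<not> p dvd (r choose i)"
  proof
    assume "p dvd (r choose i)"
    then have "p dvd fact r" unfolding binomial_fact_lemma[OF True, symmetric] by simp
    then show False using \<open>r < p\<close> prime_dvd_fact_iff[OF prime_p] by simp
  qed
  then show ?thesis using True by (simp add: of_nat_eq_0_iff_char_dvd CHAR_p)
qed (simp add: not_le binomial_eq_0)

lemma binom_support_digits:
  assumes "r < p"
  shows "binom_support (r + p * n) = (\<lambda>(i, j). i + p * j) ` ({..r} \<times> binom_support n)"
proof (intro equalityI subsetI)
  fix k assume "k \<in> binom_support (r + p * n)"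
  then have "k mod p \<le> r" "k div p \<in> binom_support n"
    using of_nat_choose_neq_0[OF assms] by (auto simp: binom_support_def choose_digits[OF assms])
  then show "k \<in> (\<lambda>(i, j). i + p * j) ` ({..r} \<times> binom_support n)"
    by (intro image_eqI[where f = "\<lambda>(i, j). i + p * j" and x = "(k mod p, k div p)"]) auto
next
  fix k assume "k \<in> (\<lambda>(i, j). i + p * j) ` ({..r} \<times> binom_support n)"
  then obtain i j where "k = i + p * j" "i \<le> r" "j \<in> binom_support n" by auto
  then show "k \<in> binom_support (r + p * n)"
    using of_nat_choose_neq_0[OF assms, of i] assms unfolding binom_support_def mem_Collect_eq choose_digits[OF assms] by auto
qed

lemma card_binom_support_digits:
  assumes "r < p" shows "card (binom_support (r + p * n)) = Suc r * card (binom_support n)"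
proof -
  have "inj_on (\<lambda>(i, j). i + p * j) ({..r} \<times> binom_support n)"
  proof (rule inj_onI)
    fix z z' assume z: "z \<in> {..r} \<times> binom_support n" "z' \<in> {..r} \<times> binom_support n"
      and eq: "(\<lambda>(i, j). i + p * j) z = (\<lambda>(i, j). i + p * j) z'"
    obtain i j i' j' where ij: "z = (i, j)" "z' = (i', j')"
      using surj_pair[of z] surj_pair[of z'] by blast
    then have lt: "i < p" "i' < p" and eq: "i + p * j = i' + p * j'" using assms z eq by auto
    have "(i + p * j) mod p = i" "(i + p * j) div p = j" "(i' + p * j') mod p = i'" "(i' + p * j') div p = j'"
      using lt by auto
    then show "z = z'" using eq ij by metis
  qed
  then show ?thesis unfolding binom_support_digits[OF assms] by (simp add: card_image card_cartesian_product)
qed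

definition Lmod :: "('a ^ 2 ^ 2 \<Rightarrow> 'a ^ 2 ^ 2) \<Rightarrow> nat \<Rightarrow> ('a, 'a \<times> 'a \<Rightarrow> 'a, 'a ^ 2 ^ 2) gmodule"
  where "Lmod \<sigma> m = funmod (\<lambda>A. rowact (\<lambda>c. c) (\<sigma> A)) (\<lambda>c. c) (lforms m)"

lemma group_module_Lmod:
  "\<sigma> \<in> hom SL2 SL2 \<Longrightarrow> m < CARD('a) \<Longrightarrow> group_module SL2 (Lmod \<sigma> m)"
  unfolding Lmod_def
  by (intro group_module_funmod group_SL2 point_action_rowact fun_subspace_lforms lforms_rowact)

lemma fg_Lmod: "\<sigma> \<in> hom SL2 SL2 \<Longrightarrow> m < CARD('a) \<Longrightarrow> fg_module SL2 (Lmod \<sigma> m)"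
  using group_module_Lmod finite_lforms by (simp add: SL2.fg_iff Lmod_def)

lemma frob_hom_p: "frob (p ^ i) \<in> hom (SL2 :: ('a ^ 2 ^ 2) monoid) SL2"
  by (rule frob_power_hom[OF prime_p CHAR_p])

text \<open>Steinberg's tensor product decomposition, one digit at a time.\<close>

lemma Lmod_tensor:
  assumes r: "r < p" and m: "r + p * n < CARD('a)"
  shows "gmodule_isomorphic SL2 (tensor (Hmod (\<lambda>c. c) (frob (p ^ i)) r) (Lmod (frob (p ^ Suc i)) n))
    (Lmod (frob (p ^ i)) (r + p * n))"
proof -
  interpret twisted_forms "\<lambda>c :: 'a. c" "frob (p ^ i)" by unfold_locales (rule frob_hom_p)
  have n: "n < CARD('a)"
  proof -
    have "1 * n \<le> p * n" using prime_gt_0_nat[OF prime_p] by (intro mult_right_mono) auto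
    then show ?thesis using m by linarith
  qed
  \<comment> \<open>The Frobenius map of the plane intertwines the action through
    \<open>frob (p ^ i)\<close> with the one through \<open>frob (p ^ Suc i)\<close>; the second
    factor is pulled back along it.\<close>
  let ?\<pi> = "\<lambda>v :: 'a \<times> 'a. (fst v ^ p, snd v ^ p)"
  show ?thesis unfolding Hmod_def Lmod_def
  proof (rule tensor_funmod[where m = "Suc r" and \<pi> = "\<lambda>v. v" and \<pi>' = ?\<pi>])
    show "group_module SL2 (funmod (\<lambda>A. rowact (\<lambda>c. c) (frob (p ^ i) A)) (\<lambda>c. c) (F r))"
      using group_module_H by (simp add: Hmod_def)
    show "group_module SL2 (funmod (\<lambda>A. rowact (\<lambda>c. c) (frob (p ^ Suc i) A)) (\<lambda>c. c) (lforms n))"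
      using group_module_Lmod[OF frob_hom_p n] by (simp only: Lmod_def)
    show "group_module SL2 (funmod (\<lambda>A. rowact (\<lambda>c. c) (frob (p ^ i) A)) (\<lambda>c. c) (lforms (r + p * n)))"
      using group_module_Lmod[OF frob_hom_p m] by (simp only: Lmod_def)
    show "card (F r) = CARD('a) ^ Suc r" using m by (intro card_F) (simp add: large_def)
    show "card (lforms (r + p * n)) = card (lforms n) ^ Suc r"
      unfolding card_lforms[OF m] card_lforms[OF n] card_binom_support_digits[OF r]
      by (simp only: power_mult[symmetric] mult.commute)
    show "?\<pi> (rowact (\<lambda>c. c) (frob (p ^ i) A) w) = rowact (\<lambda>c. c) (frob (p ^ Suc i) A) (?\<pi> w)" for A and w :: "'a \<times> 'a"
      by (simp add: rowact_def freshman power_mult_distrib power_mult[symmetric] mult.commute)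
    have e: "fst v ^ a * snd v ^ (r - a) * (fst (?\<pi> v) ^ b * snd (?\<pi> v) ^ (n - b)) =
        fst v ^ (a + p * b) * snd v ^ (r + p * n - (a + p * b))" if "a \<le> r" "b \<le> n" for a b and v :: "'a \<times> 'a"
    proof -
      have "p * b \<le> p * n" using that by simp
      then have "r + p * n - (a + p * b) = (r - a) + p * (n - b)" using that by (simp add: diff_mult_distrib2)
      then show ?thesis by (simp only: fst_conv snd_conv power_add power_mult mult.assoc mult.left_commute)
    qed
    have support: "a + p * b \<in> binom_support (r + p * n)" if "a \<le> r" "b \<in> binom_support n" for a b
      unfolding binom_support_digits[OF r] using that by force
    show "(\<lambda>w. \<phi> w * \<psi> (?\<pi> w)) \<in> lforms (r + p * n)" if \<phi>\<psi>: "\<phi> \<in> F r" "\<psi> \<in> lforms n" for \<phi> \<psi>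
    proof -
      have mono: "(\<lambda>w. (fst w ^ a * snd w ^ (r - a)) * \<psi> (?\<pi> w)) \<in> lforms (r + p * n)" if a: "a \<le> r" for a
      proof -
        have "lforms n \<subseteq> {\<psi>. (\<lambda>w. \<psi> (?\<pi> w) * (fst w ^ a * snd w ^ (r - a))) \<in> lforms (r + p * n)}"
          unfolding lforms_def[of n]
        proof (rule forms_subset[OF binom_support_subset fun_subspace_mult[OF fun_subspace_lforms]])
          fix b assume b: "b \<in> binom_support n"
          then have "b \<le> n" using binom_support_subset by auto
          from monomial_in_forms[OF support[OF a b]] subsetD[OF binom_support_subset support[OF a b]]
          have "(\<lambda>v. fst v ^ (a + p * b) * snd v ^ (r + p * n - (a + p * b))) \<in> lforms (r + p * n)"
            by (simp add: lforms_def)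
          then show "(\<lambda>v. fst v ^ b * snd v ^ (n - b)) \<in>
              {\<psi>. (\<lambda>w. \<psi> (?\<pi> w) * (fst w ^ a * snd w ^ (r - a))) \<in> lforms (r + p * n)}"
            unfolding e[OF a \<open>b \<le> n\<close>, symmetric] by (simp only: mem_Collect_eq mult.commute)
        qed
        then have "(\<lambda>w. \<psi> (?\<pi> w) * (fst w ^ a * snd w ^ (r - a))) \<in> lforms (r + p * n)" using \<phi>\<psi>(2) by blast
        then show ?thesis by (simp only: mult.commute)
      qed
      have "F r \<subseteq> {\<phi>. (\<lambda>w. \<phi> w * \<psi> (?\<pi> w)) \<in> lforms (r + p * n)}"
        by (rule forms_subset[OF order_refl fun_subspace_mult[OF fun_subspace_lforms]]) (use mono in auto)
      then show ?thesis using \<phi>\<psi>(1) by blast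
    qed
    show "lforms (r + p * n) \<subseteq> U" if U: "fun_subspace (\<lambda>c. c) U"
      "\<And>\<phi> \<psi>. \<phi> \<in> F r \<Longrightarrow> \<psi> \<in> lforms n \<Longrightarrow> (\<lambda>w. \<phi> w * \<psi> (?\<pi> w)) \<in> U" for U
      unfolding lforms_def
    proof (rule forms_subset[OF binom_support_subset U(1)])
      fix k assume "k \<in> binom_support (r + p * n)"
      then obtain a b where ab: "k = a + p * b" "a \<le> r" "b \<in> binom_support n" unfolding binom_support_digits[OF r] by auto
      then have b: "b \<le> n" using binom_support_subset by auto
      have "(\<lambda>v. fst v ^ a * snd v ^ (r - a)) \<in> F r" using monomial_in_forms[of a "{..r}" r] ab(2) by simp
      moreover have "(\<lambda>v. fst v ^ b * snd v ^ (n - b)) \<in> lforms n"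
        unfolding lforms_def by (rule monomial_in_forms[OF ab(3) b])
      ultimately show "(\<lambda>v. fst v ^ k * snd v ^ (r + p * n - k)) \<in> U"
        using U(2) unfolding ab(1) e[OF ab(2) b, symmetric] by blast
    qed
  qed (simp_all add: finite_F finite_lforms)
qed

lemma twisted_class_Suc: "(twisted_class (p ^ Suc i) :: 'a k0) = evalz (f_poly p) (twisted_class (p ^ i))"
  using twisted_class_frob[OF prime_p CHAR_p, of i] twisted_class_frob[OF prime_p CHAR_p, of "Suc i"]
  by (simp add: f_iter_Suc)

text \<open>Peeling off the lowest digit twists the remaining factor once more, so the induction on
  m has to treat all twists i together.\<close>

lemma cl_Lmod:
  "m < CARD('a) \<Longrightarrow> cl (Lmod (frob (p ^ i)) m) = evalz (ebasis p m) (twisted_class (p ^ i))"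
proof (induction m arbitrary: i rule: less_induct)
  case (less m)
  interpret twisted_forms "\<lambda>c :: 'a. c" "frob (p ^ i)" by unfold_locales (rule frob_hom_p)
  have p: "p \<ge> 2" by (rule prime_ge_2_nat[OF prime_p])
  show ?case
  proof (cases "m = 0")
    case True
    have "binom_support 0 = {..0}" using binom_support_subset[of 0] by (auto simp: binom_support_def)
    then have "Lmod (frob (p ^ i)) 0 = H 0" by (simp add: Lmod_def Hmod_def lforms_def)
    then show ?thesis using cl_H_0 True by (simp add: ebasis.simps)
  next
    case False
    define r n where "r = m mod p" and "n = m div p"
    have m: "m = r + p * n" "r < p" "n < m" using False p by (auto simp: r_def n_def)
    have r: "large TYPE('a) r" using less.prems m by (simp add: large_def)
    have n: "n < CARD('a)" using m(3) less.prems by simp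
    have lt: "r + p * n < CARD('a)" using m(1) less.prems by simp
    have "cl (Lmod (frob (p ^ i)) m) = cl (tensor (H r) (Lmod (frob (p ^ Suc i)) n))"
      unfolding m(1)
      by (rule cl_isomorphic[OF SL2.fg_tensor[OF fg_H fg_Lmod[OF frob_hom_p n]] fg_Lmod[OF frob_hom_p lt]
        Lmod_tensor[OF m(2) lt], symmetric])
    also have "\<dots> = cl (H r) * cl (Lmod (frob (p ^ Suc i)) n)"
      by (rule cl_tensor[OF fg_H fg_Lmod[OF frob_hom_p n]])
    also have "\<dots> = evalz (cheb r) (twisted_class (p ^ i)) * evalz (ebasis p n) (twisted_class (p ^ Suc i))"
      unfolding cl_H[OF r] less.IH[OF m(3) n] ..
    also have "\<dots> = evalz (ebasis p m) (twisted_class (p ^ i))"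
      using False p unfolding twisted_class_Suc by (simp add: ebasis.simps[of p m] r_def n_def)
    finally show ?thesis .
  qed
qed

end


section \<open>Classification of the simple modules\<close>

text \<open>The twisted sum over a unipotent group with the least exponent that does not vanish is
  invariant, because a translation changes it only by sums with smaller exponents.\<close>

lemma fixed_function:
  fixes \<rho> :: "'a::{field,finite} \<Rightarrow> 'y \<Rightarrow> 'y" and \<phi> :: "'y \<Rightarrow> 'a"
  assumes add: "\<And>s t y. y \<in> Y \<Longrightarrow> \<rho> s (\<rho> t y) = \<rho> (s + t) y"
    and zero: "\<And>y. y \<in> Y \<Longrightarrow> \<rho> 0 y = y" and nz: "y0 \<in> Y" "\<phi> y0 \<noteq> 0"
  obtains k where "\<exists>y\<in>Y. (\<Sum>s\<in>UNIV. s ^ k * \<phi> (\<rho> s y)) \<noteq> 0"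
    "\<And>t y. y \<in> Y \<Longrightarrow> (\<Sum>s\<in>UNIV. s ^ k * \<phi> (\<rho> s (\<rho> t y))) = (\<Sum>s\<in>UNIV. s ^ k * \<phi> (\<rho> s y))"
proof -
  define \<psi> where "\<psi> k y = (\<Sum>s\<in>UNIV. s ^ k * \<phi> (\<rho> s y))" for k y
  have "\<exists>k. \<exists>y\<in>Y. \<psi> k y \<noteq> 0"
  proof (rule ccontr)
    assume "\<not> ?thesis"
    then have 0: "\<psi> 0 y0 - \<psi> (CARD('a) - 1) y0 = 0" using nz(1) by simp
    \<comment> \<open>The function 1 - s^(q-1) is the indicator of s = 0, so the difference of these
      two sums at \<open>y0\<close> is \<open>\<phi> y0\<close>. Hence not all sums vanish.\<close>
    have "\<psi> 0 y0 - \<psi> (CARD('a) - 1) y0 = (\<Sum>s\<in>UNIV. (1 - s ^ (CARD('a) - 1)) * \<phi> (\<rho> s y0))"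
      by (simp add: \<psi>_def left_diff_distrib sum_subtractf)
    also have "\<dots> = (\<Sum>s\<in>UNIV. if s = (0 :: 'a) then \<phi> y0 else 0)"
    proof (rule sum.cong[OF refl])
      fix s :: 'a
      show "(1 - s ^ (CARD('a) - 1)) * \<phi> (\<rho> s y0) = (if s = 0 then \<phi> y0 else 0)"
        using card_field_ge_2[where 'a = 'a] field_power_card[of s] zero[OF nz(1)]
        by (cases "s = 0") (simp_all add: zero_power)
    qed
    also have "\<dots> = \<phi> y0" by simp
    finally show False using nz(2) 0 by simp
  qed
  then obtain k where k: "\<exists>y\<in>Y. \<psi> k y \<noteq> 0" "\<And>j. j < k \<Longrightarrow> \<not> (\<exists>y\<in>Y. \<psi> j y \<noteq> 0)"
    using exists_least_iff[of "\<lambda>k. \<exists>y\<in>Y. \<psi> k y \<noteq> 0"] by blast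
  have "\<psi> k (\<rho> t y) = \<psi> k y" if y: "y \<in> Y" for t y
  proof -
    have "\<psi> k (\<rho> t y) = (\<Sum>s\<in>UNIV. s ^ k * \<phi> (\<rho> (s + t) y))" by (simp add: \<psi>_def add[OF y])
    also have "\<dots> = (\<Sum>s\<in>UNIV. (s + - t) ^ k * \<phi> (\<rho> s y))"
      by (rule sum.reindex_bij_witness[of _ "\<lambda>s. s - t" "\<lambda>s. s + t"]) auto
    also have "\<dots> = (\<Sum>s\<in>UNIV. \<Sum>j\<le>k. of_nat (k choose j) * (- t) ^ (k - j) * (s ^ j * \<phi> (\<rho> s y)))"
      unfolding binomial_ring sum_distrib_right by (intro sum.cong refl) (simp only: mult_ac)
    also have "\<dots> = (\<Sum>j\<le>k. of_nat (k choose j) * (- t) ^ (k - j) * \<psi> j y)"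
      by (subst sum.swap) (simp add: \<psi>_def sum_distrib_left)
    also have "\<dots> = (\<Sum>j\<le>k. if j = k then \<psi> k y else 0)"
    proof (rule sum.cong[OF refl])
      fix j assume "j \<in> {..k}"
      then show "of_nat (k choose j) * (- t) ^ (k - j) * \<psi> j y = (if j = k then \<psi> k y else 0)"
        using k(2)[of j] y by (cases "j = k") auto
    qed
    finally show ?thesis by simp
  qed
  with k(1) that[of k] show thesis unfolding \<psi>_def by blast
qed

text \<open>The geometric series together with w^(q-1) = 1. For w = 1 the number of terms, q - 1, is
  -1 in the field. With w = t/u this is the Fourier inversion on units used in
  \<open>invariant_cases\<close>.\<close>

lemma sum_power_units:
  assumes "w \<noteq> (0 :: 'a::{field,finite})"
  shows "(\<Sum>k<CARD('a) - 1. w ^ k) = (if w = 1 then - 1 else 0)"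
proof (cases "w = 1")
  case True then show ?thesis using of_nat_CARD_minus_1[where 'a = 'a] by simp
next
  case False
  have "(1 - w) * (\<Sum>k<CARD('a) - 1. w ^ k) = 0"
    using one_diff_power_eq[of w "CARD('a) - 1"] field_power_card[OF assms] by simp
  then show ?thesis using False by simp
qed

section \<open>Explicit matrices\<close>

definition mat2 :: "'a \<Rightarrow> 'a \<Rightarrow> 'a \<Rightarrow> 'a \<Rightarrow> 'a::comm_ring_1 ^ 2 ^ 2"
  where "mat2 a b c d = vector [vector [a, b], vector [c, d]]"

lemma mat2_nth [simp]:
  "mat2 a b c d $ 1 $ 1 = a" "mat2 a b c d $ 1 $ 2 = b" "mat2 a b c d $ 2 $ 1 = c" "mat2 a b c d $ 2 $ 2 = d"
  by (simp_all add: mat2_def)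

lemma mat2_SL2: "a * d - b * c = 1 \<Longrightarrow> mat2 a b c (d :: 'a::field) \<in> carrier SL2"
  by (simp add: SL2_def det_2)

lemma vec_2_2_eqI:
  fixes A B :: "'a ^ 2 ^ 2"
  assumes "A $ 1 $ 1 = B $ 1 $ 1" "A $ 1 $ 2 = B $ 1 $ 2" "A $ 2 $ 1 = B $ 2 $ 1" "A $ 2 $ 2 = B $ 2 $ 2"
  shows "A = B"
proof -
  have "A $ i $ j = B $ i $ j" for i j using exhaust_2[of i] exhaust_2[of j] assms by metis
  then show ?thesis by (intro iffD2[OF vec_eq_iff] allI)
qed

lemma mat2_mult: "mat2 a b c d ** A = mat2 (a * A $ 1 $ 1 + b * A $ 2 $ 1) (a * A $ 1 $ 2 + b * A $ 2 $ 2)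
    (c * A $ 1 $ 1 + d * A $ 2 $ 1) (c * A $ 1 $ 2 + d * A $ 2 $ 2)"
  by (rule vec_2_2_eqI) (simp_all add: matrix_matrix_mult_def sum_2)

context finite_char begin

section \<open>Invariant functions in stable function spaces\<close>

abbreviation ract :: "'a ^ 2 ^ 2 \<Rightarrow> 'a \<times> 'a \<Rightarrow> 'a \<times> 'a"
  where "ract \<equiv> rowact (\<lambda>c. c)"

definition stable :: "('a \<times> 'a \<Rightarrow> 'a) set \<Rightarrow> bool"
  where "stable V \<longleftrightarrow> fun_subspace (\<lambda>c. c) V \<and> (\<forall>A\<in>carrier SL2. \<forall>\<phi>\<in>V. (\<lambda>v. \<phi> (ract A v)) \<in> V)"

lemma stable_subspace: "stable V \<Longrightarrow> fun_subspace (\<lambda>c. c) V"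
  by (simp add: stable_def)

lemma stable_comp:
  assumes "stable V" "\<phi> \<in> V" "a * d - b * c = 1"
  shows "(\<lambda>v. \<phi> (fst v * a + snd v * c, fst v * b + snd v * d)) \<in> V"
  using assms mat2_SL2[OF assms(3)] by (force simp: stable_def rowact_def)

text \<open>Invariance under the unipotent matrices \<open>mat2 1 s 0 1\<close>, which send (x, y)
  to (x, y + s x). For x \<noteq> 0 such a function depends on x alone; on x = 0 it is
  unrestricted.\<close>

definition invariant :: "('a \<times> 'a \<Rightarrow> 'a) \<Rightarrow> bool"
  where "invariant \<psi> \<longleftrightarrow> (\<forall>s x y. \<psi> (x, y + s * x) = \<psi> (x, y))"

definition punctured :: "'a \<times> 'a \<Rightarrow> 'a"
  where "punctured v = (if v = (0, 0) then 0 else 1)"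

lemma exists_invariant:
  assumes V: "stable V" and F: "F \<in> V" "F v0 \<noteq> 0"
  obtains \<psi> v where "\<psi> \<in> V" "invariant \<psi>" "\<psi> v \<noteq> 0"
proof -
  let ?\<rho> = "\<lambda>s (v :: 'a \<times> 'a). (fst v, snd v + s * fst v)"
  obtain k where k: "\<exists>y\<in>UNIV. (\<Sum>s\<in>UNIV. s ^ k * F (?\<rho> s y)) \<noteq> 0"
    "\<And>t y. y \<in> UNIV \<Longrightarrow> (\<Sum>s\<in>UNIV. s ^ k * F (?\<rho> s (?\<rho> t y))) = (\<Sum>s\<in>UNIV. s ^ k * F (?\<rho> s y))"
    by (rule fixed_function[of UNIV ?\<rho> v0 F]) (use F(2) in \<open>auto simp: algebra_simps\<close>)
  have "(\<lambda>v. \<Sum>s\<in>UNIV. s ^ k * F (?\<rho> s v)) \<in> V"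
  proof (intro fun_subspace_sum[OF stable_subspace[OF V]] fun_subspaceD(3)[OF stable_subspace[OF V]])
    show "(\<lambda>v. F (?\<rho> s v)) \<in> V" for s
      using stable_comp[OF V F(1), of 1 1 s 0] by (simp add: mult.commute add.commute)
  qed
  moreover have "invariant (\<lambda>v. \<Sum>s\<in>UNIV. s ^ k * F (?\<rho> s v))"
    unfolding invariant_def
  proof (intro allI)
    fix t x y :: 'a
    show "(\<Sum>s\<in>UNIV. s ^ k * F (?\<rho> s (x, y + t * x))) = (\<Sum>s\<in>UNIV. s ^ k * F (?\<rho> s (x, y)))"
      using k(2)[of "(x, y)" t] by (simp only: fst_conv snd_conv UNIV_I)
  qed
  ultimately show thesis using k(1) that by blast
qed

lemma invariant_fst:
  assumes "invariant \<psi>" "x \<noteq> 0" shows "\<psi> (x, y) = \<psi> (x, 0)"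
proof -
  have "\<psi> (x, 0 + (y / x) * x) = \<psi> (x, 0)" using assms(1) unfolding invariant_def by blast
  then show ?thesis using assms(2) by simp
qed

text \<open>The sum of the translates of \<open>\<psi>\<close> by a Weyl element combined with each
  unipotent matrix; on invariant functions this is the Hecke operator of the Weyl element. It stays
  inside every stable space and produces functions that vanish on x = 0.\<close>

definition weyl_sum :: "('a \<times> 'a \<Rightarrow> 'a) \<Rightarrow> 'a \<times> 'a \<Rightarrow> 'a"
  where "weyl_sum \<psi> v = (\<Sum>s\<in>UNIV. \<psi> (- (snd v + s * fst v), fst v))"

lemma weyl_sum_in:
  assumes V: "stable V" and \<psi>: "\<psi> \<in> V" shows "weyl_sum \<psi> \<in> V"
proof -
  have "(\<lambda>v. \<psi> (- snd v, fst v)) \<in> V" using stable_comp[OF V \<psi>, of 0 0 1 "-1"] by simp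
  from stable_comp[OF V this, of 1 1 _ 0]
  have "(\<lambda>v. \<psi> (- (snd v + s * fst v), fst v)) \<in> V" for s by (simp add: mult.commute add.commute)
  then have "(\<lambda>v. \<Sum>s\<in>UNIV. \<psi> (- (snd v + s * fst v), fst v)) \<in> V"
    by (intro fun_subspace_sum[OF stable_subspace[OF V]])
  then show ?thesis by (simp add: weyl_sum_def[abs_def])
qed

text \<open>For x = 0 all q summands are equal and cancel in characteristic p. For x \<noteq> 0 the
  first argument runs once through the field, and invariance moves the second argument to 0 wherever
  the first is nonzero.\<close>

lemma weyl_sum_eq:
  assumes "invariant \<psi>"
  shows "weyl_sum \<psi> (x, y) = (if x = 0 then 0 else \<psi> (0, x) + (\<Sum>z\<in>UNIV - {0}. \<psi> (z, 0)))"
proof (cases "x = 0")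
  case True
  then show ?thesis by (simp add: weyl_sum_def of_nat_CARD)
next
  case False
  have "weyl_sum \<psi> (x, y) = (\<Sum>z\<in>UNIV. \<psi> (z, x))"
    unfolding weyl_sum_def
    by (rule sum.reindex_bij_witness[of _ "\<lambda>z. (- z - y) / x" "\<lambda>s. - (y + s * x)"]) (use False in \<open>auto simp: field_simps\<close>)
  also have "\<dots> = \<psi> (0, x) + (\<Sum>z\<in>UNIV - {0}. \<psi> (z, x))" by (simp add: sum.remove)
  also have "(\<Sum>z\<in>UNIV - {0}. \<psi> (z, x)) = (\<Sum>z\<in>UNIV - {0}. \<psi> (z, 0))"
    by (intro sum.cong refl) (rule invariant_fst[OF assms], simp)
  finally show ?thesis using False by simp
qed

text \<open>Such a G is given by its values G(x, 0) at units and by the constant d. If a weight k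
  strictly between 0 and q - 1 occurs in G(x, 0), the diagonal matrices isolate x^k. Otherwise G(x,
  0) is a constant e: for d = e the function is a multiple of \<open>punctured\<close>, and for d
  \<noteq> e the operator \<open>weyl_sum\<close> yields x^(q-1).\<close>

lemma invariant_cases:
  assumes V: "stable V" and G: "G \<in> V" "invariant G" "G v0 \<noteq> 0" "G (0, 0) = 0" and d: "\<And>y. y \<noteq> 0 \<Longrightarrow> G (0, y) = d"
  shows "(\<exists>m. 0 < m \<and> m < CARD('a) \<and> (\<lambda>v. fst v ^ m) \<in> V) \<or> punctured \<in> V"
proof -
  define c where "c k = (\<Sum>t\<in>UNIV - {0}. inverse t ^ k * G (t, 0))" for k
  note smult = fun_subspaceD(3)[OF stable_subspace[OF V]]
  show ?thesis
  proof (cases "\<exists>k. 0 < k \<and> k < CARD('a) - 1 \<and> c k \<noteq> 0")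
    case True
    then obtain k where k: "0 < k" "k < CARD('a) - 1" "c k \<noteq> 0" by blast
    \<comment> \<open>The sum over diagonal matrices against the character t^(-k) projects to weight
      k. On x = 0 it also vanishes, because G is constant on the nonzero y there and 0 < k < q -
      1.\<close>
    have "(\<Sum>t\<in>UNIV - {0}. inverse t ^ k * G (fst v * t, snd v * inverse t)) = c k * fst v ^ k" for v
    proof (cases "fst v = 0")
      case True
      have "(\<Sum>t\<in>UNIV - {0}. inverse t ^ k * G (fst v * t, snd v * inverse t)) =
          (\<Sum>t\<in>UNIV - {0}. inverse t ^ k * t ^ 0) * G (0, snd v)"
        unfolding sum_distrib_right
      proof (intro sum.cong refl)
        fix t :: 'a assume "t \<in> UNIV - {0}"
        then have "G (fst v * t, snd v * inverse t) = G (0, snd v)"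
          using True d[of "snd v * inverse t"] d[of "snd v"] by (cases "snd v = 0") simp_all
        then show "inverse t ^ k * G (fst v * t, snd v * inverse t) = inverse t ^ k * t ^ 0 * G (0, snd v)"
          by simp
      qed
      also have "\<dots> = 0" using sum_units_power[of k 0, where 'a = 'a] k by simp
      finally show ?thesis using True k by simp
    next
      case False
      have "(\<Sum>t\<in>UNIV - {0}. inverse t ^ k * G (fst v * t, snd v * inverse t)) =
          (\<Sum>t\<in>UNIV - {0}. inverse t ^ k * G (fst v * t, 0))"
        using False
        by (intro sum.cong refl) (subst invariant_fst[OF G(2)], simp_all)
      also have "\<dots> = (\<Sum>t\<in>UNIV - {0}. fst v ^ k * (inverse t ^ k * G (t, 0)))"
        by (rule sum.reindex_bij_witness[of _ "\<lambda>t. t / fst v" "\<lambda>t. fst v * t"])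
          (use False in \<open>auto simp: power_mult_distrib field_simps\<close>)
      finally show ?thesis by (simp add: c_def sum_distrib_left mult.commute)
    qed
    moreover have "(\<lambda>v. \<Sum>t\<in>UNIV - {0}. inverse t ^ k * G (fst v * t, snd v * inverse t)) \<in> V"
    proof (intro fun_subspace_sum[OF stable_subspace[OF V]] smult)
      show "(\<lambda>v. G (fst v * t, snd v * inverse t)) \<in> V" if "t \<in> UNIV - {0}" for t
        using stable_comp[OF V G(1), of t "inverse t" 0 0] that by simp
    qed
    ultimately have "(\<lambda>v. c k * fst v ^ k) \<in> V" by (simp only:)
    from smult[OF this, of "inverse (c k)"] have "(\<lambda>v. fst v ^ k) \<in> V" using k(3) by (simp flip: mult.assoc)
    then show ?thesis using k by (intro disjI1 exI[of _ k]) simp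
  next
    case False
    \<comment> \<open>Fourier inversion on the unit group recovers G(t, 0) from the coefficients
      c_k, of which only c_0 is left.\<close>
    have const: "G (t, 0) = - c 0" if t: "t \<noteq> 0" for t
    proof -
      have "- G (t, 0) = (\<Sum>u\<in>UNIV - {0}. if u = t then - G (t, 0) else 0)" using t by simp
      also have "\<dots> = (\<Sum>u\<in>UNIV - {0}. (\<Sum>k<CARD('a) - 1. (t * inverse u) ^ k) * G (u, 0))"
      proof (intro sum.cong refl)
        fix u :: 'a assume u: "u \<in> UNIV - {0}"
        have "t * inverse u = 1 \<longleftrightarrow> u = t" using u by (auto simp: field_simps)
        then show "(if u = t then - G (t, 0) else 0) = (\<Sum>k<CARD('a) - 1. (t * inverse u) ^ k) * G (u, 0)"
          using sum_power_units[of "t * inverse u"] u t by simp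
      qed
      also have "\<dots> = (\<Sum>u\<in>UNIV - {0}. \<Sum>k<CARD('a) - 1. t ^ k * (inverse u ^ k * G (u, 0)))"
        by (simp only: sum_distrib_right power_mult_distrib mult.assoc)
      also have "\<dots> = (\<Sum>k<CARD('a) - 1. t ^ k * c k)"
        by (subst sum.swap) (simp add: c_def sum_distrib_left)
      also have "\<dots> = (\<Sum>k<CARD('a) - 1. if k = 0 then c 0 else 0)"
        using False by (intro sum.cong) auto
      also have "\<dots> = c 0" using card_field_ge_2[where 'a = 'a] by simp
      finally show ?thesis by (rule minus_equation_iff[THEN iffD1, symmetric])
    qed
    define e where "e = - c 0"
    have eG: "G (x, y) = (if x \<noteq> 0 then e else if y \<noteq> 0 then d else 0)" for x y
      using const[of x] invariant_fst[OF G(2), of x y] d[of y] G(4) by (auto simp: e_def)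
    show ?thesis
    proof (cases "d = e")
      case True
      have G': "G = (\<lambda>v. e * punctured v)" using eG True by (auto simp: fun_eq_iff punctured_def)
      then have "e \<noteq> 0" using G(3) by auto
      then have "punctured = (\<lambda>v. inverse e * G v)" unfolding G' by (simp add: fun_eq_iff)
      then show ?thesis using smult[OF G(1), of "inverse e"] by simp
    next
      case False
      \<comment> \<open>The q - 1 values e add up to -e, and x^(q-1) is the indicator of x \<noteq>
        0.\<close>
      have "weyl_sum G v = (d - e) * fst v ^ (CARD('a) - 1)" for v
      proof -
        have "(\<Sum>z\<in>UNIV - {0}. G (z, 0)) = (\<Sum>z\<in>UNIV - {0 :: 'a}. e)" by (rule sum.cong) (auto simp: eG)
        also have "\<dots> = - e" using of_nat_CARD_minus_1[where 'a = 'a] by (simp add: card_Diff_singleton)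
        finally show ?thesis
          using weyl_sum_eq[OF G(2), of "fst v" "snd v"] field_power_card[of "fst v"] card_field_ge_2[where 'a = 'a]
          by (auto simp: eG zero_power)
      qed
      then have "(\<lambda>v. fst v ^ (CARD('a) - 1)) = (\<lambda>v. inverse (d - e) * weyl_sum G v)"
        using False by (simp add: fun_eq_iff)
      also have "\<dots> \<in> V" by (rule smult[OF weyl_sum_in[OF V G(1)]])
      finally show ?thesis using card_field_ge_2[where 'a = 'a] by (intro disjI1 exI[of _ "CARD('a) - 1"]) simp
    qed
  qed
qed

text \<open>Start from a nonzero invariant \<open>\<psi>\<close>. If \<open>weyl_sum \<psi>\<close>
  is nonzero, it meets the hypotheses of \<open>invariant_cases\<close> with d = 0. If it is zero,
  then \<open>weyl_sum_eq\<close> forces \<open>\<psi>\<close> to be constant on the nonzero points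
  of x = 0, and \<open>\<psi>\<close> itself qualifies.\<close>

lemma stable_cases:
  assumes V: "stable V" and zero: "\<And>F. F \<in> V \<Longrightarrow> F (0, 0) = 0" and F: "F \<in> V" "F v0 \<noteq> 0"
  shows "(\<exists>m. 0 < m \<and> m < CARD('a) \<and> (\<lambda>v. fst v ^ m) \<in> V) \<or> punctured \<in> V"
proof -
  obtain \<psi> v1 where \<psi>: "\<psi> \<in> V" "invariant \<psi>" "\<psi> v1 \<noteq> 0" by (rule exists_invariant[OF V F])
  note W = weyl_sum_in[OF V \<psi>(1)] and w = weyl_sum_eq[OF \<psi>(2)]
  show ?thesis
  proof (cases "\<exists>v. weyl_sum \<psi> v \<noteq> 0")
    case True
    then obtain v where v: "weyl_sum \<psi> v \<noteq> 0" by blast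
    have "invariant (weyl_sum \<psi>)" by (simp add: invariant_def w)
    from invariant_cases[OF V W this v zero[OF W], of 0] show ?thesis by (simp add: w)
  next
    case False
    have "\<psi> (0, y) = - (\<Sum>z\<in>UNIV - {0}. \<psi> (z, 0))" if "y \<noteq> 0" for y
      using False w[of y 0] that by (simp add: eq_neg_iff_add_eq_0)
    from invariant_cases[OF V \<psi> zero[OF \<psi>(1)] this] show ?thesis by blast
  qed
qed

section \<open>Simplicity and distinctness of the modules \<open>L m\<close>\<close>

lemma stable_lforms: "m < CARD('a) \<Longrightarrow> stable (lforms m)"
  by (simp add: stable_def fun_subspace_lforms lforms_rowact)

lemma fst_power_in_lforms: "(\<lambda>v. fst v ^ m) \<in> lforms m"
  using pw_in_lforms[of 1 0 m] by simp

text \<open>The group is transitive on nonzero linear forms, so the translates of x^m are all the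
  m-th powers of such forms.\<close>

lemma lforms_subset_stable:
  assumes V: "stable V" and m: "0 < m" "m < CARD('a)" and "(\<lambda>v. fst v ^ m) \<in> V"
  shows "lforms m \<subseteq> V"
proof (rule lforms_subset[OF m(2) stable_subspace[OF V]])
  fix \<alpha> \<beta> :: 'a
  consider "\<alpha> \<noteq> 0" | "\<alpha> = 0" "\<beta> \<noteq> 0" | "\<alpha> = 0" "\<beta> = 0" by blast
  then show "pw m \<alpha> \<beta> \<in> V"
  proof cases
    case 1 then show ?thesis using stable_comp[OF V assms(4), of \<alpha> "inverse \<alpha>" 0 \<beta>] by simp
  next
    case 2 then show ?thesis using stable_comp[OF V assms(4), of 0 0 "- inverse \<beta>" \<beta>] by simp
  next
    case 3 then show ?thesis using fun_subspaceD(1)[OF stable_subspace[OF V]] m by (simp add: zero_power)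
  qed
qed

text \<open>At x = 1 an invariant form is a polynomial in y of degree below q that takes the same
  value at all q points, hence is constant; only the monomial x^m survives.\<close>

lemma lforms_invariant:
  assumes m: "m < CARD('a)" and \<phi>: "\<phi> \<in> lforms m" "invariant \<phi>"
  obtains c where "\<phi> = (\<lambda>v. c * fst v ^ m)"
proof -
  obtain f where f: "\<phi> = hom_poly (\<lambda>c. c) m f" using \<phi>(1) by (auto simp: lforms_def forms_def)
  define h where "h = (\<Sum>a\<le>m. monom (coeff f a) (m - a)) - [:\<phi> (1, 0):]"
  have "h = 0"
  proof (rule poly_zero_large)
    show "large TYPE('a) m" using m by (simp add: large_def)
    show "degree h \<le> m" unfolding h_def
      by (intro degree_diff_le degree_sum_le) (auto intro: order_trans[OF degree_monom_le])
    fix y :: 'a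
    have "\<phi> (1, 0 + y * 1) = \<phi> (1, 0)" using \<phi>(2) unfolding invariant_def by blast
    then show "poly h y = 0" by (simp add: h_def poly_sum poly_monom f hom_poly_def)
  qed
  have "coeff f a = 0" if a: "a < m" for a
  proof -
    have "coeff h (m - a) = (\<Sum>b\<le>m. if b = a then coeff f b else 0)"
    proof -
      have "coeff [:\<phi> (1, 0):] (m - a) = 0" using a by (intro coeff_eq_0) simp
      moreover have "(\<Sum>b\<le>m. if m - b = m - a then coeff f b else 0) = (\<Sum>b\<le>m. if b = a then coeff f b else 0)"
        using a by (intro sum.cong) auto
      ultimately show ?thesis unfolding h_def by (simp only: coeff_diff coeff_sum coeff_monom diff_zero)
    qed
    then show ?thesis using a \<open>h = 0\<close> by simp
  qed
  then have "hom_poly (\<lambda>c. c) m f v = (\<Sum>a\<le>m. if a = m then coeff f m * fst v ^ m else 0)" for v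
    unfolding hom_poly_def by (intro sum.cong) auto
  then have "\<phi> = (\<lambda>v. coeff f m * fst v ^ m)" using f by (simp add: fun_eq_iff)
  then show thesis by (rule that)
qed

lemma lforms_0:
  assumes "\<phi> \<in> lforms 0" obtains c where "\<phi> = (\<lambda>v. c)"
  using assms unfolding lforms_def forms_def by (auto simp: hom_poly_def[abs_def])

lemma lforms_zero: "0 < m \<Longrightarrow> m < CARD('a) \<Longrightarrow> \<phi> \<in> lforms m \<Longrightarrow> \<phi> (0, 0) = 0"
proof -
  assume m: "0 < m" "m < CARD('a)" "\<phi> \<in> lforms m"
  have "lforms m \<subseteq> {\<phi>. \<phi> (0, 0) = 0}"
    by (rule lforms_subset[OF m(2)]) (use m(1) in \<open>auto simp: fun_subspace_def zero_power\<close>)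
  then show ?thesis using m by blast
qed

text \<open>By \<open>stable_cases\<close> V contains some x^k or the indicator. Both are invariant,
  so inside \<open>lforms m\<close> they are multiples of x^m; this turns x^k into x^m and excludes
  the indicator, whose value at (0, 1) is 1. Degree 0 is treated apart because constants do not
  vanish at the origin.\<close>

lemma lforms_minimal:
  assumes m: "m < CARD('a)" and V: "stable V" "V \<subseteq> lforms m" "\<phi> \<in> V" "\<phi> v \<noteq> 0"
  shows "V = lforms m"
proof (cases "m = 0")
  case True
  then have "\<phi> \<in> lforms 0" using V by blast
  then obtain c where c: "\<phi> = (\<lambda>v. c)" by (rule lforms_0)
  have "(\<lambda>v. inverse c * \<phi> v) \<in> V" by (rule fun_subspaceD(3)[OF stable_subspace[OF V(1)] V(3)])
  then have "(\<lambda>v. 1) \<in> V" using c V(4) by simp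
  then have "lforms m \<subseteq> V" using True m by (intro lforms_subset[OF m stable_subspace[OF V(1)]]) simp
  then show ?thesis using V(2) by blast
next
  case False
  have zero: "F (0, 0) = 0" if "F \<in> V" for F using lforms_zero[of m F] that m False V(2) by auto
  have "(\<exists>k. 0 < k \<and> k < CARD('a) \<and> (\<lambda>v. fst v ^ k) \<in> V) \<or> punctured \<in> V"
    by (rule stable_cases[OF V(1) _ V(3) V(4)]) (rule zero)
  then have "(\<lambda>v. fst v ^ m) \<in> V"
  proof
    assume "\<exists>k. 0 < k \<and> k < CARD('a) \<and> (\<lambda>v. fst v ^ k) \<in> V"
    then obtain k where k: "(\<lambda>v. fst v ^ k) \<in> V" by blast
    obtain c where c: "(\<lambda>v :: 'a \<times> 'a. fst v ^ k) = (\<lambda>v. c * fst v ^ m)"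
      by (rule lforms_invariant[OF m, of "\<lambda>v. fst v ^ k"]) (use k V(2) in \<open>auto simp: invariant_def\<close>)
    have "c = 1" using fun_cong[OF c, of "(1, 0)"] by simp
    then show ?thesis using c k by simp
  next
    assume p: "punctured \<in> V"
    obtain c where c: "punctured = (\<lambda>v. c * fst v ^ m)"
      by (rule lforms_invariant[OF m, of punctured]) (use p V(2) in \<open>auto simp: invariant_def punctured_def\<close>)
    show ?thesis using fun_cong[OF c, of "(0, 1)"] False by (simp add: punctured_def zero_power)
  qed
  then show ?thesis using lforms_subset_stable[OF V(1) _ m] False V(2) by blast
qed

abbreviation "L \<equiv> Lmod id"

lemma carrier_L [simp]: "carrier (L m) = lforms m"
  by (simp add: Lmod_def)

lemmas group_module_L = group_module_Lmod[OF id_hom_SL2]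

lemma fg_L: "m < CARD('a) \<Longrightarrow> fg_module SL2 (L m)"
  by (rule fg_Lmod[OF id_hom_SL2])

lemma cl_L: "m < CARD('a) \<Longrightarrow> cl (L m) = evalz (ebasis p m) (twisted_class 1)"
  using cl_Lmod[of m 0] by simp

lemma gsimple_L:
  assumes m: "m < CARD('a)" shows "gsimple SL2 (L m)"
  unfolding gsimple_def
proof (intro conjI allI impI)
  show gm: "group_module SL2 (L m)" by (rule group_module_L[OF m])
  have "(\<lambda>v :: 'a \<times> 'a. fst v ^ m) \<noteq> (\<lambda>v. 0)" using fun_cong[of "\<lambda>v :: 'a \<times> 'a. fst v ^ m" "\<lambda>v. 0" "(1, 0)"] by auto
  then show "carrier (L m) \<noteq> {\<zero>\<^bsub>L m\<^esub>}" using fst_power_in_lforms[of m] by (auto simp: Lmod_def)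
  fix V assume "gsubmodule SL2 (L m) V"
  then have V: "V \<subseteq> lforms m" "stable V"
    using gsubmodule_funmod_iff[OF gm[unfolded Lmod_def]] by (auto simp: Lmod_def stable_def)
  show "V = {\<zero>\<^bsub>L m\<^esub>} \<or> V = carrier (L m)"
  proof (cases "\<exists>\<phi>\<in>V. \<exists>v. \<phi> v \<noteq> 0")
    case True then show ?thesis using lforms_minimal[OF m V(2,1)] by auto
  next
    case False
    then have "V = {\<lambda>v. 0}" using fun_subspaceD(1)[OF stable_subspace[OF V(2)]] by (auto simp: fun_eq_iff)
    then show ?thesis by (simp add: Lmod_def)
  qed
qed

text \<open>An isomorphism sends x^m to an invariant form, hence to a nonzero multiple of x^m'.
  Comparing the action of diagonal matrices gives t^m = t^m' for all units t.\<close>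

lemma not_isomorphic_L:
  assumes m: "m < m'" "m' < CARD('a)" shows "\<not> gmodule_isomorphic SL2 (L m) (L m')"
proof
  assume "gmodule_isomorphic SL2 (L m) (L m')"
  then obtain h where h: "h \<in> gmodule_hom SL2 (L m) (L m')" "bij_betw h (carrier (L m)) (carrier (L m'))"
    by (auto simp: gmodule_isomorphic_def)
  have gm: "group_module SL2 (L m)" "group_module SL2 (L m')" using group_module_L m by auto
  let ?x = "\<lambda>v :: 'a \<times> 'a. fst v ^ m"
  have x: "?x \<in> carrier (L m)" using fst_power_in_lforms by simp
  have act: "h (\<lambda>v. ?x (ract A v)) = (\<lambda>v. h ?x (ract A v))" if "A \<in> carrier SL2" for A
    using gmodule_homD(4)[OF h(1) that x] by (simp add: Lmod_def)
  have "invariant (h ?x)" unfolding invariant_def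
  proof (intro allI)
    fix s y z :: 'a
    have "mat2 1 s 0 1 \<in> carrier SL2" by (rule mat2_SL2) simp
    from act[OF this] have "h ?x (y, z) = h ?x (ract (mat2 1 s 0 1) (y, z))" by (simp add: rowact_def fun_eq_iff)
    then show "h ?x (y, z + s * y) = h ?x (y, z)" by (simp add: rowact_def mult.commute add.commute)
  qed
  moreover have "h ?x \<in> lforms m'" using gmodule_homD(1)[OF h(1) x] by simp
  ultimately obtain c where c: "h ?x = (\<lambda>v. c * fst v ^ m')" using lforms_invariant[OF m(2)] by blast
  have "c \<noteq> 0"
  proof
    assume "c = 0"
    then have "h ?x = \<zero>\<^bsub>L m'\<^esub>" using c by (simp add: Lmod_def)
    then have "?x = \<zero>\<^bsub>L m\<^esub>"
      using gmodule_hom_inj_iff[OF gm h(1)] bij_betw_imp_inj_on[OF h(2)] x by blast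
    then show False using fun_cong[of ?x "\<lambda>v. 0" "(1, 0)"] by (simp add: Lmod_def)
  qed
  have torus: "t ^ m = t ^ m'" if t: "t \<noteq> 0" for t :: 'a
  proof -
    have "mat2 t 0 0 (inverse t) \<in> carrier SL2" by (rule mat2_SL2) (use t in simp)
    from act[OF this] have "h (\<lambda>v. t ^ m * ?x v) = (\<lambda>v. h ?x (ract (mat2 t 0 0 (inverse t)) v))"
      by (simp add: rowact_def power_mult_distrib mult.commute)
    moreover have "h (\<lambda>v. t ^ m * ?x v) = (\<lambda>v. t ^ m * h ?x v)"
      using gmodule_homD(3)[OF h(1) x, of "t ^ m"] by (simp add: Lmod_def)
    ultimately have "t ^ m * h ?x (1, 0) = h ?x (ract (mat2 t 0 0 (inverse t)) (1, 0))" by metis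
    then show ?thesis using \<open>c \<noteq> 0\<close> unfolding c by (simp add: rowact_def)
  qed
  show False
  proof (cases "m' - m < CARD('a) - 1")
    case True
    show ?thesis using unit_power_neq[OF m(1) True] torus by blast
  next
    \<comment> \<open>Diagonal matrices cannot separate m = 0 from m' = q - 1. The Weyl element
      does: it fixes the constant 1 but sends (1, 0) to (0, 1), where x^m' vanishes.\<close>
    case False
    then have "m = 0" using m by linarith
    have "mat2 0 1 (- 1) 0 \<in> (carrier SL2 :: ('a ^ 2 ^ 2) set)" by (rule mat2_SL2) simp
    from act[OF this] have "h ?x (1, 0) = h ?x (ract (mat2 0 1 (- 1) 0) (1, 0))"
      using \<open>m = 0\<close> by (simp add: fun_eq_iff)
    then show ?thesis using \<open>c \<noteq> 0\<close> m unfolding c by (simp add: rowact_def zero_power)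
  qed
qed

end

section \<open>Embedding of simple modules into functions on the plane\<close>

lemma same_second_row:
  fixes A B :: "'a::field ^ 2 ^ 2"
  assumes "A \<in> carrier SL2" "B \<in> carrier SL2" "A $ 2 $ 1 = B $ 2 $ 1" "A $ 2 $ 2 = B $ 2 $ 2"
  obtains s where "B = mat2 1 s 0 1 ** A"
proof -
  have A: "A $ 1 $ 1 * A $ 2 $ 2 - A $ 1 $ 2 * A $ 2 $ 1 = 1" and B: "B $ 1 $ 1 * A $ 2 $ 2 - B $ 1 $ 2 * A $ 2 $ 1 = 1"
    using assms by (simp_all add: SL2_def det_2)
  have eq: "(B $ 1 $ 1 - A $ 1 $ 1) * A $ 2 $ 2 = (B $ 1 $ 2 - A $ 1 $ 2) * A $ 2 $ 1"
    using A B by (simp add: algebra_simps)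
  define s where "s = (if A $ 2 $ 1 = 0 then (B $ 1 $ 2 - A $ 1 $ 2) / A $ 2 $ 2 else (B $ 1 $ 1 - A $ 1 $ 1) / A $ 2 $ 1)"
  have "B $ 1 $ 1 - A $ 1 $ 1 = s * A $ 2 $ 1 \<and> B $ 1 $ 2 - A $ 1 $ 2 = s * A $ 2 $ 2"
  proof (cases "A $ 2 $ 1 = 0")
    case True
    then have "A $ 2 $ 2 \<noteq> 0" using A by auto
    then show ?thesis using True eq by (simp add: s_def)
  next
    case False
    then show ?thesis using eq by (simp add: s_def nonzero_divide_eq_eq nonzero_eq_divide_eq)
  qed
  then have "B = mat2 1 s 0 1 ** A"
    unfolding mat2_mult using assms(3,4) by (intro vec_2_2_eqI) (auto simp: algebra_simps)
  then show thesis by (rule that)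
qed

context finite_char begin

lemma ract_eq_0_iff:
  assumes "A \<in> carrier SL2" shows "ract A v = (0, 0) \<longleftrightarrow> v = (0, 0)"
proof
  assume "ract A v = (0, 0)"
  then have z: "fst v * A $ 1 $ 1 + snd v * A $ 2 $ 1 = 0" "fst v * A $ 1 $ 2 + snd v * A $ 2 $ 2 = 0"
    by (simp_all add: rowact_def)
  have d: "A $ 1 $ 1 * A $ 2 $ 2 - A $ 1 $ 2 * A $ 2 $ 1 = 1" using assms by (simp add: SL2_def det_2)
  have "fst v * (A $ 1 $ 1 * A $ 2 $ 2 - A $ 1 $ 2 * A $ 2 $ 1) =
      (fst v * A $ 1 $ 1 + snd v * A $ 2 $ 1) * A $ 2 $ 2 - (fst v * A $ 1 $ 2 + snd v * A $ 2 $ 2) * A $ 2 $ 1"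
    "snd v * (A $ 1 $ 1 * A $ 2 $ 2 - A $ 1 $ 2 * A $ 2 $ 1) =
      (fst v * A $ 1 $ 2 + snd v * A $ 2 $ 2) * A $ 1 $ 1 - (fst v * A $ 1 $ 1 + snd v * A $ 2 $ 1) * A $ 1 $ 2"
    by (simp_all add: algebra_simps)
  then show "v = (0, 0)" unfolding d z by (simp add: prod_eq_iff)
qed (simp add: rowact_def)

text \<open>A section of the map from a matrix to its second row. The cosets of the upper unipotent
  group are the fibres of this map, so each nonzero vector receives one representative.\<close>

definition row_matrix :: "'a \<times> 'a \<Rightarrow> 'a ^ 2 ^ 2"
  where "row_matrix v = (if snd v = 0 then mat2 0 (- inverse (fst v)) (fst v) 0 else mat2 (inverse (snd v)) 0 (fst v) (snd v))"

lemma row_matrix: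
  assumes "v \<noteq> (0, 0)"
  shows "row_matrix v \<in> carrier SL2" "row_matrix v $ 2 $ 1 = fst v" "row_matrix v $ 2 $ 2 = snd v"
  using assms by (auto simp: row_matrix_def prod_eq_iff intro!: mat2_SL2)

lemma row_matrix_01: "row_matrix (0, 1) = \<one>\<^bsub>SL2\<^esub>"
  by (rule vec_2_2_eqI) (simp_all add: row_matrix_def SL2_def mat_def)

text \<open>Frobenius reciprocity: a linear functional that is invariant under the upper unipotent
  matrices embeds a simple module into the functions on the punctured plane, which is the set of
  cosets of these matrices.\<close>

lemma simple_embedding:
  fixes M :: "('a, 'v, 'a ^ 2 ^ 2) gmodule"
  assumes simple: "gsimple SL2 M" and fin: "finite (carrier M)"
  shows "\<exists>V. stable V \<and> (\<forall>F\<in>V. F (0, 0) = 0) \<and>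
    gmodule_isomorphic SL2 M (funmod (\<lambda>A. ract (id A)) (\<lambda>c. c) V)"
proof -
  interpret M: group_module SL2 M using simple by (simp add: gsimple_def)
  have gm: "group_module SL2 M" by (rule M.group_module_axioms)
  define u where "u = (\<lambda>s :: 'a. mat2 1 s 0 1)"
  have u: "u s \<in> carrier SL2" "u s \<otimes>\<^bsub>SL2\<^esub> u t = u (s + t)" "u 0 = \<one>\<^bsub>SL2\<^esub>" for s t
  proof -
    show "u s \<in> carrier SL2" unfolding u_def by (rule mat2_SL2) simp
    show "u s \<otimes>\<^bsub>SL2\<^esub> u t = u (s + t)" by (simp add: u_def SL2_def mat2_mult add.commute)
    show "u 0 = \<one>\<^bsub>SL2\<^esub>" unfolding u_def by (rule vec_2_2_eqI) (simp_all add: SL2_def mat_def)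
  qed
  obtain v0 where v0: "v0 \<in> carrier M" "v0 \<noteq> \<zero>\<^bsub>M\<^esub>" using simple unfolding gsimple_def by blast
  obtain n b co where "coordinates SL2 M n b co" using exists_coordinates[OF gm fin] by blast
  then interpret C: coordinates SL2 M n b co .
  \<comment> \<open>A coordinate form that is nonzero at \<open>v0\<close> is the linear functional
    to be averaged over the unipotent group.\<close>
  have "\<exists>i<n. co i v0 \<noteq> 0"
  proof (rule ccontr)
    assume "\<not> ?thesis"
    then have 0: "co i v0 = co i \<zero>\<^bsub>M\<^esub>" if "i < n" for i
      using that C.co_smult[OF that v0(1), of 0] v0(1) by simp
    have "v0 = finsum M (\<lambda>i. co i \<zero>\<^bsub>M\<^esub> \<odot>\<^bsub>M\<^esub> b i) {..<n}"
      by (rule trans[OF C.expansion[OF v0(1)] M.finsum_eq]) (simp_all add: 0 C.basis_in)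
    also have "\<dots> = \<zero>\<^bsub>M\<^esub>" by (rule C.expansion[symmetric]) simp
    finally show False using v0(2) by simp
  qed
  then obtain i where i: "i < n" "co i v0 \<noteq> 0" by blast
  obtain k where k: "\<exists>y\<in>carrier M. (\<Sum>s\<in>UNIV. s ^ k * co i (act M (u s) y)) \<noteq> 0"
    "\<And>t y. y \<in> carrier M \<Longrightarrow>
      (\<Sum>s\<in>UNIV. s ^ k * co i (act M (u s) (act M (u t) y))) = (\<Sum>s\<in>UNIV. s ^ k * co i (act M (u s) y))"
    by (rule fixed_function[of "carrier M" "\<lambda>s. act M (u s)" v0 "co i"])
      (use v0(1) i(2) in \<open>simp_all add: u M.act_one flip: M.act_mult\<close>)
  define \<psi> where "\<psi> y = (\<Sum>s\<in>UNIV. s ^ k * co i (act M (u s) y))" for y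
  have \<psi>_u: "\<psi> (act M (u t) y) = \<psi> y" if "y \<in> carrier M" for t y using k(2)[OF that] by (simp add: \<psi>_def)
  obtain w0 where w0: "w0 \<in> carrier M" "\<psi> w0 \<noteq> 0" using k(1) by (auto simp: \<psi>_def)
  have \<psi>_add: "\<psi> (y \<oplus>\<^bsub>M\<^esub> z) = \<psi> y + \<psi> z" if "y \<in> carrier M" "z \<in> carrier M" for y z
    using that u(1) by (simp add: \<psi>_def M.act_add M.act_closed C.co_add[OF i(1)] distrib_left sum.distrib)
  have \<psi>_smult: "\<psi> (c \<odot>\<^bsub>M\<^esub> y) = c * \<psi> y" if "y \<in> carrier M" for c y
    using that u(1) by (simp add: \<psi>_def M.act_smult M.act_closed C.co_smult[OF i(1)] sum_distrib_left mult.left_commute)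
  have \<psi>_row: "\<psi> (act M B w) = \<psi> (act M A w)"
    if AB: "A \<in> carrier SL2" "B \<in> carrier SL2" "A $ 2 $ 1 = B $ 2 $ 1" "A $ 2 $ 2 = B $ 2 $ 2" and w: "w \<in> carrier M" for A B w
  proof -
    obtain s where "B = mat2 1 s 0 1 ** A" by (rule same_second_row[OF AB])
    then have "B = u s \<otimes>\<^bsub>SL2\<^esub> A" by (simp add: u_def SL2_def)
    then have "act M B w = act M (u s) (act M A w)" using M.act_mult[OF u(1) AB(1) w] by simp
    then show ?thesis using \<psi>_u[OF M.act_closed[OF AB(1) w]] by simp
  qed
  \<comment> \<open>The matrix coefficient A to \<open>\<psi> (act M A w)\<close>, which by
    \<open>\<psi>_row\<close> depends only on the second row of A. It is extended by 0 to the
    origin, which is not a second row.\<close>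
  define \<Psi> where "\<Psi> w v = (if v = (0, 0) then 0 else \<psi> (act M (row_matrix v) w))" for w v
  have \<Psi>_add: "\<Psi> (y \<oplus>\<^bsub>M\<^esub> z) = (\<lambda>v. \<Psi> y v + \<Psi> z v)" if "y \<in> carrier M" "z \<in> carrier M" for y z
    using that by (auto simp: \<Psi>_def fun_eq_iff M.act_add M.act_closed row_matrix \<psi>_add)
  have \<Psi>_smult: "\<Psi> (c \<odot>\<^bsub>M\<^esub> y) = (\<lambda>v. c * \<Psi> y v)" if "y \<in> carrier M" for c y
    using that by (auto simp: \<Psi>_def fun_eq_iff M.act_smult M.act_closed row_matrix \<psi>_smult)
  have \<Psi>_act: "\<Psi> (act M A w) = (\<lambda>v. \<Psi> w (ract A v))" if A: "A \<in> carrier SL2" and w: "w \<in> carrier M" for A w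
  proof (rule ext)
    fix v
    show "\<Psi> (act M A w) v = \<Psi> w (ract A v)"
    proof (cases "v = (0, 0)")
      case True then show ?thesis using ract_eq_0_iff[OF A] by (simp add: \<Psi>_def)
    next
      case False
      then have nz: "ract A v \<noteq> (0, 0)" using ract_eq_0_iff[OF A] by simp
      have in_SL2: "row_matrix v \<otimes>\<^bsub>SL2\<^esub> A \<in> carrier SL2" using row_matrix(1)[OF False] A
        by (rule monoid.m_closed[OF group.is_monoid[OF group_SL2]])
      have "\<psi> (act M (row_matrix v \<otimes>\<^bsub>SL2\<^esub> A) w) = \<psi> (act M (row_matrix (ract A v)) w)"
        by (rule \<psi>_row[OF row_matrix(1)[OF nz] in_SL2 _ _ w])
          (simp_all add: row_matrix[OF nz], simp_all add: rowact_def SL2_def matrix_matrix_mult_def sum_2 row_matrix[OF False])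
      then show ?thesis using False nz M.act_mult[OF row_matrix(1)[OF False] A w] by (simp add: \<Psi>_def)
    qed
  qed
  have \<Psi>_zero: "\<Psi> \<zero>\<^bsub>M\<^esub> = (\<lambda>v. 0)" using \<Psi>_smult[OF M.zero_closed, of 0] by simp
  let ?V = "\<Psi> ` carrier M"
  have V: "stable ?V" unfolding stable_def fun_subspace_def
  proof (intro conjI ballI allI)
    show "(\<lambda>y. 0) \<in> ?V" by (rule image_eqI[where f = \<Psi>, OF \<Psi>_zero[symmetric] M.zero_closed])
  next
    fix \<phi> \<theta> assume "\<phi> \<in> ?V" "\<theta> \<in> ?V"
    then obtain y z where yz: "y \<in> carrier M" "z \<in> carrier M" "\<phi> = \<Psi> y" "\<theta> = \<Psi> z" by blast
    show "(\<lambda>v. \<phi> v + \<theta> v) \<in> ?V" unfolding yz(3,4)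
      by (rule image_eqI[where f = \<Psi>, OF \<Psi>_add[OF yz(1,2), symmetric] M.a_closed[OF yz(1,2)]])
  next
    fix c \<phi> assume "\<phi> \<in> ?V"
    then obtain y where y: "y \<in> carrier M" "\<phi> = \<Psi> y" by blast
    show "(\<lambda>v. c * \<phi> v) \<in> ?V" unfolding y(2)
      by (rule image_eqI[where f = \<Psi>, OF \<Psi>_smult[OF y(1), symmetric] M.smult_in[OF y(1)]])
  next
    fix A :: "'a ^ 2 ^ 2" and \<phi> assume A: "A \<in> carrier SL2" and "\<phi> \<in> ?V"
    then obtain y where y: "y \<in> carrier M" "\<phi> = \<Psi> y" by blast
    show "(\<lambda>v. \<phi> (ract A v)) \<in> ?V" unfolding y(2)
      by (rule image_eqI[where f = \<Psi>, OF \<Psi>_act[OF A y(1), symmetric] M.act_closed[OF A y(1)]])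
  qed
  let ?N = "funmod (\<lambda>A. ract (id A)) (\<lambda>c. c) ?V"
  have gN: "group_module SL2 ?N"
    by (rule group_module_funmod[OF group_SL2 point_action_rowact[OF id_hom_SL2] stable_subspace[OF V]])
      (use V in \<open>unfold stable_def id_apply, blast\<close>)
  have hom: "\<Psi> \<in> gmodule_hom SL2 M ?N"
    by (rule gmodule_homI) (simp_all add: \<Psi>_add \<Psi>_smult \<Psi>_act)
  \<comment> \<open>The matrix chosen for (0, 1) is the identity, so \<open>\<Psi> w0\<close> takes
    there the nonzero value \<open>\<psi> w0\<close>. The kernel is therefore proper, and zero by
    simplicity.\<close>
  have "{v \<in> carrier M. \<Psi> v = \<zero>\<^bsub>?N\<^esub>} \<noteq> carrier M"
  proof
    assume "{v \<in> carrier M. \<Psi> v = \<zero>\<^bsub>?N\<^esub>} = carrier M"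
    then have "\<Psi> w0 = (\<lambda>v. 0)" using w0(1) by auto
    then have "\<Psi> w0 (0, 1) = 0" by simp
    then show False using w0 by (simp add: \<Psi>_def row_matrix_01 M.act_one)
  qed
  then have "{v \<in> carrier M. \<Psi> v = \<zero>\<^bsub>?N\<^esub>} = {\<zero>\<^bsub>M\<^esub>}"
    using simple gsubmodule_kernel[OF gm gN hom] unfolding gsimple_def by blast
  then have "inj_on \<Psi> (carrier M)" unfolding gmodule_hom_inj_iff[OF gm gN hom] by blast
  then have "gmodule_isomorphic SL2 M ?N"
    by (intro gmodule_isomorphicI[OF hom] bij_betw_imageI) simp_all
  moreover have "\<forall>F\<in>?V. F (0, 0) = 0" by (auto simp: \<Psi>_def)
  ultimately show ?thesis using V by blast
qed

lemma simple_isomorphic_L: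
  fixes M :: "('a, 'v, 'a ^ 2 ^ 2) gmodule"
  assumes simple: "gsimple SL2 M" and fin: "finite (carrier M)"
  obtains m where "m < CARD('a)" "gmodule_isomorphic SL2 M (L m)"
proof -
  obtain V where V: "stable V" "\<And>F. F \<in> V \<Longrightarrow> F (0, 0) = 0"
    and iso: "gmodule_isomorphic SL2 M (funmod (\<lambda>A. ract (id A)) (\<lambda>c. c) V)"
    using simple_embedding[OF simple fin] by blast
  let ?N = "funmod (\<lambda>A. ract (id A)) (\<lambda>c. c) V"
  have gN: "group_module SL2 ?N"
    by (rule group_module_funmod[OF group_SL2 point_action_rowact[OF id_hom_SL2] stable_subspace[OF V(1)]])
      (use V(1) in \<open>simp add: stable_def\<close>)
  have sN: "gsimple SL2 ?N" by (rule gsimple_isomorphic[OF simple gN iso])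
  have minimal: "U = V" if U: "stable U" "U \<subseteq> V" "\<phi> \<in> U" "\<phi> v \<noteq> 0" for U \<phi> v
  proof -
    have "gsubmodule SL2 ?N U" unfolding gsubmodule_funmod_iff[OF gN] using U by (simp add: stable_def)
    then have "U = {\<lambda>v. 0} \<or> U = V" using sN unfolding gsimple_def by auto
    then show ?thesis using U(3,4) by auto
  qed
  have "V \<noteq> {\<lambda>v. 0}" using sN unfolding gsimple_def by simp
  then obtain F where F: "F \<in> V" "F \<noteq> (\<lambda>v. 0)"
    using fun_subspaceD(1)[OF stable_subspace[OF V(1)]] by blast
  from F(2) obtain v0 where "F v0 \<noteq> 0" by (auto simp: fun_eq_iff)
  note F = F(1) this
  have "(\<exists>m. 0 < m \<and> m < CARD('a) \<and> (\<lambda>v. fst v ^ m) \<in> V) \<or> punctured \<in> V"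
    by (rule stable_cases[OF V(1) _ F]) (rule V(2))
  then consider m where "0 < m" "m < CARD('a)" "(\<lambda>v. fst v ^ m) \<in> V" | "punctured \<in> V"
    by blast
  then show thesis
  proof cases
    case (1 m)
    have "lforms m = V"
      by (rule minimal[OF stable_lforms[OF 1(2)] lforms_subset_stable[OF V(1) 1] fst_power_in_lforms, of "(1, 0)"]) simp
    then have "gmodule_isomorphic SL2 M (L m)" using iso by (simp add: Lmod_def)
    then show thesis using 1 that by blast
  next
    \<comment> \<open>The indicator is fixed by the group, so its multiples form a submodule and
      hence all of V. This is a trivial module, isomorphic to \<open>L 0\<close> without being equal
      to it, since \<open>L 0\<close> consists of constant functions.\<close>
    case 2
    let ?U = "range (\<lambda>c v. c * punctured v)"
    have pA: "punctured (ract A v) = punctured v" if "A \<in> carrier SL2" for A v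
      using ract_eq_0_iff[OF that] by (simp add: punctured_def)
    have "stable ?U" unfolding stable_def fun_subspace_def
    proof (intro conjI ballI allI)
      show "(\<lambda>y. 0) \<in> ?U" by (rule range_eqI[of _ _ 0]) simp
    next
      fix \<phi> \<theta> assume "\<phi> \<in> ?U" "\<theta> \<in> ?U"
      then obtain c d where "\<phi> = (\<lambda>v. c * punctured v)" "\<theta> = (\<lambda>v. d * punctured v)" by blast
      then show "(\<lambda>y. \<phi> y + \<theta> y) \<in> ?U" by (intro range_eqI[of _ _ "c + d"]) (simp add: distrib_right)
    next
      fix e \<phi> assume "\<phi> \<in> ?U"
      then obtain c where "\<phi> = (\<lambda>v. c * punctured v)" by blast
      then show "(\<lambda>y. e * \<phi> y) \<in> ?U" by (intro range_eqI[of _ _ "e * c"]) (simp add: mult.assoc)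
    next
      fix A :: "'a ^ 2 ^ 2" and \<phi> assume A: "A \<in> carrier SL2" and "\<phi> \<in> ?U"
      then obtain c where c: "\<phi> = (\<lambda>v. c * punctured v)" by blast
      show "(\<lambda>v. \<phi> (ract A v)) \<in> ?U" unfolding c pA[OF A] by blast
    qed
    moreover have "?U \<subseteq> V" using fun_subspaceD(3)[OF stable_subspace[OF V(1)] 2] by blast
    moreover have "punctured \<in> ?U" by (rule range_eqI[of _ _ 1]) simp
    moreover have "punctured (0, 1) \<noteq> 0" by (simp add: punctured_def)
    ultimately have UV: "?U = V" by (rule minimal)
    have const: "(\<lambda>v. c) \<in> lforms 0" for c
      using fun_subspaceD(3)[OF fun_subspace_lforms pw_in_lforms[of 0 0 0], of c] by simp
    let ?h = "\<lambda>(\<phi> :: 'a \<times> 'a \<Rightarrow> 'a) (v :: 'a \<times> 'a). \<phi> (1, 0)"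
    have "gmodule_isomorphic SL2 ?N (L 0)"
    proof (rule gmodule_isomorphicI)
      show "?h \<in> gmodule_hom SL2 ?N (L 0)"
      proof (rule gmodule_homI)
        fix A :: "'a ^ 2 ^ 2" and \<phi> assume A: "A \<in> carrier SL2" and "\<phi> \<in> carrier ?N"
        then obtain c where "\<phi> = (\<lambda>v. c * punctured v)" unfolding funmod_simps UV[symmetric] by blast
        then show "?h (act ?N A \<phi>) = act (L 0) A (?h \<phi>)" using pA[OF A] by (simp add: Lmod_def)
      qed (simp_all add: const Lmod_def)
      show "bij_betw ?h (carrier ?N) (carrier (L 0))"
      proof (rule bij_betw_imageI)
        show "inj_on ?h (carrier ?N)"
        proof (rule inj_onI)
          fix \<phi> \<theta> assume "\<phi> \<in> carrier ?N" "\<theta> \<in> carrier ?N" and eq: "?h \<phi> = ?h \<theta>"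
          then obtain c d where cd: "\<phi> = (\<lambda>v. c * punctured v)" "\<theta> = (\<lambda>v. d * punctured v)"
            unfolding funmod_simps UV[symmetric] by blast
          have "\<phi> (1, 0) = \<theta> (1, 0)" by (rule fun_cong[OF eq])
          then show "\<phi> = \<theta>" by (simp add: cd punctured_def)
        qed
        show "?h ` carrier ?N = carrier (L 0)"
        proof (intro equalityI subsetI)
          fix \<phi> assume "\<phi> \<in> ?h ` carrier ?N"
          then show "\<phi> \<in> carrier (L 0)" using const by auto
        next
          fix \<phi> assume "\<phi> \<in> carrier (L 0)"
          then obtain c where c: "\<phi> = (\<lambda>v. c)" using lforms_0 by (metis carrier_L)
          have "(\<lambda>v. c * punctured v) \<in> carrier ?N" unfolding funmod_simps UV[symmetric] by blast
          then show "\<phi> \<in> ?h ` carrier ?N"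
            by (rule image_eqI[rotated]) (simp add: c punctured_def)
        qed
      qed
    qed
    then have "gmodule_isomorphic SL2 M (L 0)" by (rule gmodule_isomorphic_trans[OF iso])
    then show thesis by (rule that[rotated]) simp
  qed
qed

section \<open>Evaluation at the standard class and its kernel\<close>

abbreviation std_class :: "'a k0"
  where "std_class \<equiv> cl (standard_module :: ('a, 'a ^ 2, 'a ^ 2 ^ 2) gmodule)"

lemma cl_L_std: "m < CARD('a) \<Longrightarrow> cl (L m) = evalz (ebasis p m) std_class"
  using cl_L by simp

lemma evalz_surj: "\<exists>f. evalz f std_class = u"
proof (induction u rule: k0_induct)
  case zero show ?case by (rule exI[of _ 0]) simp
next
  case (simple M)
  then have "finite (carrier M)" by (simp add: SL2.fg_iff)
  then obtain m where "m < CARD('a)" "gmodule_isomorphic SL2 M (L m)"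
    by (rule simple_isomorphic_L[OF simple(2)])
  then have "cl M = evalz (ebasis p m) std_class"
    using cl_isomorphic[OF simple(1) fg_L] cl_L_std by metis
  then show ?case by metis
next
  case (diff u v)
  then obtain f h where "evalz f std_class = u" "evalz h std_class = v" by blast
  then show ?case by (intro exI[of _ "f - h"]) simp
qed

text \<open>In the expansion of f by the \<open>ebasis\<close> polynomials the coefficient at n is
  the value of the multiplicity of \<open>L n\<close> on the class of f, because these polynomials
  evaluate to the classes of the pairwise non-isomorphic simple modules.\<close>

lemma evalz_eq_0_degree:
  assumes f: "degree f < CARD('a)" "evalz f std_class = 0" shows "f = 0"
proof -
  obtain c where c: "f = (\<Sum>m<CARD('a). smult (c m) (ebasis p m))"
    using ebasis_expansion[OF prime_ge_2_nat[OF prime_p] f(1)] by blast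
  have "c n = 0" if n: "n < CARD('a)" for n
  proof -
    obtain \<mu> :: "'a k0 \<Rightarrow> int" where \<mu>: "\<And>u v. \<mu> (u + v) = \<mu> u + \<mu> v"
      "\<And>M :: ('a, 'a \<times> 'a \<Rightarrow> 'a, 'a ^ 2 ^ 2) gmodule. fg_module SL2 M \<Longrightarrow> gsimple SL2 M \<Longrightarrow>
        \<mu> (cl M) = (if gmodule_isomorphic SL2 M (L n) then 1 else 0)"
      by (rule cl_functional[OF group_module_L[OF n]]) (rule that)
    have \<mu>0: "\<mu> 0 = 0" using \<mu>(1)[of 0 0] by simp
    have \<mu>_minus: "\<mu> (- u) = - \<mu> u" for u using \<mu>(1)[of u "- u"] \<mu>0 by simp
    have \<mu>_nat: "\<mu> (of_nat k * u) = int k * \<mu> u" for k u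
      by (induction k) (simp_all add: \<mu>0 \<mu>(1) algebra_simps)
    have \<mu>_int: "\<mu> (of_int k * u) = k * \<mu> u" for k u
      by (cases k rule: int_cases2) (simp_all add: \<mu>_nat \<mu>_minus)
    have \<mu>_sum: "\<mu> (sum h A) = (\<Sum>i\<in>A. \<mu> (h i))" for h :: "nat \<Rightarrow> 'a k0" and A
      by (induction A rule: infinite_finite_induct) (simp_all add: \<mu>0 \<mu>(1))
    have "\<mu> (cl (L m)) = (if m = n then 1 else 0)" if m: "m < CARD('a)" for m
    proof -
      have "gmodule_isomorphic SL2 (L m) (L n) \<longleftrightarrow> m = n"
      proof
        assume iso: "gmodule_isomorphic SL2 (L m) (L n)"
        have iso': "gmodule_isomorphic SL2 (L n) (L m)" by (rule gmodule_isomorphic_sym[OF group_module_L[OF m] iso])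
        show "m = n" using not_isomorphic_L[of m n] not_isomorphic_L[of n m] iso iso' m n
          by (cases m n rule: linorder_cases) auto
      qed (simp add: gmodule_isomorphic_refl)
      then show ?thesis using \<mu>(2)[OF fg_L[OF m] gsimple_L[OF m]] by simp
    qed
    then have "\<mu> (evalz f std_class) = (\<Sum>m<CARD('a). if m = n then c n else 0)"
      unfolding c evalz_sum \<mu>_sum
      by (intro sum.cong refl) (simp add: \<mu>_int flip: cl_L_std)
    then show ?thesis using f(2) n \<mu>0 by simp
  qed
  then show ?thesis unfolding c by simp
qed

lemma evalz_eq_0_iff: "evalz f std_class = 0 \<longleftrightarrow> f_iter p g - [:0, 1:] dvd f"
proof
  let ?P = "f_iter p g - [:0, 1:]"
  have rel: "evalz ?P std_class = 0"
    using f_iter_relation[OF prime_p card_field] by simp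
  show "evalz f std_class = 0" if "?P dvd f"
    using that rel by (auto elim!: dvdE)
  have p: "p \<ge> 2" by (rule prime_ge_2_nat[OF prime_p])
  \<comment> \<open>Since g is positive, the degree of the iterate exceeds 1, and subtracting x
    leaves the leading term alone.\<close>
  have "p ^ 1 \<le> p ^ g" using p g_pos by (intro power_increasing) auto
  then have lt: "degree [:0, 1 :: int:] < degree (f_iter p g)" using f_iter_monic[OF p] p by simp
  then have dP: "degree ?P = CARD('a)"
    using f_iter_monic[OF p, of g] unfolding card_field
    by (simp only: diff_conv_add_uminus degree_add_eq_left degree_minus)
  moreover have "coeff [:0, 1 :: int:] (p ^ g) = 0" using lt f_iter_monic(1)[OF p, of g] by (intro coeff_eq_0) simp
  ultimately have P: "degree ?P = CARD('a)" "lead_coeff ?P = 1"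
    using f_iter_monic[OF p, of g] unfolding card_field by (simp_all only: coeff_diff diff_zero)
  then have nz: "?P \<noteq> 0" by auto
  assume f: "evalz f std_class = 0"
  \<comment> \<open>The divisor is monic, so pseudo-division is genuine division over the integers.
    The remainder also evaluates to zero and has degree below q.\<close>
  obtain q r where qr: "pseudo_divmod f ?P = (q, r)" by (cases "pseudo_divmod f ?P")
  from pseudo_divmod[OF nz qr] P have "f = ?P * q + r" "r = 0 \<or> degree r < CARD('a)" by simp_all
  moreover from this have "evalz r std_class = 0" using f rel by simp
  ultimately have "f = ?P * q" using evalz_eq_0_degree[of r] by auto
  then show "?P dvd f" by simp
qed

end

text \<open>Every integer polynomial is built from 1 and x by sums, differences and products. This
  gives the uniqueness clause, since each element of the Grothendieck ring is the value of a
  polynomial.\<close>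

lemma ring_hom_Zx_eqI:
  assumes "ring Q" and \<alpha>: "\<alpha> \<in> ring_hom Zx Q" and \<beta>: "\<beta> \<in> ring_hom Zx Q" and x: "\<alpha> [:0, 1:] = \<beta> [:0, 1:]"
  shows "\<alpha> f = \<beta> f"
proof -
  interpret Q: ring Q by fact
  have add: "\<alpha> (h + k) = \<alpha> h \<oplus>\<^bsub>Q\<^esub> \<alpha> k" "\<beta> (h + k) = \<beta> h \<oplus>\<^bsub>Q\<^esub> \<beta> k" for h k
    using ring_hom_add[OF \<alpha>, of h k] ring_hom_add[OF \<beta>, of h k] by simp_all
  have mult: "\<alpha> (h * k) = \<alpha> h \<otimes>\<^bsub>Q\<^esub> \<alpha> k" "\<beta> (h * k) = \<beta> h \<otimes>\<^bsub>Q\<^esub> \<beta> k" for h k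
    using ring_hom_mult[OF \<alpha>, of h k] ring_hom_mult[OF \<beta>, of h k] by simp_all
  have closed: "\<alpha> h \<in> carrier Q" "\<beta> h \<in> carrier Q" for h
    using ring_hom_closed[OF \<alpha>, of h] ring_hom_closed[OF \<beta>, of h] by simp_all
  have one: "\<alpha> 1 = \<beta> 1" using ring_hom_one[OF \<alpha>] ring_hom_one[OF \<beta>] by simp
  have const: "\<alpha> [:a:] = \<beta> [:a:]" for a
  proof (induction a rule: int_induct[where k = 0])
    case base
    have "\<alpha> 0 \<oplus>\<^bsub>Q\<^esub> \<alpha> 0 = \<alpha> 0 \<oplus>\<^bsub>Q\<^esub> \<zero>\<^bsub>Q\<^esub>" "\<beta> 0 \<oplus>\<^bsub>Q\<^esub> \<beta> 0 = \<beta> 0 \<oplus>\<^bsub>Q\<^esub> \<zero>\<^bsub>Q\<^esub>"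
      using add[of 0 0] closed by simp_all
    then have "\<alpha> 0 = \<zero>\<^bsub>Q\<^esub>" "\<beta> 0 = \<zero>\<^bsub>Q\<^esub>" using closed by (simp_all add: Q.add.l_cancel)
    then show ?case by simp
  next
    case (step1 i)
    have "[:i + 1:] = [:i:] + 1" by (simp add: one_pCons)
    then show ?case using step1 add one by simp
  next
    case (step2 i)
    have "[:i - 1:] + 1 = [:i:]" by (simp add: one_pCons)
    then have "\<alpha> [:i - 1:] \<oplus>\<^bsub>Q\<^esub> \<alpha> 1 = \<beta> [:i - 1:] \<oplus>\<^bsub>Q\<^esub> \<alpha> 1" using step2 add one by metis
    then show ?case using closed by (simp add: Q.add.r_cancel)
  qed
  show ?thesis
  proof (induction f)
    case 0 then show ?case using const[of 0] by simp
  next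
    case (pCons a f)
    have "pCons a f = [:a:] + [:0, 1:] * f" by simp
    then show ?case using pCons add mult const x by metis
  qed
qed

theorem theorem1p1:
  fixes p g :: nat
  assumes "prime p" and "g > 0" and "CARD('a::{field,finite}) = p ^ g"
  defines "G \<equiv> (SL2 :: ('a ^ 2 ^ 2) monoid)"
    and "Q \<equiv> Zx Quot relation_ideal p g"
  shows "degree (f_poly p) = p \<and> lead_coeff (f_poly p) = 1 \<and> degree (f_iter p g) = p ^ g \<and>
    cring (K0 TYPE('a) G) \<and>
    (\<exists>\<phi> \<in> ring_iso (K0 TYPE('a) G) Q.
       \<phi> (K0_class G (standard_module :: ('a, _, _) gmodule)) = relation_ideal p g +>\<^bsub>Zx\<^esub> [:0, 1:] \<and>
       (\<forall>\<psi> \<in> ring_hom (K0 TYPE('a) G) Q.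
          \<psi> (K0_class G (standard_module :: ('a, _, _) gmodule)) = relation_ideal p g +>\<^bsub>Zx\<^esub> [:0, 1:] \<longrightarrow>
          (\<forall>z \<in> carrier (K0 TYPE('a) G). \<psi> z = \<phi> z)))"
proof -
  interpret finite_char p g "TYPE('a)" by unfold_locales (use assms in auto)
  interpret K: cring "K0 TYPE('a) G" unfolding G_def by (rule SL2.cring_K0)
  interpret Z: cring Zx by (rule cring_from_type_algebra)
  have p: "p \<ge> 2" by (rule prime_ge_2_nat[OF prime_p])
  \<comment> \<open>Evaluation at the standard class, brought back from the type \<open>k0\<close>
    to the ring with a carrier.\<close>
  define h where "h f = Rep_k0 (evalz f std_class)" for f
  have h_hom: "h \<in> ring_hom Zx (K0 TYPE('a) G)"
    by (rule ring_hom_memI)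
      (simp_all add: h_def G_def Rep_k0 one_k0_def plus_k0_def times_k0_def Abs_k0_inverse
        K.m_closed[unfolded G_def] K.a_closed[unfolded G_def] K.one_closed[unfolded G_def])
  interpret h: ring_hom_ring Zx "K0 TYPE('a) G" h
    using h_hom by (intro ring_hom_ringI2 Z.ring_axioms K.ring_axioms)
  have h_surj: "h ` carrier Zx = carrier (K0 TYPE('a) G)"
  proof
    show "h ` carrier Zx \<subseteq> carrier (K0 TYPE('a) G)" using h.hom_closed by blast
    show "carrier (K0 TYPE('a) G) \<subseteq> h ` carrier Zx"
    proof
      fix z assume z: "z \<in> carrier (K0 TYPE('a) G)"
      obtain f where "evalz f std_class = Abs_k0 z" using evalz_surj by blast
      then have "h f = z" using z by (simp add: h_def G_def Abs_k0_inverse)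
      then show "z \<in> h ` carrier Zx" by auto
    qed
  qed
  have "h f = \<zero>\<^bsub>K0 TYPE('a) G\<^esub> \<longleftrightarrow> evalz f std_class = 0" for f
  proof -
    have "\<zero>\<^bsub>K0 TYPE('a) G\<^esub> = Rep_k0 0" by (simp add: zero_k0_def G_def Abs_k0_inverse K.zero_closed[unfolded G_def])
    then show ?thesis by (simp add: h_def Rep_k0_inject)
  qed
  then have ker: "a_kernel Zx (K0 TYPE('a) G) h = relation_ideal p g"
    unfolding a_kernel_def' relation_ideal_def cgenideal_def evalz_eq_0_iff
    by (auto simp: evalz_eq_0_iff elim!: dvdE intro: exI mult.commute)
  have h_x: "h [:0, 1:] = K0_class G (standard_module :: ('a, _, _) gmodule)"
    using Rep_cl[of "standard_module :: ('a, 'a ^ 2, 'a ^ 2 ^ 2) gmodule"] group_module_standard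
    by (simp add: h_def G_def SL2.fg_iff)
  \<comment> \<open>The first isomorphism theorem yields a map out of the quotient; the isomorphism
    asked for goes the other way and is its inverse.\<close>
  define \<theta> where "\<theta> = (\<lambda>Y. the_elem (h ` Y))"
  have ring_Q: "ring Q" unfolding Q_def ker[symmetric]
    by (rule ideal.quotient_is_ring[OF h.kernel_is_ideal])
  have \<theta>: "\<theta> \<in> ring_iso Q (K0 TYPE('a) G)"
    using h.FactRing_iso_set[OF h_surj] by (simp add: \<theta>_def Q_def ker)
  define \<phi> where "\<phi> = inv_into (carrier Q) \<theta>"
  have \<phi>: "\<phi> \<in> ring_iso (K0 TYPE('a) G) Q" unfolding \<phi>_def by (rule ring_iso_set_sym[OF ring_Q \<theta>])
  have \<phi>_h: "\<phi> (h f) = relation_ideal p g +>\<^bsub>Zx\<^esub> f" for f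
  proof -
    have "\<theta> (relation_ideal p g +>\<^bsub>Zx\<^esub> f) = h f"
      unfolding \<theta>_def ker[symmetric] by (rule h.the_elem_simp) simp
    moreover have "relation_ideal p g +>\<^bsub>Zx\<^esub> f \<in> carrier Q"
      unfolding Q_def FactRing_def A_RCOSETS_def' by auto
    moreover have "inj_on \<theta> (carrier Q)" using \<theta> by (simp add: ring_iso_def bij_betw_def)
    ultimately show ?thesis unfolding \<phi>_def by (metis inv_into_f_f)
  qed
  have "\<psi> z = \<phi> z" if \<psi>: "\<psi> \<in> ring_hom (K0 TYPE('a) G) Q"
    "\<psi> (K0_class G (standard_module :: ('a, _, _) gmodule)) = relation_ideal p g +>\<^bsub>Zx\<^esub> [:0, 1:]"
    and z: "z \<in> carrier (K0 TYPE('a) G)" for \<psi> z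
  proof -
    obtain f where f: "z = h f" using z h_surj by blast
    have \<phi>': "\<phi> \<in> ring_hom (K0 TYPE('a) G) Q" using \<phi> by (simp add: ring_iso_def)
    have "(\<psi> \<circ> h) f = (\<phi> \<circ> h) f"
      by (rule ring_hom_Zx_eqI[OF ring_Q ring_hom_trans[OF h_hom \<psi>(1)] ring_hom_trans[OF h_hom \<phi>']])
        (simp add: h_x \<psi>(2) \<phi>_h[of "[:0, 1:]", unfolded h_x])
    then show ?thesis by (simp add: f)
  qed
  then show ?thesis
    using f_poly_monic[OF p] f_iter_monic[OF p] K.cring_axioms \<phi> \<phi>_h[of "[:0, 1:]"] h_x
    by (intro conjI bexI[of _ \<phi>]) auto
qed

end
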